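(* The (left) Bousfield localization of the left determined model structure of $\mathbf{RTS}$ with respect to the cubification functor $\underline{\mathrm{Cub}}$ exists.
   Context: Fix a nonempty set $\Sigma$ of labels. A weak transition system is a triple $X=(S,\mu:L\to\Sigma,T=\bigcup_{n\ge1}T_n)$ where $S$ is a set (states), $L$ a set (actions), $\mu$ a map (labelling map), $T_n\subset S\times L^n\times S$ ($n$-transitions), such that: (Multiset axiom) if $(\alpha,u_1,\dots,u_n,\beta)$ is a transition with $n\ge2$, so is $(\alpha,u_{\sigma(1)},\dots,u_{\sigma(n)},\beta)$ for every permutation $\sigma$; (Composition axiom) for $n\ge3$ and $p,q\ge1$ with $p+q<n$, if $(\alpha,u_1,\dots,u_n,\beta)$, $(\alpha,u_1,\dots,u_p,\nu_1)$, $(\nu_1,u_{p+1},\dots,u_n,\beta)$, $(\alpha,u_1,\dots,u_{p+q},\nu_2)$, $(\nu_2,u_{p+q+1},\dots,u_n,\beta)$ are transitions, then so is $(\nu_1,u_{p+1},\dots,u_{p+q},\nu_2)$. A map consists of a map on states and a map on actions commuting with the labelling maps to $\Sigma$, sending transitions to transitions. The category is $\mathbf{WTS}$. $X$ is regular if every action $u$ occurs in some $1$-transition $(\alpha,u,\beta)$ and CSA2 holds: for every transition $(\alpha,u_1,\dots,u_n,\beta)$ with $n\ge2$ and every $1\le p<n$ there is a unique state $\nu$ with $(\alpha,u_1,\dots,u_p,\nu)$ and $(\nu,u_{p+1},\dots,u_n,\beta)$ transitions. $\mathbf{RTS}\subset\mathbf{WTS}$ is the full subcategory of regular transition systems. A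 set is viewed as a transition system with that set of states and no actions. For $n\ge0$ and $x_1,\dots,x_n\in\Sigma$, the $n$-cube $C_n[x_1,\dots,x_n]$ has states $\{0,1\}^n$, actions $(x_1,1),\dots,(x_n,n)$ with $\mu(x_i,i)=x_i$, and transitions $((\epsilon_i),(x_{i_1},i_1),\dots,(x_{i_d},i_d),(\epsilon'_i))$, $d\geq1$, with $i_1,\dots,i_d$ distinct, $\epsilon_i\le\epsilon'_i$ for all $i$, and $\epsilon_i\ne\epsilon_i'$ iff $i\in\{i_1,\dots,i_d\}$. For $n\ge1$, the boundary $\partial C_n[x_1,\dots,x_n]$ is the regular transition system obtained by removing from the $n$-cube all its $n$-transitions (for $n=1$ it is the two-state set $\{0,1\}$, with no action). The double transition $\uparrow\! x\!\uparrow$ ($x\in\Sigma$) has states $1,2,3,4$, one action $x$ labelled $x$, and transitions $(1,x,2),(3,x,4)$. Let $\mathcal I=\{\varnothing\to\{0\},\ \{0,1\}\to\{0\}\}\cup\{\partial C_n[x_1,\dots,x_n]\to C_n[x_1,\dots,x_n]\mid n\ge1,\ x_i\in\Sigma\}\cup\{C_1[x]\to\ \uparrow\! x\!\uparrow\ \mid x\in\Sigma\}$. The cubification functor is $\underline{\mathrm{Cub}}(X)=\varinjlim_{C_n[x_1,\dots,x_n]\to X}C_n[x_1,\dots,x_n]$, the colimit being taken in $\mathbf{WTS}$ over the comma category of all maps from cubes ($n\ge0$, $x_i\in\Sigma$) to $X$; it restricts to an endofunctor of $\mathbf{RTS}$. The left determined model structure on $\mathbf{RTS}$ is the (existing, combinatorial)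 model structure with generating cofibrations $\mathcal I$ whose weak equivalences form the smallest Grothendieck localizer, where, $\mathcal C$ being the class of cofibrations, a Grothendieck localizer is a class of maps satisfying two-out-of-three, containing all maps with the right lifting property with respect to $\mathcal C$, and whose intersection with $\mathcal C$ is closed under pushouts and transfinite compositions. The Bousfield localization with respect to $\underline{\mathrm{Cub}}$ means the left Bousfield localization with respect to the class of maps $f$ of $\mathbf{RTS}$ such that $\underline{\mathrm{Cub}}(f)$ is a weak equivalence of the left determined model structure; it has the same cofibrations, and its class of weak equivalences is the smallest Grothendieck localizer containing this class of maps. *)

theory Defs
  imports "HOL-Library.Multiset" "HOL-Library.FuncSet"
begin

unbundle cardinal_syntax

section \<open>The universe\<close>

text \<open>
  The paper works with the category of all (small) transition systems, which has to be
  cocomplete.  We fix a type of inaccessible cardinality as a Grothendieck universe: a set is small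
  iff its cardinality is smaller than that of this type, and every small set is in bijection with a
  subset of the type.
\<close>

definition inaccessible :: "'u rel \<Rightarrow> bool" where
  "inaccessible r \<longleftrightarrow>
     Card_order r \<and> natLeq <o r \<and> regularCard r \<and>
     (\<forall>A :: 'u set. |A| <o r \<longrightarrow> |Pow A| <o r)"

definition small :: "'u set \<Rightarrow> bool" where
  "small A \<longleftrightarrow> |A| <o |UNIV :: 'u set|"

definition small_ordinals :: "'u rel set" where
  "small_ordinals = {r. Well_order r \<and> small (Field r)}"


section \<open>Categories\<close>

record ('o, 'm) category =
  Obj :: "'o set"
  Arr :: "'m set"
  Dom :: "'m \<Rightarrow> 'o"
  Cod :: "'m \<Rightarrow> 'o"
  Ident :: "'o \<Rightarrow> 'm"
  Comp :: "'m \<Rightarrow> 'm \<Rightarrow> 'm"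

text \<open>\<open>Comp C g f\<close> is \<open>g\<close> after \<open>f\<close>.\<close>

definition Hom :: "('o, 'm) category \<Rightarrow> 'o \<Rightarrow> 'o \<Rightarrow> 'm set" where
  "Hom C a b = {f \<in> Arr C. Dom C f = a \<and> Cod C f = b}"

definition full_subcategory :: "('o, 'm) category \<Rightarrow> 'o set \<Rightarrow> ('o, 'm) category" where
  "full_subcategory C P =
     C\<lparr>Obj := Obj C \<inter> P, Arr := {f \<in> Arr C. Dom C f \<in> P \<and> Cod C f \<in> P}\<rparr>"

text \<open>
  Diagrams are given by a set \<open>I\<close> of vertices, an object \<open>D i\<close> at each vertex and a set \<open>E\<close> of edges
  \<open>(i, a, j)\<close> with \<open>a\<close> a map from \<open>D i\<close> to \<open>D j\<close>.  The colimit of a functor is the colimit of its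
  underlying diagram.
\<close>

definition is_cocone ::
  "('o, 'm) category \<Rightarrow> 'i set \<Rightarrow> ('i \<Rightarrow> 'o) \<Rightarrow> ('i \<times> 'm \<times> 'i) set \<Rightarrow> 'o \<Rightarrow> ('i \<Rightarrow> 'm) \<Rightarrow> bool" where
  "is_cocone C I D E Z c \<longleftrightarrow>
     Z \<in> Obj C \<and> (\<forall>i\<in>I. c i \<in> Hom C (D i) Z) \<and>
     (\<forall>(i, a, j)\<in>E. Comp C (c j) a = c i)"

definition is_colimit ::
  "('o, 'm) category \<Rightarrow> 'i set \<Rightarrow> ('i \<Rightarrow> 'o) \<Rightarrow> ('i \<times> 'm \<times> 'i) set \<Rightarrow> 'o \<Rightarrow> ('i \<Rightarrow> 'm) \<Rightarrow> bool" where
  "is_colimit C I D E Z c \<longleftrightarrow>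
     is_cocone C I D E Z c \<and>
     (\<forall>Z' c'. is_cocone C I D E Z' c' \<longrightarrow>
        (\<exists>!h. h \<in> Hom C Z Z' \<and> (\<forall>i\<in>I. Comp C h (c i) = c' i)))"

text \<open>The square with top \<open>g\<close>, left \<open>f\<close>, right \<open>f'\<close> and bottom \<open>g'\<close> is a pushout square.\<close>

definition is_pushout :: "('o, 'm) category \<Rightarrow> 'm \<Rightarrow> 'm \<Rightarrow> 'm \<Rightarrow> 'm \<Rightarrow> bool" where
  "is_pushout C f g f' g' \<longleftrightarrow>
     f \<in> Arr C \<and> g \<in> Hom C (Dom C f) (Dom C f') \<and>
     f' \<in> Arr C \<and> g' \<in> Hom C (Cod C f) (Cod C f') \<and>
     Comp C g' f = Comp C f' g \<and>
     (\<forall>Z u v. u \<in> Hom C (Cod C f) Z \<and> v \<in> Hom C (Cod C g) Z \<and> Comp C u f = Comp C v g \<longrightarrow>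
        (\<exists>!h. h \<in> Hom C (Cod C f') Z \<and> Comp C h g' = u \<and> Comp C h f' = v))"

text \<open>
  \<open>f\<close> is a transfinite composition, along the well-order \<open>r\<close>, of maps in \<open>K\<close>: the map from \<open>D i\<^sub>0\<close> to
  \<open>colim D\<close> for a colimit-preserving functor \<open>D\<close> on \<open>r\<close> (with transition maps \<open>d i j\<close>) whose maps
  \<open>d i j\<close> are in \<open>K\<close> whenever \<open>j\<close> is the successor of \<open>i\<close>.
\<close>

definition is_succ_in :: "'k rel \<Rightarrow> 'k \<Rightarrow> 'k \<Rightarrow> bool" where
  "is_succ_in r i j \<longleftrightarrow> i \<in> underS r j \<and> (\<forall>k\<in>underS r j. (k, i) \<in> r)"

definition transfinite_composition ::
  "('o, 'm) category \<Rightarrow> 'k rel \<Rightarrow> 'm set \<Rightarrow> 'm \<Rightarrow> bool" where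
  "transfinite_composition C r K f \<longleftrightarrow>
     (\<exists>D d Z c i\<^sub>0.
        (\<forall>i\<in>Field r. D i \<in> Obj C \<and> d i i = Ident C (D i)) \<and>
        (\<forall>i j. (i, j) \<in> r \<longrightarrow> d i j \<in> Hom C (D i) (D j)) \<and>
        (\<forall>i j k. (i, j) \<in> r \<and> (j, k) \<in> r \<longrightarrow> Comp C (d j k) (d i j) = d i k) \<and>
        (\<forall>i j. is_succ_in r i j \<longrightarrow> d i j \<in> K) \<and>
        (\<forall>j\<in>Field r. underS r j \<noteq> {} \<and> (\<nexists>i. is_succ_in r i j) \<longrightarrow>
           is_colimit C (underS r j) D
             {(i, d i k, k) | i k. i \<in> underS r j \<and> k \<in> underS r j \<and> (i, k) \<in> r}
             (D j) (\<lambda>i. d i j)) \<and>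
        is_colimit C (Field r) D {(i, d i k, k) | i k. (i, k) \<in> r} Z c \<and>
        i\<^sub>0 \<in> Field r \<and> (\<forall>i\<in>Field r. (i\<^sub>0, i) \<in> r) \<and>
        f = c i\<^sub>0)"


section \<open>Model structures and Grothendieck localizers\<close>

definition lifts :: "('o, 'm) category \<Rightarrow> 'm \<Rightarrow> 'm \<Rightarrow> bool" where
  "lifts C i p \<longleftrightarrow>
     (\<forall>u v. u \<in> Hom C (Dom C i) (Dom C p) \<and> v \<in> Hom C (Cod C i) (Cod C p) \<and>
        Comp C p u = Comp C v i \<longrightarrow>
        (\<exists>h. h \<in> Hom C (Cod C i) (Dom C p) \<and> Comp C h i = u \<and> Comp C p h = v))"

definition rlp :: "('o, 'm) category \<Rightarrow> 'm set \<Rightarrow> 'm set" where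
  "rlp C K = {p \<in> Arr C. \<forall>i\<in>K. lifts C i p}"

definition llp :: "('o, 'm) category \<Rightarrow> 'm set \<Rightarrow> 'm set" where
  "llp C K = {i \<in> Arr C. \<forall>p\<in>K. lifts C i p}"

definition cofibrations_generated_by :: "('o, 'm) category \<Rightarrow> 'm set \<Rightarrow> 'm set" where
  "cofibrations_generated_by C I = llp C (rlp C I)"

definition weak_factorization_system :: "('o, 'm) category \<Rightarrow> 'm set \<Rightarrow> 'm set \<Rightarrow> bool" where
  "weak_factorization_system C L R \<longleftrightarrow>
     L = llp C R \<and> R = rlp C L \<and>
     (\<forall>f\<in>Arr C. \<exists>l\<in>L. \<exists>p\<in>R. Cod C l = Dom C p \<and> f = Comp C p l)"

definition two_out_of_three :: "('o, 'm) category \<Rightarrow> 'm set \<Rightarrow> bool" where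
  "two_out_of_three C W \<longleftrightarrow>
     (\<forall>f\<in>Arr C. \<forall>g\<in>Arr C. Cod C f = Dom C g \<longrightarrow>
        (f \<in> W \<and> g \<in> W \<longrightarrow> Comp C g f \<in> W) \<and>
        (f \<in> W \<and> Comp C g f \<in> W \<longrightarrow> g \<in> W) \<and>
        (g \<in> W \<and> Comp C g f \<in> W \<longrightarrow> f \<in> W))"

definition is_retract :: "('o, 'm) category \<Rightarrow> 'm \<Rightarrow> 'm \<Rightarrow> bool" where
  "is_retract C f g \<longleftrightarrow>
     f \<in> Arr C \<and> g \<in> Arr C \<and>
     (\<exists>s r s' r'.
        s \<in> Hom C (Dom C f) (Dom C g) \<and> r \<in> Hom C (Dom C g) (Dom C f) \<and>
        s' \<in> Hom C (Cod C f) (Cod C g) \<and> r' \<in> Hom C (Cod C g) (Cod C f) \<and>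
        Comp C r s = Ident C (Dom C f) \<and> Comp C r' s' = Ident C (Cod C f) \<and>
        Comp C g s = Comp C s' f \<and> Comp C f r = Comp C r' g)"

record 'm model_data =
  cofibrations :: "'m set"
  weak_equivalences :: "'m set"
  fibrations :: "'m set"

definition model_structure :: "('o, 'm) category \<Rightarrow> 'm model_data \<Rightarrow> bool" where
  "model_structure C M \<longleftrightarrow>
     cofibrations M \<subseteq> Arr C \<and> weak_equivalences M \<subseteq> Arr C \<and> fibrations M \<subseteq> Arr C \<and>
     two_out_of_three C (weak_equivalences M) \<and>
     (\<forall>f g. is_retract C f g \<and> g \<in> weak_equivalences M \<longrightarrow> f \<in> weak_equivalences M) \<and>
     weak_factorization_system C (cofibrations M \<inter> weak_equivalences M) (fibrations M) \<and>
     weak_factorization_system C (cofibrations M) (fibrations M \<inter> weak_equivalences M)"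

text \<open>
  Localizers relative to a class \<open>Cof\<close> of maps; \<open>ords\<close> is the set of well-orders along which
  transfinite compositions are taken.
\<close>

definition grothendieck_localizer ::
  "('o, 'm) category \<Rightarrow> 'k rel set \<Rightarrow> 'm set \<Rightarrow> 'm set \<Rightarrow> bool" where
  "grothendieck_localizer C ords Cof W \<longleftrightarrow>
     W \<subseteq> Arr C \<and> two_out_of_three C W \<and> rlp C Cof \<subseteq> W \<and>
     (\<forall>f g f' g'. f \<in> W \<inter> Cof \<and> is_pushout C f g f' g' \<longrightarrow> f' \<in> W \<inter> Cof) \<and>
     (\<forall>r\<in>ords. \<forall>f. transfinite_composition C r (W \<inter> Cof) f \<longrightarrow> f \<in> W \<inter> Cof)"

definition smallest_localizer ::
  "('o, 'm) category \<Rightarrow> 'k rel set \<Rightarrow> 'm set \<Rightarrow> 'm set \<Rightarrow> 'm set" where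
  "smallest_localizer C ords Cof S = \<Inter>{W. grothendieck_localizer C ords Cof W \<and> S \<subseteq> W}"

lemma transfinite_composition_mono:
  assumes "transfinite_composition C r K f" and "K \<subseteq> K'"
  shows "transfinite_composition C r K' f"
proof -
  from assms(1) obtain D d Z c i\<^sub>0 where
    "\<forall>i\<in>Field r. D i \<in> Obj C \<and> d i i = Ident C (D i)"
    "\<forall>i j. (i, j) \<in> r \<longrightarrow> d i j \<in> Hom C (D i) (D j)"
    "\<forall>i j k. (i, j) \<in> r \<and> (j, k) \<in> r \<longrightarrow> Comp C (d j k) (d i j) = d i k"
    "\<forall>i j. is_succ_in r i j \<longrightarrow> d i j \<in> K"
    "\<forall>j\<in>Field r. underS r j \<noteq> {} \<and> (\<nexists>i. is_succ_in r i j) \<longrightarrow>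
       is_colimit C (underS r j) D
         {(i, d i k, k) | i k. i \<in> underS r j \<and> k \<in> underS r j \<and> (i, k) \<in> r}
         (D j) (\<lambda>i. d i j)"
    "is_colimit C (Field r) D {(i, d i k, k) | i k. (i, k) \<in> r} Z c"
    "i\<^sub>0 \<in> Field r" "\<forall>i\<in>Field r. (i\<^sub>0, i) \<in> r" "f = c i\<^sub>0"
    unfolding transfinite_composition_def by blast
  moreover from this(4) assms(2) have "\<forall>i j. is_succ_in r i j \<longrightarrow> d i j \<in> K'" by blast
  ultimately show ?thesis unfolding transfinite_composition_def by (intro exI conjI)
qed

lemma two_out_of_three_Inter:
  assumes "\<And>V. V \<in> L \<Longrightarrow> two_out_of_three C V"
  shows "two_out_of_three C (\<Inter>L)"
  unfolding two_out_of_three_def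
proof (intro ballI impI conjI InterI; elim conjE)
  fix f g V
  assume fg: "f \<in> Arr C" "g \<in> Arr C" "Cod C f = Dom C g" and V: "V \<in> L"
  note * = assms[OF V, unfolded two_out_of_three_def, rule_format, OF fg]
  show "Comp C g f \<in> V" if "f \<in> \<Inter>L" "g \<in> \<Inter>L"
    using * InterD[OF that(1) V] InterD[OF that(2) V] by blast
  show "g \<in> V" if "f \<in> \<Inter>L" "Comp C g f \<in> \<Inter>L"
    using * InterD[OF that(1) V] InterD[OF that(2) V] by blast
  show "f \<in> V" if "g \<in> \<Inter>L" "Comp C g f \<in> \<Inter>L"
    using * InterD[OF that(1) V] InterD[OF that(2) V] by blast
qed

lemma grothendieck_localizer_smallest_localizer:
  assumes "grothendieck_localizer C ords Cof W" and "S \<subseteq> W"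
  shows "grothendieck_localizer C ords Cof (smallest_localizer C ords Cof S)"
proof -
  let ?L = "{W. grothendieck_localizer C ords Cof W \<and> S \<subseteq> W}"
  have *: "grothendieck_localizer C ords Cof V" if "V \<in> ?L" for V
    using that by blast
  have "two_out_of_three C V" if "V \<in> ?L" for V
    using *[OF that] unfolding grothendieck_localizer_def by blast
  then have 1: "two_out_of_three C (\<Inter>?L)" by (rule two_out_of_three_Inter)
  have 2: "\<Inter>?L \<subseteq> Arr C"
    using assms unfolding grothendieck_localizer_def by blast
  have 3: "rlp C Cof \<subseteq> \<Inter>?L"
    unfolding grothendieck_localizer_def by blast
  have pushout: "f' \<in> \<Inter>?L \<inter> Cof" if "f \<in> \<Inter>?L \<inter> Cof" "is_pushout C f g f' g'" for f g f' g'
  proof -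
    have "f' \<in> V \<inter> Cof" if "V \<in> ?L" for V
      using *[OF that] that \<open>f \<in> \<Inter>?L \<inter> Cof\<close> \<open>is_pushout C f g f' g'\<close>
      unfolding grothendieck_localizer_def by blast
    then show ?thesis using assms by blast
  qed
  have 5: "f \<in> \<Inter>?L \<inter> Cof" if "r \<in> ords" "transfinite_composition C r (\<Inter>?L \<inter> Cof) f" for r f
  proof -
    have "f \<in> V \<inter> Cof" if "V \<in> ?L" for V
    proof -
      have "transfinite_composition C r (V \<inter> Cof) f"
        using \<open>transfinite_composition C r (\<Inter>?L \<inter> Cof) f\<close> by (rule transfinite_composition_mono) (use that in blast)
      then show ?thesis
        using *[OF that] \<open>r \<in> ords\<close> unfolding grothendieck_localizer_def by blast
    qed
    then show ?thesis using assms by blast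
  qed
  show ?thesis
    unfolding smallest_localizer_def
  proof (subst grothendieck_localizer_def, intro conjI allI ballI impI, goal_cases)
    case (4 f g f' g')
    then show ?case by (elim conjE) (rule pushout)
  qed (rule 1 2 3 5; assumption)+
qed

text \<open>The left determined model structure with generating cofibrations \<open>I\<close>.\<close>

definition left_determined :: "('o, 'm) category \<Rightarrow> 'k rel set \<Rightarrow> 'm set \<Rightarrow> 'm model_data" where
  "left_determined C ords I =
     (let Cof = cofibrations_generated_by C I; W = smallest_localizer C ords Cof {} in
      \<lparr>cofibrations = Cof, weak_equivalences = W, fibrations = rlp C (Cof \<inter> W)\<rparr>)"

text \<open>
  \<open>N\<close> is the left Bousfield localization, with respect to \<open>S\<close>, of the left determined model
  structure with generating cofibrations \<open>I\<close>.  The weak equivalences of the latter belong to every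
  localizer, hence are weak equivalences of \<open>N\<close>.
\<close>

definition left_bousfield_localization ::
  "('o, 'm) category \<Rightarrow> 'k rel set \<Rightarrow> 'm set \<Rightarrow> 'm set \<Rightarrow> 'm model_data \<Rightarrow> bool" where
  "left_bousfield_localization C ords I S N \<longleftrightarrow>
     model_structure C N \<and>
     cofibrations N = cofibrations (left_determined C ords I) \<and>
     weak_equivalences N = smallest_localizer C ords (cofibrations N) S"


section \<open>Transition systems\<close>

text \<open>A transition \<open>(\<alpha>, [u\<^sub>1, \<dots>, u\<^sub>n], \<beta>)\<close> stands for \<open>(\<alpha>, u\<^sub>1, \<dots>, u\<^sub>n, \<beta>)\<close>; the set of labels is the
  type \<open>'l\<close>.\<close>

record ('s, 'a, 'l) transition_system =
  states :: "'s set"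
  actions :: "'a set"
  label :: "'a \<Rightarrow> 'l"
  transitions :: "('s \<times> 'a list \<times> 's) set"

definition multiset_axiom :: "('s, 'a, 'l) transition_system \<Rightarrow> bool" where
  "multiset_axiom X \<longleftrightarrow>
     (\<forall>\<alpha> us vs \<beta>. (\<alpha>, us, \<beta>) \<in> transitions X \<and> length us \<ge> 2 \<and> mset vs = mset us \<longrightarrow>
        (\<alpha>, vs, \<beta>) \<in> transitions X)"

definition composition_axiom :: "('s, 'a, 'l) transition_system \<Rightarrow> bool" where
  "composition_axiom X \<longleftrightarrow>
     (\<forall>\<alpha> us vs ws \<beta> \<nu>\<^sub>1 \<nu>\<^sub>2. us \<noteq> [] \<and> vs \<noteq> [] \<and> ws \<noteq> [] \<and>
        (\<alpha>, us @ vs @ ws, \<beta>) \<in> transitions X \<and>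
        (\<alpha>, us, \<nu>\<^sub>1) \<in> transitions X \<and> (\<nu>\<^sub>1, vs @ ws, \<beta>) \<in> transitions X \<and>
        (\<alpha>, us @ vs, \<nu>\<^sub>2) \<in> transitions X \<and> (\<nu>\<^sub>2, ws, \<beta>) \<in> transitions X \<longrightarrow>
        (\<nu>\<^sub>1, vs, \<nu>\<^sub>2) \<in> transitions X)"

text \<open>Labelling maps, and below maps of transition systems, are made extensional, so that equality
  in HOL is the intended one.\<close>

definition weak_transition_system :: "('s, 'a, 'l) transition_system \<Rightarrow> bool" where
  "weak_transition_system X \<longleftrightarrow>
     label X \<in> extensional (actions X) \<and>
     (\<forall>(\<alpha>, us, \<beta>)\<in>transitions X.
        \<alpha> \<in> states X \<and> us \<noteq> [] \<and> set us \<subseteq> actions X \<and> \<beta> \<in> states X) \<and>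
     multiset_axiom X \<and> composition_axiom X"

definition CSA2 :: "('s, 'a, 'l) transition_system \<Rightarrow> bool" where
  "CSA2 X \<longleftrightarrow>
     (\<forall>\<alpha> us vs \<beta>. us \<noteq> [] \<and> vs \<noteq> [] \<and> (\<alpha>, us @ vs, \<beta>) \<in> transitions X \<longrightarrow>
        (\<exists>!\<nu>. \<nu> \<in> states X \<and> (\<alpha>, us, \<nu>) \<in> transitions X \<and> (\<nu>, vs, \<beta>) \<in> transitions X))"

definition regular :: "('s, 'a, 'l) transition_system \<Rightarrow> bool" where
  "regular X \<longleftrightarrow>
     (\<forall>u\<in>actions X. \<exists>\<alpha> \<beta>. (\<alpha>, [u], \<beta>) \<in> transitions X) \<and> CSA2 X"

type_synonym ('u, 'l) ts = "('u, 'u, 'l) transition_system"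

record ('u, 'l) ts_map =
  source :: "('u, 'l) ts"
  target :: "('u, 'l) ts"
  on_states :: "'u \<Rightarrow> 'u"
  on_actions :: "'u \<Rightarrow> 'u"

definition wts_map :: "('u, 'l) ts_map \<Rightarrow> bool" where
  "wts_map f \<longleftrightarrow>
     on_states f \<in> states (source f) \<rightarrow>\<^sub>E states (target f) \<and>
     on_actions f \<in> actions (source f) \<rightarrow>\<^sub>E actions (target f) \<and>
     (\<forall>u\<in>actions (source f). label (target f) (on_actions f u) = label (source f) u) \<and>
     (\<forall>(\<alpha>, us, \<beta>)\<in>transitions (source f).
        (on_states f \<alpha>, map (on_actions f) us, on_states f \<beta>) \<in> transitions (target f))"

definition WTS :: "(('u, 'l) ts, ('u, 'l) ts_map) category" where
  "WTS =
     (let objs = {X. weak_transition_system X \<and> small (states X) \<and> small (actions X)} in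
      \<lparr>Obj = objs,
       Arr = {f. source f \<in> objs \<and> target f \<in> objs \<and> wts_map f},
       Dom = source,
       Cod = target,
       Ident = (\<lambda>X. \<lparr>source = X, target = X,
                     on_states = restrict id (states X), on_actions = restrict id (actions X)\<rparr>),
       Comp = (\<lambda>g f. \<lparr>source = source f, target = target g,
                      on_states = compose (states (source f)) (on_states g) (on_states f),
                      on_actions = compose (actions (source f)) (on_actions g) (on_actions f)\<rparr>)\<rparr>)"

definition RTS :: "(('u, 'l) ts, ('u, 'l) ts_map) category" where
  "RTS = full_subcategory WTS {X. regular X}"


section \<open>Cubes and generating cofibrations\<close>

text \<open>
  Cubes and the other systems below are first defined on their natural types of states and actions,
  and then copied into the universe \<open>'u\<close> along arbitrary injections.  The latter exist for the types
  used here (\<open>bool list\<close>, \<open>nat\<close>, \<open>'l\<close> and \<open>'l \<times> nat\<close>) as soon as \<open>'u\<close> is inaccessible and \<open>'l\<close>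
  is smaller than \<open>'u\<close>.
\<close>

definition enc :: "'x \<Rightarrow> 'u" where
  "enc = (SOME e. inj e)"

definition copy :: "('s, 'a, 'l) transition_system \<Rightarrow> ('u, 'l) ts" where
  "copy X =
     \<lparr>states = enc ` states X,
      actions = enc ` actions X,
      label = restrict (label X \<circ> inv enc) (enc ` actions X),
      transitions = {(enc \<alpha>, map enc us, enc \<beta>) | \<alpha> us \<beta>. (\<alpha>, us, \<beta>) \<in> transitions X}\<rparr>"

definition copy_map ::
  "('s, 'a, 'l) transition_system \<Rightarrow> ('t, 'b, 'l) transition_system \<Rightarrow>
   ('s \<Rightarrow> 't) \<Rightarrow> ('a \<Rightarrow> 'b) \<Rightarrow> ('u, 'l) ts_map" where
  "copy_map X Y f g =
     \<lparr>source = copy X,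
      target = copy Y,
      on_states = restrict (enc \<circ> f \<circ> inv enc) (enc ` states X),
      on_actions = restrict (enc \<circ> g \<circ> inv enc) (enc ` actions X)\<rparr>"

definition discrete :: "'s set \<Rightarrow> ('s, 'a, 'l) transition_system" where
  "discrete S = \<lparr>states = S, actions = {}, label = (\<lambda>_. undefined), transitions = {}\<rparr>"

text \<open>The \<open>n\<close>-cube on the list \<open>xs\<close> of its \<open>n\<close> labels; coordinates are numbered from \<open>0\<close>, and \<open>False\<close>
  and \<open>True\<close> stand for the coordinates \<open>0\<close> and \<open>1\<close> of a state.\<close>

definition cube_transitions :: "'l list \<Rightarrow> (bool list \<times> ('l \<times> nat) list \<times> bool list) set" where
  "cube_transitions xs =
     {(\<epsilon>, map (\<lambda>i. (xs ! i, i)) js, \<epsilon>') | \<epsilon> js \<epsilon>'.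
        length \<epsilon> = length xs \<and> length \<epsilon>' = length xs \<and>
        js \<noteq> [] \<and> distinct js \<and> set js \<subseteq> {..<length xs} \<and>
        (\<forall>i<length xs. \<epsilon> ! i \<le> \<epsilon>' ! i \<and> (\<epsilon> ! i \<noteq> \<epsilon>' ! i \<longleftrightarrow> i \<in> set js))}"

definition cube :: "'l list \<Rightarrow> (bool list, 'l \<times> nat, 'l) transition_system" where
  "cube xs =
     \<lparr>states = {\<epsilon>. length \<epsilon> = length xs},
      actions = {(xs ! i, i) | i. i < length xs},
      label = restrict fst {(xs ! i, i) | i. i < length xs},
      transitions = cube_transitions xs\<rparr>"

text \<open>For \<open>n = 1\<close> the single action has to be removed together with the \<open>1\<close>-transition.\<close>

definition boundary :: "'l list \<Rightarrow> (bool list, 'l \<times> nat, 'l) transition_system" where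
  "boundary xs =
     (if length xs = 1 then discrete (states (cube xs))
      else (cube xs)\<lparr>transitions :=
              {(\<alpha>, us, \<beta>) \<in> transitions (cube xs). length us \<noteq> length xs}\<rparr>)"

definition double_transition :: "'l \<Rightarrow> (nat, 'l, 'l) transition_system" where
  "double_transition x =
     \<lparr>states = {1, 2, 3, 4},
      actions = {x},
      label = restrict id {x},
      transitions = {(1, [x], 2), (3, [x], 4)}\<rparr>"

text \<open>In the last family, \<open>C\<^sub>1[x]\<close> is sent onto the transition \<open>(1, x, 2)\<close>; up to the symmetry of the
  double transition this is the only map.  Systems without actions are given the type of actions
  \<open>nat\<close>, which is irrelevant.\<close>

definition generating_cofibrations :: "('u, 'l) ts_map set" where
  "generating_cofibrations =
     {copy_map (discrete {} :: (nat, nat, 'l) transition_system)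
               (discrete {0} :: (nat, nat, 'l) transition_system) id id,
      copy_map (discrete {0, 1} :: (nat, nat, 'l) transition_system)
               (discrete {0} :: (nat, nat, 'l) transition_system) (\<lambda>_. 0) id} \<union>
     {copy_map (boundary xs) (cube xs) id id | xs. xs \<noteq> []} \<union>
     {copy_map (cube [x]) (double_transition x) (\<lambda>\<epsilon>. if \<epsilon> = [False] then 1 else 2) fst | x. True}"


section \<open>The cubification functor\<close>

text \<open>
  The comma category of all maps from cubes to \<open>X\<close>, as a diagram indexed by these maps.  The colimit
  is taken in \<^const>\<open>WTS\<close>; it is defined up to isomorphism, and we choose one.
\<close>

definition cubes_over :: "('u, 'l) ts \<Rightarrow> ('u, 'l) ts_map set" where
  "cubes_over X = {c \<in> Arr WTS. source c \<in> range (\<lambda>xs. copy (cube xs)) \<and> target c = X}"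

definition cubes_over_maps ::
  "('u, 'l) ts \<Rightarrow> (('u, 'l) ts_map \<times> ('u, 'l) ts_map \<times> ('u, 'l) ts_map) set" where
  "cubes_over_maps X =
     {(c, \<phi>, c'). c \<in> cubes_over X \<and> c' \<in> cubes_over X \<and>
        \<phi> \<in> Hom WTS (source c) (source c') \<and> Comp WTS c' \<phi> = c}"

definition Cub_cocone :: "('u, 'l) ts \<Rightarrow> ('u, 'l) ts \<times> (('u, 'l) ts_map \<Rightarrow> ('u, 'l) ts_map)" where
  "Cub_cocone X =
     (SOME (Z, \<gamma>). is_colimit WTS (cubes_over X) source (cubes_over_maps X) Z \<gamma>)"

definition Cub :: "('u, 'l) ts \<Rightarrow> ('u, 'l) ts" where
  "Cub X = fst (Cub_cocone X)"

definition Cub_map :: "('u, 'l) ts_map \<Rightarrow> ('u, 'l) ts_map" where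
  "Cub_map f =
     (THE h. h \<in> Hom WTS (Cub (source f)) (Cub (target f)) \<and>
        (\<forall>c\<in>cubes_over (source f).
           Comp WTS h (snd (Cub_cocone (source f)) c) =
           snd (Cub_cocone (target f)) (Comp WTS f c)))"

definition Cub_equivalences :: "('u, 'l) ts_map set" where
  "Cub_equivalences =
     {f \<in> Arr RTS. Cub_map f \<in> weak_equivalences
        (left_determined RTS (small_ordinals :: 'u rel set) generating_cofibrations)}"

end

theory Submission
  imports Defs "HOL-Library.Countable"
begin

text \<open>
  The cofibrations are the maps injective on actions, and the trivial fibrations are the maps that
  only duplicate actions: bijective on states, surjective on actions, and reflecting transitions.
  Call a system local if distinct actions have distinct labels.  The weak equivalences of the
  localization are the maps \<open>f\<close> such that composition with \<open>f\<close> is bijective on maps to local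
  systems, that is, those inverted by the reflection onto local systems.

  They form a localizer because they are defined by unique extension, and this localizer contains the
  maps inverted by cubification because a map from \<open>X\<close> to a local system is determined by the cubes
  of \<open>X\<close>.  Conversely, the cubification of a graph gives each edge its own action, so every localizer
  containing the cubification equivalences allows all the edges of \<open>X\<close> to exchange actions with the
  same label; once the edges are saturated, duplicating actions along a pushout saturates the higher
  transitions, and this produces the reflection of \<open>X\<close> up to a trivial fibration.

  The model structure then only needs each map \<open>X \<rightarrow> Y\<close> to factor as a weak equivalence followed by
  a fibration.  The middle object is cut out of the product of \<open>Y\<close> and the reflection of \<open>X\<close>, and no
  small object argument is needed.
\<close>

section \<open>Orthogonality and lifting in a category\<close>

text \<open>Why labels decide locality: trivial fibrations merge actions, but only with equal
  labels, and the cubification of a graph gives each edge an action of its own. Once both are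
  inverted, an edge keeps nothing of its action but the label. The obstacle is that cubification
  gives direct control over edges only: longer transitions of \<open>X\<close> keep their actions.
  The remedy is that \<open>doubled X\<close>, where every action carries a second name, contains a
  system in which only edges carry arbitrary second names, and this inclusion lies in every
  localizer, by two-out-of-three between two diagonals. Pushing it out turns saturated edges into
  saturated transitions. Colimits of regular systems involve identifications forced by unique
  intermediate states, so pushouts are recognised by their universal property, and quotients are
  defined by the maps that must factor through them, with codes bounding their size. Finally, a map
  to a local system has its action part forced by labels, so being determined by the values on
  \<open>X\<close> is a condition on states alone, and the union of all good state sets is
  good.\<close>

locale cat =
  fixes C :: "('o, 'm) category" (structure)
  assumes Dom_Obj: "f \<in> Arr C \<Longrightarrow> Dom C f \<in> Obj C"
    and Cod_Obj: "f \<in> Arr C \<Longrightarrow> Cod C f \<in> Obj C"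
    and Ident_Hom: "a \<in> Obj C \<Longrightarrow> Ident C a \<in> Hom C a a"
    and Comp_Hom: "f \<in> Hom C a b \<Longrightarrow> g \<in> Hom C b c \<Longrightarrow> Comp C g f \<in> Hom C a c"
    and Comp_assoc: "f \<in> Hom C a b \<Longrightarrow> g \<in> Hom C b c \<Longrightarrow> h \<in> Hom C c d \<Longrightarrow>
          Comp C (Comp C h g) f = Comp C h (Comp C g f)"
    and Comp_Ident: "f \<in> Hom C a b \<Longrightarrow> Comp C f (Ident C a) = f"
    and Ident_Comp: "f \<in> Hom C a b \<Longrightarrow> Comp C (Ident C b) f = f"
begin

lemma Hom_self: "f \<in> Arr C \<Longrightarrow> f \<in> Hom C (Dom C f) (Cod C f)"
  by (simp add: Hom_def)

lemma HomD: "f \<in> Hom C a b \<Longrightarrow> f \<in> Arr C" "f \<in> Hom C a b \<Longrightarrow> Dom C f = a"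
  "f \<in> Hom C a b \<Longrightarrow> Cod C f = b"
  by (simp_all add: Hom_def)

lemma Hom_Obj: "f \<in> Hom C a b \<Longrightarrow> a \<in> Obj C" "f \<in> Hom C a b \<Longrightarrow> b \<in> Obj C"
  using Dom_Obj Cod_Obj by (auto simp: Hom_def)

lemma Comp_Arr:
  "f \<in> Arr C \<Longrightarrow> g \<in> Arr C \<Longrightarrow> Cod C f = Dom C g \<Longrightarrow> Comp C g f \<in> Hom C (Dom C f) (Cod C g)"
  by (metis Comp_Hom Hom_self)

section \<open>Orthogonality to a class of objects\<close>

definition local_equivalences :: "'o set \<Rightarrow> 'm set" where
  "local_equivalences L =
     {f \<in> Arr C. \<forall>K\<in>L. \<forall>g\<in>Hom C (Dom C f) K. \<exists>!h. h \<in> Hom C (Cod C f) K \<and> Comp C h f = g}"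

lemma local_equivalencesI:
  assumes "f \<in> Hom C a b"
    and "\<And>K g. K \<in> L \<Longrightarrow> g \<in> Hom C a K \<Longrightarrow> \<exists>h\<in>Hom C b K. Comp C h f = g"
    and "\<And>K h h'. K \<in> L \<Longrightarrow> h \<in> Hom C b K \<Longrightarrow> h' \<in> Hom C b K \<Longrightarrow>
           Comp C h f = Comp C h' f \<Longrightarrow> h = h'"
  shows "f \<in> local_equivalences L"
proof -
  have "\<exists>!h. h \<in> Hom C b K \<and> Comp C h f = g" if "K \<in> L" "g \<in> Hom C a K" for K g
    using assms(2,3)[OF that(1)] that(2) by metis
  then show ?thesis
    unfolding local_equivalences_def using HomD[OF assms(1)] by simp
qed

lemma local_equivalences_ex:
  assumes "f \<in> local_equivalences L" "f \<in> Hom C a b" "K \<in> L" "g \<in> Hom C a K"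
  obtains h where "h \<in> Hom C b K" "Comp C h f = g"
proof -
  have "\<exists>!h. h \<in> Hom C b K \<and> Comp C h f = g"
    using assms(1,3,4) HomD[OF assms(2)] unfolding local_equivalences_def by simp
  with that show thesis by blast
qed

lemma local_equivalences_uniq:
  assumes "f \<in> local_equivalences L" "f \<in> Hom C a b" "K \<in> L"
    and "h \<in> Hom C b K" "h' \<in> Hom C b K" "Comp C h f = Comp C h' f"
  shows "h = h'"
proof -
  have "Comp C h f \<in> Hom C a K" by (rule Comp_Hom[OF assms(2,4)])
  then have "\<exists>!k. k \<in> Hom C b K \<and> Comp C k f = Comp C h f"
    using assms(1,3) HomD[OF assms(2)] unfolding local_equivalences_def by simp
  with assms(4-6) show ?thesis by metis
qed

lemma local_equivalences_Arr: "f \<in> local_equivalences L \<Longrightarrow> f \<in> Arr C"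
  by (simp add: local_equivalences_def)

lemma Ident_local_equivalence: "a \<in> Obj C \<Longrightarrow> Ident C a \<in> local_equivalences L"
  by (rule local_equivalencesI[OF Ident_Hom]) (metis Comp_Ident)+

lemma local_equivalence_comp:
  assumes f: "f \<in> Hom C a b" "f \<in> local_equivalences L"
    and g: "g \<in> Hom C b c" "g \<in> local_equivalences L"
  shows "Comp C g f \<in> local_equivalences L"
proof (rule local_equivalencesI[OF Comp_Hom[OF f(1) g(1)]])
  fix K k assume "K \<in> L" "k \<in> Hom C a K"
  then obtain h where h: "h \<in> Hom C b K" "Comp C h f = k"
    using local_equivalences_ex f by metis
  obtain h' where "h' \<in> Hom C c K" "Comp C h' g = h"
    using local_equivalences_ex[OF g(2,1) \<open>K \<in> L\<close> h(1)] .
  then show "\<exists>h\<in>Hom C c K. Comp C h (Comp C g f) = k"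
    using Comp_assoc[OF f(1) g(1)] h(2) by metis
next
  fix K h h' assume K: "K \<in> L" and h: "h \<in> Hom C c K" "h' \<in> Hom C c K"
    "Comp C h (Comp C g f) = Comp C h' (Comp C g f)"
  then have "Comp C (Comp C h g) f = Comp C (Comp C h' g) f"
    using Comp_assoc[OF f(1) g(1)] by metis
  then have "Comp C h g = Comp C h' g"
    using local_equivalences_uniq[OF f(2,1) K Comp_Hom[OF g(1) h(1)] Comp_Hom[OF g(1) h(2)]] by blast
  then show "h = h'"
    using local_equivalences_uniq[OF g(2,1) K h(1,2)] by blast
qed

text \<open>For each \<open>K\<close> in \<open>L\<close>, precomposition with \<open>f\<close> and
  \<open>g\<close> gives a composite Hom(c, K) -> Hom(b, K) -> Hom(a, K), and bijections satisfy
  two-out-of-three; each block chases one element through this composite.\<close>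

lemma two_out_of_three_local_equivalences: "two_out_of_three C (local_equivalences L)"
  unfolding two_out_of_three_def
proof (intro ballI impI conjI; (elim conjE)?)
  fix f g assume "f \<in> Arr C" "g \<in> Arr C" "Cod C f = Dom C g"
  then obtain a b c where f: "f \<in> Hom C a b" and g: "g \<in> Hom C b c"
    by (metis Hom_self)
  note gf = Comp_Hom[OF f g]
  note ass = Comp_assoc[OF f g]
  { assume "f \<in> local_equivalences L" "g \<in> local_equivalences L"
    then show "Comp C g f \<in> local_equivalences L" by (intro local_equivalence_comp[OF f _ g]) }
  { assume F: "f \<in> local_equivalences L" and GF: "Comp C g f \<in> local_equivalences L"
    show "g \<in> local_equivalences L"
    proof (rule local_equivalencesI[OF g])
      fix K k assume K: "K \<in> L" and k: "k \<in> Hom C b K"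
      obtain h where h: "h \<in> Hom C c K" "Comp C h (Comp C g f) = Comp C k f"
        using local_equivalences_ex[OF GF gf K Comp_Hom[OF f k]] .
      have "Comp C h g = k"
        using local_equivalences_uniq[OF F f K Comp_Hom[OF g h(1)] k] ass[OF h(1)] h(2) by metis
      with h show "\<exists>h\<in>Hom C c K. Comp C h g = k" by blast
    next
      fix K h h' assume K: "K \<in> L" and h: "h \<in> Hom C c K" "h' \<in> Hom C c K"
        "Comp C h g = Comp C h' g"
      show "h = h'"
        using local_equivalences_uniq[OF GF gf K h(1,2)] ass[OF h(1)] ass[OF h(2)] h(3) by metis
    qed }
  { assume G: "g \<in> local_equivalences L" and GF: "Comp C g f \<in> local_equivalences L"
    show "f \<in> local_equivalences L"
    proof (rule local_equivalencesI[OF f])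
      fix K k assume K: "K \<in> L" and k: "k \<in> Hom C a K"
      obtain h where h: "h \<in> Hom C c K" "Comp C h (Comp C g f) = k"
        using local_equivalences_ex[OF GF gf K k] .
      with ass[OF h(1)] Comp_Hom[OF g h(1)] show "\<exists>h\<in>Hom C b K. Comp C h f = k" by metis
    next
      fix K h h' assume K: "K \<in> L" and h: "h \<in> Hom C b K" "h' \<in> Hom C b K"
        "Comp C h f = Comp C h' f"
      obtain k k' where k: "k \<in> Hom C c K" "Comp C k g = h" "k' \<in> Hom C c K" "Comp C k' g = h'"
        using local_equivalences_ex[OF G g K] h(1,2) by metis
      then have "Comp C k (Comp C g f) = Comp C k' (Comp C g f)"
        using ass h(3) by metis
      then show "h = h'"
        using local_equivalences_uniq[OF GF gf K k(1,3)] k by blast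
    qed }
qed

lemma is_retractE:
  assumes "is_retract C f g"
  obtains a b x y s r s' r' where
    "f \<in> Hom C a b" "g \<in> Hom C x y" "s \<in> Hom C a x" "r \<in> Hom C x a" "s' \<in> Hom C b y" "r' \<in> Hom C y b"
    "Comp C r s = Ident C a" "Comp C r' s' = Ident C b"
    "Comp C g s = Comp C s' f" "Comp C f r = Comp C r' g"
proof -
  from assms obtain s r s' r' where
    "f \<in> Arr C" "g \<in> Arr C" "s \<in> Hom C (Dom C f) (Dom C g)" "r \<in> Hom C (Dom C g) (Dom C f)"
    "s' \<in> Hom C (Cod C f) (Cod C g)" "r' \<in> Hom C (Cod C g) (Cod C f)"
    "Comp C r s = Ident C (Dom C f)" "Comp C r' s' = Ident C (Cod C f)"
    "Comp C g s = Comp C s' f" "Comp C f r = Comp C r' g"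
    unfolding is_retract_def by blast
  then show thesis using that Hom_self by metis
qed

text \<open>Precomposition makes restriction along \<open>f\<close> a retract of restriction along
  \<open>g\<close>, and a retract of a bijection is a bijection. An extension over \<open>b\<close>
  is found by pulling back to \<open>x\<close>, extending over \<open>y\<close> and restricting
  along \<open>s'\<close>.\<close>

lemma local_equivalence_retract:
  assumes "is_retract C f g" and G: "g \<in> local_equivalences L"
  shows "f \<in> local_equivalences L"
  using assms(1)
proof (rule is_retractE)
  fix a b x y s r s' r'
  assume f: "f \<in> Hom C a b" and g: "g \<in> Hom C x y"
    and s: "s \<in> Hom C a x" and r: "r \<in> Hom C x a" and s': "s' \<in> Hom C b y" and r': "r' \<in> Hom C y b"
    and rs: "Comp C r s = Ident C a" and rs': "Comp C r' s' = Ident C b"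
    and gs: "Comp C g s = Comp C s' f" and fr: "Comp C f r = Comp C r' g"
  show "f \<in> local_equivalences L"
  proof (rule local_equivalencesI[OF f])
    fix K k assume K: "K \<in> L" and k: "k \<in> Hom C a K"
    obtain h where h: "h \<in> Hom C y K" "Comp C h g = Comp C k r"
      using local_equivalences_ex[OF G g K Comp_Hom[OF r k]] .
    have "Comp C (Comp C h s') f = Comp C h (Comp C g s)"
      using Comp_assoc[OF f s' h(1)] gs by simp
    also have "\<dots> = Comp C k (Comp C r s)"
      using Comp_assoc[OF s g h(1)] Comp_assoc[OF s r k] h(2) by simp
    also have "\<dots> = k" using rs Comp_Ident[OF k] by simp
    finally show "\<exists>h\<in>Hom C b K. Comp C h f = k" using Comp_Hom[OF s' h(1)] by blast
  next
    fix K h h' assume K: "K \<in> L" and h: "h \<in> Hom C b K" "h' \<in> Hom C b K"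
      "Comp C h f = Comp C h' f"
    have "Comp C (Comp C h r') g = Comp C (Comp C h f) r" if "h \<in> Hom C b K" for h
      using Comp_assoc[OF g r' that] Comp_assoc[OF r f that] fr by simp
    from this[OF h(1)] this[OF h(2)] h(3) have "Comp C (Comp C h r') g = Comp C (Comp C h' r') g"
      by simp
    then have e: "Comp C h r' = Comp C h' r'"
      using local_equivalences_uniq[OF G g K Comp_Hom[OF r' h(1)] Comp_Hom[OF r' h(2)]] by blast
    have "Comp C (Comp C h r') s' = h" if "h \<in> Hom C b K" for h
      using Comp_assoc[OF s' r' that] rs' Comp_Ident[OF that] by simp
    from this[OF h(1)] this[OF h(2)] e show "h = h'" by metis
  qed
qed

text \<open>Uniqueness is split off as joint epimorphy of the two legs. The universal property
  speaks of compatible pairs, and any map out of the corner yields such a pair because the square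
  commutes.\<close>

lemma is_pushoutE:
  assumes "is_pushout C f g f' g'"
  obtains a b c d where "f \<in> Hom C a b" "g \<in> Hom C a c" "f' \<in> Hom C c d" "g' \<in> Hom C b d"
    "Comp C g' f = Comp C f' g"
    "\<And>Z u v. u \<in> Hom C b Z \<Longrightarrow> v \<in> Hom C c Z \<Longrightarrow> Comp C u f = Comp C v g \<Longrightarrow>
        \<exists>h\<in>Hom C d Z. Comp C h g' = u \<and> Comp C h f' = v"
    "\<And>Z h h'. h \<in> Hom C d Z \<Longrightarrow> h' \<in> Hom C d Z \<Longrightarrow> Comp C h g' = Comp C h' g' \<Longrightarrow>
        Comp C h f' = Comp C h' f' \<Longrightarrow> h = h'"
proof -
  define a b c d where abcd: "a = Dom C f" "b = Cod C f" "c = Dom C f'" "d = Cod C f'"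
  have fg: "f \<in> Hom C a b" "g \<in> Hom C a c" "f' \<in> Hom C c d" "g' \<in> Hom C b d"
    and e: "Comp C g' f = Comp C f' g"
    and u: "\<And>Z u v. u \<in> Hom C b Z \<Longrightarrow> v \<in> Hom C c Z \<Longrightarrow> Comp C u f = Comp C v g \<Longrightarrow>
        (\<exists>!h. h \<in> Hom C d Z \<and> Comp C h g' = u \<and> Comp C h f' = v)"
    using assms unfolding is_pushout_def abcd by (auto simp: Hom_def)
  show thesis
  proof (rule that[OF fg e])
    fix Z u v assume "u \<in> Hom C b Z" "v \<in> Hom C c Z" "Comp C u f = Comp C v g"
    from u[OF this] show "\<exists>h\<in>Hom C d Z. Comp C h g' = u \<and> Comp C h f' = v" by blast
  next
    fix Z h h' assume h: "h \<in> Hom C d Z" "h' \<in> Hom C d Z"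
      and eq: "Comp C h g' = Comp C h' g'" "Comp C h f' = Comp C h' f'"
    have "Comp C (Comp C h g') f = Comp C (Comp C h f') g"
      using Comp_assoc[OF fg(1,4) h(1)] Comp_assoc[OF fg(2,3) h(1)] e by simp
    from u[OF Comp_Hom[OF fg(4) h(1)] Comp_Hom[OF fg(3) h(1)] this] h eq show "h = h'"
      by (metis (no_types, lifting))
  qed
qed

lemma is_pushoutI:
  assumes fg: "f \<in> Hom C a b" "g \<in> Hom C a c" "f' \<in> Hom C c d" "g' \<in> Hom C b d"
    and "Comp C g' f = Comp C f' g"
    and "\<And>Z u v. u \<in> Hom C b Z \<Longrightarrow> v \<in> Hom C c Z \<Longrightarrow> Comp C u f = Comp C v g \<Longrightarrow>
        \<exists>h\<in>Hom C d Z. Comp C h g' = u \<and> Comp C h f' = v"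
    and "\<And>Z h h'. h \<in> Hom C d Z \<Longrightarrow> h' \<in> Hom C d Z \<Longrightarrow> Comp C h g' = Comp C h' g' \<Longrightarrow>
        Comp C h f' = Comp C h' f' \<Longrightarrow> h = h'"
  shows "is_pushout C f g f' g'"
proof -
  have "\<exists>!h. h \<in> Hom C d Z \<and> Comp C h g' = u \<and> Comp C h f' = v"
    if "u \<in> Hom C b Z" "v \<in> Hom C c Z" "Comp C u f = Comp C v g" for Z u v
    using assms(6)[OF that] assms(7) by (metis (no_types))
  moreover have "Cod C g = c" "Cod C f = b" "Cod C f' = d" "Dom C f = a" "Dom C f' = c"
    using fg by (auto simp: Hom_def)
  ultimately show ?thesis
    unfolding is_pushout_def using fg assms(5) by (simp add: HomD)
qed

text \<open>A map out of \<open>c\<close> is restricted along \<open>g\<close>, extended over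
  \<open>b\<close> and glued with itself. For uniqueness, the component on \<open>b\<close> is
  already determined by its restriction along \<open>f\<close>.\<close>

lemma local_equivalence_pushout:
  assumes "is_pushout C f g f' g'" and F: "f \<in> local_equivalences L"
  shows "f' \<in> local_equivalences L"
  using assms(1)
proof (rule is_pushoutE)
  fix a b c d
  assume f: "f \<in> Hom C a b" and g: "g \<in> Hom C a c" and f': "f' \<in> Hom C c d" and g': "g' \<in> Hom C b d"
    and e: "Comp C g' f = Comp C f' g"
    and ex: "\<And>Z u v. u \<in> Hom C b Z \<Longrightarrow> v \<in> Hom C c Z \<Longrightarrow> Comp C u f = Comp C v g \<Longrightarrow>
        \<exists>h\<in>Hom C d Z. Comp C h g' = u \<and> Comp C h f' = v"
    and un: "\<And>Z h h'. h \<in> Hom C d Z \<Longrightarrow> h' \<in> Hom C d Z \<Longrightarrow> Comp C h g' = Comp C h' g' \<Longrightarrow>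
        Comp C h f' = Comp C h' f' \<Longrightarrow> h = h'"
  show "f' \<in> local_equivalences L"
  proof (rule local_equivalencesI[OF f'])
    fix K k assume K: "K \<in> L" and k: "k \<in> Hom C c K"
    obtain u where u: "u \<in> Hom C b K" "Comp C u f = Comp C k g"
      using local_equivalences_ex[OF F f K Comp_Hom[OF g k]] .
    from ex[OF u(1) k u(2)] show "\<exists>h\<in>Hom C d K. Comp C h f' = k" by blast
  next
    fix K h h' assume K: "K \<in> L" and h: "h \<in> Hom C d K" "h' \<in> Hom C d K"
      and eq: "Comp C h f' = Comp C h' f'"
    have "Comp C (Comp C h g') f = Comp C (Comp C h f') g" if "h \<in> Hom C d K" for h
      using Comp_assoc[OF f g' that] Comp_assoc[OF g f' that] e by simp
    from this[OF h(1)] this[OF h(2)] eq have "Comp C (Comp C h g') f = Comp C (Comp C h' g') f" by simp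
    then have "Comp C h g' = Comp C h' g'"
      using local_equivalences_uniq[OF F f K Comp_Hom[OF g' h(1)] Comp_Hom[OF g' h(2)]] by blast
    with un[OF h] eq show "h = h'" by blast
  qed
qed

text \<open>A chain with bottom \<open>i\<^sub>0\<close>: the shape of the stages and of the limit steps of a transfinite
  composition.\<close>

definition chain :: "'k rel \<Rightarrow> 'k set \<Rightarrow> ('k \<Rightarrow> 'o) \<Rightarrow> ('k \<Rightarrow> 'k \<Rightarrow> 'm) \<Rightarrow> 'k \<Rightarrow> bool" where
  "chain r J D d i\<^sub>0 \<longleftrightarrow>
     i\<^sub>0 \<in> J \<and> (\<forall>i\<in>J. (i\<^sub>0, i) \<in> r \<and> (i, i) \<in> r) \<and> (\<forall>i\<in>J. \<forall>j\<in>J. (i, j) \<in> r \<or> (j, i) \<in> r) \<and>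
     (\<forall>i j. (i, j) \<in> r \<longrightarrow> d i j \<in> Hom C (D i) (D j)) \<and>
     (\<forall>i j k. (i, j) \<in> r \<and> (j, k) \<in> r \<longrightarrow> Comp C (d j k) (d i j) = d i k)"

text \<open>Only the maps out of the bottom stage are followed, because the composite is the bottom
  leg \<open>c i\<^sub>0\<close> of the colimit. The induction along \<open>r\<close> composes with
  a map of \<open>K\<close> at successors, and the single hypothesis \<open>colim\<close> serves the
  limit stages as well as the final colimit.\<close>

lemma transfinite_composition_in:
  assumes r: "Well_order r" and "transfinite_composition C r K f"
    and ident: "\<And>a. a \<in> Obj C \<Longrightarrow> Ident C a \<in> M"
    and comp: "\<And>a b c f g. f \<in> Hom C a b \<Longrightarrow> f \<in> M \<Longrightarrow> g \<in> Hom C b c \<Longrightarrow> g \<in> K \<Longrightarrow> Comp C g f \<in> M"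
    and colim: "\<And>J D d Z c i\<^sub>0. chain r J D d i\<^sub>0 \<Longrightarrow> (\<forall>i\<in>J. d i\<^sub>0 i \<in> M) \<Longrightarrow>
        is_colimit C J D {(i, d i k, k) | i k. i \<in> J \<and> k \<in> J \<and> (i, k) \<in> r} Z c \<Longrightarrow> c i\<^sub>0 \<in> M"
  shows "f \<in> M"
proof -
  from assms(2) obtain D d Z c i\<^sub>0 where
    Dd: "\<forall>i\<in>Field r. D i \<in> Obj C \<and> d i i = Ident C (D i)"
    and hom: "\<forall>i j. (i, j) \<in> r \<longrightarrow> d i j \<in> Hom C (D i) (D j)"
    and dd: "\<forall>i j k. (i, j) \<in> r \<and> (j, k) \<in> r \<longrightarrow> Comp C (d j k) (d i j) = d i k"
    and succ: "\<forall>i j. is_succ_in r i j \<longrightarrow> d i j \<in> K"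
    and lim: "\<forall>j\<in>Field r. underS r j \<noteq> {} \<and> (\<nexists>i. is_succ_in r i j) \<longrightarrow>
       is_colimit C (underS r j) D
         {(i, d i k, k) | i k. i \<in> underS r j \<and> k \<in> underS r j \<and> (i, k) \<in> r}
         (D j) (\<lambda>i. d i j)"
    and col: "is_colimit C (Field r) D {(i, d i k, k) | i k. (i, k) \<in> r} Z c"
    and i0: "i\<^sub>0 \<in> Field r" "\<forall>i\<in>Field r. (i\<^sub>0, i) \<in> r" and f: "f = c i\<^sub>0"
    unfolding transfinite_composition_def by blast
  have refl: "(i, i) \<in> r" if "i \<in> Field r" for i
    using r that unfolding well_order_on_def linear_order_on_def partial_order_on_def preorder_on_def
    by (auto simp: refl_on_def)
  have total: "(i, j) \<in> r \<or> (j, i) \<in> r" if "i \<in> Field r" "j \<in> Field r" for i j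
    using r that refl unfolding well_order_on_def linear_order_on_def total_on_def by metis
  have wf: "wf (r - Id)" using r unfolding well_order_on_def by blast
  have chain: "chain r J D d i\<^sub>0" if "i\<^sub>0 \<in> J" "J \<subseteq> Field r" for J
    unfolding chain_def using that i0 refl total hom dd by blast
  have M: "d i\<^sub>0 j \<in> M" if "j \<in> Field r" for j
    using wf that
  proof (induction j rule: wf_induct_rule)
    case (less j)
    have IH: "d i\<^sub>0 i \<in> M" if "i \<in> underS r j" for i
      using less.IH[of i] that unfolding underS_def by (auto simp: Field_def)
    show ?case
    proof (cases "underS r j = {}")
      case True
      then have "j = i\<^sub>0" using bspec[OF i0(2) less.prems] unfolding underS_def by auto
      then show ?thesis using Dd less.prems ident by metis
    next
      case ne: False
      show ?thesis
      proof (cases "\<exists>i. is_succ_in r i j")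
        case True
        then obtain i where i: "is_succ_in r i j" by blast
        then have ij: "(i, j) \<in> r" "i \<in> underS r j" "i \<in> Field r"
          unfolding is_succ_in_def underS_def Field_def by auto
        have i0i: "(i\<^sub>0, i) \<in> r" using i0 ij by blast
        have "Comp C (d i j) (d i\<^sub>0 i) \<in> M"
          using comp[of "d i\<^sub>0 i" "D i\<^sub>0" "D i" "d i j" "D j"] hom ij i0i IH succ i by blast
        then show ?thesis using dd ij i0i by metis
      next
        case False
        have sub: "underS r j \<subseteq> Field r" unfolding underS_def Field_def by auto
        have "i\<^sub>0 \<in> underS r j"
        proof (rule ccontr)
          assume "i\<^sub>0 \<notin> underS r j"
          then have "i\<^sub>0 = j" using bspec[OF i0(2) less.prems] unfolding underS_def by auto
          obtain k where k: "k \<in> underS r j" using ne by blast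
          then have "(k, j) \<in> r" "(j, k) \<in> r" "k \<noteq> j"
            using i0(2) \<open>i\<^sub>0 = j\<close> unfolding underS_def Field_def by auto
          then show False
            using r unfolding well_order_on_def linear_order_on_def partial_order_on_def antisym_def by blast
        qed
        then show ?thesis
          using colim[of "underS r j" D d i\<^sub>0 "D j" "\<lambda>i. d i j"] chain sub IH lim False ne less.prems by blast
      qed
    qed
  qed
  \<comment> \<open>Related elements lie in the field anyway, so the final colimit has the shape of
    a limit stage.\<close>
  have "{(i, d i k, k) | i k. (i, k) \<in> r} =
      {(i, d i k, k) | i k. i \<in> Field r \<and> k \<in> Field r \<and> (i, k) \<in> r}"
    by (auto simp: Field_def)
  then show ?thesis
    using colim[of "Field r" D d i\<^sub>0 Z c] chain i0 M col f by simp
qed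

text \<open>A map on the bottom stage extends uniquely to each stage. Uniqueness at a stage makes
  these extensions compatible, so they form a cocone and the colimit supplies the extension.\<close>

lemma local_equivalence_transfinite_composition:
  assumes "Well_order r" "transfinite_composition C r K f" "K \<subseteq> local_equivalences L"
  shows "f \<in> local_equivalences L"
proof (rule transfinite_composition_in[OF assms(1,2)])
  fix J D d Z c i\<^sub>0
  assume ch: "chain r J D d i\<^sub>0" and M: "\<forall>i\<in>J. d i\<^sub>0 i \<in> local_equivalences L"
    and col: "is_colimit C J D {(i, d i k, k) | i k. i \<in> J \<and> k \<in> J \<and> (i, k) \<in> r} Z c"
  have i0: "i\<^sub>0 \<in> J" and le: "\<And>i. i \<in> J \<Longrightarrow> (i\<^sub>0, i) \<in> r"
    and hom: "\<And>i j. (i, j) \<in> r \<Longrightarrow> d i j \<in> Hom C (D i) (D j)"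
    and dd: "\<And>i j k. (i, j) \<in> r \<Longrightarrow> (j, k) \<in> r \<Longrightarrow> Comp C (d j k) (d i j) = d i k"
    using ch unfolding chain_def by blast+
  let ?E = "{(i, d i k, k) | i k. i \<in> J \<and> k \<in> J \<and> (i, k) \<in> r}"
  have c: "\<And>i. i \<in> J \<Longrightarrow> c i \<in> Hom C (D i) Z"
    and cd: "\<And>i k. i \<in> J \<Longrightarrow> k \<in> J \<Longrightarrow> (i, k) \<in> r \<Longrightarrow> Comp C (c k) (d i k) = c i"
    using col unfolding is_colimit_def is_cocone_def by blast+
  have un: "\<exists>!h. h \<in> Hom C Z Z' \<and> (\<forall>i\<in>J. Comp C h (c i) = c' i)" if "is_cocone C J D ?E Z' c'" for Z' c'
    using col that unfolding is_colimit_def by blast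
  have d0: "\<And>i. i \<in> J \<Longrightarrow> d i\<^sub>0 i \<in> Hom C (D i\<^sub>0) (D i)" using le hom by blast
  show "c i\<^sub>0 \<in> local_equivalences L"
  proof (rule local_equivalencesI[OF c[OF i0]])
    fix K k assume K: "K \<in> L" and k: "k \<in> Hom C (D i\<^sub>0) K"
    have "\<exists>h. h \<in> Hom C (D i) K \<and> Comp C h (d i\<^sub>0 i) = k" if "i \<in> J" for i
      using local_equivalences_ex[OF M[rule_format, OF that] d0[OF that] K k] by blast
    then obtain c' where c': "\<And>i. i \<in> J \<Longrightarrow> c' i \<in> Hom C (D i) K \<and> Comp C (c' i) (d i\<^sub>0 i) = k"
      by metis
    have "Comp C (c' j) (d i j) = c' i" if ij: "i \<in> J" "j \<in> J" "(i, j) \<in> r" for i j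
    proof (rule local_equivalences_uniq[OF M[rule_format, OF ij(1)] d0[OF ij(1)] K])
      show "Comp C (c' j) (d i j) \<in> Hom C (D i) K" "c' i \<in> Hom C (D i) K"
        using c' ij hom Comp_Hom by blast+
      show "Comp C (Comp C (c' j) (d i j)) (d i\<^sub>0 i) = Comp C (c' i) (d i\<^sub>0 i)"
        using Comp_assoc[OF d0[OF ij(1)] hom[OF ij(3)], of "c' j" K] c'[OF ij(1)] c'[OF ij(2)] ij(3)
          dd[OF le[OF ij(1)] ij(3)] by simp
    qed
    then have "is_cocone C J D ?E K c'"
      unfolding is_cocone_def using c' Hom_Obj k by blast
    then obtain h where h: "h \<in> Hom C Z K" "\<forall>i\<in>J. Comp C h (c i) = c' i" using un by blast
    have "c' i\<^sub>0 = k"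
    proof -
      have "Comp C h (c i\<^sub>0) = Comp C h (Comp C (c i\<^sub>0) (d i\<^sub>0 i\<^sub>0))" using cd[OF i0 i0] le i0 by simp
      also have "\<dots> = k" using Comp_assoc[OF d0[OF i0] c[OF i0] h(1)] h(2) i0 c' by simp
      finally show ?thesis using h i0 by simp
    qed
    with h i0 show "\<exists>h\<in>Hom C Z K. Comp C h (c i\<^sub>0) = k" by metis
  next
    fix K h h' assume K: "K \<in> L" and h: "h \<in> Hom C Z K" "h' \<in> Hom C Z K"
      and eq: "Comp C h (c i\<^sub>0) = Comp C h' (c i\<^sub>0)"
    have key: "Comp C (Comp C h (c i)) (d i\<^sub>0 i) = Comp C h (c i\<^sub>0)" if "i \<in> J" "h \<in> Hom C Z K" for h i
      using Comp_assoc[OF d0 c] that cd le i0 by simp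
    have "Comp C h (c i) = Comp C h' (c i)" if "i \<in> J" for i
      using local_equivalences_uniq[OF M[rule_format, OF that] d0[OF that] K
          Comp_Hom[OF c[OF that] h(1)] Comp_Hom[OF c[OF that] h(2)]] key[OF that] h eq by simp
    moreover have "is_cocone C J D ?E K (\<lambda>i. Comp C h (c i))"
      unfolding is_cocone_def using Hom_Obj h(1) Comp_Hom[OF c h(1)] Comp_assoc[OF hom c h(1)] cd by auto
    ultimately show "h = h'" using un h by (metis (no_types, lifting))
  qed
next
  fix a b c f g
  assume "f \<in> Hom C a b" "f \<in> local_equivalences L" "g \<in> Hom C b c" "g \<in> K"
  then show "Comp C g f \<in> local_equivalences L"
    using local_equivalence_comp assms(3) by blast
qed (rule Ident_local_equivalence)

section \<open>Isomorphisms, lifting properties and retracts\<close>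

definition iso :: "'m \<Rightarrow> bool" where
  "iso p \<longleftrightarrow> p \<in> Arr C \<and> (\<exists>q\<in>Hom C (Cod C p) (Dom C p).
     Comp C q p = Ident C (Dom C p) \<and> Comp C p q = Ident C (Cod C p))"

lemma isoI:
  assumes "p \<in> Hom C a b" "q \<in> Hom C b a" "Comp C q p = Ident C a" "Comp C p q = Ident C b"
  shows "iso p"
  using assms unfolding iso_def by (auto simp: Hom_def)

text \<open>The identity of \<open>a\<close> extends along \<open>p\<close> to some
  \<open>q\<close>, and uniqueness of extensions along \<open>p\<close> turns the one-sided inverse
  into a two-sided one.\<close>

lemma local_equivalence_between_local:
  assumes p: "p \<in> Hom C a b" "p \<in> local_equivalences L" and L: "a \<in> L" "b \<in> L"
  shows "iso p"
proof -
  note ab = Hom_Obj[OF p(1)]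
  obtain q where q: "q \<in> Hom C b a" "Comp C q p = Ident C a"
    using local_equivalences_ex[OF p(2,1) L(1) Ident_Hom[OF ab(1)]] .
  have "Comp C (Comp C p q) p = Comp C (Ident C b) p"
    using Comp_assoc[OF p(1) q(1) p(1)] q(2) Comp_Ident[OF p(1)] Ident_Comp[OF p(1)] by simp
  then have "Comp C p q = Ident C b"
    using local_equivalences_uniq[OF p(2,1) L(2) Comp_Hom[OF q(1) p(1)] Ident_Hom[OF ab(2)]] by blast
  with p q show ?thesis by (intro isoI)
qed

lemma liftsI:
  assumes "i \<in> Hom C a b" "p \<in> Hom C x y"
    and "\<And>u v. u \<in> Hom C a x \<Longrightarrow> v \<in> Hom C b y \<Longrightarrow> Comp C p u = Comp C v i \<Longrightarrow>
          \<exists>h\<in>Hom C b x. Comp C h i = u \<and> Comp C p h = v"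
  shows "lifts C i p"
  using assms unfolding lifts_def by (auto simp: HomD)

lemma liftsE:
  assumes "lifts C i p" "i \<in> Hom C a b" "p \<in> Hom C x y"
    and "u \<in> Hom C a x" "v \<in> Hom C b y" "Comp C p u = Comp C v i"
  obtains h where "h \<in> Hom C b x" "Comp C h i = u" "Comp C p h = v"
proof -
  have "u \<in> Hom C (Dom C i) (Dom C p) \<and> v \<in> Hom C (Cod C i) (Cod C p) \<and> Comp C p u = Comp C v i"
    using assms by (simp add: HomD)
  then obtain h where "h \<in> Hom C (Cod C i) (Dom C p) \<and> Comp C h i = u \<and> Comp C p h = v"
    using assms(1) unfolding lifts_def by blast
  with that show thesis unfolding HomD(2,3)[OF assms(2)] HomD(2,3)[OF assms(3)] by blast
qed

lemma iso_rlp: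
  assumes "iso p" "K \<subseteq> Arr C"
  shows "p \<in> rlp C K"
  unfolding rlp_def
proof (intro CollectI conjI ballI)
  show "p \<in> Arr C" using assms by (simp add: iso_def)
  fix i assume "i \<in> K"
  with assms have i: "i \<in> Hom C (Dom C i) (Cod C i)" and p: "p \<in> Hom C (Dom C p) (Cod C p)"
    by (auto simp: iso_def Hom_def)
  obtain q where q: "q \<in> Hom C (Cod C p) (Dom C p)" "Comp C q p = Ident C (Dom C p)"
    "Comp C p q = Ident C (Cod C p)" using assms(1) unfolding iso_def by blast
  show "lifts C i p"
  proof (rule liftsI[OF i p])
    fix u v assume u: "u \<in> Hom C (Dom C i) (Dom C p)" and v: "v \<in> Hom C (Cod C i) (Cod C p)"
      and e: "Comp C p u = Comp C v i"
    have "Comp C (Comp C q v) i = u"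
      using Comp_assoc[OF i v q(1)] Comp_assoc[OF u p q(1)] q(2) e Ident_Comp[OF u] by simp
    moreover have "Comp C p (Comp C q v) = v"
      using Comp_assoc[OF v q(1) p] q(3) Ident_Comp[OF v] by simp
    ultimately show "\<exists>h\<in>Hom C (Cod C i) (Dom C p). Comp C h i = u \<and> Comp C p h = v"
      using Comp_Hom[OF v q(1)] by blast
  qed
qed

lemma rlp_comp:
  assumes p: "p \<in> Hom C x y" "p \<in> rlp C K" and q: "q \<in> Hom C y z" "q \<in> rlp C K" and K: "K \<subseteq> Arr C"
  shows "Comp C q p \<in> rlp C K"
  unfolding rlp_def
proof (intro CollectI conjI ballI)
  show "Comp C q p \<in> Arr C" using Comp_Hom[OF p(1) q(1)] by (simp add: HomD)
  fix i assume "i \<in> K"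
  with K have i: "i \<in> Hom C (Dom C i) (Cod C i)" by (auto simp: Hom_def)
  have lp: "lifts C i p" and lq: "lifts C i q" using p q \<open>i \<in> K\<close> unfolding rlp_def by blast+
  show "lifts C i (Comp C q p)"
  proof (rule liftsI[OF i Comp_Hom[OF p(1) q(1)]])
    fix u v assume u: "u \<in> Hom C (Dom C i) x" and v: "v \<in> Hom C (Cod C i) z"
      and "Comp C (Comp C q p) u = Comp C v i"
    then have "Comp C q (Comp C p u) = Comp C v i" using Comp_assoc[OF u p(1) q(1)] by simp
    then obtain h where h: "h \<in> Hom C (Cod C i) y" "Comp C h i = Comp C p u" "Comp C q h = v"
      using liftsE[OF lq i q(1) Comp_Hom[OF u p(1)] v] by metis
    obtain k where k: "k \<in> Hom C (Cod C i) x" "Comp C k i = u" "Comp C p k = h"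
      using liftsE[OF lp i p(1) u h(1)] h(2) by metis
    then show "\<exists>h\<in>Hom C (Cod C i) x. Comp C h i = u \<and> Comp C (Comp C q p) h = v"
      using Comp_assoc[OF k(1) p(1) q(1)] h(3) by metis
  qed
qed

text \<open>The retract argument: lifting a composite against its second factor gives a section of
  \<open>p\<close> compatible with \<open>i\<close>, and the domain part of the retract is the
  identity. The version on the right is dual, with a retraction of \<open>i\<close>.\<close>

lemma retract_argument_left:
  assumes i: "i \<in> Hom C a b" and p: "p \<in> Hom C b c" and l: "lifts C (Comp C p i) p"
  shows "is_retract C (Comp C p i) i"
proof -
  note f = Comp_Hom[OF i p]
  note ob = Hom_Obj[OF f]
  obtain h where h: "h \<in> Hom C c b" "Comp C h (Comp C p i) = i" "Comp C p h = Ident C c"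
    using liftsE[OF l f p i Ident_Hom[OF ob(2)]] Ident_Comp[OF f] by metis
  show ?thesis
    unfolding is_retract_def HomD(2,3)[OF f] HomD(2,3)[OF i]
    using HomD(1)[OF f] HomD(1)[OF i] h p Ident_Hom[OF ob(1)] Comp_Ident[OF i] Comp_Ident[OF f]
      Comp_Ident[OF Ident_Hom[OF ob(1)]] by metis
qed

lemma retract_argument_right:
  assumes i: "i \<in> Hom C a b" and p: "p \<in> Hom C b c" and l: "lifts C i (Comp C p i)"
  shows "is_retract C (Comp C p i) p"
proof -
  note f = Comp_Hom[OF i p]
  note ob = Hom_Obj[OF f]
  obtain h where h: "h \<in> Hom C b a" "Comp C h i = Ident C a" "Comp C (Comp C p i) h = p"
    using liftsE[OF l i f Ident_Hom[OF ob(1)] p] Comp_Ident[OF f] by metis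
  show ?thesis
    unfolding is_retract_def HomD(2,3)[OF f] HomD(2,3)[OF p]
    using HomD(1)[OF f] HomD(1)[OF p] h i Ident_Hom[OF ob(2)] Ident_Comp[OF p] Ident_Comp[OF f]
      Comp_Ident[OF Ident_Hom[OF ob(2)]] by metis
qed

lemma rlp_retract:
  assumes "is_retract C f g" "g \<in> rlp C K" "K \<subseteq> Arr C"
  shows "f \<in> rlp C K"
  using assms(1)
proof (rule is_retractE)
  fix a b x y s r s' r'
  assume f: "f \<in> Hom C a b" and g: "g \<in> Hom C x y"
    and s: "s \<in> Hom C a x" and r: "r \<in> Hom C x a" and s': "s' \<in> Hom C b y" and r': "r' \<in> Hom C y b"
    and rs: "Comp C r s = Ident C a" and rs': "Comp C r' s' = Ident C b"
    and gs: "Comp C g s = Comp C s' f" and fr: "Comp C f r = Comp C r' g"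
  show "f \<in> rlp C K"
    unfolding rlp_def
  proof (intro CollectI conjI ballI)
    show "f \<in> Arr C" using f by (rule HomD)
    fix i assume "i \<in> K"
    with assms(2,3) have i: "i \<in> Hom C (Dom C i) (Cod C i)" and l: "lifts C i g"
      by (auto simp: Hom_def rlp_def)
    show "lifts C i f"
    proof (rule liftsI[OF i f])
      fix u v assume u: "u \<in> Hom C (Dom C i) a" and v: "v \<in> Hom C (Cod C i) b"
        and e: "Comp C f u = Comp C v i"
      have "Comp C g (Comp C s u) = Comp C (Comp C s' v) i"
        using Comp_assoc[OF u s g] Comp_assoc[OF u f s'] Comp_assoc[OF i v s'] gs e by simp
      then obtain h where h: "h \<in> Hom C (Cod C i) x" "Comp C h i = Comp C s u" "Comp C g h = Comp C s' v"
        using liftsE[OF l i g Comp_Hom[OF u s] Comp_Hom[OF v s']] by metis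
      have "Comp C (Comp C r h) i = u"
        using Comp_assoc[OF i h(1) r] h(2) Comp_assoc[OF u s r] rs Ident_Comp[OF u] by simp
      moreover have "Comp C f (Comp C r h) = v"
        using Comp_assoc[OF h(1) r f] fr Comp_assoc[OF h(1) g r'] h(3) Comp_assoc[OF v s' r'] rs'
          Ident_Comp[OF v] by simp
      ultimately show "\<exists>h\<in>Hom C (Cod C i) a. Comp C h i = u \<and> Comp C f h = v"
        using Comp_Hom[OF h(1) r] by blast
    qed
  qed
qed

lemma llp_pushout:
  assumes "is_pushout C f g f' g'" and F: "f \<in> llp C K" and K: "K \<subseteq> Arr C"
  shows "f' \<in> llp C K"
  using assms(1)
proof (rule is_pushoutE)
  fix a b c d
  assume f: "f \<in> Hom C a b" and g: "g \<in> Hom C a c" and f': "f' \<in> Hom C c d" and g': "g' \<in> Hom C b d"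
    and e: "Comp C g' f = Comp C f' g"
    and ex: "\<And>Z u v. u \<in> Hom C b Z \<Longrightarrow> v \<in> Hom C c Z \<Longrightarrow> Comp C u f = Comp C v g \<Longrightarrow>
        \<exists>h\<in>Hom C d Z. Comp C h g' = u \<and> Comp C h f' = v"
    and un: "\<And>Z h h'. h \<in> Hom C d Z \<Longrightarrow> h' \<in> Hom C d Z \<Longrightarrow> Comp C h g' = Comp C h' g' \<Longrightarrow>
        Comp C h f' = Comp C h' f' \<Longrightarrow> h = h'"
  show "f' \<in> llp C K"
    unfolding llp_def
  proof (intro CollectI conjI ballI)
    show "f' \<in> Arr C" using f' by (rule HomD)
    fix p assume "p \<in> K"
    with K F have p: "p \<in> Hom C (Dom C p) (Cod C p)" and l: "lifts C f p"
      by (auto simp: Hom_def llp_def)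
    show "lifts C f' p"
    proof (rule liftsI[OF f' p])
      fix u v assume u: "u \<in> Hom C c (Dom C p)" and v: "v \<in> Hom C d (Cod C p)"
        and uv: "Comp C p u = Comp C v f'"
      have "Comp C p (Comp C u g) = Comp C (Comp C v g') f"
        using Comp_assoc[OF g u p] Comp_assoc[OF g f' v] Comp_assoc[OF f g' v] e uv by simp
      then obtain w where w: "w \<in> Hom C b (Dom C p)" "Comp C w f = Comp C u g" "Comp C p w = Comp C v g'"
        using liftsE[OF l f p Comp_Hom[OF g u] Comp_Hom[OF g' v]] by metis
      obtain h where h: "h \<in> Hom C d (Dom C p)" "Comp C h g' = w" "Comp C h f' = u"
        using ex[OF w(1) u w(2)] by blast
      have "Comp C p h = v"
        using un[OF Comp_Hom[OF h(1) p] v] Comp_assoc[OF g' h(1) p] Comp_assoc[OF f' h(1) p] h w uv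
        by simp
      with h show "\<exists>h\<in>Hom C d (Dom C p). Comp C h f' = u \<and> Comp C p h = v" by blast
    qed
  qed
qed

text \<open>The usual factorization into a trivial cofibration and a fibration is weakened to a weak
  equivalence followed by a fibration; factoring the weak equivalence once more through
  \<open>Cof\<close> and \<open>TF\<close> repairs it. An explicit middle object is therefore
  enough, and the map into it need not be a cofibration. With the fibrations taken to be
  \<open>rlp C (Cof \<inter> W)\<close>, the remaining equalities of classes are retract
  arguments.\<close>

theorem model_structureI:
  assumes cof: "Cof = llp C TF" "TF = rlp C Cof"
    and fact: "\<And>f. f \<in> Arr C \<Longrightarrow> \<exists>c\<in>Cof. \<exists>t\<in>TF. Cod C c = Dom C t \<and> f = Comp C t c"
    and W: "W \<subseteq> Arr C" "two_out_of_three C W"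
    and ret: "\<And>f g. is_retract C f g \<Longrightarrow> g \<in> W \<Longrightarrow> f \<in> W"
    and TFW: "TF \<subseteq> W"
    and factW: "\<And>f. f \<in> Arr C \<Longrightarrow>
          \<exists>e\<in>W. \<exists>m\<in>rlp C (Cof \<inter> W). Cod C e = Dom C m \<and> f = Comp C m e"
  shows "model_structure C \<lparr>cofibrations = Cof, weak_equivalences = W, fibrations = rlp C (Cof \<inter> W)\<rparr>"
proof -
  let ?F = "rlp C (Cof \<inter> W)"
  have CofArr: "Cof \<subseteq> Arr C" unfolding cof(1) llp_def by blast
  have TFF: "TF \<subseteq> ?F" unfolding cof(2) rlp_def by blast
  have FArr: "?F \<subseteq> Arr C" unfolding rlp_def by blast
  have factL: "\<exists>j\<in>Cof \<inter> W. \<exists>p\<in>?F. Cod C j = Dom C p \<and> f = Comp C p j" if f: "f \<in> Arr C" for f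
  proof -
    obtain e m where e: "e \<in> W" and m: "m \<in> ?F" and em: "Cod C e = Dom C m" "f = Comp C m e"
      using factW[OF f] by blast
    have e': "e \<in> Arr C" and m': "m \<in> Arr C" using e W(1) m FArr by blast+
    obtain c t where c: "c \<in> Cof" and t: "t \<in> TF" and ct: "Cod C c = Dom C t" "e = Comp C t c"
      using fact[OF e'] by blast
    have c': "c \<in> Arr C" and t': "t \<in> Arr C" using c CofArr t TFW W(1) by blast+
    \<comment> \<open>Two-out-of-three for \<open>e\<close>, which is \<open>t\<close> after
      \<open>c\<close>. The spare factor \<open>t\<close> is then absorbed into the fibration
      \<open>m\<close>, since trivial fibrations are fibrations.\<close>
    have "c \<in> W" using W(2) c' t' ct e t TFW unfolding two_out_of_three_def by blast
    have hc: "c \<in> Hom C (Dom C c) (Dom C t)" using Hom_self[OF c'] ct by simp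
    have "Cod C t = Cod C e" using Comp_Arr[OF c' t' ct(1)] ct(2) by (simp add: HomD)
    then have ht: "t \<in> Hom C (Dom C t) (Dom C m)" using Hom_self[OF t'] em by simp
    have hm: "m \<in> Hom C (Dom C m) (Cod C m)" by (rule Hom_self[OF m'])
    have "Comp C m t \<in> ?F"
      using rlp_comp[OF ht _ hm] t TFF m CofArr by blast
    moreover have "f = Comp C (Comp C m t) c" using Comp_assoc[OF hc ht hm] em ct by simp
    moreover have "Dom C (Comp C m t) = Cod C c" using Comp_Hom[OF ht hm] ct by (simp add: HomD)
    ultimately show ?thesis using c \<open>c \<in> W\<close> by (metis IntI)
  qed
  have L: "Cof \<inter> W = llp C ?F"
  proof
    show "Cof \<inter> W \<subseteq> llp C ?F" using CofArr unfolding llp_def rlp_def by blast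
    show "llp C ?F \<subseteq> Cof \<inter> W"
    proof
      fix i assume i: "i \<in> llp C ?F"
      then have "i \<in> Cof" using TFF unfolding cof(1) llp_def by blast
      obtain j p where j: "j \<in> Cof \<inter> W" and p: "p \<in> ?F" and jp: "Cod C j = Dom C p" "i = Comp C p j"
        using factL[of i] i unfolding llp_def by blast
      have hj: "j \<in> Hom C (Dom C j) (Dom C p)" and hp: "p \<in> Hom C (Dom C p) (Cod C p)"
        using j p CofArr FArr jp by (auto simp: Hom_def)
      have "lifts C (Comp C p j) p" using i p jp unfolding llp_def by blast
      from retract_argument_left[OF hj hp this] have "i \<in> W" using ret j jp by blast
      with \<open>i \<in> Cof\<close> show "i \<in> Cof \<inter> W" by blast
    qed
  qed
  have R: "?F \<inter> W = TF"
  proof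
    show "TF \<subseteq> ?F \<inter> W" using TFF TFW by blast
    show "?F \<inter> W \<subseteq> TF"
    proof
      fix p assume p: "p \<in> ?F \<inter> W"
      then have p': "p \<in> Arr C" using FArr by blast
      obtain c t where c: "c \<in> Cof" and t: "t \<in> TF" and ct: "Cod C c = Dom C t" "p = Comp C t c"
        using fact[OF p'] by blast
      have c': "c \<in> Arr C" and t': "t \<in> Arr C" using c CofArr t TFW W(1) by blast+
      have "c \<in> W" using W(2) c' t' ct p t TFW unfolding two_out_of_three_def by blast
      have hc: "c \<in> Hom C (Dom C c) (Dom C t)" and ht: "t \<in> Hom C (Dom C t) (Cod C t)"
        using Hom_self[OF c'] ct Hom_self[OF t'] by simp_all
      have "lifts C c (Comp C t c)" using p c \<open>c \<in> W\<close> ct unfolding rlp_def by blast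
      from retract_argument_right[OF hc ht this] show "p \<in> TF"
        using rlp_retract[of p t Cof] t cof(2) CofArr ct by metis
    qed
  qed
  have "weak_factorization_system C (Cof \<inter> W) ?F"
    unfolding weak_factorization_system_def using L factL by blast
  moreover have "weak_factorization_system C Cof (?F \<inter> W)"
    unfolding weak_factorization_system_def R using cof fact by blast
  ultimately show ?thesis
    unfolding model_structure_def using CofArr W FArr by (auto intro: ret)
qed

end

section \<open>Small sets\<close>

lemma inj_card_le: "inj (f :: 'a \<Rightarrow> 'b) \<Longrightarrow> |UNIV :: 'a set| \<le>o |UNIV :: 'b set|"
  by (rule iffD1[OF card_of_ordLeq]) auto

lemma finite_card_less: "finite A \<Longrightarrow> infinite B \<Longrightarrow> |A| <o |B|"
  by (subst not_ordLeq_iff_ordLess[OF card_of_Well_order card_of_Well_order, symmetric])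
    (use card_of_ordLeq_finite[of B A] in auto)

text \<open>The parameter \<open>ty\<close> only carries the two type variables into the
  assumptions, which speak of types and not of terms.\<close>

locale small_universe =
  fixes ty :: "('u \<times> 'l) itself"
  assumes inaccessible: "inaccessible |UNIV :: 'u set|"
    and labels_small: "|UNIV :: 'l set| <o |UNIV :: 'u set|"
begin

lemma infinite_universe: "infinite (UNIV :: 'u set)"
  using inaccessible infinite_iff_natLeq_ordLeq ordLess_imp_ordLeq unfolding inaccessible_def by blast

lemma finite_small: "finite (A :: 'u set) \<Longrightarrow> small A"
  unfolding small_def by (rule finite_card_less[OF _ infinite_universe])

lemma small_le: "|A :: 'a set| \<le>o |B :: 'u set| \<Longrightarrow> small B \<Longrightarrow> |A| <o |UNIV :: 'u set|"
  unfolding small_def by (rule ordLeq_ordLess_trans)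

lemma small_subset: "small (B :: 'u set) \<Longrightarrow> A \<subseteq> B \<Longrightarrow> small A"
  using small_le[of A B] card_of_mono1[of A B] by (simp add: small_def)

lemma small_image_less: "|A :: 'a set| <o |UNIV :: 'u set| \<Longrightarrow> small (f ` A :: 'u set)"
  unfolding small_def by (rule ordLeq_ordLess_trans[OF card_of_image])

lemma small_Un: "small (A :: 'u set) \<Longrightarrow> small B \<Longrightarrow> small (A \<union> B)"
  unfolding small_def using infinite_universe by (rule card_of_Un_ordLess_infinite)

text \<open>Squaring preserves the cardinality of infinite sets only, hence the case distinction;
  passing to the union treats both factors at once.\<close>

lemma Times_less:
  assumes "small (A :: 'u set)" "small (B :: 'u set)"
  shows "|A \<times> B| <o |UNIV :: 'u set|"
proof (cases "finite (A \<union> B)")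
  case True
  then show ?thesis using infinite_universe by (auto intro: finite_card_less)
next
  case False
  have "|A \<times> B| \<le>o |(A \<union> B) \<times> (A \<union> B)|" by (rule card_of_mono1) auto
  moreover have "|(A \<union> B) \<times> (A \<union> B)| =o |A \<union> B|" by (rule card_of_Times_same_infinite[OF False])
  ultimately have "|A \<times> B| \<le>o |A \<union> B|" by (rule ordLeq_ordIso_trans)
  then show ?thesis using small_Un[OF assms] by (rule small_le)
qed

lemma small_image_Times: "small (A :: 'u set) \<Longrightarrow> small (B :: 'u set) \<Longrightarrow> small (f ` (A \<times> B) :: 'u set)"
  by (rule small_image_less[OF Times_less])

lemma inj_encI: "|UNIV :: 'x set| \<le>o |UNIV :: 'u set| \<Longrightarrow> inj (enc :: 'x \<Rightarrow> 'u)"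
  unfolding enc_def using iffD2[OF card_of_ordLeq, of "UNIV :: 'x set" "UNIV :: 'u set"]
  by (intro someI_ex[of inj]) auto

lemma inj_enc_pair: "inj (enc :: 'u \<times> 'u \<Rightarrow> 'u)"
  using inj_encI[where 'x = "'u \<times> 'u"] card_of_Times_same_infinite[OF infinite_universe] ordIso_iff_ordLeq
  by (metis UNIV_Times_UNIV)

lemma countable_le: "inj (f :: 'x \<Rightarrow> nat) \<Longrightarrow> |UNIV :: 'x set| \<le>o |UNIV :: 'u set|"
proof -
  assume "inj f"
  then have "|UNIV :: 'x set| \<le>o |UNIV :: nat set|" by (rule inj_card_le)
  also have "|UNIV :: nat set| \<le>o |UNIV :: 'u set|"
    using infinite_universe infinite_iff_card_of_nat by blast
  finally show ?thesis .
qed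

lemma labels_le: "|UNIV :: 'l set| \<le>o |UNIV :: 'u set|"
  by (rule ordLess_imp_ordLeq[OF labels_small])

lemma inj_enc_label: "inj (enc :: 'l \<Rightarrow> 'u)"
  by (rule inj_encI[OF labels_le])

lemma inj_enc_nat: "inj (enc :: nat \<Rightarrow> 'u)"
  by (rule inj_encI[OF countable_le[of id]]) simp

lemma inj_enc_bools: "inj (enc :: bool list \<Rightarrow> 'u)"
  by (rule inj_encI[OF countable_le[of to_nat]]) simp

text \<open>Labels and numbers embed separately, and the universe codes its own pairs.\<close>

lemma inj_enc_label_nat: "inj (enc :: 'l \<times> nat \<Rightarrow> 'u)"
proof (rule inj_encI)
  let ?f = "\<lambda>(x :: 'l, n :: nat). enc (enc x :: 'u, enc n :: 'u) :: 'u"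
  have "inj ?f"
  proof (rule injI)
    fix p q :: "'l \<times> nat" assume "?f p = ?f q"
    moreover obtain x n y m where pq: "p = (x, n)" "q = (y, m)" by fastforce
    ultimately have "enc (enc x :: 'u, enc n :: 'u) = (enc (enc y :: 'u, enc m :: 'u) :: 'u)" by simp
    from injD[OF inj_enc_pair this] show "p = q"
      by (simp add: pq inj_eq[OF inj_enc_label] inj_eq[OF inj_enc_nat])
  qed
  then show "|UNIV :: ('l \<times> nat) set| \<le>o |UNIV :: 'u set|" by (rule inj_card_le)
qed

end


section \<open>Maps of transition systems\<close>

text \<open>Raw functions between arbitrary types, without extensionality, so that composites can be
  computed pointwise and systems outside the universe can take part; \<open>mk\<close> turns such a
  pair into an arrow by restriction.\<close>

definition ts_hom ::
  "('s, 'a, 'l) transition_system \<Rightarrow> ('t, 'b, 'l) transition_system \<Rightarrow> ('s \<Rightarrow> 't) \<Rightarrow> ('a \<Rightarrow> 'b) \<Rightarrow> bool" where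
  "ts_hom X Y f g \<longleftrightarrow>
     (\<forall>s\<in>states X. f s \<in> states Y) \<and>
     (\<forall>u\<in>actions X. g u \<in> actions Y \<and> label Y (g u) = label X u) \<and>
     (\<forall>\<alpha> us \<beta>. (\<alpha>, us, \<beta>) \<in> transitions X \<longrightarrow> (f \<alpha>, map g us, f \<beta>) \<in> transitions Y)"

lemma ts_homI:
  assumes "\<And>s. s \<in> states X \<Longrightarrow> f s \<in> states Y"
    and "\<And>u. u \<in> actions X \<Longrightarrow> g u \<in> actions Y"
    and "\<And>u. u \<in> actions X \<Longrightarrow> label Y (g u) = label X u"
    and "\<And>\<alpha> us \<beta>. (\<alpha>, us, \<beta>) \<in> transitions X \<Longrightarrow> (f \<alpha>, map g us, f \<beta>) \<in> transitions Y"
  shows "ts_hom X Y f g"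
  using assms unfolding ts_hom_def by blast

lemma ts_homD:
  assumes "ts_hom X Y f g"
  shows "s \<in> states X \<Longrightarrow> f s \<in> states Y"
    and "u \<in> actions X \<Longrightarrow> g u \<in> actions Y"
    and "u \<in> actions X \<Longrightarrow> label Y (g u) = label X u"
    and "(\<alpha>, us, \<beta>) \<in> transitions X \<Longrightarrow> (f \<alpha>, map g us, f \<beta>) \<in> transitions Y"
  using assms unfolding ts_hom_def by blast+

lemma ts_hom_comp:
  assumes "ts_hom X Y f g" "ts_hom Y Z f' g'"
  shows "ts_hom X Z (\<lambda>s. f' (f s)) (\<lambda>u. g' (g u))"
proof (rule ts_homI)
  fix \<alpha> us \<beta> assume "(\<alpha>, us, \<beta>) \<in> transitions X"
  from ts_homD(4)[OF assms(2) ts_homD(4)[OF assms(1) this]]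
  show "(f' (f \<alpha>), map (\<lambda>u. g' (g u)) us, f' (f \<beta>)) \<in> transitions Z" by (simp add: comp_def)
qed (use ts_homD(1-3)[OF assms(1)] ts_homD(1-3)[OF assms(2)] in auto)

lemma weakD:
  assumes "weak_transition_system X" "(\<alpha>, us, \<beta>) \<in> transitions X"
  shows "\<alpha> \<in> states X" "us \<noteq> []" "set us \<subseteq> actions X" "\<beta> \<in> states X"
  using assms unfolding weak_transition_system_def by blast+

lemma ts_hom_cong:
  assumes "weak_transition_system X" "ts_hom X Y f g"
    and f: "\<And>s. s \<in> states X \<Longrightarrow> f' s = f s" and g: "\<And>u. u \<in> actions X \<Longrightarrow> g' u = g u"
  shows "ts_hom X Y f' g'"
proof (rule ts_homI)
  fix \<alpha> us \<beta> assume t: "(\<alpha>, us, \<beta>) \<in> transitions X"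
  have [simp]: "map g' us = map g us" using weakD(3)[OF assms(1) t] g by (intro map_cong) auto
  then show "(f' \<alpha>, map g' us, f' \<beta>) \<in> transitions Y"
    using ts_homD(4)[OF assms(2) t] f[OF weakD(1)[OF assms(1) t]] f[OF weakD(4)[OF assms(1) t]] by simp
qed (use ts_homD(1-3)[OF assms(2)] f g in auto)

definition mk :: "('u, 'l) ts \<Rightarrow> ('u, 'l) ts \<Rightarrow> ('u \<Rightarrow> 'u) \<Rightarrow> ('u \<Rightarrow> 'u) \<Rightarrow> ('u, 'l) ts_map" where
  "mk X Y f g =
     \<lparr>source = X, target = Y, on_states = restrict f (states X), on_actions = restrict g (actions X)\<rparr>"

lemma mk_sel [simp]:
  "source (mk X Y f g) = X" "target (mk X Y f g) = Y"
  "s \<in> states X \<Longrightarrow> on_states (mk X Y f g) s = f s"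
  "u \<in> actions X \<Longrightarrow> on_actions (mk X Y f g) u = g u"
  by (simp_all add: mk_def)

lemma Obj_WTS: "X \<in> Obj WTS \<longleftrightarrow> weak_transition_system X \<and> small (states X) \<and> small (actions X)"
  by (simp add: WTS_def Let_def)

lemma Obj_RTS: "X \<in> Obj RTS \<longleftrightarrow> X \<in> Obj WTS \<and> regular X"
  by (simp add: RTS_def full_subcategory_def)

lemma RTS_WTS [simp]: "Comp RTS = Comp WTS" "Ident RTS = Ident WTS" "Dom RTS = source"
    "Cod RTS = target" "Dom WTS = source" "Cod WTS = target"
  by (simp_all add: RTS_def WTS_def full_subcategory_def Let_def)

lemma wts_map_iff:
  assumes "weak_transition_system (source f)"
  shows "wts_map f \<longleftrightarrow> ts_hom (source f) (target f) (on_states f) (on_actions f) \<and>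
    on_states f \<in> extensional (states (source f)) \<and> on_actions f \<in> extensional (actions (source f))"
  unfolding wts_map_def ts_hom_def PiE_def Pi_def by auto

lemma Hom_WTS:
  "h \<in> Hom WTS X Y \<longleftrightarrow> X \<in> Obj WTS \<and> Y \<in> Obj WTS \<and> source h = X \<and> target h = Y \<and>
     ts_hom X Y (on_states h) (on_actions h) \<and>
     on_states h \<in> extensional (states X) \<and> on_actions h \<in> extensional (actions X)"
proof -
  have "h \<in> Hom WTS X Y \<longleftrightarrow> X \<in> Obj WTS \<and> Y \<in> Obj WTS \<and> source h = X \<and> target h = Y \<and> wts_map h"
    unfolding Hom_def by (auto simp: WTS_def Let_def)
  then show ?thesis using wts_map_iff[of h] by (auto simp: Obj_WTS)
qed

lemma Hom_RTS: "h \<in> Hom RTS X Y \<longleftrightarrow> h \<in> Hom WTS X Y \<and> regular X \<and> regular Y"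
  unfolding Hom_def by (auto simp: RTS_def full_subcategory_def WTS_def Let_def)

lemma Arr_RTS: "f \<in> Arr RTS \<longleftrightarrow> f \<in> Hom RTS (source f) (target f)"
  by (simp add: Hom_def)

lemma HomD_WTS:
  assumes "h \<in> Hom WTS X Y"
  shows "X \<in> Obj WTS" "Y \<in> Obj WTS" "source h = X" "target h = Y"
    "ts_hom X Y (on_states h) (on_actions h)" "weak_transition_system X" "weak_transition_system Y"
  using assms by (auto simp: Hom_WTS Obj_WTS)

lemmas Hom_hom = ts_homD[OF HomD_WTS(5)]

lemma Hom_eqI:
  assumes "h \<in> Hom WTS X Y" "h' \<in> Hom WTS X Y"
    and "\<And>s. s \<in> states X \<Longrightarrow> on_states h s = on_states h' s"
    and "\<And>u. u \<in> actions X \<Longrightarrow> on_actions h u = on_actions h' u"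
  shows "h = h'"
proof -
  have "on_states h = on_states h'" "on_actions h = on_actions h'"
    using assms by (auto simp: Hom_WTS intro: extensionalityI)
  then show ?thesis using assms(1,2) by (auto simp: Hom_WTS)
qed

lemma mk_Hom:
  assumes "X \<in> Obj WTS" "Y \<in> Obj WTS" "ts_hom X Y f g"
  shows "mk X Y f g \<in> Hom WTS X Y"
  using assms ts_hom_cong[of X Y f g "restrict f (states X)" "restrict g (actions X)"]
  by (auto simp: Hom_WTS mk_def Obj_WTS)

lemma mk_Hom_RTS:
  assumes "X \<in> Obj RTS" "Y \<in> Obj RTS" "ts_hom X Y f g"
  shows "mk X Y f g \<in> Hom RTS X Y"
  using assms mk_Hom[of X Y f g] by (auto simp: Hom_RTS Obj_RTS)

lemma Comp_sel:
  "source (Comp WTS g f) = source f" "target (Comp WTS g f) = target g"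
  "s \<in> states (source f) \<Longrightarrow> on_states (Comp WTS g f) s = on_states g (on_states f s)"
  "u \<in> actions (source f) \<Longrightarrow> on_actions (Comp WTS g f) u = on_actions g (on_actions f u)"
  by (simp_all add: WTS_def Let_def compose_def)

lemma Comp_states: "f \<in> Hom WTS X Y \<Longrightarrow> s \<in> states X \<Longrightarrow> on_states (Comp WTS g f) s = on_states g (on_states f s)"
  and Comp_actions: "f \<in> Hom WTS X Y \<Longrightarrow> u \<in> actions X \<Longrightarrow> on_actions (Comp WTS g f) u = on_actions g (on_actions f u)"
  using Comp_sel(3,4)[of _ f g] by (simp_all add: Hom_WTS)

lemma Comp_Hom_WTS:
  assumes "f \<in> Hom WTS X Y" "g \<in> Hom WTS Y Z"
  shows "Comp WTS g f \<in> Hom WTS X Z"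
proof -
  have "ts_hom X Z (\<lambda>s. on_states g (on_states f s)) (\<lambda>u. on_actions g (on_actions f u))"
    using ts_hom_comp HomD_WTS(5)[OF assms(1)] HomD_WTS(5)[OF assms(2)] .
  then have "ts_hom X Z (on_states (Comp WTS g f)) (on_actions (Comp WTS g f))"
    by (rule ts_hom_cong[OF HomD_WTS(6)[OF assms(1)]])
      (rule Comp_states[OF assms(1)] Comp_actions[OF assms(1)]; assumption)+
  moreover have "on_states (Comp WTS g f) \<in> extensional (states X)"
    "on_actions (Comp WTS g f) \<in> extensional (actions X)"
    using assms(1) by (auto simp: WTS_def Let_def compose_def Hom_def)
  ultimately show ?thesis using assms by (auto simp: Hom_WTS Comp_sel)
qed

lemma Comp_eqI:
  assumes "f \<in> Hom WTS X Y" "g \<in> Hom WTS Y Z" "h \<in> Hom WTS X Z"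
    and "\<And>s. s \<in> states X \<Longrightarrow> on_states g (on_states f s) = on_states h s"
    and "\<And>u. u \<in> actions X \<Longrightarrow> on_actions g (on_actions f u) = on_actions h u"
  shows "Comp WTS g f = h"
  by (rule Hom_eqI[OF Comp_Hom_WTS[OF assms(1,2)] assms(3)])
    (simp_all add: Comp_states[OF assms(1)] Comp_actions[OF assms(1)] assms)

lemma Comp_eqD:
  assumes "Comp WTS g f = Comp WTS g' f'" "f \<in> Hom WTS X Y" "f' \<in> Hom WTS X Y'"
  shows "s \<in> states X \<Longrightarrow> on_states g (on_states f s) = on_states g' (on_states f' s)"
    and "u \<in> actions X \<Longrightarrow> on_actions g (on_actions f u) = on_actions g' (on_actions f' u)"
  using Comp_states[OF assms(2), of s g] Comp_states[OF assms(3), of s g']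
    Comp_actions[OF assms(2), of u g] Comp_actions[OF assms(3), of u g'] assms(1) by auto

lemma Ident_sel [simp]:
  "s \<in> states X \<Longrightarrow> on_states (Ident WTS X) s = s"
  "u \<in> actions X \<Longrightarrow> on_actions (Ident WTS X) u = u"
  by (simp_all add: WTS_def Let_def)

lemma Ident_mk: "Ident WTS X = mk X X (\<lambda>s. s) (\<lambda>u. u)"
  by (simp add: WTS_def Let_def mk_def id_def)

lemma Ident_Hom_WTS: "X \<in> Obj WTS \<Longrightarrow> Ident WTS X \<in> Hom WTS X X"
  unfolding Ident_mk by (rule mk_Hom) (auto simp: ts_hom_def)

interpretation WTS: cat WTS
proof
  fix f :: "('u, 'l) ts_map" assume "f \<in> Arr WTS"
  then show "Dom WTS f \<in> Obj WTS" "Cod WTS f \<in> Obj WTS" by (auto simp: WTS_def Let_def)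
next
  fix f g h :: "('u, 'l) ts_map" and a b c d
  assume f: "f \<in> Hom WTS a b" and g: "g \<in> Hom WTS b c" and h: "h \<in> Hom WTS c d"
  show "Comp WTS (Comp WTS h g) f = Comp WTS h (Comp WTS g f)"
    by (rule Comp_eqI[OF f Comp_Hom_WTS[OF g h] Comp_Hom_WTS[OF Comp_Hom_WTS[OF f g] h]])
      (simp_all add: Comp_states[OF Comp_Hom_WTS[OF f g]] Comp_states[OF f] Comp_states[OF g]
        Comp_actions[OF Comp_Hom_WTS[OF f g]] Comp_actions[OF f] Comp_actions[OF g] Hom_hom[OF f])
next
  fix f :: "('u, 'l) ts_map" and a b assume f: "f \<in> Hom WTS a b"
  show "Comp WTS f (Ident WTS a) = f"
    by (rule Comp_eqI[OF Ident_Hom_WTS f f]) (use HomD_WTS[OF f] in auto)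
  show "Comp WTS (Ident WTS b) f = f"
    by (rule Comp_eqI[OF f Ident_Hom_WTS f]) (use HomD_WTS[OF f] Hom_hom[OF f] in auto)
qed (rule Ident_Hom_WTS Comp_Hom_WTS; assumption)+

interpretation RTS: cat RTS
proof
  fix f :: "('u, 'l) ts_map" assume "f \<in> Arr RTS"
  then show "Dom RTS f \<in> Obj RTS" "Cod RTS f \<in> Obj RTS"
    by (auto simp: RTS_def WTS_def Let_def full_subcategory_def)
qed (auto simp: Hom_RTS Obj_RTS Comp_Hom_WTS WTS.Comp_assoc WTS.Comp_Ident WTS.Ident_Comp Ident_Hom_WTS)


section \<open>Regular transition systems\<close>

text \<open>The existence half of CSA2 fused with the multiset axiom: \<open>us @ vs\<close> may be
  any rearrangement of \<open>w\<close>. In this form the property is stable under unions, so every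
  set of transitions has a largest subset with it. Uniqueness of intermediate states is kept apart
  in \<open>unique_split\<close>.\<close>

definition closed_split :: "('s \<times> 'a list \<times> 's) set \<Rightarrow> bool" where
  "closed_split T \<longleftrightarrow>
     (\<forall>\<alpha> w \<beta> us vs. (\<alpha>, w, \<beta>) \<in> T \<and> us \<noteq> [] \<and> vs \<noteq> [] \<and> mset (us @ vs) = mset w \<longrightarrow>
        (\<exists>\<nu>. (\<alpha>, us, \<nu>) \<in> T \<and> (\<nu>, vs, \<beta>) \<in> T))"

definition unique_split :: "('s \<times> 'a list \<times> 's) set \<Rightarrow> bool" where
  "unique_split T \<longleftrightarrow>
     (\<forall>\<alpha> us vs \<beta> \<nu> \<nu>'. us \<noteq> [] \<and> vs \<noteq> [] \<and> (\<alpha>, us @ vs, \<beta>) \<in> T \<and> (\<alpha>, us, \<nu>) \<in> T \<and> (\<nu>, vs, \<beta>) \<in> T \<and>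
        (\<alpha>, us, \<nu>') \<in> T \<and> (\<nu>', vs, \<beta>) \<in> T \<longrightarrow> \<nu> = \<nu>')"

definition perm_closed :: "('s \<times> 'a list \<times> 's) set \<Rightarrow> bool" where
  "perm_closed T \<longleftrightarrow> (\<forall>\<alpha> w \<beta> v. (\<alpha>, w, \<beta>) \<in> T \<and> mset v = mset w \<longrightarrow> (\<alpha>, v, \<beta>) \<in> T)"

lemma closed_splitD:
  "closed_split T \<Longrightarrow> (\<alpha>, w, \<beta>) \<in> T \<Longrightarrow> us \<noteq> [] \<Longrightarrow> vs \<noteq> [] \<Longrightarrow> mset (us @ vs) = mset w \<Longrightarrow>
     \<exists>\<nu>. (\<alpha>, us, \<nu>) \<in> T \<and> (\<nu>, vs, \<beta>) \<in> T"
  unfolding closed_split_def by blast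

lemma unique_splitD:
  "unique_split T \<Longrightarrow> us \<noteq> [] \<Longrightarrow> vs \<noteq> [] \<Longrightarrow> (\<alpha>, us @ vs, \<beta>) \<in> T \<Longrightarrow> (\<alpha>, us, \<nu>) \<in> T \<Longrightarrow>
     (\<nu>, vs, \<beta>) \<in> T \<Longrightarrow> (\<alpha>, us, \<nu>') \<in> T \<Longrightarrow> (\<nu>', vs, \<beta>) \<in> T \<Longrightarrow> \<nu> = \<nu>'"
  unfolding unique_split_def by blast

lemma perm_closedD: "perm_closed T \<Longrightarrow> (\<alpha>, w, \<beta>) \<in> T \<Longrightarrow> mset v = mset w \<Longrightarrow> (\<alpha>, v, \<beta>) \<in> T"
  unfolding perm_closed_def by blast

lemma weak_perm_closed:
  assumes "weak_transition_system X"
  shows "perm_closed (transitions X)"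
  unfolding perm_closed_def
proof (intro allI impI, elim conjE)
  fix \<alpha> w \<beta> v assume t: "(\<alpha>, w, \<beta>) \<in> transitions X" and m: "mset v = mset w"
  show "(\<alpha>, v, \<beta>) \<in> transitions X"
  proof (cases "length w \<ge> 2")
    case True
    then show ?thesis using assms t m unfolding weak_transition_system_def multiset_axiom_def by blast
  next
    case False
    then obtain u where "w = [u]" using weakD(2)[OF assms t] by (cases w; cases "tl w") auto
    then show ?thesis using m t by simp
  qed
qed

lemma composition_axiomD:
  assumes "composition_axiom X" "us \<noteq> []" "vs \<noteq> []" "ws \<noteq> []" "(\<alpha>, us @ vs @ ws, \<beta>) \<in> transitions X"
    "(\<alpha>, us, \<nu>\<^sub>1) \<in> transitions X" "(\<nu>\<^sub>1, vs @ ws, \<beta>) \<in> transitions X"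
    "(\<alpha>, us @ vs, \<nu>\<^sub>2) \<in> transitions X" "(\<nu>\<^sub>2, ws, \<beta>) \<in> transitions X"
  shows "(\<nu>\<^sub>1, vs, \<nu>\<^sub>2) \<in> transitions X"
  using assms unfolding composition_axiom_def by blast

lemma regular_closed_split:
  assumes "weak_transition_system X" "regular X"
  shows "closed_split (transitions X)"
  unfolding closed_split_def
proof (intro allI impI, elim conjE)
  fix \<alpha> w \<beta> us vs assume t: "(\<alpha>, w, \<beta>) \<in> transitions X" and ne: "us \<noteq> []" "vs \<noteq> []"
    and m: "mset (us @ vs) = mset w"
  have "(\<alpha>, us @ vs, \<beta>) \<in> transitions X"
    using perm_closedD[OF weak_perm_closed[OF assms(1)] t m] .
  then show "\<exists>\<nu>. (\<alpha>, us, \<nu>) \<in> transitions X \<and> (\<nu>, vs, \<beta>) \<in> transitions X"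
    using assms(2) ne unfolding regular_def CSA2_def by blast
qed

lemma regular_unique_split:
  assumes "weak_transition_system X" "regular X"
  shows "unique_split (transitions X)"
  unfolding unique_split_def
proof (intro allI impI, elim conjE)
  fix \<alpha> us vs \<beta> \<nu> \<nu>' assume ne: "us \<noteq> []" "vs \<noteq> []" "(\<alpha>, us @ vs, \<beta>) \<in> transitions X"
    and t: "(\<alpha>, us, \<nu>) \<in> transitions X" "(\<nu>, vs, \<beta>) \<in> transitions X"
    "(\<alpha>, us, \<nu>') \<in> transitions X" "(\<nu>', vs, \<beta>) \<in> transitions X"
  have "\<exists>!\<nu>. \<nu> \<in> states X \<and> (\<alpha>, us, \<nu>) \<in> transitions X \<and> (\<nu>, vs, \<beta>) \<in> transitions X"
    using assms(2) ne unfolding regular_def CSA2_def by blast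
  moreover have "\<nu> \<in> states X" "\<nu>' \<in> states X" using weakD[OF assms(1)] t by blast+
  ultimately show "\<nu> = \<nu>'" using t by blast
qed

text \<open>The composition axiom is inherited because splittings in \<open>X\<close> are unique.\<close>

definition subsystem ::
  "('s, 'a, 'l) transition_system \<Rightarrow> ('s \<times> 'a list \<times> 's) set \<Rightarrow> ('s, 'a, 'l) transition_system" where
  "subsystem X T =
     \<lparr>states = states X,
      actions = {u. \<exists>\<alpha> \<beta>. (\<alpha>, [u], \<beta>) \<in> T},
      label = restrict (label X) {u. \<exists>\<alpha> \<beta>. (\<alpha>, [u], \<beta>) \<in> T},
      transitions = T\<rparr>"

text \<open>Uniqueness of intermediate states comes from \<open>X\<close> and their existence from
  \<open>T\<close>. The quotients and products constructed below are only known to have uniqueness,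
  and regular systems are cut out of them in this way.\<close>

lemma subsystem_regular:
  assumes X: "weak_transition_system X" "unique_split (transitions X)"
    and T: "T \<subseteq> transitions X" "closed_split T" "perm_closed T"
  shows "weak_transition_system (subsystem X T)" "regular (subsystem X T)" "actions (subsystem X T) \<subseteq> actions X"
proof -
  let ?Y = "subsystem X T"
  have uniq: "\<nu> = \<nu>'" if "us \<noteq> []" "vs \<noteq> []" "(\<alpha>, us @ vs, \<beta>) \<in> T" "(\<alpha>, us, \<nu>) \<in> T" "(\<nu>, vs, \<beta>) \<in> T"
    "(\<alpha>, us, \<nu>') \<in> transitions X" "(\<nu>', vs, \<beta>) \<in> transitions X" for \<alpha> us vs \<beta> \<nu> \<nu>'
    using that T(1) unique_splitD[OF X(2)] by blast
  \<comment> \<open>A letter of a word can be moved to the front and split off, so it already occurs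
    on an edge of \<open>T\<close>.\<close>
  have used: "u \<in> actions ?Y" if t: "(\<alpha>, w, \<beta>) \<in> T" and u: "u \<in> set w" for \<alpha> w \<beta> u
  proof (cases "remove1 u w = []")
    case True
    then have "w = [u]" using u by (cases w) (auto split: if_splits)
    then show ?thesis using t by (auto simp: subsystem_def)
  next
    case False
    have "mset ([u] @ remove1 u w) = mset w" using u by simp
    from closed_splitD[OF T(2) t _ False this] show ?thesis by (auto simp: subsystem_def)
  qed
  have "composition_axiom ?Y"
    unfolding composition_axiom_def
  proof (intro allI impI, elim conjE)
    fix \<alpha> us vs ws \<beta> \<nu>\<^sub>1 \<nu>\<^sub>2
    assume ne: "us \<noteq> []" "vs \<noteq> []" "ws \<noteq> []" and t: "(\<alpha>, us @ vs @ ws, \<beta>) \<in> transitions ?Y"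
      "(\<alpha>, us, \<nu>\<^sub>1) \<in> transitions ?Y" "(\<nu>\<^sub>1, vs @ ws, \<beta>) \<in> transitions ?Y"
      "(\<alpha>, us @ vs, \<nu>\<^sub>2) \<in> transitions ?Y" "(\<nu>\<^sub>2, ws, \<beta>) \<in> transitions ?Y"
    then have tT: "(\<alpha>, us @ vs @ ws, \<beta>) \<in> T" "(\<alpha>, us, \<nu>\<^sub>1) \<in> T" "(\<nu>\<^sub>1, vs @ ws, \<beta>) \<in> T"
      "(\<alpha>, us @ vs, \<nu>\<^sub>2) \<in> T" "(\<nu>\<^sub>2, ws, \<beta>) \<in> T" by (simp_all add: subsystem_def)
    have "(\<nu>\<^sub>1, vs, \<nu>\<^sub>2) \<in> transitions X"
      using composition_axiomD[of X us vs ws \<alpha> \<beta>] X(1) ne tT T(1)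
      unfolding weak_transition_system_def by blast
    \<comment> \<open>The splitting inside \<open>T\<close> and the given state solve the same
      splitting problem in \<open>X\<close>. They coincide, which puts the composite found in
      \<open>X\<close> into \<open>T\<close>.\<close>
    moreover obtain \<nu> where \<nu>: "(\<nu>\<^sub>1, vs, \<nu>) \<in> T" "(\<nu>, ws, \<beta>) \<in> T"
      using closed_splitD[OF T(2) tT(3) ne(2,3)] by auto
    ultimately have "\<nu> = \<nu>\<^sub>2"
      using uniq[OF ne(2,3) tT(3)] tT(5) T(1) by blast
    with \<nu> show "(\<nu>\<^sub>1, vs, \<nu>\<^sub>2) \<in> transitions ?Y" by (simp add: subsystem_def)
  qed
  moreover have "multiset_axiom ?Y"
    unfolding multiset_axiom_def by (simp add: subsystem_def) (blast intro: perm_closedD[OF T(3)])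
  moreover have "\<alpha> \<in> states ?Y \<and> us \<noteq> [] \<and> set us \<subseteq> actions ?Y \<and> \<beta> \<in> states ?Y"
    if "(\<alpha>, us, \<beta>) \<in> transitions ?Y" for \<alpha> us \<beta>
  proof -
    have t: "(\<alpha>, us, \<beta>) \<in> T" using that by (simp add: subsystem_def)
    then have "(\<alpha>, us, \<beta>) \<in> transitions X" using T(1) by blast
    from weakD[OF X(1) this] used[OF t] show ?thesis by (auto simp: subsystem_def)
  qed
  moreover have "label ?Y \<in> extensional (actions ?Y)" by (simp add: subsystem_def)
  ultimately show "weak_transition_system ?Y"
    unfolding weak_transition_system_def by blast
  have "CSA2 ?Y"
    unfolding CSA2_def
  proof (intro allI impI, elim conjE)
    fix \<alpha> us vs \<beta> assume ne: "us \<noteq> []" "vs \<noteq> []" and "(\<alpha>, us @ vs, \<beta>) \<in> transitions ?Y"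
    then have t: "(\<alpha>, us @ vs, \<beta>) \<in> T" by (simp add: subsystem_def)
    obtain \<nu> where \<nu>: "(\<alpha>, us, \<nu>) \<in> T" "(\<nu>, vs, \<beta>) \<in> T"
      using closed_splitD[OF T(2) t ne] by auto
    show "\<exists>!\<nu>. \<nu> \<in> states ?Y \<and> (\<alpha>, us, \<nu>) \<in> transitions ?Y \<and> (\<nu>, vs, \<beta>) \<in> transitions ?Y"
    proof (rule ex1I[of _ \<nu>])
      show "\<nu> \<in> states ?Y \<and> (\<alpha>, us, \<nu>) \<in> transitions ?Y \<and> (\<nu>, vs, \<beta>) \<in> transitions ?Y"
        using \<nu> T(1) weakD[OF X(1)] by (auto simp: subsystem_def)
    next
      fix \<nu>' assume "\<nu>' \<in> states ?Y \<and> (\<alpha>, us, \<nu>') \<in> transitions ?Y \<and> (\<nu>', vs, \<beta>) \<in> transitions ?Y"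
      then show "\<nu>' = \<nu>" using uniq[OF ne t \<nu>] T(1) by (auto simp: subsystem_def)
    qed
  qed
  then show "regular ?Y"
    unfolding regular_def by (auto simp: subsystem_def)
  show "actions ?Y \<subseteq> actions X"
    using T(1) weakD(3)[OF X(1)] by (fastforce simp: subsystem_def)
qed

section \<open>The largest regular subsystem\<close>

definition core_transitions :: "('s \<times> 'a list \<times> 's) set \<Rightarrow> ('s \<times> 'a list \<times> 's) set" where
  "core_transitions T = \<Union>{T'. T' \<subseteq> T \<and> closed_split T'}"

lemma core_transitions_subset: "core_transitions T \<subseteq> T"
  unfolding core_transitions_def by blast

lemma core_transitions_maximal: "T' \<subseteq> T \<Longrightarrow> closed_split T' \<Longrightarrow> T' \<subseteq> core_transitions T"
  unfolding core_transitions_def by blast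

lemma closed_split_core_transitions: "closed_split (core_transitions T)"
  unfolding closed_split_def
proof (intro allI impI, elim conjE)
  fix \<alpha> w \<beta> us vs assume "(\<alpha>, w, \<beta>) \<in> core_transitions T" and s: "us \<noteq> []" "vs \<noteq> []" "mset (us @ vs) = mset w"
  then obtain T' where T': "T' \<subseteq> T" "closed_split T'" "(\<alpha>, w, \<beta>) \<in> T'"
    unfolding core_transitions_def by blast
  from closed_splitD[OF T'(2,3) s] core_transitions_maximal[OF T'(1,2)]
  show "\<exists>\<nu>. (\<alpha>, us, \<nu>) \<in> core_transitions T \<and> (\<nu>, vs, \<beta>) \<in> core_transitions T" by blast
qed

text \<open>Adding all rearrangements preserves \<open>closed_split\<close>, which does not see the
  order of letters; maximality then absorbs the enlarged set.\<close>

lemma perm_closed_core_transitions: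
  assumes "perm_closed T"
  shows "perm_closed (core_transitions T)"
proof -
  let ?T = "{(\<alpha>, v, \<beta>). \<exists>w. mset v = mset w \<and> (\<alpha>, w, \<beta>) \<in> core_transitions T}"
  have "closed_split ?T"
    unfolding closed_split_def
  proof (intro allI impI, elim conjE)
    fix \<alpha> w \<beta> us vs assume "(\<alpha>, w, \<beta>) \<in> ?T" and ne: "us \<noteq> []" "vs \<noteq> []" and m: "mset (us @ vs) = mset w"
    then obtain w' where "mset w = mset w'" "(\<alpha>, w', \<beta>) \<in> core_transitions T" by auto
    with closed_splitD[OF closed_split_core_transitions, of \<alpha> w' \<beta> T us vs] ne m
    show "\<exists>\<nu>. (\<alpha>, us, \<nu>) \<in> ?T \<and> (\<nu>, vs, \<beta>) \<in> ?T" by auto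
  qed
  moreover have "?T \<subseteq> T" using assms core_transitions_subset unfolding perm_closed_def by fast
  ultimately have "?T \<subseteq> core_transitions T" by (rule core_transitions_maximal[rotated])
  then show ?thesis unfolding perm_closed_def by blast
qed

text \<open>A word of length one has no proper splitting, so an edge alone is a closed set.\<close>

lemma edge_core_transitions:
  assumes "(\<alpha>, [u], \<beta>) \<in> T"
  shows "(\<alpha>, [u], \<beta>) \<in> core_transitions T"
proof -
  have "closed_split {(\<alpha>, [u], \<beta>)}"
    unfolding closed_split_def
  proof (intro allI impI, elim conjE)
    fix a w b us vs assume "(a, w, b) \<in> {(\<alpha>, [u], \<beta>)}" "us \<noteq> []" "vs \<noteq> []" "mset (us @ vs) = mset w"
    then have "length (us @ vs) = length [u]" using mset_eq_length by blast
    with \<open>us \<noteq> []\<close> \<open>vs \<noteq> []\<close> have False by (cases us; cases vs) auto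
    then show "\<exists>\<nu>. (a, us, \<nu>) \<in> {(\<alpha>, [u], \<beta>)} \<and> (\<nu>, vs, b) \<in> {(\<alpha>, [u], \<beta>)}" ..
  qed
  then show ?thesis using core_transitions_maximal[of "{(\<alpha>, [u], \<beta>)}" T] assms by blast
qed

text \<open>For systems with unique splittings this is the coreflection onto regular systems: every
  map from a regular system lands in it. No edge is lost, and the actions that disappear are those
  without an edge.\<close>

definition core :: "('s, 'a, 'l) transition_system \<Rightarrow> ('s, 'a, 'l) transition_system" where
  "core X = subsystem X (core_transitions (transitions X))"

lemma core_sel: "states (core X) = states X" "transitions (core X) = core_transitions (transitions X)"
  "u \<in> actions (core X) \<longleftrightarrow> (\<exists>\<alpha> \<beta>. (\<alpha>, [u], \<beta>) \<in> transitions X)"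
  "u \<in> actions (core X) \<Longrightarrow> label (core X) u = label X u"
proof -
  have "(\<alpha>, [u], \<beta>) \<in> core_transitions (transitions X) \<longleftrightarrow> (\<alpha>, [u], \<beta>) \<in> transitions X" for \<alpha> u \<beta>
    by (rule iffI[OF subsetD[OF core_transitions_subset] edge_core_transitions])
  then show "states (core X) = states X" "transitions (core X) = core_transitions (transitions X)"
    "u \<in> actions (core X) \<longleftrightarrow> (\<exists>\<alpha> \<beta>. (\<alpha>, [u], \<beta>) \<in> transitions X)"
    "u \<in> actions (core X) \<Longrightarrow> label (core X) u = label X u"
    by (simp_all add: core_def subsystem_def)
qed

lemma core_regular:
  assumes "weak_transition_system X" "unique_split (transitions X)"
  shows "weak_transition_system (core X)" "regular (core X)" "actions (core X) \<subseteq> actions X"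
  using subsystem_regular[OF assms core_transitions_subset closed_split_core_transitions
      perm_closed_core_transitions[OF weak_perm_closed[OF assms(1)]]]
  by (simp_all add: core_def)

lemma (in small_universe) core_Obj:
  fixes X :: "('u, 'l) ts"
  assumes "X \<in> Obj WTS" "unique_split (transitions X)"
  shows "core X \<in> Obj RTS"
proof -
  have X: "weak_transition_system X" "small (states X)" "small (actions X)"
    using assms(1) by (simp_all add: Obj_WTS)
  show ?thesis
    unfolding Obj_RTS Obj_WTS core_sel(1)
    using core_regular(1,2)[OF X(1) assms(2)] small_subset[OF X(3) core_regular(3)[OF X(1) assms(2)]] X(2)
    by blast
qed

text \<open>Letters are matched one at a time. This pulls rearrangements of an image word back to
  the word itself, which is what makes closure under splitting pass to images.\<close>

lemma mset_map_preimage: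
  assumes "mset ys = mset (map f xs)"
  shows "\<exists>zs. mset zs = mset xs \<and> map f zs = ys"
  using assms
proof (induction ys arbitrary: xs)
  case Nil
  then show ?case by (intro exI[of _ "[]"]) auto
next
  case (Cons y ys)
  have "y \<in> set (map f xs)" using Cons.prems by (metis list.set_intros(1) set_mset_mset)
  then obtain x where x: "x \<in> set xs" "y = f x" by auto
  then have "mset xs = add_mset x (mset (remove1 x xs))" by simp
  then have "image_mset f (mset xs) = add_mset y (image_mset f (mset (remove1 x xs)))"
    using x(2) by (metis image_mset_add_mset)
  moreover have "add_mset y (mset ys) = image_mset f (mset xs)" using Cons.prems by simp
  ultimately have "mset ys = mset (map f (remove1 x xs))"
    by (metis add_mset_add_mset_same_iff mset_map)
  from Cons.IH[OF this] obtain zs where "mset zs = mset (remove1 x xs)" "map f zs = ys" by blast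
  then show ?case using x by (intro exI[of _ "x # zs"]) auto
qed

lemma closed_split_image:
  assumes "closed_split T"
  shows "closed_split {(f \<alpha>, map g w, f \<beta>) | \<alpha> w \<beta>. (\<alpha>, w, \<beta>) \<in> T}"
  unfolding closed_split_def
proof (intro allI impI, elim conjE)
  fix a v b us vs assume "(a, v, b) \<in> {(f \<alpha>, map g w, f \<beta>) | \<alpha> w \<beta>. (\<alpha>, w, \<beta>) \<in> T}"
    and ne: "us \<noteq> []" "vs \<noteq> []" and m: "mset (us @ vs) = mset v"
  then obtain \<alpha> w \<beta> where e: "a = f \<alpha>" "v = map g w" "b = f \<beta>" and t: "(\<alpha>, w, \<beta>) \<in> T" by blast
  obtain zs where zs: "mset zs = mset w" "map g zs = us @ vs" using mset_map_preimage m e by metis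
  then obtain us' vs' where s: "zs = us' @ vs'" "map g us' = us" "map g vs' = vs"
    by (metis map_eq_append_conv)
  with ne zs obtain \<nu> where "(\<alpha>, us', \<nu>) \<in> T" "(\<nu>, vs', \<beta>) \<in> T"
    using closed_splitD[OF assms t, of us' vs'] by auto
  then show "\<exists>\<nu>. (a, us, \<nu>) \<in> {(f \<alpha>, map g w, f \<beta>) | \<alpha> w \<beta>. (\<alpha>, w, \<beta>) \<in> T} \<and>
      (\<nu>, vs, b) \<in> {(f \<alpha>, map g w, f \<beta>) | \<alpha> w \<beta>. (\<alpha>, w, \<beta>) \<in> T}"
    using e s by blast
qed

text \<open>The image of the transitions of \<open>B\<close> is closed under splitting, hence
  contained in the largest such set; regularity of \<open>B\<close> puts every image action on an
  edge.\<close>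

lemma ts_hom_core:
  assumes B: "weak_transition_system B" "regular B" and f: "ts_hom B X f g"
  shows "ts_hom B (core X) f g"
proof (rule ts_homI)
  have sub: "{(f \<alpha>, map g w, f \<beta>) | \<alpha> w \<beta>. (\<alpha>, w, \<beta>) \<in> transitions B} \<subseteq> transitions (core X)"
    unfolding core_sel
    by (rule core_transitions_maximal[OF _ closed_split_image[OF regular_closed_split[OF B]]])
      (use ts_homD(4)[OF f] in blast)
  fix \<alpha> us \<beta> assume "(\<alpha>, us, \<beta>) \<in> transitions B"
  with sub show "(f \<alpha>, map g us, f \<beta>) \<in> transitions (core X)" by blast
next
  fix u assume u: "u \<in> actions B"
  then obtain \<alpha> \<beta> where "(\<alpha>, [u], \<beta>) \<in> transitions B" using B(2) unfolding regular_def by blast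
  from ts_homD(4)[OF f this] show g: "g u \<in> actions (core X)" unfolding core_sel by auto
  show "label (core X) (g u) = label B u" using core_sel(4)[OF g] ts_homD(3)[OF f u] by simp
qed (use ts_homD(1)[OF f] in \<open>simp add: core_sel\<close>)

lemma core_ts_hom:
  assumes "weak_transition_system X" "unique_split (transitions X)"
  shows "ts_hom (core X) X (\<lambda>s. s) (\<lambda>u. u)"
  using core_regular(3)[OF assms] core_sel(4)[of _ X] subsetD[OF core_transitions_subset[of "transitions X"]]
  by (intro ts_homI) (auto simp: core_sel(1,2))

section \<open>Quotients determined by a class of maps\<close>

text \<open>The values of \<open>\<phi>\<close> may live in a type much larger than the universe.
  Naming each class by the code of a chosen representative brings the quotient back among the
  codes.\<close>

lemma quotient_codes:
  assumes "\<And>p q. p \<in> P \<Longrightarrow> q \<in> P \<Longrightarrow> \<sigma> p = \<sigma> q \<Longrightarrow> \<phi> p = \<phi> q"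
  shows "\<exists>\<kappa>. \<forall>p\<in>P. \<kappa> p \<in> \<sigma> ` P \<and> (\<forall>q\<in>P. \<kappa> p = \<kappa> q \<longleftrightarrow> \<phi> p = \<phi> q)"
proof (intro exI ballI conjI)
  let ?r = "\<lambda>p. SOME q. q \<in> P \<and> \<phi> q = \<phi> p"
  have r: "?r p \<in> P \<and> \<phi> (?r p) = \<phi> p" if "p \<in> P" for p
    by (rule someI[of _ p]) (use that in auto)
  show "\<sigma> (?r p) \<in> \<sigma> ` P" if "p \<in> P" for p using r[OF that] by blast
  show "\<sigma> (?r p) = \<sigma> (?r q) \<longleftrightarrow> \<phi> p = \<phi> q" if "p \<in> P" "q \<in> P" for p q
    using r[OF that(1)] r[OF that(2)] assms by metis
qed

context small_universe
begin

text \<open>The codes \<open>\<sigma>\<close> and \<open>\<tau>\<close> bound the size of the quotient.\<close>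

lemma quotient_exists:
  fixes D :: "'i \<Rightarrow> ('u, 'l) ts" and \<sigma> \<tau> :: "'i \<times> 'u \<Rightarrow> 'u" and G :: "(('u, 'l) ts \<times> ('i \<Rightarrow> ('u, 'l) ts_map)) set"
  assumes D: "\<And>i. i \<in> I \<Longrightarrow> D i \<in> Obj WTS"
    and GO: "\<And>g. g \<in> G \<Longrightarrow> fst g \<in> Obj WTS"
    and G: "\<And>g i. g \<in> G \<Longrightarrow> i \<in> I \<Longrightarrow> snd g i \<in> Hom WTS (D i) (fst g)"
    and \<sigma>: "\<And>i s j t g. i \<in> I \<Longrightarrow> s \<in> states (D i) \<Longrightarrow> j \<in> I \<Longrightarrow> t \<in> states (D j) \<Longrightarrow> \<sigma> (i, s) = \<sigma> (j, t) \<Longrightarrow>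
      g \<in> G \<Longrightarrow> on_states (snd g i) s = on_states (snd g j) t"
    and \<tau>: "\<And>i u j v g. i \<in> I \<Longrightarrow> u \<in> actions (D i) \<Longrightarrow> j \<in> I \<Longrightarrow> v \<in> actions (D j) \<Longrightarrow> \<tau> (i, u) = \<tau> (j, v) \<Longrightarrow>
      g \<in> G \<Longrightarrow> on_actions (snd g i) u = on_actions (snd g j) v"
    and \<tau>l: "\<And>i u j v. i \<in> I \<Longrightarrow> u \<in> actions (D i) \<Longrightarrow> j \<in> I \<Longrightarrow> v \<in> actions (D j) \<Longrightarrow> \<tau> (i, u) = \<tau> (j, v) \<Longrightarrow>
      label (D i) u = label (D j) v"
    and small: "small (\<sigma> ` (SIGMA i:I. states (D i)))" "small (\<tau> ` (SIGMA i:I. actions (D i)))"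
  obtains Q q h where
    "Q \<in> Obj WTS" "\<And>i. i \<in> I \<Longrightarrow> q i \<in> Hom WTS (D i) Q"
    "states Q = (\<Union>i\<in>I. on_states (q i) ` states (D i))"
    "actions Q = (\<Union>i\<in>I. on_actions (q i) ` actions (D i))"
    "\<And>i s j t. i \<in> I \<Longrightarrow> s \<in> states (D i) \<Longrightarrow> j \<in> I \<Longrightarrow> t \<in> states (D j) \<Longrightarrow>
       on_states (q i) s = on_states (q j) t \<longleftrightarrow> (\<forall>g\<in>G. on_states (snd g i) s = on_states (snd g j) t)"
    "\<And>i u j v. i \<in> I \<Longrightarrow> u \<in> actions (D i) \<Longrightarrow> j \<in> I \<Longrightarrow> v \<in> actions (D j) \<Longrightarrow>
       on_actions (q i) u = on_actions (q j) v \<longleftrightarrow>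
         label (D i) u = label (D j) v \<and> (\<forall>g\<in>G. on_actions (snd g i) u = on_actions (snd g j) v)"
    "\<And>g. g \<in> G \<Longrightarrow> h g \<in> Hom WTS Q (fst g)"
    "\<And>g i. g \<in> G \<Longrightarrow> i \<in> I \<Longrightarrow> Comp WTS (h g) (q i) = snd g i"
    "\<And>\<alpha> w \<beta>. (\<alpha>, w, \<beta>) \<in> transitions Q \<longleftrightarrow>
       \<alpha> \<in> states Q \<and> \<beta> \<in> states Q \<and> w \<noteq> [] \<and> set w \<subseteq> actions Q \<and>
       (\<forall>g\<in>G. (on_states (h g) \<alpha>, map (on_actions (h g)) w, on_states (h g) \<beta>) \<in> transitions (fst g))"
proof -
  let ?S = "SIGMA i:I. states (D i)" and ?A = "SIGMA i:I. actions (D i)"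
  \<comment> \<open>A point is identified with the family of its values under \<open>G\<close>;
    \<open>None\<close> outside \<open>G\<close> makes equality of families mean agreement on
    \<open>G\<close>. The label is part of the data of an action, so that the quotient is labelled
    whatever \<open>G\<close> is.\<close>
  let ?f = "\<lambda>p. (\<lambda>g. if g \<in> G then Some (on_states (snd g (fst p)) (snd p)) else None)"
  let ?g = "\<lambda>p. (label (D (fst p)) (snd p), \<lambda>g. if g \<in> G then Some (on_actions (snd g (fst p)) (snd p)) else None)"
  have f: "?f p = ?f p' \<longleftrightarrow> (\<forall>g\<in>G. on_states (snd g (fst p)) (snd p) = on_states (snd g (fst p')) (snd p'))" for p p'
    by (auto simp: fun_eq_iff)
  have g: "?g p = ?g p' \<longleftrightarrow> label (D (fst p)) (snd p) = label (D (fst p')) (snd p') \<and>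
      (\<forall>g\<in>G. on_actions (snd g (fst p)) (snd p) = on_actions (snd g (fst p')) (snd p'))" for p p'
    by (auto simp: fun_eq_iff)
  have fS: "?f p = ?f p'" if "p \<in> ?S" "p' \<in> ?S" "\<sigma> p = \<sigma> p'" for p p'
    unfolding f using \<sigma>[of "fst p" "snd p" "fst p'" "snd p'"] that by auto
  have gA: "?g p = ?g p'" if "p \<in> ?A" "p' \<in> ?A" "\<tau> p = \<tau> p'" for p p'
    unfolding g using \<tau>[of "fst p" "snd p" "fst p'" "snd p'"] \<tau>l[of "fst p" "snd p" "fst p'" "snd p'"] that
    by auto
  have "\<exists>\<kappa>. \<forall>p\<in>?S. \<kappa> p \<in> \<sigma> ` ?S \<and> (\<forall>p'\<in>?S. \<kappa> p = \<kappa> p' \<longleftrightarrow> ?f p = ?f p')"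
    by (rule quotient_codes) (rule fS)
  then obtain \<kappa> where \<kappa>: "\<And>p. p \<in> ?S \<Longrightarrow> \<kappa> p \<in> \<sigma> ` ?S"
    "\<And>p p'. p \<in> ?S \<Longrightarrow> p' \<in> ?S \<Longrightarrow> \<kappa> p = \<kappa> p' \<longleftrightarrow> ?f p = ?f p'"
  proof (elim exE)
    fix \<kappa> assume k: "\<forall>p\<in>?S. \<kappa> p \<in> \<sigma> ` ?S \<and> (\<forall>p'\<in>?S. \<kappa> p = \<kappa> p' \<longleftrightarrow> ?f p = ?f p')"
    show thesis
      by (rule that[of \<kappa>]) (rule conjunct1[OF bspec[OF k]] bspec[OF conjunct2[OF bspec[OF k]]]; assumption)+
  qed
  have "\<exists>\<mu>. \<forall>p\<in>?A. \<mu> p \<in> \<tau> ` ?A \<and> (\<forall>p'\<in>?A. \<mu> p = \<mu> p' \<longleftrightarrow> ?g p = ?g p')"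
    by (rule quotient_codes) (rule gA)
  then obtain \<mu> where \<mu>: "\<And>p. p \<in> ?A \<Longrightarrow> \<mu> p \<in> \<tau> ` ?A"
    "\<And>p p'. p \<in> ?A \<Longrightarrow> p' \<in> ?A \<Longrightarrow> \<mu> p = \<mu> p' \<longleftrightarrow> ?g p = ?g p'"
  proof (elim exE)
    fix \<mu> assume k: "\<forall>p\<in>?A. \<mu> p \<in> \<tau> ` ?A \<and> (\<forall>p'\<in>?A. \<mu> p = \<mu> p' \<longleftrightarrow> ?g p = ?g p')"
    show thesis
      by (rule that[of \<mu>]) (rule conjunct1[OF bspec[OF k]] bspec[OF conjunct2[OF bspec[OF k]]]; assumption)+
  qed
  define ps where "ps k = (SOME p. p \<in> ?S \<and> \<kappa> p = k)" for k
  define pa where "pa k = (SOME p. p \<in> ?A \<and> \<mu> p = k)" for k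
  have ps: "ps (\<kappa> p) \<in> ?S \<and> \<kappa> (ps (\<kappa> p)) = \<kappa> p" if "p \<in> ?S" for p
    unfolding ps_def by (rule someI[of _ p]) (use that in auto)
  have pa: "pa (\<mu> p) \<in> ?A \<and> \<mu> (pa (\<mu> p)) = \<mu> p" if "p \<in> ?A" for p
    unfolding pa_def by (rule someI[of _ p]) (use that in auto)
  define hs where "hs g k = on_states (snd g (fst (ps k))) (snd (ps k))" for g :: "('u, 'l) ts \<times> ('i \<Rightarrow> ('u, 'l) ts_map)" and k
  define ha where "ha g k = on_actions (snd g (fst (pa k))) (snd (pa k))" for g :: "('u, 'l) ts \<times> ('i \<Rightarrow> ('u, 'l) ts_map)" and k
  have hs: "hs g (\<kappa> (i, s)) = on_states (snd g i) s" if "i \<in> I" "s \<in> states (D i)" "g \<in> G" for g i s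
  proof -
    have p: "(i, s) \<in> ?S" using that by simp
    have "?f (ps (\<kappa> (i, s))) = ?f (i, s)" 
      by (rule iffD1[OF \<kappa>(2)[OF conjunct1[OF ps[OF p]] p] conjunct2[OF ps[OF p]]])
    then show ?thesis unfolding f hs_def using that by simp
  qed
  have pa': "?g (pa (\<mu> (i, u))) = ?g (i, u)" if "i \<in> I" "u \<in> actions (D i)" for i u
  proof -
    have p: "(i, u) \<in> ?A" using that by simp
    show ?thesis 
      by (rule iffD1[OF \<mu>(2)[OF conjunct1[OF pa[OF p]] p] conjunct2[OF pa[OF p]]])
  qed
  have ha: "ha g (\<mu> (i, u)) = on_actions (snd g i) u" if "i \<in> I" "u \<in> actions (D i)" "g \<in> G" for g i u
    using pa'[OF that(1,2)] that(3) unfolding g ha_def by simp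
  \<comment> \<open>The largest set of transitions for which all induced maps are maps of systems.
    The multiset and composition axioms are inherited because they hold after each of these
    maps.\<close>
  define T where "T = {(\<alpha>, w, \<beta>). \<alpha> \<in> \<kappa> ` ?S \<and> \<beta> \<in> \<kappa> ` ?S \<and> w \<noteq> [] \<and> set w \<subseteq> \<mu> ` ?A \<and>
      (\<forall>g\<in>G. (hs g \<alpha>, map (ha g) w, hs g \<beta>) \<in> transitions (fst g))}"
  define Q where "Q = \<lparr>states = \<kappa> ` ?S, actions = \<mu> ` ?A,
      label = restrict (\<lambda>k. label (D (fst (pa k))) (snd (pa k))) (\<mu> ` ?A), transitions = T\<rparr>"
  have Q_sel: "states Q = \<kappa> ` ?S" "actions Q = \<mu> ` ?A" "transitions Q = T" by (simp_all add: Q_def)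
  have Q_label: "label Q (\<mu> (i, u)) = label (D i) u" if "i \<in> I" "u \<in> actions (D i)" for i u
    using pa'[OF that] that by (auto simp: Q_def)
  have T_I: "(\<alpha>, w, \<beta>) \<in> T" if "\<alpha> \<in> \<kappa> ` ?S" "\<beta> \<in> \<kappa> ` ?S" "w \<noteq> []" "set w \<subseteq> \<mu> ` ?A"
    "\<And>g. g \<in> G \<Longrightarrow> (hs g \<alpha>, map (ha g) w, hs g \<beta>) \<in> transitions (fst g)" for \<alpha> w \<beta>
    using that unfolding T_def by blast
  have T_D: "\<alpha> \<in> \<kappa> ` ?S" "\<beta> \<in> \<kappa> ` ?S" "w \<noteq> []" "set w \<subseteq> \<mu> ` ?A"
    "g \<in> G \<Longrightarrow> (hs g \<alpha>, map (ha g) w, hs g \<beta>) \<in> transitions (fst g)" if "(\<alpha>, w, \<beta>) \<in> T" for \<alpha> w \<beta> g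
    using that unfolding T_def by blast+
  have GW: "weak_transition_system (fst g)" if "g \<in> G" for g using GO[OF that] by (simp add: Obj_WTS)
  have "multiset_axiom Q"
    unfolding multiset_axiom_def Q_sel
  proof (intro allI impI, elim conjE)
    fix \<alpha> us vs \<beta> assume t: "(\<alpha>, us, \<beta>) \<in> T" and m: "mset vs = mset us"
    show "(\<alpha>, vs, \<beta>) \<in> T"
    proof (rule T_I)
      show "vs \<noteq> []" using T_D(3)[OF t] m by auto
      show "set vs \<subseteq> \<mu> ` ?A" using T_D(4)[OF t] mset_eq_setD[OF m] by simp
      fix g assume "g \<in> G"
      with perm_closedD[OF weak_perm_closed[OF GW] T_D(5)[OF t]] m
      show "(hs g \<alpha>, map (ha g) vs, hs g \<beta>) \<in> transitions (fst g)" by simp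
    qed (use T_D[OF t] in auto)
  qed
  moreover have "composition_axiom Q"
    unfolding composition_axiom_def Q_sel
  proof (intro allI impI, elim conjE)
    fix \<alpha> us vs ws \<beta> \<nu>\<^sub>1 \<nu>\<^sub>2
    assume ne: "us \<noteq> []" "vs \<noteq> []" "ws \<noteq> []" and t: "(\<alpha>, us @ vs @ ws, \<beta>) \<in> T"
      "(\<alpha>, us, \<nu>\<^sub>1) \<in> T" "(\<nu>\<^sub>1, vs @ ws, \<beta>) \<in> T" "(\<alpha>, us @ vs, \<nu>\<^sub>2) \<in> T" "(\<nu>\<^sub>2, ws, \<beta>) \<in> T"
    show "(\<nu>\<^sub>1, vs, \<nu>\<^sub>2) \<in> T"
    proof (rule T_I)
      fix g assume g: "g \<in> G"
      have "composition_axiom (fst g)" using GW[OF g] unfolding weak_transition_system_def by blast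
      then show "(hs g \<nu>\<^sub>1, map (ha g) vs, hs g \<nu>\<^sub>2) \<in> transitions (fst g)"
        by (rule composition_axiomD[where us = "map (ha g) us" and ws = "map (ha g) ws" and \<alpha> = "hs g \<alpha>" and \<beta> = "hs g \<beta>"])
          (use ne T_D(5)[OF t(1) g] T_D(5)[OF t(2) g] T_D(5)[OF t(3) g] T_D(5)[OF t(4) g] T_D(5)[OF t(5) g] in auto)
    qed (use T_D(2)[OF t(2)] T_D(2)[OF t(4)] T_D(4)[OF t(4)] ne in auto)
  qed
  ultimately have "weak_transition_system Q"
    unfolding weak_transition_system_def using T_D(1-4) by (fastforce simp: Q_def)
  moreover have "\<kappa> ` ?S \<subseteq> \<sigma> ` ?S" "\<mu> ` ?A \<subseteq> \<tau> ` ?A" using \<kappa>(1) \<mu>(1) by blast+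
  ultimately have Q: "Q \<in> Obj WTS"
    unfolding Obj_WTS using small_subset small by (auto simp: Q_sel)
  define q where "q i = mk (D i) Q (\<lambda>s. \<kappa> (i, s)) (\<lambda>u. \<mu> (i, u))" for i
  have q: "q i \<in> Hom WTS (D i) Q" if i: "i \<in> I" for i
    unfolding q_def
  proof (rule mk_Hom[OF D[OF i] Q], rule ts_homI)
    fix \<alpha> us \<beta> assume t: "(\<alpha>, us, \<beta>) \<in> transitions (D i)"
    have w: "\<alpha> \<in> states (D i)" "us \<noteq> []" "set us \<subseteq> actions (D i)" "\<beta> \<in> states (D i)"
      using weakD[OF _ t] D[OF i] unfolding Obj_WTS by blast+
    show "(\<kappa> (i, \<alpha>), map (\<lambda>u. \<mu> (i, u)) us, \<kappa> (i, \<beta>)) \<in> transitions Q"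
      unfolding Q_sel
    proof (rule T_I)
      fix g assume g: "g \<in> G"
      have "map (ha g) (map (\<lambda>u. \<mu> (i, u)) us) = map (on_actions (snd g i)) us"
        using w(3) ha[OF i _ g] by auto
      then show "(hs g (\<kappa> (i, \<alpha>)), map (ha g) (map (\<lambda>u. \<mu> (i, u)) us), hs g (\<kappa> (i, \<beta>))) \<in> transitions (fst g)"
        using Hom_hom(4)[OF G[OF g i] t] by (simp only: hs[OF i w(1) g] hs[OF i w(4) g])
    qed (use w i in auto)
  qed (use i Q_label in \<open>auto simp: Q_sel\<close>)
  have h: "mk Q (fst g) (hs g) (ha g) \<in> Hom WTS Q (fst g)" if g: "g \<in> G" for g
  proof (rule mk_Hom[OF Q GO[OF g]], rule ts_homI)
    show "(hs g \<alpha>, map (ha g) us, hs g \<beta>) \<in> transitions (fst g)" if "(\<alpha>, us, \<beta>) \<in> transitions Q" for \<alpha> us \<beta>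
      using T_D(5)[OF that[unfolded Q_sel] g] .
  qed (use hs[OF _ _ g] ha[OF _ _ g] Hom_hom(1-3)[OF G[OF g]] Q_label in \<open>auto simp: Q_sel\<close>)
  have hq: "Comp WTS (mk Q (fst g) (hs g) (ha g)) (q i) = snd g i" if g: "g \<in> G" and i: "i \<in> I" for g i
    by (rule Comp_eqI[OF q[OF i] h[OF g] G[OF g i]])
      (use i hs[OF i _ g] ha[OF i _ g] Hom_hom(1,2)[OF q[OF i]] in \<open>auto simp: q_def Q_sel\<close>)
  show thesis
  proof (rule that[of Q q "\<lambda>g. mk Q (fst g) (hs g) (ha g)"])
    show "states Q = (\<Union>i\<in>I. on_states (q i) ` states (D i))"
      "actions Q = (\<Union>i\<in>I. on_actions (q i) ` actions (D i))"
      by (force simp: q_def Q_sel)+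
    show "on_states (q i) s = on_states (q j) t \<longleftrightarrow> (\<forall>g\<in>G. on_states (snd g i) s = on_states (snd g j) t)"
      if "i \<in> I" "s \<in> states (D i)" "j \<in> I" "t \<in> states (D j)" for i s j t
      using \<kappa>(2)[of "(i, s)" "(j, t)", unfolded f] that by (simp add: q_def)
    show "on_actions (q i) u = on_actions (q j) v \<longleftrightarrow>
         label (D i) u = label (D j) v \<and> (\<forall>g\<in>G. on_actions (snd g i) u = on_actions (snd g j) v)"
      if "i \<in> I" "u \<in> actions (D i)" "j \<in> I" "v \<in> actions (D j)" for i u j v
      using \<mu>(2)[of "(i, u)" "(j, v)", unfolded g] that by (simp add: q_def)
    have eq: "(on_states (mk Q (fst g) (hs g) (ha g)) \<alpha>, map (on_actions (mk Q (fst g) (hs g) (ha g))) w,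
        on_states (mk Q (fst g) (hs g) (ha g)) \<beta>) = (hs g \<alpha>, map (ha g) w, hs g \<beta>)"
      if "\<alpha> \<in> states Q" "\<beta> \<in> states Q" "set w \<subseteq> actions Q" for g \<alpha> w \<beta>
    proof -
      have "map (on_actions (mk Q (fst g) (hs g) (ha g))) w = map (ha g) w"
        using that by (intro map_cong) auto
      then show ?thesis using that by simp
    qed
    show "(\<alpha>, w, \<beta>) \<in> transitions Q \<longleftrightarrow>
       \<alpha> \<in> states Q \<and> \<beta> \<in> states Q \<and> w \<noteq> [] \<and> set w \<subseteq> actions Q \<and>
       (\<forall>g\<in>G. (on_states (mk Q (fst g) (hs g) (ha g)) \<alpha>, map (on_actions (mk Q (fst g) (hs g) (ha g))) w,
        on_states (mk Q (fst g) (hs g) (ha g)) \<beta>) \<in> transitions (fst g))" for \<alpha> w \<beta>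
      using eq[of \<alpha> \<beta> w] T_D[of \<alpha> w \<beta>] T_I[of \<alpha> \<beta> w] unfolding Q_sel by metis
  qed (use Q q h hq in auto)
qed

text \<open>The image of \<open>X\<close> in the product of all targets, cut down to its core. Since
  the targets separate the states of this image, it has unique splittings; its size is bounded by
  \<open>X\<close>, however large \<open>G\<close> is. The last clause speaks of edges because
  longer transitions common to all of \<open>G\<close> may be lost in the core.\<close>

lemma regular_quotient_exists:
  fixes X :: "('u, 'l) ts"
  assumes X: "X \<in> Obj RTS" and G: "\<And>g. g \<in> G \<Longrightarrow> g \<in> Hom RTS X (target g)"
  obtains Q q where "q \<in> Hom RTS X Q" "on_states q ` states X = states Q" "on_actions q ` actions X = actions Q"
    "\<And>g. g \<in> G \<Longrightarrow> \<exists>h\<in>Hom RTS Q (target g). Comp RTS h q = g"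
    "\<And>u v. u \<in> actions X \<Longrightarrow> v \<in> actions X \<Longrightarrow> label X u = label X v \<Longrightarrow>
        (\<And>g. g \<in> G \<Longrightarrow> on_actions g u = on_actions g v) \<Longrightarrow> on_actions q u = on_actions q v"
    "\<And>\<alpha> u \<beta>. \<alpha> \<in> states X \<Longrightarrow> \<beta> \<in> states X \<Longrightarrow> u \<in> actions X \<Longrightarrow>
        (\<And>g. g \<in> G \<Longrightarrow> (on_states g \<alpha>, [on_actions g u], on_states g \<beta>) \<in> transitions (target g)) \<Longrightarrow>
        (on_states q \<alpha>, [on_actions q u], on_states q \<beta>) \<in> transitions Q"
proof -
  have XW: "X \<in> Obj WTS" "weak_transition_system X" "regular X" using X by (auto simp: Obj_RTS Obj_WTS)
  have GW: "g \<in> Hom WTS X (target g)" "target g \<in> Obj WTS" "regular (target g)" "weak_transition_system (target g)"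
    if "g \<in> G" for g using G[OF that] by (auto simp: Hom_RTS Hom_WTS Obj_WTS)
  let ?G = "(\<lambda>g. (target g, \<lambda>_ :: unit. g)) ` G"
  have sm: "small (snd ` (SIGMA i:{()}. states X))" "small (snd ` (SIGMA i:{()}. actions X))"
  proof -
    have "snd ` (SIGMA i:{()}. A) = A" for A :: "'u set" by force
    then show "small (snd ` (SIGMA i:{()}. states X))" "small (snd ` (SIGMA i:{()}. actions X))"
      using XW(1) by (simp_all add: Obj_WTS)
  qed
  show thesis
  proof (rule quotient_exists[of "{()}" "\<lambda>_. X" ?G snd snd])
    show "small (snd ` (SIGMA i:{()}. states X))" "small (snd ` (SIGMA i:{()}. actions X))" by (rule sm)+
    fix Q q h
    assume Q: "Q \<in> Obj WTS" and q: "\<And>i. i \<in> {()} \<Longrightarrow> q i \<in> Hom WTS X Q"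
      and st: "states Q = (\<Union>i\<in>{()}. on_states (q i) ` states X)"
      and ac: "actions Q = (\<Union>i\<in>{()}. on_actions (q i) ` actions X)"
      and ste: "\<And>i s j t. i \<in> {()} \<Longrightarrow> s \<in> states X \<Longrightarrow> j \<in> {()} \<Longrightarrow> t \<in> states X \<Longrightarrow>
       on_states (q i) s = on_states (q j) t \<longleftrightarrow> (\<forall>g\<in>?G. on_states (snd g i) s = on_states (snd g j) t)"
      and ace: "\<And>i u j v. i \<in> {()} \<Longrightarrow> u \<in> actions X \<Longrightarrow> j \<in> {()} \<Longrightarrow> v \<in> actions X \<Longrightarrow>
       on_actions (q i) u = on_actions (q j) v \<longleftrightarrow>
         label X u = label X v \<and> (\<forall>g\<in>?G. on_actions (snd g i) u = on_actions (snd g j) v)"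
      and h: "\<And>g. g \<in> ?G \<Longrightarrow> h g \<in> Hom WTS Q (fst g)"
      and hq: "\<And>g i. g \<in> ?G \<Longrightarrow> i \<in> {()} \<Longrightarrow> Comp WTS (h g) (q i) = snd g i"
      and tr: "\<And>\<alpha> w \<beta>. (\<alpha>, w, \<beta>) \<in> transitions Q \<longleftrightarrow>
       \<alpha> \<in> states Q \<and> \<beta> \<in> states Q \<and> w \<noteq> [] \<and> set w \<subseteq> actions Q \<and>
       (\<forall>g\<in>?G. (on_states (h g) \<alpha>, map (on_actions (h g)) w, on_states (h g) \<beta>) \<in> transitions (fst g))"
    let ?q = "q ()" and ?h = "\<lambda>g. h (target g, \<lambda>_. g)"
    have q: "?q \<in> Hom WTS X Q" using q by simp
    have h: "?h g \<in> Hom WTS Q (target g)" "Comp WTS (?h g) ?q = g" if "g \<in> G" for g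
      using h[of "(target g, \<lambda>_. g)"] hq[of "(target g, \<lambda>_. g)" "()"] that by auto
    have hqs: "on_states (?h g) (on_states ?q s) = on_states g s" if "g \<in> G" "s \<in> states X" for g s
      using Comp_states[OF q that(2), of "?h g"] h(2)[OF that(1)] by simp
    have hqa: "on_actions (?h g) (on_actions ?q u) = on_actions g u" if "g \<in> G" "u \<in> actions X" for g u
      using Comp_actions[OF q that(2), of "?h g"] h(2)[OF that(1)] by simp
    have ste: "on_states ?q s = on_states ?q t" if "s \<in> states X" "t \<in> states X"
      "\<And>g. g \<in> G \<Longrightarrow> on_states g s = on_states g t" for s t
      using ste[of "()" s "()" t] that by simp
    have ace: "on_actions ?q s = on_actions ?q t" if "s \<in> actions X" "t \<in> actions X" "label X s = label X t"
      "\<And>g. g \<in> G \<Longrightarrow> on_actions g s = on_actions g t" for s t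
      using ace[of "()" s "()" t] that by simp
    have tr: "(\<alpha>, w, \<beta>) \<in> transitions Q \<longleftrightarrow> \<alpha> \<in> states Q \<and> \<beta> \<in> states Q \<and> w \<noteq> [] \<and> set w \<subseteq> actions Q \<and>
       (\<forall>g\<in>G. (on_states (?h g) \<alpha>, map (on_actions (?h g)) w, on_states (?h g) \<beta>) \<in> transitions (target g))"
      for \<alpha> w \<beta> using tr[of \<alpha> w \<beta>] by simp
    have st: "states Q = on_states ?q ` states X" and ac: "actions Q = on_actions ?q ` actions X"
      using st ac by simp_all
    have QW: "weak_transition_system Q" using Q by (simp add: Obj_WTS)
    have us: "unique_split (transitions Q)"
      unfolding unique_split_def
    proof (intro allI impI, elim conjE)
      fix \<alpha> us vs \<beta> \<nu> \<nu>'
      assume ne: "us \<noteq> []" "vs \<noteq> []" and t: "(\<alpha>, us @ vs, \<beta>) \<in> transitions Q" "(\<alpha>, us, \<nu>) \<in> transitions Q"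
        "(\<nu>, vs, \<beta>) \<in> transitions Q" "(\<alpha>, us, \<nu>') \<in> transitions Q" "(\<nu>', vs, \<beta>) \<in> transitions Q"
      obtain s s' where s: "s \<in> states X" "\<nu> = on_states ?q s" "s' \<in> states X" "\<nu>' = on_states ?q s'"
        using weakD(1)[OF QW t(3)] weakD(1)[OF QW t(5)] unfolding st by blast
      have "on_states g s = on_states g s'" if g: "g \<in> G" for g
      proof -
        have "on_states (?h g) \<nu> = on_states (?h g) \<nu>'"
          by (rule unique_splitD[OF regular_unique_split[OF GW(4,3)[OF g]], of "map (on_actions (?h g)) us" "map (on_actions (?h g)) vs"
                "on_states (?h g) \<alpha>" "on_states (?h g) \<beta>"])
            (use ne Hom_hom(4)[OF h(1)[OF g] t(1)] Hom_hom(4)[OF h(1)[OF g] t(2)] Hom_hom(4)[OF h(1)[OF g] t(3)]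
              Hom_hom(4)[OF h(1)[OF g] t(4)] Hom_hom(4)[OF h(1)[OF g] t(5)] in auto)
        then show ?thesis using hqs[OF g] s by simp
      qed
      from ste[OF s(1,3) this] s(2,4) show "\<nu> = \<nu>'" by simp
    qed
    have C: "core Q \<in> Obj RTS" by (rule core_Obj[OF Q us])
    have qc: "ts_hom X (core Q) (on_states ?q) (on_actions ?q)"
      by (rule ts_hom_core[OF XW(2,3) HomD_WTS(5)[OF q]])
    have acC: "actions (core Q) = on_actions ?q ` actions X"
      using core_regular(3)[OF QW us] ac ts_homD(2)[OF qc] by blast
    let ?c = "mk X (core Q) (on_states ?q) (on_actions ?q)"
    have c: "?c \<in> Hom RTS X (core Q)" by (rule mk_Hom_RTS[OF X C qc])
    show thesis
    proof (rule that[OF c])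
      show "on_states ?c ` states X = states (core Q)" "on_actions ?c ` actions X = actions (core Q)"
        using st acC by (auto simp: core_sel(1))
      show "\<exists>k\<in>Hom RTS (core Q) (target g). Comp RTS k ?c = g" if g: "g \<in> G" for g
      proof
        have "ts_hom (core Q) (target g) (on_states (?h g)) (on_actions (?h g))"
          using ts_hom_comp[OF core_ts_hom[OF QW us] HomD_WTS(5)[OF h(1)[OF g]]] .
        then show k: "mk (core Q) (target g) (on_states (?h g)) (on_actions (?h g)) \<in> Hom RTS (core Q) (target g)"
          by (rule mk_Hom_RTS[OF C, rotated]) (simp add: Obj_RTS GW[OF g])
        show "Comp RTS (mk (core Q) (target g) (on_states (?h g)) (on_actions (?h g))) ?c = g"
          unfolding RTS_WTS
          by (rule Comp_eqI[OF _ _ GW(1)[OF g]])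
            (use c k hqs[OF g] hqa[OF g] ts_homD(1,2)[OF qc] in \<open>auto simp: Hom_RTS\<close>)
      qed
      show "on_actions ?c u = on_actions ?c v" if "u \<in> actions X" "v \<in> actions X" "label X u = label X v"
        "\<And>g. g \<in> G \<Longrightarrow> on_actions g u = on_actions g v" for u v
        using ace[OF that] that by simp
      show "(on_states ?c \<alpha>, [on_actions ?c u], on_states ?c \<beta>) \<in> transitions (core Q)"
        if e: "\<alpha> \<in> states X" "\<beta> \<in> states X" "u \<in> actions X" and
          "\<And>g. g \<in> G \<Longrightarrow> (on_states g \<alpha>, [on_actions g u], on_states g \<beta>) \<in> transitions (target g)" for \<alpha> u \<beta>
      proof -
        have "(on_states ?q \<alpha>, [on_actions ?q u], on_states ?q \<beta>) \<in> transitions Q"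
          unfolding tr using that hqs hqa Hom_hom(1,2)[OF q] by simp
        from edge_core_transitions[OF this] show ?thesis using e by (simp add: core_sel)
      qed
    qed
  qed (use XW GW in auto)
qed

end

section \<open>Cofibrations and trivial fibrations\<close>

definition action_injections :: "('u, 'l) ts_map set" where
  "action_injections = {i \<in> Arr RTS. inj_on (on_actions i) (actions (source i))}"

definition trivial_fibrations :: "('u, 'l) ts_map set" where
  "trivial_fibrations =
     {p \<in> Arr RTS. bij_betw (on_states p) (states (source p)) (states (target p)) \<and>
        on_actions p ` actions (source p) = actions (target p) \<and>
        (\<forall>\<alpha> w \<beta>. \<alpha> \<in> states (source p) \<and> \<beta> \<in> states (source p) \<and> set w \<subseteq> actions (source p) \<and>
           (on_states p \<alpha>, map (on_actions p) w, on_states p \<beta>) \<in> transitions (target p) \<longrightarrow>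
           (\<alpha>, w, \<beta>) \<in> transitions (source p))}"

lemma trivial_fibrationI:
  assumes "p \<in> Hom RTS X Y" "bij_betw (on_states p) (states X) (states Y)"
    and "on_actions p ` actions X = actions Y"
    and "\<And>\<alpha> w \<beta>. \<alpha> \<in> states X \<Longrightarrow> \<beta> \<in> states X \<Longrightarrow> set w \<subseteq> actions X \<Longrightarrow>
       (on_states p \<alpha>, map (on_actions p) w, on_states p \<beta>) \<in> transitions Y \<Longrightarrow> (\<alpha>, w, \<beta>) \<in> transitions X"
  shows "p \<in> trivial_fibrations"
proof -
  have "source p = X" "target p = Y" "p \<in> Arr RTS" using assms(1) by (auto simp: Hom_RTS Hom_WTS Hom_def)
  then show ?thesis unfolding trivial_fibrations_def using assms(2-) by blast
qed

lemma trivial_fibrationD: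
  assumes "p \<in> trivial_fibrations" "p \<in> Hom WTS X Y"
  shows "bij_betw (on_states p) (states X) (states Y)" "on_actions p ` actions X = actions Y"
    "\<alpha> \<in> states X \<Longrightarrow> \<beta> \<in> states X \<Longrightarrow> set w \<subseteq> actions X \<Longrightarrow>
       (on_states p \<alpha>, map (on_actions p) w, on_states p \<beta>) \<in> transitions Y \<Longrightarrow> (\<alpha>, w, \<beta>) \<in> transitions X"
proof -
  have "source p = X" "target p = Y" using assms(2) by (simp_all add: Hom_WTS)
  with assms(1) show "bij_betw (on_states p) (states X) (states Y)" "on_actions p ` actions X = actions Y"
    "\<alpha> \<in> states X \<Longrightarrow> \<beta> \<in> states X \<Longrightarrow> set w \<subseteq> actions X \<Longrightarrow>
       (on_states p \<alpha>, map (on_actions p) w, on_states p \<beta>) \<in> transitions Y \<Longrightarrow> (\<alpha>, w, \<beta>) \<in> transitions X"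
    unfolding trivial_fibrations_def by blast+
qed

lemma trivial_fibrations_Arr: "trivial_fibrations \<subseteq> Arr RTS"
  unfolding trivial_fibrations_def by blast

lemma action_injectionI:
  "i \<in> Hom RTS X Y \<Longrightarrow> inj_on (on_actions i) (actions X) \<Longrightarrow> i \<in> action_injections"
  unfolding action_injections_def using RTS.HomD[of i X Y] by simp

text \<open>On states the bijection forces the lift. On actions the lift is forced on the image of
  \<open>i\<close>, where injectivity makes it well defined, and any preimage under \<open>p\<close>
  serves elsewhere. Labels are read off through \<open>p\<close>, and transitions exist because
  \<open>p\<close> reflects them.\<close>

lemma lifts_trivial_fibration:
  assumes i: "i \<in> Hom WTS A B" "inj_on (on_actions i) (actions A)" and p: "p \<in> trivial_fibrations"
  shows "lifts RTS i p"
  unfolding lifts_def RTS_WTS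
proof (intro allI impI, elim conjE)
  have iAB: "source i = A" "target i = B" using i(1) by (simp_all add: Hom_WTS)
  define X Y where "X = source p" and "Y = target p"
  have pR: "p \<in> Hom RTS X Y" using p trivial_fibrations_Arr by (auto simp: Hom_def X_def Y_def)
  then have pW: "p \<in> Hom WTS X Y" by (simp add: Hom_RTS)
  note pD = trivial_fibrationD[OF p pW]
  fix u v assume "u \<in> Hom RTS (source i) (source p)" "v \<in> Hom RTS (target i) (target p)"
    and e: "Comp WTS p u = Comp WTS v i"
  then have u: "u \<in> Hom WTS A X" and v: "v \<in> Hom WTS B Y" and vR: "v \<in> Hom RTS B Y"
    unfolding iAB X_def Y_def by (simp_all add: Hom_RTS)
  define hs where "hs = (\<lambda>s. inv_into (states X) (on_states p) (on_states v s))"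
  define ha where "ha = (\<lambda>b. if b \<in> on_actions i ` actions A
      then on_actions u (inv_into (actions A) (on_actions i) b)
      else (SOME x. x \<in> actions X \<and> on_actions p x = on_actions v b))"
  have hs: "hs s \<in> states X" "on_states p (hs s) = on_states v s" if "s \<in> states B" for s
  proof -
    have "on_states v s \<in> on_states p ` states X"
      using pD(1) Hom_hom(1)[OF v that] by (simp add: bij_betw_def)
    then show "hs s \<in> states X" "on_states p (hs s) = on_states v s"
      unfolding hs_def by (rule inv_into_into, rule f_inv_into_f)
  qed
  have hi: "ha (on_actions i a) = on_actions u a" if "a \<in> actions A" for a
    using that i(2) by (simp add: ha_def)
  have ha: "ha b \<in> actions X \<and> on_actions p (ha b) = on_actions v b" if b: "b \<in> actions B" for b
  proof (cases "b \<in> on_actions i ` actions A")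
    case True
    then obtain a where a: "a \<in> actions A" "b = on_actions i a" by blast
    then show ?thesis using hi[OF a(1)] Hom_hom(2)[OF u a(1)] Comp_eqD(2)[OF e u i(1) a(1)] by simp
  next
    case False
    have "\<exists>x. x \<in> actions X \<and> on_actions p x = on_actions v b"
      using pD(2) Hom_hom(2)[OF v b] by (metis imageE)
    from someI_ex[OF this] show ?thesis using False by (simp add: ha_def)
  qed
  have hom: "ts_hom B X hs ha"
  proof (rule ts_homI)
    fix b assume b: "b \<in> actions B"
    show "label X (ha b) = label B b"
      using ha[OF b] Hom_hom(3)[OF pW, of "ha b"] Hom_hom(3)[OF v b] by simp
  next
    fix \<alpha> us \<beta> assume t: "(\<alpha>, us, \<beta>) \<in> transitions B"
    note w = weakD[OF HomD_WTS(6)[OF v] t]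
    have "map (on_actions p) (map ha us) = map (on_actions v) us" using w(3) ha by auto
    then have "(on_states p (hs \<alpha>), map (on_actions p) (map ha us), on_states p (hs \<beta>)) \<in> transitions Y"
      using Hom_hom(4)[OF v t] by (simp only: hs(2)[OF w(1)] hs(2)[OF w(4)])
    then show "(hs \<alpha>, map ha us, hs \<beta>) \<in> transitions X"
      by (rule pD(3)[rotated 3]) (use w hs ha in auto)
  qed (use hs ha in auto)
  have "B \<in> Obj RTS" "X \<in> Obj RTS" using vR pR by (auto simp: Hom_RTS Hom_WTS Obj_RTS)
  then have hR: "mk B X hs ha \<in> Hom RTS B X" using hom by (rule mk_Hom_RTS)
  then have h: "mk B X hs ha \<in> Hom WTS B X" by (simp add: Hom_RTS)
  show "\<exists>h. h \<in> Hom RTS (target i) (source p) \<and> Comp WTS h i = u \<and> Comp WTS p h = v"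
    unfolding iAB X_def[symmetric]
  proof (intro exI conjI)
    show "mk B X hs ha \<in> Hom RTS B X" by (rule hR)
    show "Comp WTS (mk B X hs ha) i = u"
    proof (rule Comp_eqI[OF i(1) h u])
      fix s assume s: "s \<in> states A"
      have "on_states p (on_states u s) = on_states v (on_states i s)" by (rule Comp_eqD(1)[OF e u i(1) s])
      then have "hs (on_states i s) = on_states u s"
        unfolding hs_def using inv_into_f_eq[of "on_states p" "states X" "on_states u s"] pD(1)
          Hom_hom(1)[OF u s] by (simp add: bij_betw_def)
      then show "on_states (mk B X hs ha) (on_states i s) = on_states u s"
        using Hom_hom(1)[OF i(1) s] by simp
    qed (use hi Hom_hom(2)[OF i(1)] in simp)
    show "Comp WTS p (mk B X hs ha) = v"
      by (rule Comp_eqI[OF h pW v]) (use hs ha in auto)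
  qed
qed

section \<open>Changing the actions along a surjection\<close>

definition expand ::
  "('s, 'a, 'l) transition_system \<Rightarrow> 'b set \<Rightarrow> ('b \<Rightarrow> 'a) \<Rightarrow> ('s, 'b, 'l) transition_system" where
  "expand X D p =
     \<lparr>states = states X, actions = D, label = restrict (\<lambda>d. label X (p d)) D,
      transitions = {(\<alpha>, w, \<beta>). set w \<subseteq> D \<and> (\<alpha>, map p w, \<beta>) \<in> transitions X}\<rparr>"

lemma expand_sel [simp]:
  "states (expand X D p) = states X" "actions (expand X D p) = D"
  "d \<in> D \<Longrightarrow> label (expand X D p) d = label X (p d)"
  "(\<alpha>, w, \<beta>) \<in> transitions (expand X D p) \<longleftrightarrow> set w \<subseteq> D \<and> (\<alpha>, map p w, \<beta>) \<in> transitions X"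
  by (simp_all add: expand_def)

lemma expand_regular:
  assumes X: "weak_transition_system X" "regular X" and p: "p ` D = actions X"
  shows "weak_transition_system (expand X D p)" "regular (expand X D p)"
proof -
  let ?Y = "expand X D p"
  have "multiset_axiom ?Y"
    unfolding multiset_axiom_def
  proof (intro allI impI, elim conjE)
    fix \<alpha> us vs \<beta> assume t: "(\<alpha>, us, \<beta>) \<in> transitions ?Y" and m: "mset vs = mset us"
    have "(\<alpha>, map p us, \<beta>) \<in> transitions X" using t by simp
    from perm_closedD[OF weak_perm_closed[OF X(1)] this, of "map p vs"] m mset_eq_setD[OF m] t
    show "(\<alpha>, vs, \<beta>) \<in> transitions ?Y" by simp
  qed
  moreover have "composition_axiom ?Y"
    unfolding composition_axiom_def
  proof (intro allI impI, elim conjE)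
    fix \<alpha> us vs ws \<beta> \<nu>\<^sub>1 \<nu>\<^sub>2
    assume ne: "us \<noteq> []" "vs \<noteq> []" "ws \<noteq> []" and t: "(\<alpha>, us @ vs @ ws, \<beta>) \<in> transitions ?Y"
      "(\<alpha>, us, \<nu>\<^sub>1) \<in> transitions ?Y" "(\<nu>\<^sub>1, vs @ ws, \<beta>) \<in> transitions ?Y"
      "(\<alpha>, us @ vs, \<nu>\<^sub>2) \<in> transitions ?Y" "(\<nu>\<^sub>2, ws, \<beta>) \<in> transitions ?Y"
    have "composition_axiom X" using X(1) unfolding weak_transition_system_def by blast
    from composition_axiomD[OF this, of "map p us" "map p vs" "map p ws" \<alpha> \<beta> \<nu>\<^sub>1 \<nu>\<^sub>2] ne t
    show "(\<nu>\<^sub>1, vs, \<nu>\<^sub>2) \<in> transitions ?Y" by simp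
  qed
  moreover have "\<alpha> \<in> states ?Y \<and> us \<noteq> [] \<and> set us \<subseteq> actions ?Y \<and> \<beta> \<in> states ?Y"
    if "(\<alpha>, us, \<beta>) \<in> transitions ?Y" for \<alpha> us \<beta>
    using that weakD[OF X(1), of \<alpha> "map p us" \<beta>] by auto
  moreover have "label ?Y \<in> extensional (actions ?Y)" by (simp add: expand_def)
  ultimately show "weak_transition_system ?Y"
    unfolding weak_transition_system_def by blast
  have "\<exists>\<alpha> \<beta>. (\<alpha>, [d], \<beta>) \<in> transitions ?Y" if "d \<in> actions ?Y" for d
  proof -
    have "p d \<in> actions X" using that p by auto
    then obtain \<alpha> \<beta> where "(\<alpha>, [p d], \<beta>) \<in> transitions X" using X(2) unfolding regular_def by blast
    with that show ?thesis by auto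
  qed
  moreover have "CSA2 ?Y"
    unfolding CSA2_def
  proof (intro allI impI, elim conjE)
    fix \<alpha> us vs \<beta> assume ne: "us \<noteq> []" "vs \<noteq> []" and t: "(\<alpha>, us @ vs, \<beta>) \<in> transitions ?Y"
    have "\<exists>!\<nu>. \<nu> \<in> states X \<and> (\<alpha>, map p us, \<nu>) \<in> transitions X \<and> (\<nu>, map p vs, \<beta>) \<in> transitions X"
      using X(2) ne t unfolding regular_def CSA2_def by simp
    then show "\<exists>!\<nu>. \<nu> \<in> states ?Y \<and> (\<alpha>, us, \<nu>) \<in> transitions ?Y \<and> (\<nu>, vs, \<beta>) \<in> transitions ?Y"
      using t by simp
  qed
  ultimately show "regular ?Y" unfolding regular_def by blast
qed

lemma expand_Obj:
  fixes X :: "('u, 'l) ts"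
  assumes "X \<in> Obj RTS" "p ` D = actions X" "small D"
  shows "expand X D p \<in> Obj RTS"
  using assms expand_regular[of X p D] by (simp add: Obj_RTS Obj_WTS)

lemma expand_Hom:
  fixes X :: "('u, 'l) ts"
  assumes "X \<in> Obj RTS" "p ` D = actions X" "small D"
  shows "mk (expand X D p) X (\<lambda>s. s) p \<in> Hom RTS (expand X D p) X"
  by (rule mk_Hom_RTS[OF expand_Obj[OF assms] assms(1)], rule ts_homI) (use assms(2) in auto)

lemma expand_trivial_fibration:
  fixes X :: "('u, 'l) ts"
  assumes "X \<in> Obj RTS" "p ` D = actions X" "small D"
  shows "mk (expand X D p) X (\<lambda>s. s) p \<in> trivial_fibrations"
proof (rule trivial_fibrationI[OF expand_Hom[OF assms]])
  show "bij_betw (on_states (mk (expand X D p) X (\<lambda>s. s) p)) (states (expand X D p)) (states X)"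
    by (auto simp: bij_betw_def inj_on_def image_iff)
  show "on_actions (mk (expand X D p) X (\<lambda>s. s) p) ` actions (expand X D p) = actions X"
    using assms(2) by (auto simp: image_iff)
  fix \<alpha> w \<beta> assume a: "\<alpha> \<in> states (expand X D p)" "\<beta> \<in> states (expand X D p)" "set w \<subseteq> actions (expand X D p)"
    and t: "(on_states (mk (expand X D p) X (\<lambda>s. s) p) \<alpha>, map (on_actions (mk (expand X D p) X (\<lambda>s. s) p)) w,
       on_states (mk (expand X D p) X (\<lambda>s. s) p) \<beta>) \<in> transitions X"
  have "map (on_actions (mk (expand X D p) X (\<lambda>s. s) p)) w = map p w" using a(3) by (intro map_cong) auto
  with t a show "(\<alpha>, w, \<beta>) \<in> transitions (expand X D p)" by (simp del: map_eq_conv)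
qed

context small_universe
begin

lemma two_elements: obtains a b :: 'u where "a \<noteq> b"
proof -
  have "\<not> (\<forall>x y :: 'u. x = y)"
  proof
    assume "\<forall>x y :: 'u. x = y"
    then have "(UNIV :: 'u set) = {undefined}" by auto
    then have "finite (UNIV :: 'u set)" by (metis finite.emptyI finite.insertI)
    then show False using infinite_universe by blast
  qed
  then show thesis using that by blast
qed

text \<open>A mapping cylinder on actions: the middle system is \<open>Y\<close> with the disjoint
  union of the actions of \<open>X\<close> and \<open>Y\<close>, tagged by \<open>a\<close> and
  \<open>b\<close>. The first summand makes the inclusion injective, the second makes the projection
  surjective.\<close>

lemma factor_action_injection:
  fixes f :: "('u, 'l) ts_map"
  assumes "f \<in> Arr RTS"
  shows "\<exists>c\<in>action_injections. \<exists>t\<in>trivial_fibrations. Cod RTS c = Dom RTS t \<and> f = Comp RTS t c"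
proof -
  define X Y where "X = source f" and "Y = target f"
  have f: "f \<in> Hom RTS X Y" using assms by (simp add: Hom_def X_def Y_def)
  then have fW: "f \<in> Hom WTS X Y" and XY: "X \<in> Obj RTS" "Y \<in> Obj RTS"
    by (auto simp: Hom_RTS Hom_WTS Obj_RTS)
  obtain a b :: 'u where ab: "a \<noteq> b" by (rule two_elements)
  define D where "D = (enc ` ({a} \<times> actions X) \<union> enc ` ({b} \<times> actions Y) :: 'u set)"
  define p where "p = (\<lambda>d :: 'u. case inv enc d of (c, u) \<Rightarrow> if c = a then on_actions f u else u)"
  have p: "p (enc (c, u)) = (if c = a then on_actions f u else u)" for c u
    by (simp add: p_def inv_f_f[OF inj_enc_pair])
  have sm: "small D"
    unfolding D_def using XY
    by (intro small_Un small_image_Times) (auto simp: Obj_RTS Obj_WTS intro: finite_small)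
  have pD: "p ` D = actions Y"
  proof
    show "p ` D \<subseteq> actions Y" using Hom_hom(2)[OF fW] ab by (auto simp: D_def p)
    show "actions Y \<subseteq> p ` D"
    proof
      fix u assume "u \<in> actions Y"
      then have "enc (b, u) \<in> D" "p (enc (b, u)) = u" using ab by (auto simp: D_def p)
      then show "u \<in> p ` D" by (metis imageI)
    qed
  qed
  let ?E = "expand Y D p"
  let ?t = "mk ?E Y (\<lambda>s. s) p"
  let ?c = "mk X ?E (on_states f) (\<lambda>u. enc (a, u))"
  have t: "?t \<in> trivial_fibrations" "?t \<in> Hom RTS ?E Y"
    using expand_trivial_fibration[OF XY(2) pD sm] expand_Hom[OF XY(2) pD sm] .
  have inD: "enc (a, u) \<in> D" if "u \<in> actions X" for u using that by (simp add: D_def)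
  have c: "?c \<in> Hom RTS X ?E"
  proof (rule mk_Hom_RTS[OF XY(1) expand_Obj[OF XY(2) pD sm]], rule ts_homI)
    fix \<alpha> us \<beta> assume tr: "(\<alpha>, us, \<beta>) \<in> transitions X"
    have us: "set us \<subseteq> actions X" using weakD(3)[OF HomD_WTS(6)[OF fW] tr] .
    have "map p (map (\<lambda>u. enc (a, u)) us) = map (on_actions f) us" using p by simp
    then show "(on_states f \<alpha>, map (\<lambda>u. enc (a, u)) us, on_states f \<beta>) \<in> transitions ?E"
      using Hom_hom(4)[OF fW tr] inD us by (auto simp del: map_map)
  qed (use Hom_hom[OF fW] inD p in auto)
  have "inj_on (on_actions ?c) (actions X)"
    by (rule inj_onI) (auto dest: injD[OF inj_enc_pair])
  then have "?c \<in> action_injections" by (rule action_injectionI[OF c])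
  moreover have "f = Comp WTS ?t ?c"
    by (rule sym, rule Comp_eqI[of _ _ ?E, OF _ _ fW])
      (use c t(2) inD p Hom_hom(1)[OF fW] in \<open>simp_all add: Hom_RTS\<close>)
  ultimately show ?thesis using t(1) by (intro bexI[of _ ?c] bexI[of _ ?t]) auto
qed

text \<open>Lifting \<open>i\<close> against the second factor of its own factorization gives
  \<open>h\<close> with \<open>h\<close> after \<open>i\<close> equal to \<open>c\<close>. As
  \<open>c\<close> is injective on actions, so is \<open>i\<close>.\<close>

lemma llp_trivial_fibrations: "llp RTS trivial_fibrations = (action_injections :: ('u, 'l) ts_map set)"
proof
  show "action_injections \<subseteq> (llp RTS trivial_fibrations :: ('u, 'l) ts_map set)"
    unfolding llp_def using lifts_trivial_fibration
    by (auto simp: action_injections_def Arr_RTS Hom_RTS)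
  show "llp RTS trivial_fibrations \<subseteq> (action_injections :: ('u, 'l) ts_map set)"
  proof
    fix i :: "('u, 'l) ts_map" assume i: "i \<in> llp RTS trivial_fibrations"
    then have iA: "i \<in> Arr RTS" by (simp add: llp_def)
    obtain c t where c: "c \<in> action_injections" and t: "t \<in> trivial_fibrations"
      and ct: "Cod RTS c = Dom RTS t" "i = Comp RTS t c"
      using factor_action_injection[OF iA] by blast
    have cH: "c \<in> Hom RTS (source c) (source t)" and tH: "t \<in> Hom RTS (source t) (target t)"
      using c t ct trivial_fibrations_Arr by (auto simp: action_injections_def Hom_def)
    have iH: "i \<in> Hom RTS (source c) (target t)" using RTS.Comp_Hom[OF cH tH] ct by simp
    have "lifts RTS i t" using i t by (simp add: llp_def)
    then obtain h where h: "h \<in> Hom RTS (target t) (source t)" "Comp RTS h i = c"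
      using RTS.liftsE[OF _ iH tH cH RTS.Ident_Hom] RTS.Ident_Comp[OF iH] RTS.Hom_Obj[OF iH] ct(2) by metis
    have "inj_on (on_actions i) (actions (source c))"
    proof (rule inj_onI)
      fix u v assume uv: "u \<in> actions (source c)" "v \<in> actions (source c)" "on_actions i u = on_actions i v"
      have "on_actions c u = on_actions h (on_actions i u)" if "u \<in> actions (source c)" for u
        using h(2) Comp_actions[of i "source c" "target t" u h] iH that by (simp add: Hom_RTS)
      from this[OF uv(1)] this[OF uv(2)] uv have "on_actions c u = on_actions c v" by simp
      then show "u = v" using c uv by (auto simp: action_injections_def inj_on_def)
    qed
    then show "i \<in> action_injections" by (rule action_injectionI[OF iH])
  qed
qed

text \<open>A map to this system is a set of actions of its source.\<close>

definition bicoloured :: "'u \<Rightarrow> 'u \<Rightarrow> ('u, 'l) ts" where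
  "bicoloured a b =
     (let A = enc ` ({a, b} \<times> range (enc :: 'l \<Rightarrow> 'u)) in
      \<lparr>states = {a}, actions = A, label = restrict (\<lambda>v. inv enc (snd (inv enc v :: 'u \<times> 'u))) A,
       transitions = {(a, w, a) | w. w \<noteq> [] \<and> set w \<subseteq> A}\<rparr>)"

text \<open>The first component of the image of an action records membership in \<open>B\<close>,
  the second its label, which every map has to keep.\<close>

definition colouring :: "'u \<Rightarrow> 'u \<Rightarrow> ('u, 'l) ts \<Rightarrow> 'u set \<Rightarrow> ('u, 'l) ts_map" where
  "colouring a b X B =
     mk X (bicoloured a b) (\<lambda>_. a) (\<lambda>u. enc (if u \<in> B then a else b, enc (label X u) :: 'u))"

lemma bicoloured_Obj: "bicoloured a b \<in> Obj RTS"
proof -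
  let ?X = "bicoloured a b"
  have "small (actions ?X)"
    unfolding bicoloured_def Let_def
    using small_image_Times[of "{a, b}" "range (enc :: 'l \<Rightarrow> 'u)" enc] finite_small[of "{a, b}"]
      small_image_less[OF labels_small, of enc] by simp
  moreover have "small (states ?X)" by (simp add: bicoloured_def Let_def finite_small)
  moreover have "multiset_axiom ?X"
    unfolding multiset_axiom_def bicoloured_def Let_def by (auto dest: mset_eq_setD)
  moreover have "composition_axiom ?X" "CSA2 ?X"
    unfolding composition_axiom_def CSA2_def bicoloured_def Let_def by auto
  moreover have "\<exists>\<alpha> \<beta>. (\<alpha>, [u], \<beta>) \<in> transitions ?X" if "u \<in> actions ?X" for u
    using that unfolding bicoloured_def Let_def by auto
  moreover have "label ?X \<in> extensional (actions ?X)" by (simp add: bicoloured_def Let_def)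
  moreover have "\<alpha> \<in> states ?X \<and> us \<noteq> [] \<and> set us \<subseteq> actions ?X \<and> \<beta> \<in> states ?X"
    if "(\<alpha>, us, \<beta>) \<in> transitions ?X" for \<alpha> us \<beta>
    using that by (auto simp: bicoloured_def Let_def)
  ultimately show ?thesis
    unfolding Obj_RTS Obj_WTS regular_def weak_transition_system_def by blast
qed

lemma colouring_Hom:
  assumes X: "X \<in> Obj RTS"
  shows "colouring a b X B \<in> Hom RTS X (bicoloured a b)"
  unfolding colouring_def
proof (rule mk_Hom_RTS[OF X bicoloured_Obj], rule ts_homI)
  have XW: "weak_transition_system X" using X by (simp add: Obj_RTS Obj_WTS)
  fix \<alpha> us \<beta> assume "(\<alpha>, us, \<beta>) \<in> transitions X"
  from weakD[OF XW this]
  show "(a, map (\<lambda>u. enc (if u \<in> B then a else b, enc (label X u) :: 'u)) us, a) \<in> transitions (bicoloured a b)"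
    by (auto simp: bicoloured_def Let_def)
qed (auto simp: bicoloured_def Let_def inv_f_f[OF inj_enc_pair] inv_f_f[OF inj_enc_label])

lemma colouring_action:
  assumes "u \<in> actions X" "v \<in> actions X" "a \<noteq> b" "on_actions (colouring a b X B) u = on_actions (colouring a b X B) v"
  shows "u \<in> B \<longleftrightarrow> v \<in> B"
proof -
  have "(if u \<in> B then a else b) = (if v \<in> B then a else b)"
    using assms(4) unfolding colouring_def mk_sel(4)[OF assms(1)] mk_sel(4)[OF assms(2)]
    by (simp only: inj_eq[OF inj_enc_pair] prod.inject)
  then show ?thesis using assms(3) by (auto split: if_splits)
qed

lemma colouring_Comp:
  assumes f: "f \<in> Hom RTS X Y" and B: "\<And>u. u \<in> actions X \<Longrightarrow> on_actions f u \<in> B \<longleftrightarrow> u \<in> B'"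
  shows "Comp RTS (colouring a b Y B) f = colouring a b X B'"
proof -
  have XY: "X \<in> Obj RTS" "Y \<in> Obj RTS" and fW: "f \<in> Hom WTS X Y" using f by (auto simp: Hom_RTS Hom_WTS Obj_RTS)
  have c: "colouring a b Y B \<in> Hom WTS Y (bicoloured a b)" "colouring a b X B' \<in> Hom WTS X (bicoloured a b)"
    by (rule conjunct1[OF iffD1[OF Hom_RTS colouring_Hom[OF XY(2)]]] conjunct1[OF iffD1[OF Hom_RTS colouring_Hom[OF XY(1)]]])+
  show ?thesis
    unfolding RTS_WTS
  proof (rule Comp_eqI[OF fW c])
    fix s assume "s \<in> states X"
    then show "on_states (colouring a b Y B) (on_states f s) = on_states (colouring a b X B') s"
      unfolding colouring_def using Hom_hom(1)[OF fW] by simp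
  next
    fix u assume u: "u \<in> actions X"
    show "on_actions (colouring a b Y B) (on_actions f u) = on_actions (colouring a b X B') u"
      unfolding colouring_def mk_sel(4)[OF u] mk_sel(4)[OF Hom_hom(2)[OF fW u]] B[OF u] Hom_hom(3)[OF fW u] ..
  qed
qed

text \<open>Injectivity on the colimit is tested by maps to \<open>bicoloured\<close>, without
  computing the colimit. If two actions of the bottom stage coincide in the colimit, the set of
  actions that eventually equal one of them also contains the other. They then agree at some stage,
  and the map from the bottom to that stage is injective.\<close>

lemma action_injection_transfinite_composition:
  fixes f :: "('u, 'l) ts_map"
  assumes "Well_order r" "transfinite_composition RTS r K f" "K \<subseteq> action_injections"
  shows "f \<in> action_injections"
proof (rule RTS.transfinite_composition_in[OF assms(1,2)])
  fix a :: "('u, 'l) ts" assume "a \<in> Obj RTS"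
  then have "Ident RTS a \<in> Hom RTS a a" by (rule RTS.Ident_Hom)
  then show "Ident RTS a \<in> action_injections" by (rule action_injectionI) (auto intro: inj_onI)
next
  fix a b c :: "('u, 'l) ts" and f g
  assume f: "f \<in> Hom RTS a b" "f \<in> action_injections" and g: "g \<in> Hom RTS b c" "g \<in> K"
  have fW: "f \<in> Hom WTS a b" and gW: "g \<in> Hom WTS b c" using f g by (auto simp: Hom_RTS)
  have "inj_on (on_actions f) (actions a)" "inj_on (on_actions g) (actions b)"
    using f g assms(3) by (auto simp: action_injections_def Hom_RTS Hom_WTS)
  then have "inj_on (on_actions (Comp RTS g f)) (actions a)"
    using Comp_actions[OF fW] Hom_hom(2)[OF fW] by (auto simp: inj_on_def)
  then show "Comp RTS g f \<in> action_injections" by (rule action_injectionI[OF RTS.Comp_Hom[OF f(1) g(1)]])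
next
  fix J and D :: "_ \<Rightarrow> ('u, 'l) ts" and d Z c i\<^sub>0
  assume ch: "RTS.chain r J D d i\<^sub>0" and M: "\<forall>i\<in>J. d i\<^sub>0 i \<in> action_injections"
    and col: "is_colimit RTS J D {(i, d i k, k) | i k. i \<in> J \<and> k \<in> J \<and> (i, k) \<in> r} Z c"
  have i0: "i\<^sub>0 \<in> J" and le: "\<And>i. i \<in> J \<Longrightarrow> (i\<^sub>0, i) \<in> r"
    and refl: "\<And>i. i \<in> J \<Longrightarrow> (i, i) \<in> r" and tot: "\<And>i j. i \<in> J \<Longrightarrow> j \<in> J \<Longrightarrow> (i, j) \<in> r \<or> (j, i) \<in> r"
    and hom: "\<And>i j. (i, j) \<in> r \<Longrightarrow> d i j \<in> Hom RTS (D i) (D j)"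
    and dd: "\<And>i j k. (i, j) \<in> r \<Longrightarrow> (j, k) \<in> r \<Longrightarrow> Comp RTS (d j k) (d i j) = d i k"
    using ch unfolding RTS.chain_def by blast+
  let ?E = "{(i, d i k, k) | i k. i \<in> J \<and> k \<in> J \<and> (i, k) \<in> r}"
  have c: "\<And>i. i \<in> J \<Longrightarrow> c i \<in> Hom RTS (D i) Z"
    using col unfolding is_colimit_def is_cocone_def by blast
  have trans: "(i, k) \<in> r" if "(i, j) \<in> r" "(j, k) \<in> r" for i j k
    using assms(1) that unfolding well_order_on_def linear_order_on_def partial_order_on_def
      preorder_on_def trans_def by blast
  have dda: "on_actions (d i k) u = on_actions (d j k) (on_actions (d i j) u)"
    if "(i, j) \<in> r" "(j, k) \<in> r" "u \<in> actions (D i)" for i j k u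
    using dd[OF that(1,2)] Comp_actions[of "d i j" "D i" "D j" u "d j k"] hom[OF that(1)] that(3)
    by (simp add: Hom_RTS)
  have "inj_on (on_actions (c i\<^sub>0)) (actions (D i\<^sub>0))"
  proof (rule inj_onI)
    fix u v assume uv: "u \<in> actions (D i\<^sub>0)" "v \<in> actions (D i\<^sub>0)" "on_actions (c i\<^sub>0) u = on_actions (c i\<^sub>0) v"
    obtain a b :: 'u where ab: "a \<noteq> b" by (rule two_elements)
    \<comment> \<open>Eventual equality with \<open>v\<close>: the smallest family containing
      \<open>v\<close> that is both preserved and reflected by the transition maps, so that the
      colourings form a cocone.\<close>
    define B where "B k = {x. \<exists>m\<in>J. (k, m) \<in> r \<and> on_actions (d k m) x = on_actions (d i\<^sub>0 m) v}" for k
    have B: "on_actions (d k k') x \<in> B k' \<longleftrightarrow> x \<in> B k"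
      if k: "k \<in> J" "k' \<in> J" "(k, k') \<in> r" and x: "x \<in> actions (D k)" for k k' x
    proof
      assume "on_actions (d k k') x \<in> B k'"
      then obtain m where m: "m \<in> J" "(k', m) \<in> r" "on_actions (d k' m) (on_actions (d k k') x) = on_actions (d i\<^sub>0 m) v"
        unfolding B_def by blast
      then show "x \<in> B k" unfolding B_def using dda[OF k(3) m(2) x] trans[OF k(3) m(2)] by auto
    next
      assume "x \<in> B k"
      then obtain m where m: "m \<in> J" "(k, m) \<in> r" "on_actions (d k m) x = on_actions (d i\<^sub>0 m) v"
        unfolding B_def by blast
      obtain n where n: "n \<in> J" "(m, n) \<in> r" "(k', n) \<in> r"
        using tot[OF m(1) k(2)] refl[OF m(1)] refl[OF k(2)] m(1) k(2) by blast
      have "on_actions (d k' n) (on_actions (d k k') x) = on_actions (d m n) (on_actions (d k m) x)"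
        using dda[OF k(3) n(3) x] dda[OF m(2) n(2) x] by simp
      also have "\<dots> = on_actions (d i\<^sub>0 n) v" using m(3) dda[OF le[OF m(1)] n(2) uv(2)] by simp
      finally show "on_actions (d k k') x \<in> B k'" unfolding B_def using n by blast
    qed
    have D: "D i \<in> Obj RTS" if "i \<in> J" for i using RTS.Hom_Obj(1)[OF c[OF that]] .
    have "is_cocone RTS J D ?E (bicoloured a b) (\<lambda>k. colouring a b (D k) (B k))"
      unfolding is_cocone_def
      using bicoloured_Obj colouring_Hom[OF D] colouring_Comp[OF hom] B by auto
    then obtain h where h: "h \<in> Hom RTS Z (bicoloured a b)"
      "\<And>k. k \<in> J \<Longrightarrow> Comp RTS h (c k) = colouring a b (D k) (B k)"
      using col unfolding is_colimit_def by blast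
    have "on_actions (colouring a b (D i\<^sub>0) (B i\<^sub>0)) x = on_actions h (on_actions (c i\<^sub>0) x)"
      if "x \<in> actions (D i\<^sub>0)" for x
      using h(2)[OF i0] Comp_actions[of "c i\<^sub>0" "D i\<^sub>0" Z x h] c[OF i0] that by (simp add: Hom_RTS)
    from this[OF uv(1)] this[OF uv(2)] uv(3)
    have "u \<in> B i\<^sub>0 \<longleftrightarrow> v \<in> B i\<^sub>0" using colouring_action[OF uv(1,2) ab] by simp
    moreover have "v \<in> B i\<^sub>0" unfolding B_def using i0 refl[OF i0] by blast
    ultimately obtain m where m: "m \<in> J" "on_actions (d i\<^sub>0 m) u = on_actions (d i\<^sub>0 m) v"
      unfolding B_def by blast
    have "inj_on (on_actions (d i\<^sub>0 m)) (actions (D i\<^sub>0))"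
      using M[rule_format, OF m(1)] hom[OF le[OF m(1)]] by (simp add: action_injections_def Hom_RTS Hom_WTS)
    then show "u = v" using m(2) uv by (auto simp: inj_on_def)
  qed
  then show "c i\<^sub>0 \<in> action_injections" by (rule action_injectionI[OF c[OF i0]])
qed

end

section \<open>Cubes\<close>

text \<open>Using the set of actions instead of a list of indices turns the axioms for cubes into
  statements about one coordinate at a time.\<close>

lemma cube_transition_iff:
  "(\<epsilon>, us, \<epsilon>') \<in> transitions (cube xs) \<longleftrightarrow>
     length \<epsilon> = length xs \<and> length \<epsilon>' = length xs \<and> us \<noteq> [] \<and> set us \<subseteq> actions (cube xs) \<and> distinct us \<and>
     (\<forall>i<length xs. (\<epsilon>' ! i \<longleftrightarrow> \<epsilon> ! i \<or> (xs ! i, i) \<in> set us) \<and> ((xs ! i, i) \<in> set us \<longrightarrow> \<not> \<epsilon> ! i))"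
    (is "_ \<longleftrightarrow> ?R")
proof
  assume "(\<epsilon>, us, \<epsilon>') \<in> transitions (cube xs)"
  then obtain js where js: "us = map (\<lambda>i. (xs ! i, i)) js" "length \<epsilon> = length xs" "length \<epsilon>' = length xs"
    "js \<noteq> []" "distinct js" "set js \<subseteq> {..<length xs}"
    "\<forall>i<length xs. \<epsilon> ! i \<le> \<epsilon>' ! i \<and> (\<epsilon> ! i \<noteq> \<epsilon>' ! i \<longleftrightarrow> i \<in> set js)"
    unfolding cube_def cube_transitions_def by auto
  have "(xs ! i, i) \<in> set us \<longleftrightarrow> i \<in> set js" for i unfolding js(1) by auto
  with js show ?R by (auto simp: cube_def distinct_map inj_on_def)
next
  assume R: ?R
  define js where "js = map snd us"
  have us: "us = map (\<lambda>i. (xs ! i, i)) js"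
    unfolding js_def map_map using R by (intro map_idI[symmetric]) (auto simp: cube_def)
  have mem: "(xs ! i, i) \<in> set us \<longleftrightarrow> i \<in> set js" for i unfolding us by auto
  have "distinct js" using R us distinct_map by metis
  moreover have "set js \<subseteq> {..<length xs}" unfolding js_def using R by (auto simp: cube_def)
  moreover have "\<forall>i<length xs. \<epsilon> ! i \<le> \<epsilon>' ! i \<and> (\<epsilon> ! i \<noteq> \<epsilon>' ! i \<longleftrightarrow> i \<in> set js)"
    using R unfolding mem by auto
  moreover have "js \<noteq> []" using R js_def by simp
  ultimately show "(\<epsilon>, us, \<epsilon>') \<in> transitions (cube xs)"
    unfolding cube_def cube_transitions_def using R us by auto
qed

lemma cube_sel: "states (cube xs) = {\<epsilon>. length \<epsilon> = length xs}"
  "actions (cube xs) = {(xs ! i, i) | i. i < length xs}"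
  "a \<in> actions (cube xs) \<Longrightarrow> label (cube xs) a = fst a"
  by (simp_all add: cube_def)

lemma finite_cube: "finite (states (cube xs))" "finite (actions (cube xs))" "card (actions (cube xs)) \<le> length xs"
proof -
  have "states (cube xs) = {\<epsilon>. set \<epsilon> \<subseteq> UNIV \<and> length \<epsilon> = length xs}" by (simp add: cube_sel)
  then show "finite (states (cube xs))" using finite_lists_length_eq[of "UNIV :: bool set"] by simp
  have e: "actions (cube xs) = (\<lambda>i. (xs ! i, i)) ` {..<length xs}" by (auto simp: cube_sel)
  show "finite (actions (cube xs))" "card (actions (cube xs)) \<le> length xs"
    unfolding e using card_image_le[of "{..<length xs}" "\<lambda>i. (xs ! i, i)"] by auto
qed

lemma cube_transition_length: "(\<epsilon>, us, \<epsilon>') \<in> transitions (cube xs) \<Longrightarrow> length us \<le> length xs"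
  unfolding cube_transition_iff using finite_cube(2,3)[of xs] card_mono distinct_card
  by (metis le_trans)

lemma cube_regular: "weak_transition_system (cube xs)" "regular (cube xs)"
proof -
  have "multiset_axiom (cube xs)"
    unfolding multiset_axiom_def
  proof (intro allI impI, elim conjE)
    fix \<alpha> us vs \<beta> assume t: "(\<alpha>, us, \<beta>) \<in> transitions (cube xs)" and m: "mset vs = mset us"
    have "vs \<noteq> [] \<longleftrightarrow> us \<noteq> []" using m by auto
    then show "(\<alpha>, vs, \<beta>) \<in> transitions (cube xs)"
      using t unfolding cube_transition_iff mset_eq_setD[OF m] mset_eq_imp_distinct_iff[OF m] by simp
  qed
  moreover have "composition_axiom (cube xs)"
    unfolding composition_axiom_def
  proof (intro allI impI, elim conjE)
    fix \<alpha> us vs ws \<beta> \<nu>\<^sub>1 \<nu>\<^sub>2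
    assume "vs \<noteq> []" and t: "(\<alpha>, us @ vs @ ws, \<beta>) \<in> transitions (cube xs)"
      "(\<alpha>, us, \<nu>\<^sub>1) \<in> transitions (cube xs)" "(\<nu>\<^sub>1, vs @ ws, \<beta>) \<in> transitions (cube xs)"
      "(\<alpha>, us @ vs, \<nu>\<^sub>2) \<in> transitions (cube xs)" "(\<nu>\<^sub>2, ws, \<beta>) \<in> transitions (cube xs)"
    note t' = t[unfolded cube_transition_iff]
    have "(\<nu>\<^sub>2 ! i \<longleftrightarrow> \<nu>\<^sub>1 ! i \<or> (xs ! i, i) \<in> set vs) \<and> ((xs ! i, i) \<in> set vs \<longrightarrow> \<not> \<nu>\<^sub>1 ! i)"
      if "i < length xs" for i
      using t'(2-4) that by (metis Un_iff set_append)
    with \<open>vs \<noteq> []\<close> t' show "(\<nu>\<^sub>1, vs, \<nu>\<^sub>2) \<in> transitions (cube xs)"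
      unfolding cube_transition_iff by simp
  qed
  moreover have "label (cube xs) \<in> extensional (actions (cube xs))" by (simp add: cube_def)
  ultimately show "weak_transition_system (cube xs)"
    unfolding weak_transition_system_def using cube_transition_iff[of _ _ _ xs] by (auto simp: cube_sel(1))
  have "\<exists>\<alpha> \<beta>. (\<alpha>, [u], \<beta>) \<in> transitions (cube xs)" if u: "u \<in> actions (cube xs)" for u
  proof -
    obtain i where i: "i < length xs" "u = (xs ! i, i)" using u by (auto simp: cube_sel)
    have "(replicate (length xs) False, [u], (replicate (length xs) False)[i := True]) \<in> transitions (cube xs)"
      unfolding cube_transition_iff using i u by (auto simp: nth_list_update)
    then show ?thesis by blast
  qed
  moreover have "CSA2 (cube xs)"
    unfolding CSA2_def
  proof (intro allI impI, elim conjE)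
    fix \<alpha> us vs \<beta> assume ne: "us \<noteq> []" "vs \<noteq> []" and t: "(\<alpha>, us @ vs, \<beta>) \<in> transitions (cube xs)"
    \<comment> \<open>The only vertex that \<open>us\<close> can reach from \<open>\<alpha>\<close>:
      exactly the coordinates of \<open>us\<close> are switched on.\<close>
    define \<nu> where "\<nu> = map (\<lambda>i. \<alpha> ! i \<or> (xs ! i, i) \<in> set us) [0..<length xs]"
    have \<nu>: "length \<nu> = length xs" "\<And>i. i < length xs \<Longrightarrow> \<nu> ! i \<longleftrightarrow> \<alpha> ! i \<or> (xs ! i, i) \<in> set us"
      by (simp_all add: \<nu>_def)
    note t' = t[unfolded cube_transition_iff]
    have pt: "(\<beta> ! i \<longleftrightarrow> \<nu> ! i \<or> (xs ! i, i) \<in> set vs) \<and> ((xs ! i, i) \<in> set us \<longrightarrow> \<not> \<alpha> ! i) \<and>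
        ((xs ! i, i) \<in> set vs \<longrightarrow> \<not> \<nu> ! i)" if "i < length xs" for i
    proof -
      have "\<not> ((xs ! i, i) \<in> set us \<and> (xs ! i, i) \<in> set vs)" using t' by auto
      then show ?thesis using t' that \<nu>(2)[OF that] by (metis Un_iff set_append)
    qed
    have "(\<alpha>, us, \<nu>) \<in> transitions (cube xs)"
      using t' ne pt unfolding cube_transition_iff by (simp add: \<nu>)
    moreover have "(\<nu>, vs, \<beta>) \<in> transitions (cube xs)"
      using t' ne pt unfolding cube_transition_iff by (simp add: \<nu>(1))
    moreover have "\<nu>' = \<nu>" if "(\<alpha>, us, \<nu>') \<in> transitions (cube xs)" for \<nu>'
      using that unfolding cube_transition_iff by (intro nth_equalityI) (simp_all add: \<nu>)
    ultimately show "\<exists>!\<nu>. \<nu> \<in> states (cube xs) \<and> (\<alpha>, us, \<nu>) \<in> transitions (cube xs) \<and>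
        (\<nu>, vs, \<beta>) \<in> transitions (cube xs)"
      unfolding cube_sel(1) mem_Collect_eq using \<nu>(1) by blast
  qed
  ultimately show "regular (cube xs)" unfolding regular_def by blast
qed

definition cube_word :: "'l list \<Rightarrow> ('l \<times> nat) list" where
  "cube_word xs = map (\<lambda>i. (xs ! i, i)) [0..<length xs]"

lemma cube_top_transition:
  "xs \<noteq> [] \<Longrightarrow> (replicate (length xs) False, cube_word xs, replicate (length xs) True) \<in> transitions (cube xs)"
  unfolding cube_transition_iff cube_word_def
  by (auto simp: cube_sel(2) distinct_map inj_on_def)

text \<open>The state at the vertex \<open>\<epsilon>\<close> is obtained by splitting a rearrangement of the transition into the
  actions at the coordinates equal to \<open>1\<close> followed by those at the coordinates equal to \<open>0\<close>.\<close>

lemma cube_extension: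
  assumes Y: "weak_transition_system Y" "regular Y" and t: "(\<alpha>, w, \<beta>) \<in> transitions Y"
  obtains \<phi> where "ts_hom (cube (map (label Y) w)) Y \<phi> (\<lambda>a. w ! snd a)"
    "\<phi> (replicate (length w) False) = \<alpha>" "\<phi> (replicate (length w) True) = \<beta>"
proof -
  let ?n = "length w" and ?T = "transitions Y" and ?xs = "map (label Y) w"
  note tw = weakD[OF Y(1) t]
  define I where "I \<epsilon> = filter (\<lambda>i. \<epsilon> ! i) [0..<?n]" for \<epsilon>
  define J where "J \<epsilon> = filter (\<lambda>i. \<not> \<epsilon> ! i) [0..<?n]" for \<epsilon>
  let ?m = "map ((!) w)"
  have IJ: "mset (I \<epsilon>) + mset (J \<epsilon>) = mset [0..<?n]" for \<epsilon>
    unfolding I_def J_def mset_filter by (rule multiset_partition[symmetric])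
  have mw: "mset (?m [0..<?n]) = mset w" by (simp add: map_nth flip: mset_map)
  have perm: "mset (?m ks) = mset w" if "mset ks = mset [0..<?n]" for ks
  proof -
    have "mset (?m ks) = mset (?m [0..<?n])" using that by (simp only: mset_map)
    then show ?thesis using mw by simp
  qed
  \<comment> \<open>At the two extreme vertices one part of the splitting is empty, so the end
    points of the transition are put in by hand. These cases exclude each other because
    \<open>w\<close> is nonempty.\<close>
  define \<phi> where "\<phi> \<epsilon> = (if J \<epsilon> = [] then \<beta> else if I \<epsilon> = [] then \<alpha> else
      SOME \<nu>. (\<alpha>, ?m (I \<epsilon>), \<nu>) \<in> ?T \<and> (\<nu>, ?m (J \<epsilon>), \<beta>) \<in> ?T)" for \<epsilon>
  note pc = perm_closedD[OF weak_perm_closed[OF Y(1)]]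
  have mid: "(\<alpha>, ?m (I \<epsilon>), \<phi> \<epsilon>) \<in> ?T \<and> (\<phi> \<epsilon>, ?m (J \<epsilon>), \<beta>) \<in> ?T" if ne: "I \<epsilon> \<noteq> []" "J \<epsilon> \<noteq> []" for \<epsilon>
  proof -
    have "mset (?m (I \<epsilon>) @ ?m (J \<epsilon>)) = mset w"
      using perm[of "I \<epsilon> @ J \<epsilon>"] IJ by simp
    then have "\<exists>\<nu>. (\<alpha>, ?m (I \<epsilon>), \<nu>) \<in> ?T \<and> (\<nu>, ?m (J \<epsilon>), \<beta>) \<in> ?T"
      using closed_splitD[OF regular_closed_split[OF Y] t] ne by simp
    from someI_ex[OF this] ne show ?thesis by (simp add: \<phi>_def)
  qed
  have A: "(\<alpha>, ?m (I \<epsilon>), \<phi> \<epsilon>) \<in> ?T" if "I \<epsilon> \<noteq> []" for \<epsilon>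
  proof (cases "J \<epsilon> = []")
    case True
    then have "mset (?m (I \<epsilon>)) = mset w" using perm[of "I \<epsilon>"] IJ[of \<epsilon>] by simp
    from pc[OF t this] True show ?thesis by (simp add: \<phi>_def)
  qed (use mid that in blast)
  have B: "(\<phi> \<epsilon>, ?m (J \<epsilon>), \<beta>) \<in> ?T" if "J \<epsilon> \<noteq> []" for \<epsilon>
  proof (cases "I \<epsilon> = []")
    case True
    then have "mset (?m (J \<epsilon>)) = mset w" using perm[of "J \<epsilon>"] IJ[of \<epsilon>] by simp
    from pc[OF t this] True that show ?thesis by (simp add: \<phi>_def)
  qed (use mid that in blast)
  have "ts_hom (cube ?xs) Y \<phi> (\<lambda>a. w ! snd a)"
  proof (rule ts_homI)
    fix \<epsilon> show "\<phi> \<epsilon> \<in> states Y"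
    proof (cases "J \<epsilon> = []")
      case True
      then show ?thesis using tw by (simp add: \<phi>_def)
    next
      case False
      then show ?thesis using weakD(1)[OF Y(1) B] by simp
    qed
  next
    fix \<epsilon> us \<epsilon>' assume tr: "(\<epsilon>, us, \<epsilon>') \<in> transitions (cube ?xs)"
    define js where "js = map snd us"
    have R: "us \<noteq> []" "distinct us" "set us \<subseteq> actions (cube ?xs)"
      "\<And>i. i < ?n \<Longrightarrow> \<epsilon>' ! i \<longleftrightarrow> \<epsilon> ! i \<or> (?xs ! i, i) \<in> set us"
      "\<And>i. i < ?n \<Longrightarrow> (?xs ! i, i) \<in> set us \<Longrightarrow> \<not> \<epsilon> ! i"
      using tr unfolding cube_transition_iff by auto
    have us: "us = map (\<lambda>i. (?xs ! i, i)) js"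
      unfolding js_def map_map using R(3) by (intro map_idI[symmetric]) (auto simp: cube_sel)
    have mem: "(?xs ! i, i) \<in> set us \<longleftrightarrow> i \<in> set js" if "i < ?n" for i unfolding us by auto
    have js: "js \<noteq> []" "distinct js" "set js \<subseteq> {..<?n}"
    proof -
      show "js \<noteq> []" using R(1) by (simp add: js_def)
      show "distinct js" using R(2) us distinct_map by metis
      show "set js \<subseteq> {..<?n}" using R(3) by (auto simp: js_def cube_sel)
    qed
    have I': "mset (I \<epsilon>') = mset (I \<epsilon> @ js)"
      by (rule set_eq_iff_mset_eq_distinct[THEN iffD1])
        (use js R(4,5) mem in \<open>auto simp: I_def\<close>)
    have J': "mset (J \<epsilon>) = mset (js @ J \<epsilon>')"
      by (rule set_eq_iff_mset_eq_distinct[THEN iffD1])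
        (use js R(4,5) mem in \<open>auto simp: J_def\<close>)
    have ne: "I \<epsilon>' \<noteq> []" "J \<epsilon> \<noteq> []" using I' J' js(1) by auto
    have "map (\<lambda>a. w ! snd a) us = ?m js" by (simp add: js_def)
    moreover have "(\<phi> \<epsilon>, ?m js, \<phi> \<epsilon>') \<in> ?T"
    proof -
      have mI: "mset (?m (I \<epsilon>')) = mset (?m (I \<epsilon>) @ ?m js)" and mJ: "mset (?m (J \<epsilon>)) = mset (?m js @ ?m (J \<epsilon>'))"
        using I' J' by (simp_all only: mset_map mset_append image_mset_union)
      \<comment> \<open>A transition that starts at the bottom vertex or ends at the top one is
        given by \<open>A\<close> or \<open>B\<close> directly. Between two interior vertices it is
        the middle piece of a splitting into three, and the composition axiom provides it.\<close>
      consider "I \<epsilon> = []" | "J \<epsilon>' = []" | "I \<epsilon> \<noteq> []" "J \<epsilon>' \<noteq> []" by blast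
      then show ?thesis
      proof cases
        case 1
        then have "\<phi> \<epsilon> = \<alpha>" using ne by (simp add: \<phi>_def)
        with pc[OF A[OF ne(1)], of "?m js"] mI 1 show ?thesis by simp
      next
        case 2
        then have "\<phi> \<epsilon>' = \<beta>" by (simp add: \<phi>_def)
        with pc[OF B[OF ne(2)], of "?m js"] mJ 2 show ?thesis by simp
      next
        case 3
        have "mset (I \<epsilon> @ js @ J \<epsilon>') = mset [0..<?n]" using IJ[of \<epsilon>] J' by simp
        from pc[OF t perm[OF this]] have "(\<alpha>, ?m (I \<epsilon>) @ ?m js @ ?m (J \<epsilon>'), \<beta>) \<in> ?T" by simp
        moreover have "(\<phi> \<epsilon>, ?m js @ ?m (J \<epsilon>'), \<beta>) \<in> ?T" by (rule pc[OF B[OF ne(2)]]) (rule mJ[symmetric])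
        moreover have "(\<alpha>, ?m (I \<epsilon>) @ ?m js, \<phi> \<epsilon>') \<in> ?T" by (rule pc[OF A[OF ne(1)]]) (rule mI[symmetric])
        moreover have "composition_axiom Y" using Y(1) unfolding weak_transition_system_def by blast
        ultimately show ?thesis
          using composition_axiomD[of Y "?m (I \<epsilon>)" "?m js" "?m (J \<epsilon>')" \<alpha> \<beta>] A B 3 js(1) by simp
      qed
    qed
    ultimately show "(\<phi> \<epsilon>, map (\<lambda>a. w ! snd a) us, \<phi> \<epsilon>') \<in> ?T" by simp
  qed (use tw in \<open>auto simp: cube_sel\<close>)
  moreover have "J (replicate ?n True) = []" "I (replicate ?n False) = []" by (auto simp: I_def J_def)
  moreover have "J (replicate ?n False) \<noteq> []" using tw(2) by (auto simp: J_def filter_empty_conv)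
  ultimately show thesis using that by (simp add: \<phi>_def)
qed

text \<open>When all transitions are edges no word has a proper splitting, so every axiom about
  splittings holds vacuously.\<close>

lemma edges_regular:
  assumes T: "\<And>\<alpha> us \<beta>. (\<alpha>, us, \<beta>) \<in> transitions X \<Longrightarrow> \<alpha> \<in> states X \<and> \<beta> \<in> states X \<and> (\<exists>u\<in>actions X. us = [u])"
    and used: "\<And>u. u \<in> actions X \<Longrightarrow> \<exists>\<alpha> \<beta>. (\<alpha>, [u], \<beta>) \<in> transitions X"
    and ext: "label X \<in> extensional (actions X)"
  shows "weak_transition_system X" "regular X"
proof -
  have no: False if "us \<noteq> []" "vs \<noteq> []" "(\<alpha>, us @ vs, \<beta>) \<in> transitions X" for \<alpha> us vs \<beta>
    using T[OF that(3)] that by (cases us; cases vs) auto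
  have "multiset_axiom X" unfolding multiset_axiom_def using T by fastforce
  moreover have "composition_axiom X" unfolding composition_axiom_def using no by blast
  ultimately show "weak_transition_system X"
    unfolding weak_transition_system_def using ext T by fastforce
  show "regular X" unfolding regular_def CSA2_def using used no by blast
qed

lemma subsystem_eq:
  assumes "label X \<in> extensional (actions X)" "actions X = {u. \<exists>\<alpha> \<beta>. (\<alpha>, [u], \<beta>) \<in> T}"
  shows "subsystem X T = X\<lparr>transitions := T\<rparr>"
  using assms by (cases X) (simp add: subsystem_def extensional_restrict)

text \<open>Both parts of a proper splitting are shorter than the dimension, so removing the longest
  transitions leaves a set closed under splitting. In dimension one the action disappears together
  with its edge, whence the separate case.\<close>

lemma boundary_regular:
  assumes "xs \<noteq> []"
  shows "weak_transition_system (boundary xs)" "regular (boundary xs)"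
proof -
  have "weak_transition_system (boundary xs) \<and> regular (boundary xs)"
  proof (cases "length xs = 1")
    case True
    then show ?thesis
      using edges_regular[of "discrete (states (cube xs))"] by (simp add: boundary_def discrete_def)
  next
    case False
    define T where "T = {(\<alpha>, us, \<beta>) \<in> transitions (cube xs). length us \<noteq> length xs}"
    have "closed_split T"
      unfolding closed_split_def
    proof (intro allI impI, elim conjE)
      fix \<alpha> w \<beta> us vs assume t: "(\<alpha>, w, \<beta>) \<in> T" and ne: "us \<noteq> []" "vs \<noteq> []" and m: "mset (us @ vs) = mset w"
      have "length (us @ vs) = length w" using m by (rule mset_eq_length)
      moreover have "length w \<le> length xs" using cube_transition_length t by (auto simp: T_def)
      ultimately have "length us < length xs" "length vs < length xs" using ne by (cases us; cases vs; simp)+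
      then show "\<exists>\<nu>. (\<alpha>, us, \<nu>) \<in> T \<and> (\<nu>, vs, \<beta>) \<in> T"
        using closed_splitD[OF regular_closed_split[OF cube_regular] _ ne m, of \<alpha> \<beta> xs] t by (auto simp: T_def)
    qed
    moreover have "perm_closed T"
      unfolding perm_closed_def T_def
      by (auto dest: mset_eq_length intro: perm_closedD[OF weak_perm_closed[OF cube_regular(1)]])
    ultimately have *: "weak_transition_system (subsystem (cube xs) T)" "regular (subsystem (cube xs) T)"
      using subsystem_regular[OF cube_regular(1) regular_unique_split[OF cube_regular], of T xs]
      by (auto simp: T_def)
    have "(\<exists>\<alpha> \<beta>. (\<alpha>, [u], \<beta>) \<in> T) \<longleftrightarrow> u \<in> actions (cube xs)" for u
    proof
      assume "\<exists>\<alpha> \<beta>. (\<alpha>, [u], \<beta>) \<in> T"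
      then obtain \<alpha> \<beta> where "(\<alpha>, [u], \<beta>) \<in> transitions (cube xs)" by (auto simp: T_def)
      from weakD(3)[OF cube_regular(1) this] show "u \<in> actions (cube xs)" by simp
    next
      assume "u \<in> actions (cube xs)"
      then obtain \<alpha> \<beta> where "(\<alpha>, [u], \<beta>) \<in> transitions (cube xs)"
        using cube_regular(2)[of xs] unfolding regular_def by blast
      then have "(\<alpha>, [u], \<beta>) \<in> T" using False by (simp add: T_def)
      then show "\<exists>\<alpha> \<beta>. (\<alpha>, [u], \<beta>) \<in> T" by blast
    qed
    then have "actions (cube xs) = {u. \<exists>\<alpha> \<beta>. (\<alpha>, [u], \<beta>) \<in> T}" by blast
    then have "boundary xs = subsystem (cube xs) T"
      using False cube_regular(1)[of xs] unfolding weak_transition_system_def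
      by (simp add: subsystem_eq boundary_def T_def)
    with * show ?thesis by simp
  qed
  then show "weak_transition_system (boundary xs)" "regular (boundary xs)" by blast+
qed

lemma double_transition_regular: "weak_transition_system (double_transition x)" "regular (double_transition x)"
  by (rule edges_regular; auto simp: double_transition_def)+

lemma discrete_regular: "weak_transition_system (discrete S)" "regular (discrete S)"
  by (rule edges_regular; simp add: discrete_def)+


section \<open>Copies in the universe\<close>

lemma copy_sel: "states (copy X) = enc ` states X" "actions (copy X) = enc ` actions X"
  "(a, v, b) \<in> transitions (copy X) \<longleftrightarrow> (\<exists>\<alpha> us \<beta>. a = enc \<alpha> \<and> v = map enc us \<and> b = enc \<beta> \<and> (\<alpha>, us, \<beta>) \<in> transitions X)"
  by (auto simp: copy_def)

context
  fixes X :: "('s, 'a, 'l) transition_system" and ty :: "'u itself"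
  assumes inj: "inj (enc :: 's \<Rightarrow> 'u)" "inj (enc :: 'a \<Rightarrow> 'u)"
begin

lemma copy_transition_enc:
  "(enc \<alpha> :: 'u, map enc us, enc \<beta>) \<in> transitions (copy X) \<longleftrightarrow> (\<alpha>, us, \<beta>) \<in> transitions X"
  unfolding copy_sel using inj by (auto simp: inj_eq inj_map_eq_map)

lemma copy_label: "u \<in> actions X \<Longrightarrow> label (copy X) (enc u :: 'u) = label X u"
  using inj by (simp add: copy_def inv_f_f)

lemma copy_regular:
  assumes X: "weak_transition_system X" "regular X"
  shows "weak_transition_system (copy X :: ('u, 'l) ts)" "regular (copy X :: ('u, 'l) ts)"
proof -
  let ?Y = "copy X :: ('u, 'l) ts"
  have "multiset_axiom ?Y"
    unfolding multiset_axiom_def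
  proof (intro allI impI, elim conjE)
    fix a us vs b assume "(a, us, b) \<in> transitions ?Y" and m: "mset vs = mset us"
    then obtain \<alpha> w \<beta> where w: "a = enc \<alpha>" "us = map enc w" "b = enc \<beta>" "(\<alpha>, w, \<beta>) \<in> transitions X"
      unfolding copy_sel by blast
    obtain v where v: "mset v = mset w" "map enc v = vs" using mset_map_preimage m w(2) by metis
    from perm_closedD[OF weak_perm_closed[OF X(1)] w(4) v(1)] w v show "(a, vs, b) \<in> transitions ?Y"
      unfolding copy_sel by blast
  qed
  moreover have "composition_axiom ?Y"
    unfolding composition_axiom_def
  proof (intro allI impI, elim conjE)
    fix a us vs ws b \<nu>\<^sub>1 \<nu>\<^sub>2
    assume ne: "us \<noteq> []" "vs \<noteq> []" "ws \<noteq> []" and t: "(a, us @ vs @ ws, b) \<in> transitions ?Y"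
      "(a, us, \<nu>\<^sub>1) \<in> transitions ?Y" "(\<nu>\<^sub>1, vs @ ws, b) \<in> transitions ?Y"
      "(a, us @ vs, \<nu>\<^sub>2) \<in> transitions ?Y" "(\<nu>\<^sub>2, ws, b) \<in> transitions ?Y"
    obtain \<alpha> w \<beta> where w: "a = enc \<alpha>" "us @ vs @ ws = map enc w" "b = enc \<beta>" "(\<alpha>, w, \<beta>) \<in> transitions X"
      using t(1) unfolding copy_sel by blast
    obtain us' vs' ws' :: "'a list" where s: "us = map enc us'" "vs = map enc vs'" "ws = map enc ws'"
      using w(2) unfolding append_eq_map_conv by blast
    obtain n1 n2 :: 's where n: "\<nu>\<^sub>1 = enc n1" "\<nu>\<^sub>2 = enc n2" using t(2,4) unfolding copy_sel by blast
    have "composition_axiom X" using X(1) unfolding weak_transition_system_def by blast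
    from composition_axiomD[OF this, of us' vs' ws' \<alpha> \<beta> n1 n2] ne t
    show "(\<nu>\<^sub>1, vs, \<nu>\<^sub>2) \<in> transitions ?Y"
      unfolding s n w(1,3) map_append[symmetric] copy_transition_enc by simp
  qed
  moreover have "a \<in> states ?Y \<and> us \<noteq> [] \<and> set us \<subseteq> actions ?Y \<and> b \<in> states ?Y"
    if "(a, us, b) \<in> transitions ?Y" for a us b
    using that weakD[OF X(1)] unfolding copy_sel by fastforce
  moreover have "label ?Y \<in> extensional (actions ?Y)" by (simp add: copy_def)
  ultimately show "weak_transition_system ?Y"
    unfolding weak_transition_system_def by blast
  have "CSA2 ?Y"
    unfolding CSA2_def
  proof (intro allI impI, elim conjE)
    fix a us vs b assume ne: "us \<noteq> []" "vs \<noteq> []" and t: "(a, us @ vs, b) \<in> transitions ?Y"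
    obtain \<alpha> w \<beta> where w: "a = enc \<alpha>" "us @ vs = map enc w" "b = enc \<beta>" "(\<alpha>, w, \<beta>) \<in> transitions X"
      using t unfolding copy_sel by blast
    obtain us' vs' :: "'a list" where s: "us = map enc us'" "vs = map enc vs'"
      using w(2) unfolding append_eq_map_conv by blast
    have t': "(\<alpha>, us' @ vs', \<beta>) \<in> transitions X"
      using t unfolding s w(1,3) map_append[symmetric] copy_transition_enc .
    have ne': "us' \<noteq> []" "vs' \<noteq> []" using ne s by auto
    obtain \<nu> where \<nu>: "(\<alpha>, us', \<nu>) \<in> transitions X" "(\<nu>, vs', \<beta>) \<in> transitions X"
      using closed_splitD[OF regular_closed_split[OF X] t' ne'] by auto
    show "\<exists>!\<nu>. \<nu> \<in> states ?Y \<and> (a, us, \<nu>) \<in> transitions ?Y \<and> (\<nu>, vs, b) \<in> transitions ?Y"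
    proof (rule ex1I[of _ "enc \<nu>"])
      show "enc \<nu> \<in> states ?Y \<and> (a, us, enc \<nu>) \<in> transitions ?Y \<and> (enc \<nu>, vs, b) \<in> transitions ?Y"
        unfolding s w(1,3) copy_transition_enc using \<nu> weakD(4)[OF X(1) \<nu>(1)] by (simp add: copy_sel)
      fix m assume m: "m \<in> states ?Y \<and> (a, us, m) \<in> transitions ?Y \<and> (m, vs, b) \<in> transitions ?Y"
      then obtain \<nu>' :: 's where "m = enc \<nu>'" by (auto simp: copy_sel(1))
      with m have "(\<alpha>, us', \<nu>') \<in> transitions X" "(\<nu>', vs', \<beta>) \<in> transitions X"
        unfolding s w(1,3) by (simp_all add: copy_transition_enc)
      from unique_splitD[OF regular_unique_split[OF X] ne' t' this \<nu>] \<open>m = enc \<nu>'\<close> show "m = enc \<nu>" by simp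
    qed
  qed
  moreover have "\<exists>\<alpha> \<beta>. (\<alpha>, [u], \<beta>) \<in> transitions ?Y" if u: "u \<in> actions ?Y" for u
  proof -
    obtain v :: 'a where v: "u = enc v" "v \<in> actions X" using u by (auto simp: copy_sel)
    then obtain \<alpha> \<beta> where "(\<alpha>, [v], \<beta>) \<in> transitions X" using X(2) unfolding regular_def by blast
    then show ?thesis using copy_transition_enc[of \<alpha> "[v]" \<beta>] v by auto
  qed
  ultimately show "regular ?Y" unfolding regular_def by blast
qed

lemma ts_hom_from_copy:
  assumes "ts_hom X Z f g"
  shows "ts_hom (copy X :: ('u, 'l) ts) Z (f \<circ> inv enc) (g \<circ> inv enc)"
proof (rule ts_homI)
  fix a v b assume "(a, v, b) \<in> transitions (copy X :: ('u, 'l) ts)"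
  then obtain \<alpha> us \<beta> where t: "a = enc \<alpha>" "v = map enc us" "b = enc \<beta>" "(\<alpha>, us, \<beta>) \<in> transitions X"
    unfolding copy_sel by blast
  from ts_homD(4)[OF assms t(4)] show "((f \<circ> inv enc) a, map (g \<circ> inv enc) v, (f \<circ> inv enc) b) \<in> transitions Z"
    using inj by (simp add: t inv_f_f comp_def)
qed (use ts_homD(1-3)[OF assms] in \<open>auto simp: copy_sel inv_f_f inj copy_label\<close>)

end

lemma ts_hom_to_copy:
  fixes Y :: "('t, 'b, 'l) transition_system"
  assumes inj: "inj (enc :: 't \<Rightarrow> 'u)" "inj (enc :: 'b \<Rightarrow> 'u)" and "ts_hom X Y f g"
  shows "ts_hom X (copy Y :: ('u, 'l) ts) (enc \<circ> f) (enc \<circ> g)"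
proof (rule ts_homI)
  fix \<alpha> us \<beta> assume "(\<alpha>, us, \<beta>) \<in> transitions X"
  from ts_homD(4)[OF assms(3) this]
  show "((enc \<circ> f) \<alpha>, map (enc \<circ> g) us, (enc \<circ> f) \<beta>) \<in> transitions (copy Y :: ('u, 'l) ts)"
    using copy_transition_enc[OF inj, of "f \<alpha>" "map g us" "f \<beta>" Y] by simp
qed (use ts_homD(1-3)[OF assms(3)] in \<open>auto simp: copy_sel copy_label[OF inj]\<close>)

lemma copy_map_mk:
  "copy_map X Y f g = mk (copy X) (copy Y) (enc \<circ> (f \<circ> inv enc)) (enc \<circ> (g \<circ> inv enc))"
  by (simp add: copy_map_def mk_def copy_sel comp_assoc)

context small_universe
begin

lemma copy_Obj:
  fixes X :: "('s, 'a, 'l) transition_system"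
  assumes "inj (enc :: 's \<Rightarrow> 'u)" "inj (enc :: 'a \<Rightarrow> 'u)" "weak_transition_system X" "regular X"
    and "finite (states X)" "finite (actions X)"
  shows "(copy X :: ('u, 'l) ts) \<in> Obj RTS"
  using copy_regular[OF assms(1-4)] assms(5,6) finite_small by (simp add: Obj_RTS Obj_WTS copy_sel)

lemma copy_cube_Obj: "(copy (cube xs) :: ('u, 'l) ts) \<in> Obj RTS"
  by (rule copy_Obj[OF inj_enc_bools inj_enc_label_nat cube_regular finite_cube(1,2)])

lemma copy_boundary_Obj: "xs \<noteq> [] \<Longrightarrow> (copy (boundary xs) :: ('u, 'l) ts) \<in> Obj RTS"
  using finite_cube[of xs]
  by (intro copy_Obj[OF inj_enc_bools inj_enc_label_nat boundary_regular]) (auto simp: boundary_def discrete_def)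

lemma copy_double_Obj: "(copy (double_transition x) :: ('u, 'l) ts) \<in> Obj RTS"
  by (rule copy_Obj[OF inj_enc_nat inj_enc_label double_transition_regular]) (simp_all add: double_transition_def)

lemma copy_discrete_Obj: "finite S \<Longrightarrow> (copy (discrete S :: (nat, nat, 'l) transition_system) :: ('u, 'l) ts) \<in> Obj RTS"
  by (rule copy_Obj[OF inj_enc_nat inj_enc_nat discrete_regular]) (simp_all add: discrete_def)

lemma copy_map_Hom:
  fixes A :: "('s, 'a, 'l) transition_system" and B :: "('t, 'b, 'l) transition_system"
  assumes "inj (enc :: 's \<Rightarrow> 'u)" "inj (enc :: 'a \<Rightarrow> 'u)" "inj (enc :: 't \<Rightarrow> 'u)" "inj (enc :: 'b \<Rightarrow> 'u)"
    and "(copy A :: ('u, 'l) ts) \<in> Obj RTS" "(copy B :: ('u, 'l) ts) \<in> Obj RTS" "ts_hom A B f g"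
  shows "copy_map A B f g \<in> Hom RTS (copy A :: ('u, 'l) ts) (copy B)"
proof -
  have "ts_hom (copy A :: ('u, 'l) ts) (copy B :: ('u, 'l) ts) (enc \<circ> (f \<circ> inv enc)) (enc \<circ> (g \<circ> inv enc))"
    by (rule ts_hom_to_copy[OF assms(3,4) ts_hom_from_copy[OF assms(1,2,7)]])
  then have "mk (copy A :: ('u, 'l) ts) (copy B) (enc \<circ> (f \<circ> inv enc)) (enc \<circ> (g \<circ> inv enc)) \<in> Hom RTS (copy A) (copy B)"
    by (rule mk_Hom_RTS[OF assms(5,6)])
  then show ?thesis by (simp only: copy_map_mk)
qed

text \<open>Moves a lifting problem out of the universe: squares and lifts become functions on the
  natural states and actions, so that arguments about generating cofibrations are free of
  codes.\<close>

lemma copy_map_lift: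
  fixes A :: "('s, 'a, 'l) transition_system" and B :: "('t, 'b, 'l) transition_system" and p :: "('u, 'l) ts_map"
  assumes inj: "inj (enc :: 's \<Rightarrow> 'u)" "inj (enc :: 'a \<Rightarrow> 'u)" "inj (enc :: 't \<Rightarrow> 'u)" "inj (enc :: 'b \<Rightarrow> 'u)"
    and A: "(copy A :: ('u, 'l) ts) \<in> Obj RTS" and B: "(copy B :: ('u, 'l) ts) \<in> Obj RTS" and fg: "ts_hom A B f g"
    and p: "p \<in> Hom RTS X Y" "lifts RTS (copy_map A B f g) p"
    and u: "ts_hom A X u u'" and v: "ts_hom B Y v v'"
    and "\<And>s. s \<in> states A \<Longrightarrow> on_states p (u s) = v (f s)" "\<And>a. a \<in> actions A \<Longrightarrow> on_actions p (u' a) = v' (g a)"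
  obtains h h' where "ts_hom B X h h'" "\<And>s. s \<in> states A \<Longrightarrow> h (f s) = u s" "\<And>a. a \<in> actions A \<Longrightarrow> h' (g a) = u' a"
    "\<And>s. s \<in> states B \<Longrightarrow> on_states p (h s) = v s" "\<And>b. b \<in> actions B \<Longrightarrow> on_actions p (h' b) = v' b"
proof -
  have pW: "p \<in> Hom WTS X Y" and XY: "X \<in> Obj RTS" "Y \<in> Obj RTS" using p(1) by (auto simp: Hom_RTS Hom_WTS Obj_RTS)
  let ?i = "copy_map A B f g :: ('u, 'l) ts_map" and ?u = "mk (copy A) X (u \<circ> inv enc) (u' \<circ> inv enc)"
    and ?v = "mk (copy B) Y (v \<circ> inv enc) (v' \<circ> inv enc)"
  have i: "?i \<in> Hom RTS (copy A) (copy B)" by (rule copy_map_Hom[OF inj A B fg])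
  have U: "?u \<in> Hom RTS (copy A) X" by (rule mk_Hom_RTS[OF A XY(1) ts_hom_from_copy[OF inj(1,2) u]])
  have V: "?v \<in> Hom RTS (copy B) Y" by (rule mk_Hom_RTS[OF B XY(2) ts_hom_from_copy[OF inj(3,4) v]])
  have iW: "?i \<in> Hom WTS (copy A) (copy B)" and UW: "?u \<in> Hom WTS (copy A) X" and VW: "?v \<in> Hom WTS (copy B) Y"
    using i U V by (simp_all add: Hom_RTS)
  have iss: "on_states ?i (enc s) = enc (f s)" if "s \<in> states A" for s
    using that inj by (simp add: copy_map_mk copy_sel inv_f_f)
  have ia: "on_actions ?i (enc s) = enc (g s)" if "s \<in> actions A" for s
    using that inj by (simp add: copy_map_mk copy_sel inv_f_f)
  have us: "on_states ?u (enc s) = u s" if "s \<in> states A" for s using that inj by (simp add: copy_sel inv_f_f)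
  have ua: "on_actions ?u (enc s) = u' s" if "s \<in> actions A" for s using that inj by (simp add: copy_sel inv_f_f)
  have vs: "on_states ?v (enc s) = v s" if "s \<in> states B" for s using that inj by (simp add: copy_sel inv_f_f)
  have va: "on_actions ?v (enc s) = v' s" if "s \<in> actions B" for s using that inj by (simp add: copy_sel inv_f_f)
  have "Comp RTS p ?u = Comp RTS ?v ?i"
    unfolding RTS_WTS
  proof (rule Comp_eqI[OF UW pW Comp_Hom_WTS[OF iW VW]])
    fix s assume s: "s \<in> states (copy A :: ('u, 'l) ts)"
    then obtain s' where s': "s = enc s'" "s' \<in> states A" by (auto simp: copy_sel)
    show "on_states p (on_states ?u s) = on_states (Comp WTS ?v ?i) s"
      by (subst Comp_states[OF iW s])
        (simp only: s'(1) iss[OF s'(2)] us[OF s'(2)] vs[OF ts_homD(1)[OF fg s'(2)]] assms(12)[OF s'(2)])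
  next
    fix s assume s: "s \<in> actions (copy A :: ('u, 'l) ts)"
    then obtain s' where s': "s = enc s'" "s' \<in> actions A" by (auto simp: copy_sel)
    show "on_actions p (on_actions ?u s) = on_actions (Comp WTS ?v ?i) s"
      by (subst Comp_actions[OF iW s])
        (simp only: s'(1) ia[OF s'(2)] ua[OF s'(2)] va[OF ts_homD(2)[OF fg s'(2)]] assms(13)[OF s'(2)])
  qed
  then obtain h where h: "h \<in> Hom RTS (copy B) X" "Comp RTS h ?i = ?u" "Comp RTS p h = ?v"
    by (rule RTS.liftsE[OF p(2) i p(1) U V])
  have hW: "h \<in> Hom WTS (copy B) X" using h(1) by (simp add: Hom_RTS)
  have "ts_hom B B id id" by (simp add: ts_hom_def)
  from ts_hom_comp[OF ts_hom_to_copy[OF inj(3,4) this] HomD_WTS(5)[OF hW]]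
  have hom: "ts_hom B X (\<lambda>s. on_states h (enc s)) (\<lambda>b. on_actions h (enc b))" by simp
  show thesis
  proof (rule that[OF hom])
    show "on_states h (enc (f s)) = u s" if "s \<in> states A" for s
      using arg_cong[OF h(2), of "\<lambda>k. on_states k (enc s)"] Comp_states[OF iW, of "enc s" h] iss[OF that] us[OF that] that
      by (simp add: copy_sel)
    show "on_actions h (enc (g s)) = u' s" if "s \<in> actions A" for s
      using arg_cong[OF h(2), of "\<lambda>k. on_actions k (enc s)"] Comp_actions[OF iW, of "enc s" h] ia[OF that] ua[OF that] that
      by (simp add: copy_sel)
    show "on_states p (on_states h (enc s)) = v s" if "s \<in> states B" for s
      using arg_cong[OF h(3), of "\<lambda>k. on_states k (enc s)"] Comp_states[OF hW, of "enc s" p] vs[OF that] that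
      by (simp add: copy_sel)
    show "on_actions p (on_actions h (enc s)) = v' s" if "s \<in> actions B" for s
      using arg_cong[OF h(3), of "\<lambda>k. on_actions k (enc s)"] Comp_actions[OF hW, of "enc s" p] va[OF that] that
      by (simp add: copy_sel)
  qed
qed

end

lemma ts_hom_boundary: "ts_hom (boundary xs) (cube xs) id id"
  by (rule ts_homI) (auto simp: boundary_def discrete_def split: if_splits)

lemma ts_hom_double:
  "ts_hom (cube [x]) (double_transition x) (\<lambda>\<epsilon>. if \<epsilon> = [False] then 1 else 2) fst"
proof (rule ts_homI)
  fix \<alpha> us \<beta> assume "(\<alpha>, us, \<beta>) \<in> transitions (cube [x])"
  then have t: "length \<alpha> = 1" "length \<beta> = 1" "us \<noteq> []" "set us \<subseteq> {(x, 0)}" "distinct us"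
    "\<beta> ! 0 \<longleftrightarrow> \<alpha> ! 0 \<or> (x, 0) \<in> set us" "(x, 0) \<in> set us \<Longrightarrow> \<not> \<alpha> ! 0"
    unfolding cube_transition_iff by (auto simp: cube_sel)
  have "length us \<le> 1" using t(4,5) card_mono[of "{(x, 0)}" "set us"] distinct_card[of us] by simp
  then obtain u where "us = [u]" using t(3) by (cases us) auto
  with t have "us = [(x, 0)]" by simp
  with t have "\<not> \<alpha> ! 0" "\<beta> ! 0" by auto
  then have "\<alpha> = [False]" "\<beta> = [True]" using t(1,2) by (auto simp: length_Suc_conv)
  then show "(if \<alpha> = [False] then 1 else 2, map fst us, if \<beta> = [False] then 1 else 2) \<in> transitions (double_transition x)"
    using \<open>us = [(x, 0)]\<close> by (simp add: double_transition_def)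
qed (auto simp: double_transition_def cube_def)

section \<open>Lifting properties of the generating cofibrations\<close>

context small_universe
begin

lemma copy_map_action_injection:
  fixes A :: "('s, 'a, 'l) transition_system" and B :: "('t, 'b, 'l) transition_system"
  assumes inj: "inj (enc :: 's \<Rightarrow> 'u)" "inj (enc :: 'a \<Rightarrow> 'u)" "inj (enc :: 't \<Rightarrow> 'u)" "inj (enc :: 'b \<Rightarrow> 'u)"
    and "(copy A :: ('u, 'l) ts) \<in> Obj RTS" "(copy B :: ('u, 'l) ts) \<in> Obj RTS" "ts_hom A B f g"
    and g: "inj_on g (actions A)"
  shows "(copy_map A B f g :: ('u, 'l) ts_map) \<in> action_injections"
proof (rule action_injectionI[OF copy_map_Hom[OF assms(1-7)]])
  show "inj_on (on_actions (copy_map A B f g :: ('u, 'l) ts_map)) (actions (copy A))"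
  proof (rule inj_onI)
    fix x y assume "x \<in> actions (copy A :: ('u, 'l) ts)" "y \<in> actions (copy A :: ('u, 'l) ts)"
      and e: "on_actions (copy_map A B f g :: ('u, 'l) ts_map) x = on_actions (copy_map A B f g :: ('u, 'l) ts_map) y"
    then obtain a b where ab: "x = enc a" "y = enc b" "a \<in> actions A" "b \<in> actions A"
      unfolding copy_sel by blast
    then have "(enc (g a) :: 'u) = enc (g b)"
      using e by (simp add: copy_map_def inv_f_f[OF inj(2)])
    then have "g a = g b" by (rule injD[OF inj(4)])
    then show "x = y" using inj_onD[OF g _ ab(3,4)] ab(1,2) by simp
  qed
qed

lemma generating_cofibrations_injective: "(generating_cofibrations :: ('u, 'l) ts_map set) \<subseteq> action_injections"
proof -
  note d = copy_map_action_injection[OF inj_enc_nat inj_enc_nat inj_enc_nat inj_enc_nat copy_discrete_Obj copy_discrete_Obj]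
  have "(copy_map (discrete {} :: (nat, nat, 'l) transition_system)
      (discrete {0} :: (nat, nat, 'l) transition_system) id id :: ('u, 'l) ts_map) \<in> action_injections"
    by (rule d) (auto simp: ts_hom_def discrete_def)
  moreover have "(copy_map (discrete {0, 1} :: (nat, nat, 'l) transition_system)
      (discrete {0} :: (nat, nat, 'l) transition_system) (\<lambda>_. 0) id :: ('u, 'l) ts_map) \<in> action_injections"
    by (rule d) (auto simp: ts_hom_def discrete_def)
  moreover have "(copy_map (boundary xs) (cube xs) id id :: ('u, 'l) ts_map) \<in> action_injections"
    if "xs \<noteq> []" for xs :: "'l list"
    by (rule copy_map_action_injection[OF inj_enc_bools inj_enc_label_nat inj_enc_bools inj_enc_label_nat
          copy_boundary_Obj[OF that] copy_cube_Obj ts_hom_boundary]) simp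
  moreover have "(copy_map (cube [x]) (double_transition x) (\<lambda>\<epsilon>. if \<epsilon> = [False] then 1 else 2) fst :: ('u, 'l) ts_map)
      \<in> action_injections" for x :: 'l
    by (rule copy_map_action_injection[OF inj_enc_bools inj_enc_label_nat inj_enc_nat inj_enc_label
          copy_cube_Obj copy_double_Obj ts_hom_double]) (auto simp: cube_sel inj_on_def)
  ultimately show ?thesis unfolding generating_cofibrations_def by blast
qed

text \<open>Each family of generators yields one clause. The maps between sets make the state map
  bijective, boundaries of 1-cubes provide preimages of edges, double transitions reflect edges, and
  boundaries of higher cubes reflect longer transitions by induction on the length.\<close>

lemma rlp_generating_cofibrations_subset: "rlp RTS (generating_cofibrations :: ('u, 'l) ts_map set) \<subseteq> trivial_fibrations"
proof
  fix p :: "('u, 'l) ts_map" assume pI: "p \<in> rlp RTS generating_cofibrations"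
  define X Y where "X = source p" and "Y = target p"
  have p: "p \<in> Hom RTS X Y" using pI by (simp add: rlp_def Hom_def X_def Y_def)
  then have pW: "p \<in> Hom WTS X Y" and XY: "X \<in> Obj RTS" "Y \<in> Obj RTS" by (auto simp: Hom_RTS Hom_WTS Obj_RTS)
  have XW: "weak_transition_system X" "regular X" and YW: "weak_transition_system Y" "regular Y"
    using XY by (simp_all add: Obj_RTS Obj_WTS)
  note d = copy_map_lift[OF inj_enc_nat inj_enc_nat inj_enc_nat inj_enc_nat copy_discrete_Obj copy_discrete_Obj]
  have surj: "\<exists>x\<in>states X. on_states p x = y" if y: "y \<in> states Y" for y
  proof (rule d[of "{}" "{0}" id id p X Y "\<lambda>_. y" "\<lambda>_. y" "\<lambda>_. y" "\<lambda>_. y"])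
    show "lifts RTS (copy_map (discrete {} :: (nat, nat, 'l) transition_system)
       (discrete {0} :: (nat, nat, 'l) transition_system) id id) p"
      using pI by (auto simp: rlp_def generating_cofibrations_def)
    fix h h' assume "ts_hom (discrete {0} :: (nat, nat, 'l) transition_system) X h h'"
      "\<And>s. s \<in> states (discrete {0} :: (nat, nat, 'l) transition_system) \<Longrightarrow> on_states p (h s) = y"
    then show ?thesis by (auto simp: ts_hom_def discrete_def)
  qed (use p y in \<open>auto simp: ts_hom_def discrete_def\<close>)
  have inj: "s = t" if st: "s \<in> states X" "t \<in> states X" "on_states p s = on_states p t" for s t
  proof (rule d[of "{0, 1}" "{0}" "\<lambda>_. 0" id p X Y "\<lambda>n. if n = 0 then s else t" "\<lambda>_. s" "\<lambda>_. on_states p s" "\<lambda>_. s"])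
    show "lifts RTS (copy_map (discrete {0, 1} :: (nat, nat, 'l) transition_system)
       (discrete {0} :: (nat, nat, 'l) transition_system) (\<lambda>_. 0) id) p"
      using pI by (auto simp: rlp_def generating_cofibrations_def)
    fix h h' assume "\<And>n. n \<in> states (discrete {0, 1} :: (nat, nat, 'l) transition_system) \<Longrightarrow> h 0 = (if n = 0 then s else t)"
    from this[of 0] this[of 1] show ?thesis by (simp add: discrete_def)
  qed (use p st Hom_hom(1)[OF pW] in \<open>auto simp: ts_hom_def discrete_def\<close>)
  have bij: "bij_betw (on_states p) (states X) (states Y)"
    unfolding bij_betw_def inj_on_def using inj surj Hom_hom(1)[OF pW] by blast
  define q where "q = inv_into (states X) (on_states p)"
  have q: "q s \<in> states X" "on_states p (q s) = s" if "s \<in> states Y" for s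
    using bij that inv_into_into[of s "on_states p" "states X"] f_inv_into_f[of s "on_states p" "states X"]
    unfolding q_def bij_betw_def by auto
  have qp: "q (on_states p s) = s" if "s \<in> states X" for s
    using bij that unfolding q_def bij_betw_def by simp
  have bl: "lifts RTS (copy_map (boundary xs) (cube xs) id id) p" if "xs \<noteq> []" for xs :: "'l list"
    using pI that by (auto simp: rlp_def generating_cofibrations_def)
  have dl: "lifts RTS (copy_map (cube [x]) (double_transition x) (\<lambda>\<epsilon>. if \<epsilon> = [False] then 1 else 2) fst) p" for x :: 'l
    using pI by (auto simp: rlp_def generating_cofibrations_def)
  note b = copy_map_lift[OF inj_enc_bools inj_enc_label_nat inj_enc_bools inj_enc_label_nat
      copy_boundary_Obj copy_cube_Obj ts_hom_boundary p bl]
  have edge: "\<exists>u\<in>actions X. (q \<alpha>, [u], q \<beta>) \<in> transitions X \<and> on_actions p u = v"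
    if t: "(\<alpha>, [v], \<beta>) \<in> transitions Y" for \<alpha> v \<beta>
  proof (rule cube_extension[OF YW t])
    let ?xs = "map (label Y) [v]"
    fix \<phi> assume \<phi>: "ts_hom (cube ?xs) Y \<phi> (\<lambda>a. [v] ! snd a)"
      "\<phi> (replicate (length [v]) False) = \<alpha>" "\<phi> (replicate (length [v]) True) = \<beta>"
    have top: "([False], [(label Y v, 0)], [True]) \<in> transitions (cube ?xs)"
      using cube_top_transition[of ?xs] by (simp add: cube_word_def)
    show ?thesis
    proof (rule b[of ?xs "q \<circ> \<phi>" "\<lambda>_. v" \<phi> "\<lambda>a. [v] ! snd a"])
      show "ts_hom (boundary ?xs) X (q \<circ> \<phi>) (\<lambda>_. v)"
        using q(1) ts_homD(1)[OF \<phi>(1)] by (auto simp: ts_hom_def boundary_def discrete_def)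
      show "on_states p ((q \<circ> \<phi>) s) = \<phi> (id s)" if "s \<in> states (boundary ?xs)" for s
        using q(2) ts_homD(1)[OF \<phi>(1)] that by (simp add: boundary_def discrete_def)
      show "on_actions p v = [v] ! snd (id a)" if "a \<in> actions (boundary ?xs)" for a
        using that by (simp add: boundary_def discrete_def)
      fix h h' assume h: "ts_hom (cube ?xs) X h h'"
        "\<And>s. s \<in> states (boundary ?xs) \<Longrightarrow> h (id s) = (q \<circ> \<phi>) s"
        "\<And>b. b \<in> actions (cube ?xs) \<Longrightarrow> on_actions p (h' b) = [v] ! snd b"
      have hq: "h s = q (\<phi> s)" if "length s = 1" for s
        using h(2)[of s] that by (simp add: boundary_def discrete_def cube_sel(1))
      have a: "(label Y v, 0) \<in> actions (cube ?xs)" by (simp add: cube_sel)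
      have "(q \<alpha>, [h' (label Y v, 0)], q \<beta>) \<in> transitions X"
        using ts_homD(4)[OF h(1) top] hq[of "[False]"] hq[of "[True]"] \<phi>(2,3) by simp
      then show ?thesis using ts_homD(2)[OF h(1) a] h(3)[OF a] by (intro bexI[of _ "h' (label Y v, 0)"]) simp_all
    qed (use \<phi>(1) in auto)
  qed
  \<comment> \<open>Regularity puts \<open>u\<close> on some edge of \<open>X\<close>. That edge
    fills the first half of the double transition, states 1 and 2, and the lift carries the same
    action over to the second half, states 3 and 4.\<close>
  have double: "(\<alpha>, [u], \<beta>) \<in> transitions X"
    if u: "u \<in> actions X" and \<alpha>\<beta>: "\<alpha> \<in> states X" "\<beta> \<in> states X"
      and t: "(on_states p \<alpha>, [on_actions p u], on_states p \<beta>) \<in> transitions Y" for \<alpha> u \<beta>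
  proof -
    obtain \<gamma> \<delta> where cd: "(\<gamma>, [u], \<delta>) \<in> transitions X" using XW(2) u unfolding regular_def by blast
    note cd' = weakD[OF XW(1) cd]
    let ?x = "label X u"
    let ?u = "\<lambda>\<epsilon>. if \<epsilon> = [False] then \<gamma> else \<delta>"
    let ?v = "\<lambda>n :: nat. on_states p (if n = 1 then \<gamma> else if n = 2 then \<delta> else if n = 3 then \<alpha> else \<beta>)"
    have len: "\<epsilon> = [False] \<or> \<epsilon> = [True]" if "length \<epsilon> = 1" for \<epsilon> :: "bool list"
      using that by (auto simp: length_Suc_conv)
    show ?thesis
    proof (rule copy_map_lift[OF inj_enc_bools inj_enc_label_nat inj_enc_nat inj_enc_label
          copy_cube_Obj copy_double_Obj ts_hom_double p dl, of ?x ?u "\<lambda>_. u" ?v "\<lambda>_. on_actions p u"])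
      show "ts_hom (cube [?x]) X ?u (\<lambda>_. u)"
      proof (rule ts_homI)
        fix a us b assume "(a, us, b) \<in> transitions (cube [?x])"
        from ts_homD(4)[OF ts_hom_double this]
        show "(?u a, map (\<lambda>_. u) us, ?u b) \<in> transitions X"
          using cd by (auto simp: double_transition_def split: if_splits)
      qed (use cd' u in \<open>auto simp: cube_sel\<close>)
      show "ts_hom (double_transition ?x) Y ?v (\<lambda>_. on_actions p u)"
        using Hom_hom(1)[OF pW] Hom_hom(2,3)[OF pW u] Hom_hom(4)[OF pW cd] cd' t \<alpha>\<beta>
        by (auto simp: ts_hom_def double_transition_def)
      show "on_states p (?u s) = ?v (if s = [False] then 1 else 2)" for s by simp
      fix h h' assume h: "ts_hom (double_transition ?x) X h h'"
        "\<And>a. a \<in> actions (cube [?x]) \<Longrightarrow> h' (fst a) = u"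
        "\<And>s. s \<in> states (double_transition ?x) \<Longrightarrow> on_states p (h s) = ?v s"
      have h34: "h 3 = \<alpha>" "h 4 = \<beta>"
        using h(3)[of 3] h(3)[of 4] ts_homD(1)[OF h(1), of 3] ts_homD(1)[OF h(1), of 4] inj \<alpha>\<beta>
        by (auto simp: double_transition_def)
      have "(h 3, [h' ?x], h 4) \<in> transitions X"
        using ts_homD(4)[OF h(1), of 3 "[?x]" 4] by (simp add: double_transition_def)
      moreover have "h' ?x = u" using h(2)[of "(?x, 0)"] by (simp add: cube_sel)
      ultimately show "(\<alpha>, [u], \<beta>) \<in> transitions X" using h34 by simp
    qed (use u in simp_all)
  qed
  have words: "(\<alpha>, w, \<beta>) \<in> transitions X"
    if "\<alpha> \<in> states X" "\<beta> \<in> states X" "set w \<subseteq> actions X"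
      "(on_states p \<alpha>, map (on_actions p) w, on_states p \<beta>) \<in> transitions Y" for \<alpha> w \<beta>
    using that
  proof (induction w arbitrary: \<alpha> \<beta> rule: length_induct)
    case (1 w)
    have "map (on_actions p) w \<noteq> []" using weakD(2)[OF YW(1) 1(5)] .
    then consider u where "w = [u]" | "length w \<ge> 2" by (cases w; cases "tl w") auto
    then show ?case
    proof cases
      case 1
      then show ?thesis using double that "1.prems" by simp
    next
      case 2
      let ?w = "map (on_actions p) w"
      define xs where "xs = map (label Y) ?w"
      have lxs: "length xs = length w" "xs \<noteq> []" using 2 by (auto simp: xs_def)
      \<comment> \<open>The image transition spans a cube in \<open>Y\<close>. Its boundary lifts
        with the letters of \<open>w\<close> as actions, because shorter words are reflected by the
        induction hypothesis; the filler then has \<open>w\<close> as its longest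
        transition.\<close>
      show ?thesis
      proof (rule cube_extension[OF YW "1.prems"(4), folded xs_def])
        fix \<phi> assume \<phi>: "ts_hom (cube xs) Y \<phi> (\<lambda>a. ?w ! snd a)"
          "\<phi> (replicate (length ?w) False) = on_states p \<alpha>" "\<phi> (replicate (length ?w) True) = on_states p \<beta>"
        have bd: "states (boundary xs) = states (cube xs)" "actions (boundary xs) = actions (cube xs)"
          "label (boundary xs) = label (cube xs)"
          "transitions (boundary xs) = {(\<alpha>, us, \<beta>) \<in> transitions (cube xs). length us \<noteq> length w}"
          using 2 lxs by (auto simp: boundary_def)
        have act: "snd a < length w" if "a \<in> actions (cube xs)" for a using that lxs by (auto simp: cube_sel)
        have pw: "on_actions p (w ! snd a) = ?w ! snd a" if "a \<in> actions (cube xs)" for a using act[OF that] by simp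
        have wX: "w ! snd a \<in> actions X" if "a \<in> actions (cube xs)" for a using act[OF that] "1.prems"(3) by auto
        have hom: "ts_hom (boundary xs) X (q \<circ> \<phi>) (\<lambda>a. w ! snd a)"
        proof (rule ts_homI)
          fix s assume "s \<in> states (boundary xs)"
          then show "(q \<circ> \<phi>) s \<in> states X" using q(1) ts_homD(1)[OF \<phi>(1)] by (simp add: bd)
        next
          fix a assume a: "a \<in> actions (boundary xs)"
          then show "w ! snd a \<in> actions X" using wX by (simp add: bd)
          show "label X (w ! snd a) = label (boundary xs) a"
            using a ts_homD(3)[OF \<phi>(1), of a] pw[of a] Hom_hom(3)[OF pW wX[of a]] by (simp add: bd)
        next
          fix \<epsilon> us \<epsilon>' assume t: "(\<epsilon>, us, \<epsilon>') \<in> transitions (boundary xs)"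
          then have tc: "(\<epsilon>, us, \<epsilon>') \<in> transitions (cube xs)" and "length us \<noteq> length w" by (auto simp: bd)
          then have len: "length us < length w" using cube_transition_length[OF tc] lxs by simp
          note tcw = weakD[OF cube_regular(1) tc]
          have *: "map (on_actions p) (map (\<lambda>a. w ! snd a) us) = map (\<lambda>a. ?w ! snd a) us"
            using tcw(3) pw by auto
          have \<phi>Y: "\<phi> \<epsilon> \<in> states Y" "\<phi> \<epsilon>' \<in> states Y" using ts_homD(1)[OF \<phi>(1)] tcw by blast+
          have "(on_states p (q (\<phi> \<epsilon>)), map (on_actions p) (map (\<lambda>a. w ! snd a) us), on_states p (q (\<phi> \<epsilon>'))) \<in> transitions Y"
            using ts_homD(4)[OF \<phi>(1) tc] unfolding * q(2)[OF \<phi>Y(1)] q(2)[OF \<phi>Y(2)] .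
          moreover have "set (map (\<lambda>a. w ! snd a) us) \<subseteq> actions X" using tcw(3) wX by auto
          ultimately show "((q \<circ> \<phi>) \<epsilon>, map (\<lambda>a. w ! snd a) us, (q \<circ> \<phi>) \<epsilon>') \<in> transitions X"
            using "1.IH" len q(1)[OF \<phi>Y(1)] q(1)[OF \<phi>Y(2)] by (simp del: map_map)
        qed
        show ?thesis
        proof (rule b[of xs "q \<circ> \<phi>" "\<lambda>a. w ! snd a" \<phi> "\<lambda>a. ?w ! snd a"])
          show "xs \<noteq> []" "xs \<noteq> []" by (rule lxs)+
          show "ts_hom (boundary xs) X (q \<circ> \<phi>) (\<lambda>a. w ! snd a)" by (rule hom)
          show "ts_hom (cube xs) Y \<phi> (\<lambda>a. ?w ! snd a)" by (rule \<phi>(1))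
          show "on_states p ((q \<circ> \<phi>) s) = \<phi> (id s)" if "s \<in> states (boundary xs)" for s
            using that q(2) ts_homD(1)[OF \<phi>(1)] by (simp add: bd)
          show "on_actions p (w ! snd a) = ?w ! snd (id a)" if "a \<in> actions (boundary xs)" for a
            using that pw by (simp add: bd)
          fix h h' assume h: "ts_hom (cube xs) X h h'"
            "\<And>s. s \<in> states (boundary xs) \<Longrightarrow> h (id s) = (q \<circ> \<phi>) s"
            "\<And>a. a \<in> actions (boundary xs) \<Longrightarrow> h' (id a) = w ! snd a"
          have hs: "h (replicate (length w) False) = \<alpha>" "h (replicate (length w) True) = \<beta>"
            using h(2)[of "replicate (length w) False"] h(2)[of "replicate (length w) True"] \<phi>(2,3) qp "1.prems"(1,2)
            by (simp_all add: bd cube_sel(1) lxs)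
          have "map h' (cube_word xs) = map (\<lambda>i. w ! i) [0..<length w]"
            unfolding cube_word_def map_map using h(3)
            by (intro map_cong) (auto simp: bd cube_sel(2) lxs)
          then have hw: "map h' (cube_word xs) = w" by (simp add: map_nth)
          from ts_homD(4)[OF h(1) cube_top_transition[OF lxs(2)]] hs lxs
          show "(\<alpha>, w, \<beta>) \<in> transitions X" unfolding hw by simp
        qed
      qed
    qed
  qed
  have "actions Y \<subseteq> on_actions p ` actions X"
  proof
    fix v assume "v \<in> actions Y"
    then obtain \<alpha> \<beta> where "(\<alpha>, [v], \<beta>) \<in> transitions Y" using YW(2) unfolding regular_def by blast
    from edge[OF this] show "v \<in> on_actions p ` actions X" by auto
  qed
  then have "on_actions p ` actions X = actions Y" using Hom_hom(2)[OF pW] by blast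
  with trivial_fibrationI[OF p bij] words show "p \<in> trivial_fibrations" by blast
qed

lemma rlp_generating_cofibrations: "rlp RTS (generating_cofibrations :: ('u, 'l) ts_map set) = trivial_fibrations"
proof
  show "trivial_fibrations \<subseteq> rlp RTS (generating_cofibrations :: ('u, 'l) ts_map set)"
  proof
    fix p :: "('u, 'l) ts_map" assume p: "p \<in> trivial_fibrations"
    have "lifts RTS i p" if "i \<in> generating_cofibrations" for i
    proof -
      have "i \<in> action_injections" using that generating_cofibrations_injective by blast
      then have "i \<in> Hom WTS (source i) (target i)" "inj_on (on_actions i) (actions (source i))"
        by (simp_all add: action_injections_def Arr_RTS Hom_RTS)
      then show ?thesis using lifts_trivial_fibration p by blast
    qed
    then show "p \<in> rlp RTS generating_cofibrations"
      using p trivial_fibrations_Arr unfolding rlp_def by blast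
  qed
qed (rule rlp_generating_cofibrations_subset)

lemma cofibrations_generated:
  "cofibrations_generated_by RTS generating_cofibrations = (action_injections :: ('u, 'l) ts_map set)"
  unfolding cofibrations_generated_by_def rlp_generating_cofibrations llp_trivial_fibrations ..

lemma rlp_action_injections: "rlp RTS action_injections = (trivial_fibrations :: ('u, 'l) ts_map set)"
proof
  show "rlp RTS action_injections \<subseteq> (trivial_fibrations :: ('u, 'l) ts_map set)"
    unfolding rlp_generating_cofibrations[symmetric] rlp_def using generating_cofibrations_injective by blast
  have "p \<in> rlp RTS (llp RTS trivial_fibrations)" if "p \<in> trivial_fibrations" for p :: "('u, 'l) ts_map"
    using that trivial_fibrations_Arr unfolding rlp_def llp_def by blast
  then show "(trivial_fibrations :: ('u, 'l) ts_map set) \<subseteq> rlp RTS action_injections"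
    unfolding llp_trivial_fibrations by blast
qed

end

section \<open>Local objects and local equivalences\<close>

definition local_objects :: "('u, 'l) ts set" where
  "local_objects = {K \<in> Obj RTS. inj_on (label K) (actions K)}"

lemma surjective_epi:
  assumes q: "q \<in> Hom WTS X Q" "on_states q ` states X = states Q" "on_actions q ` actions X = actions Q"
    and h: "h \<in> Hom WTS Q Z" "h' \<in> Hom WTS Q Z" and e: "Comp WTS h q = Comp WTS h' q"
  shows "h = h'"
proof (rule Hom_eqI[OF h])
  fix s assume "s \<in> states Q"
  then obtain x where "x \<in> states X" "s = on_states q x" using q(2) by blast
  then show "on_states h s = on_states h' s" using Comp_eqD(1)[OF e q(1) q(1)] by simp
next
  fix s assume "s \<in> actions Q"
  then obtain x where "x \<in> actions X" "s = on_actions q x" using q(3) by blast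
  then show "on_actions h s = on_actions h' s" using Comp_eqD(2)[OF e q(1) q(1)] by simp
qed

text \<open>A local target leaves no choice on actions, since the label of an image determines it.
  Comparing maps to a local object is thereby a question about states.\<close>

lemma local_action_eq:
  assumes "K \<in> local_objects" "g \<in> Hom WTS X K" "h \<in> Hom WTS Y K" "u \<in> actions X" "v \<in> actions Y"
    "label X u = label Y v"
  shows "on_actions g u = on_actions h v"
  using assms Hom_hom(2,3)[OF assms(2,4)] Hom_hom(2,3)[OF assms(3,5)]
  unfolding local_objects_def inj_on_def by simp

lemma local_Obj: "K \<in> local_objects \<Longrightarrow> K \<in> Obj RTS"
  by (simp add: local_objects_def)

text \<open>Any section of \<open>p\<close> on states and actions is a map of systems, because
  \<open>p\<close> reflects transitions. Following \<open>p\<close> by this section changes an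
  action only within its label, which a map to a local object does not see.\<close>

lemma trivial_fibration_local_equivalence:
  assumes "p \<in> trivial_fibrations"
  shows "p \<in> RTS.local_equivalences local_objects"
proof -
  define X Y where "X = source p" and "Y = target p"
  have p: "p \<in> Hom RTS X Y" using assms trivial_fibrations_Arr by (auto simp: Hom_def X_def Y_def)
  then have pW: "p \<in> Hom WTS X Y" by (simp add: Hom_RTS)
  note pD = trivial_fibrationD[OF assms pW]
  show ?thesis
  proof (rule RTS.local_equivalencesI[OF p])
    fix K g assume K: "K \<in> local_objects" and g: "g \<in> Hom RTS X K"
    have gW: "g \<in> Hom WTS X K" using g by (simp add: Hom_RTS)
    define qs where "qs = inv_into (states X) (on_states p)"
    define qa where "qa = inv_into (actions X) (on_actions p)"
    have qs: "qs s \<in> states X" "on_states p (qs s) = s" if "s \<in> states Y" for s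
      using pD(1) that inv_into_into[of s "on_states p" "states X"] f_inv_into_f[of s "on_states p" "states X"]
      unfolding qs_def bij_betw_def by auto
    have qa: "qa u \<in> actions X" "on_actions p (qa u) = u" if "u \<in> actions Y" for u
      using pD(2) that inv_into_into[of u "on_actions p" "actions X"] f_inv_into_f[of u "on_actions p" "actions X"]
      unfolding qa_def by auto
    have "ts_hom Y X qs qa"
    proof (rule ts_homI)
      fix u assume u: "u \<in> actions Y"
      show "label X (qa u) = label Y u" using Hom_hom(3)[OF pW qa(1)[OF u]] qa(2)[OF u] by simp
    next
      fix \<alpha> us \<beta> assume t: "(\<alpha>, us, \<beta>) \<in> transitions Y"
      note w = weakD[OF HomD_WTS(7)[OF pW] t]
      have "map (on_actions p) (map qa us) = us" unfolding map_map using w(3) qa(2) by (intro map_idI) auto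
      then show "(qs \<alpha>, map qa us, qs \<beta>) \<in> transitions X"
        using pD(3)[of "qs \<alpha>" "qs \<beta>" "map qa us"] t qs w qa(1) by auto
    qed (use qs qa in auto)
    from ts_hom_comp[OF this HomD_WTS(5)[OF gW]]
    have h: "mk Y K (\<lambda>s. on_states g (qs s)) (\<lambda>u. on_actions g (qa u)) \<in> Hom RTS Y K"
      by (rule mk_Hom_RTS[OF RTS.Hom_Obj(2)[OF p] local_Obj[OF K]])
    then have hW: "mk Y K (\<lambda>s. on_states g (qs s)) (\<lambda>u. on_actions g (qa u)) \<in> Hom WTS Y K" by (simp add: Hom_RTS)
    have "Comp WTS (mk Y K (\<lambda>s. on_states g (qs s)) (\<lambda>u. on_actions g (qa u))) p = g"
    proof (rule Comp_eqI[OF pW hW gW])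
      fix s assume s: "s \<in> states X"
      have "qs (on_states p s) = s" using pD(1) s unfolding qs_def bij_betw_def by simp
      then show "on_states (mk Y K (\<lambda>s. on_states g (qs s)) (\<lambda>u. on_actions g (qa u))) (on_states p s) = on_states g s"
        using Hom_hom(1)[OF pW s] by simp
    next
      fix u assume u: "u \<in> actions X"
      then show "on_actions (mk Y K (\<lambda>s. on_states g (qs s)) (\<lambda>u. on_actions g (qa u))) (on_actions p u) = on_actions g u"
        using local_action_eq[OF K hW gW Hom_hom(2)[OF pW u] u Hom_hom(3)[OF pW u]] by blast
    qed
    with h show "\<exists>h\<in>Hom RTS Y K. Comp RTS h p = g" by (auto intro: bexI)
  next
    fix K h h' assume "h \<in> Hom RTS Y K" "h' \<in> Hom RTS Y K" "Comp RTS h p = Comp RTS h' p"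
    then have "h \<in> Hom WTS Y K" "h' \<in> Hom WTS Y K" "Comp WTS h p = Comp WTS h' p" by (simp_all add: Hom_RTS)
    then show "h = h'" by (rule surjective_epi[OF pW bij_betw_imp_surj_on[OF pD(1)] pD(2)])
  qed
qed

context small_universe
begin

text \<open>The universal quotient for all maps to local objects is local itself, since each of
  these maps already identifies actions with equal labels. Uniqueness of extensions comes from
  surjectivity of the quotient map.\<close>

lemma reflection:
  fixes X :: "('u, 'l) ts"
  assumes X: "X \<in> Obj RTS"
  obtains K \<eta> where "K \<in> local_objects" "\<eta> \<in> Hom RTS X K" "on_states \<eta> ` states X = states K"
    "on_actions \<eta> ` actions X = actions K" "\<eta> \<in> RTS.local_equivalences local_objects"
proof (rule regular_quotient_exists[OF X, of "{g. target g \<in> local_objects \<and> g \<in> Hom RTS X (target g)}"])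
  let ?G = "{g :: ('u, 'l) ts_map. target g \<in> local_objects \<and> g \<in> Hom RTS X (target g)}"
  fix Q q
  assume q: "q \<in> Hom RTS X Q" and st: "on_states q ` states X = states Q" and ac: "on_actions q ` actions X = actions Q"
    and fac: "\<And>g. g \<in> ?G \<Longrightarrow> \<exists>h\<in>Hom RTS Q (target g). Comp RTS h q = g"
    and ae: "\<And>u v. u \<in> actions X \<Longrightarrow> v \<in> actions X \<Longrightarrow> label X u = label X v \<Longrightarrow>
        (\<And>g. g \<in> ?G \<Longrightarrow> on_actions g u = on_actions g v) \<Longrightarrow> on_actions q u = on_actions q v"
  have qW: "q \<in> Hom WTS X Q" using q by (simp add: Hom_RTS)
  have "inj_on (label Q) (actions Q)"
  proof (rule inj_onI)
    fix a b assume "a \<in> actions Q" "b \<in> actions Q" and l: "label Q a = label Q b"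
    then obtain u v where uv: "u \<in> actions X" "v \<in> actions X" "a = on_actions q u" "b = on_actions q v"
      using ac by blast
    have lX: "label X u = label X v" using l uv Hom_hom(3)[OF qW] by simp
    have "on_actions g u = on_actions g v" if "g \<in> ?G" for g
    proof -
      have g: "target g \<in> local_objects" "g \<in> Hom WTS X (target g)" using that by (simp_all add: Hom_RTS)
      show ?thesis by (rule local_action_eq[OF g(1) g(2) g(2) uv(1,2) lX])
    qed
    then show "a = b" using ae[OF uv(1,2) lX] uv(3,4) by simp
  qed
  then have Q: "Q \<in> local_objects" using RTS.Hom_Obj(2)[OF q] by (simp add: local_objects_def)
  have "q \<in> RTS.local_equivalences local_objects"
  proof (rule RTS.local_equivalencesI[OF q])
    fix K g assume K: "K \<in> local_objects" and g: "g \<in> Hom RTS X K"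
    then have "target g = K" by (simp add: Hom_RTS Hom_WTS)
    then show "\<exists>h\<in>Hom RTS Q K. Comp RTS h q = g" using fac[of g] K g by simp
  next
    fix K h h' assume "h \<in> Hom RTS Q K" "h' \<in> Hom RTS Q K" "Comp RTS h q = Comp RTS h' q"
    then have "h \<in> Hom WTS Q K" "h' \<in> Hom WTS Q K" "Comp WTS h q = Comp WTS h' q" by (simp_all add: Hom_RTS)
    then show "h = h'" by (rule surjective_epi[OF qW st ac])
  qed
  with that Q q st ac show thesis by blast
qed simp

lemma local_equivalences_localizer:
  "grothendieck_localizer RTS (small_ordinals :: 'u rel set) action_injections
     (RTS.local_equivalences (local_objects :: ('u, 'l) ts set))"
  unfolding grothendieck_localizer_def
proof (intro conjI allI impI ballI)
  let ?W = "RTS.local_equivalences (local_objects :: ('u, 'l) ts set)"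
  show "?W \<subseteq> Arr RTS" using RTS.local_equivalences_Arr by blast
  show "two_out_of_three RTS ?W" by (rule RTS.two_out_of_three_local_equivalences)
  show "rlp RTS action_injections \<subseteq> ?W"
    unfolding rlp_action_injections using trivial_fibration_local_equivalence by blast
  { fix f g f' g' :: "('u, 'l) ts_map"
    assume "f \<in> ?W \<inter> action_injections \<and> is_pushout RTS f g f' g'"
    then have f: "f \<in> ?W" "f \<in> llp RTS trivial_fibrations" and po: "is_pushout RTS f g f' g'"
      by (simp_all add: llp_trivial_fibrations)
    have "f' \<in> ?W" by (rule RTS.local_equivalence_pushout[OF po f(1)])
    moreover have "f' \<in> action_injections"
      using RTS.llp_pushout[OF po f(2) trivial_fibrations_Arr] by (simp add: llp_trivial_fibrations)
    ultimately show "f' \<in> ?W \<inter> action_injections" by blast }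
  { fix r :: "'u rel" and f :: "('u, 'l) ts_map"
    assume r: "r \<in> small_ordinals" and f: "transfinite_composition RTS r (?W \<inter> action_injections) f"
    have wo: "Well_order r" using r by (simp add: small_ordinals_def)
    have "f \<in> ?W" by (rule RTS.local_equivalence_transfinite_composition[OF wo f]) simp
    moreover have "f \<in> action_injections" by (rule action_injection_transfinite_composition[OF wo f]) simp
    ultimately show "f \<in> ?W \<inter> action_injections" by blast }
qed

end


section \<open>The cubification functor\<close>

lemma (in cat) colimit_eqI:
  assumes col: "is_colimit C I D E Z c" and E: "\<And>i a j. (i, a, j) \<in> E \<Longrightarrow> i \<in> I \<and> j \<in> I \<and> a \<in> Hom C (D i) (D j)"
    and h: "h \<in> Hom C Z Z'" "h' \<in> Hom C Z Z'" and e: "\<And>i. i \<in> I \<Longrightarrow> Comp C h (c i) = Comp C h' (c i)"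
  shows "h = h'"
proof -
  have c: "\<And>i. i \<in> I \<Longrightarrow> c i \<in> Hom C (D i) Z" and ca: "\<And>i a j. (i, a, j) \<in> E \<Longrightarrow> Comp C (c j) a = c i"
    using col unfolding is_colimit_def is_cocone_def by blast+
  have "Comp C (Comp C h (c j)) a = Comp C h (c i)" if "(i, a, j) \<in> E" for i a j
    using Comp_assoc[of a "D i" "D j" "c j" Z h Z'] E[OF that] c h(1) ca[OF that] by simp
  then have "is_cocone C I D E Z' (\<lambda>i. Comp C h (c i))"
    unfolding is_cocone_def using Hom_Obj(2)[OF h(1)] Comp_Hom[OF c h(1)] by blast
  then have "\<exists>!k. k \<in> Hom C Z Z' \<and> (\<forall>i\<in>I. Comp C k (c i) = Comp C h (c i))"
    using col unfolding is_colimit_def by blast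
  with h e show ?thesis by metis
qed

section \<open>Points and edges as cubes, and the colimit over cubes\<close>

definition cube_map :: "('u, 'l) ts \<Rightarrow> 'l list \<Rightarrow> (bool list \<Rightarrow> 'u) \<Rightarrow> ('l \<times> nat \<Rightarrow> 'u) \<Rightarrow> ('u, 'l) ts_map" where
  "cube_map X xs f g = mk (copy (cube xs)) X (f \<circ> inv enc) (g \<circ> inv enc)"

definition point :: "('u, 'l) ts \<Rightarrow> 'u \<Rightarrow> ('u, 'l) ts_map" where
  "point X s = cube_map X [] (\<lambda>_. s) (\<lambda>_. undefined)"

definition edge :: "('u, 'l) ts \<Rightarrow> 'u \<Rightarrow> 'u \<Rightarrow> 'u \<Rightarrow> ('u, 'l) ts_map" where
  "edge X \<alpha> u \<beta> = cube_map X [label X u] (\<lambda>\<epsilon>. if \<epsilon> = [False] then \<alpha> else \<beta>) (\<lambda>_. u)"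

abbreviation cube_diagram_colimit :: "('u, 'l) ts \<Rightarrow> ('u, 'l) ts \<Rightarrow> (('u, 'l) ts_map \<Rightarrow> ('u, 'l) ts_map) \<Rightarrow> bool" where
  "cube_diagram_colimit X Z c \<equiv> is_colimit WTS (cubes_over X) source (cubes_over_maps X) Z c"

abbreviation cube_diagram_cocone :: "('u, 'l) ts \<Rightarrow> ('u, 'l) ts \<Rightarrow> (('u, 'l) ts_map \<Rightarrow> ('u, 'l) ts_map) \<Rightarrow> bool" where
  "cube_diagram_cocone X Z c \<equiv> is_cocone WTS (cubes_over X) source (cubes_over_maps X) Z c"

lemma cubes_over_Hom: "c \<in> cubes_over X \<Longrightarrow> c \<in> Hom WTS (source c) X"
  by (simp add: cubes_over_def Hom_def)

lemma cubes_over_maps_Hom: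
  "(c, \<phi>, c') \<in> cubes_over_maps X \<Longrightarrow>
     c \<in> cubes_over X \<and> c' \<in> cubes_over X \<and> \<phi> \<in> Hom WTS (source c) (source c')"
  by (simp add: cubes_over_maps_def)

context small_universe
begin

lemma cube_map_Hom:
  fixes X :: "('u, 'l) ts"
  assumes "X \<in> Obj WTS" "ts_hom (cube xs) X f g"
  shows "cube_map X xs f g \<in> Hom WTS (copy (cube xs)) X" "cube_map X xs f g \<in> cubes_over X"
proof -
  have "(copy (cube xs) :: ('u, 'l) ts) \<in> Obj WTS" using copy_cube_Obj by (simp add: Obj_RTS)
  then show "cube_map X xs f g \<in> Hom WTS (copy (cube xs)) X"
    unfolding cube_map_def
    by (rule mk_Hom[OF _ assms(1) ts_hom_from_copy[OF inj_enc_bools inj_enc_label_nat assms(2)]])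
  then show "cube_map X xs f g \<in> cubes_over X"
    unfolding cubes_over_def by (auto simp: Hom_def)
qed

lemma cube_map_sel:
  fixes X :: "('u, 'l) ts"
  shows "length \<epsilon> = length xs \<Longrightarrow> on_states (cube_map X xs f g) (enc \<epsilon>) = f \<epsilon>"
    and "a \<in> actions (cube xs) \<Longrightarrow> on_actions (cube_map X xs f g) (enc a) = g a"
    and "source (cube_map X xs f g) = copy (cube xs)"
  unfolding cube_map_def
  by (simp_all add: copy_sel cube_sel inv_f_f[OF inj_enc_bools] inv_f_f[OF inj_enc_label_nat])

lemma point_hom: "s \<in> states X \<Longrightarrow> ts_hom (cube []) X (\<lambda>_. s) (\<lambda>_. undefined)"
  by (rule ts_homI) (auto simp: cube_sel cube_transition_iff)

lemma edge_cube_transition: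
  "(\<alpha>, us, \<beta>) \<in> transitions (cube [x]) \<longleftrightarrow> \<alpha> = [False] \<and> us = [(x, 0)] \<and> \<beta> = [True]"
proof
  assume t: "(\<alpha>, us, \<beta>) \<in> transitions (cube [x])"
  have "length us = 1" using cube_transition_length[OF t] t[unfolded cube_transition_iff] by (cases us) auto
  with t have "us = [(x, 0)]" unfolding cube_transition_iff by (auto simp: length_Suc_conv cube_sel)
  with t show "\<alpha> = [False] \<and> us = [(x, 0)] \<and> \<beta> = [True]"
    unfolding cube_transition_iff by (auto simp: length_Suc_conv)
qed (use cube_top_transition[of "[x]"] in \<open>simp add: cube_word_def\<close>)

lemma edge_hom:
  assumes "weak_transition_system X" "(\<alpha>, [u], \<beta>) \<in> transitions X"
  shows "ts_hom (cube [label X u]) X (\<lambda>\<epsilon>. if \<epsilon> = [False] then \<alpha> else \<beta>) (\<lambda>_. u)"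
proof (rule ts_homI)
  fix a us b assume "(a, us, b) \<in> transitions (cube [label X u])"
  then show "(if a = [False] then \<alpha> else \<beta>, map (\<lambda>_. u) us, if b = [False] then \<alpha> else \<beta>) \<in> transitions X"
    using assms(2) by (simp add: edge_cube_transition)
qed (use weakD[OF assms] in \<open>auto simp: cube_sel\<close>)

text \<open>Naturality along the 0-cube at \<open>s\<close>: a leg sees a state of a cube only
  through its image in \<open>X\<close>. With the analogue for edges this bounds the colimit in
  terms of \<open>X\<close>.\<close>

lemma cocone_point:
  fixes X :: "('u, 'l) ts"
  assumes X: "X \<in> Obj WTS" and cc: "cube_diagram_cocone X Z k" and c: "c \<in> cubes_over X" and s: "s \<in> states (source c)"
  shows "on_states (k c) s = on_states (k (point X (on_states c s))) (enc ([] :: bool list))"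
proof -
  note cH = cubes_over_Hom[OF c]
  have S: "source c \<in> Obj WTS" using HomD_WTS(1)[OF cH] .
  let ?\<phi> = "point (source c) s" and ?p = "point X (on_states c s)"
  have phi: "?\<phi> \<in> Hom WTS (copy (cube [])) (source c)"
    unfolding point_def by (rule cube_map_Hom(1)[OF S point_hom[OF s]])
  have p: "?p \<in> Hom WTS (copy (cube [])) X" "?p \<in> cubes_over X"
    unfolding point_def by (rule cube_map_Hom[OF X point_hom[OF Hom_hom(1)[OF cH s]]])+
  have sp: "source ?p = copy (cube [])" unfolding point_def by (rule cube_map_sel)
  have "Comp WTS c ?\<phi> = ?p"
    by (rule Comp_eqI[OF phi cH p(1)]) (auto simp: copy_sel cube_sel point_def cube_map_sel)
  then have "(?p, ?\<phi>, c) \<in> cubes_over_maps X"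
    unfolding cubes_over_maps_def using c p phi sp by simp
  then have "Comp WTS (k c) ?\<phi> = k ?p" using cc unfolding is_cocone_def by blast
  moreover have "on_states (Comp WTS (k c) ?\<phi>) (enc ([] :: bool list)) = on_states (k c) s"
    using Comp_states[OF phi, of "enc ([] :: bool list)" "k c"]
    by (simp add: copy_sel cube_sel point_def cube_map_sel)
  ultimately show ?thesis by simp
qed

text \<open>Naturality along the 1-cube of an edge. The value depends on the whole edge of
  \<open>X\<close> and not just on its action: two edges with the same action may be separated,
  which is what cubification does.\<close>

lemma cocone_edge:
  fixes X :: "('u, 'l) ts"
  assumes X: "X \<in> Obj WTS" and cc: "cube_diagram_cocone X Z k" and c: "c \<in> cubes_over X"
    and t: "(\<alpha>, [a], \<beta>) \<in> transitions (source c)"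
  shows "on_actions (k c) a = on_actions (k (edge X (on_states c \<alpha>) (on_actions c a) (on_states c \<beta>)))
    (enc (label X (on_actions c a), 0 :: nat))"
proof -
  note cH = cubes_over_Hom[OF c]
  note w = weakD[OF HomD_WTS(6)[OF cH] t]
  have S: "source c \<in> Obj WTS" using HomD_WTS(1)[OF cH] .
  let ?\<phi> = "edge (source c) \<alpha> a \<beta>" and ?e = "edge X (on_states c \<alpha>) (on_actions c a) (on_states c \<beta>)"
  let ?x = "label X (on_actions c a)"
  have l: "label (source c) a = ?x" using Hom_hom(3)[OF cH] w(3) by simp
  have tX: "(on_states c \<alpha>, [on_actions c a], on_states c \<beta>) \<in> transitions X"
    using Hom_hom(4)[OF cH t] by simp
  have phi: "?\<phi> \<in> Hom WTS (copy (cube [?x])) (source c)"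
    unfolding edge_def l[symmetric] by (rule cube_map_Hom(1)[OF S edge_hom[OF HomD_WTS(6)[OF cH] t]])
  have e: "?e \<in> Hom WTS (copy (cube [?x])) X" "?e \<in> cubes_over X"
    unfolding edge_def by (rule cube_map_Hom[OF X edge_hom[OF HomD_WTS(7)[OF cH] tX]])+
  have se: "source ?e = copy (cube [?x])" unfolding edge_def by (rule cube_map_sel)
  have "Comp WTS c ?\<phi> = ?e"
    by (rule Comp_eqI[OF phi cH e(1)]) (auto simp: copy_sel edge_def l cube_map_sel cube_sel(1))
  then have "(?e, ?\<phi>, c) \<in> cubes_over_maps X"
    unfolding cubes_over_maps_def using c e phi se by simp
  then have "Comp WTS (k c) ?\<phi> = k ?e" using cc unfolding is_cocone_def by blast
  moreover have m: "(?x, 0) \<in> actions (cube [?x])" by (simp add: cube_sel)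
  moreover have "on_actions (Comp WTS (k c) ?\<phi>) (enc (?x, 0 :: nat)) = on_actions (k c) (on_actions ?\<phi> (enc (?x, 0 :: nat)))"
    by (rule Comp_actions[OF phi]) (use m in \<open>simp add: copy_sel\<close>)
  moreover have "on_actions ?\<phi> (enc (?x, 0 :: nat)) = a"
    unfolding edge_def l by (rule cube_map_sel(2)[OF m])
  ultimately show ?thesis by simp
qed

lemma cube_source_edge:
  assumes "c \<in> cubes_over (X :: ('u, 'l) ts)" "a \<in> actions (source c)"
  shows "\<exists>\<alpha> \<beta>. (\<alpha>, [a], \<beta>) \<in> transitions (source c)"
proof -
  obtain xs :: "'l list" where "source c = copy (cube xs)" using assms(1) by (auto simp: cubes_over_def)
  then have "regular (source c)" using copy_cube_Obj by (simp add: Obj_RTS)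
  then show ?thesis using assms(2) unfolding regular_def by blast
qed

lemma identity_cocone:
  fixes X :: "('u, 'l) ts"
  assumes "X \<in> Obj WTS" shows "cube_diagram_cocone X X (\<lambda>c. c)"
  using assms cubes_over_Hom unfolding is_cocone_def cubes_over_maps_def by auto

text \<open>The quotient of all cubes over \<open>X\<close> determined by the class of all cocones
  is the initial cocone: factorizations are built in, and joint surjectivity of the legs makes them
  unique.\<close>

lemma Cub_colimit:
  fixes X :: "('u, 'l) ts"
  assumes X: "X \<in> Obj WTS"
  shows "cube_diagram_colimit X (Cub X) (snd (Cub_cocone X))"
proof -
  let ?I = "cubes_over X"
  \<comment> \<open>An action of a cube lies on several parallel edges; fixing one of them provides
    end points for its code.\<close>
  define ea where "ea c a = (SOME p. (fst p, [a], snd p) \<in> transitions (source c))" for c :: "('u, 'l) ts_map" and a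
  have ea: "(fst (ea c a), [a], snd (ea c a)) \<in> transitions (source c)" if "c \<in> ?I" "a \<in> actions (source c)" for c a
  proof -
    have "\<exists>p. (fst p, [a], snd p) \<in> transitions (source c)" using cube_source_edge[OF that] by auto
    from someI_ex[OF this] show ?thesis unfolding ea_def .
  qed
  define \<sigma> where "\<sigma> = (\<lambda>(c :: ('u, 'l) ts_map, s). on_states c s)"
  \<comment> \<open>The code of an action is the edge of \<open>X\<close> under the chosen edge of
    the cube. By \<open>cocone_edge\<close> this edge determines the value of every cocone, so equal
    codes are identified.\<close>
  define \<tau> where "\<tau> = (\<lambda>(c :: ('u, 'l) ts_map, a). enc (on_states c (fst (ea c a)),
      enc (on_actions c a, on_states c (snd (ea c a))) :: 'u) :: 'u)"
  have \<tau>: "on_states c (fst (ea c a)) = on_states d (fst (ea d b)) \<and> on_actions c a = on_actions d b \<and>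
      on_states c (snd (ea c a)) = on_states d (snd (ea d b))" if "\<tau> (c, a) = \<tau> (d, b)" for c a d b
    using that unfolding \<tau>_def by (simp add: inj_eq[OF inj_enc_pair])
  let ?G = "{(Z, k). cube_diagram_cocone X Z k}"
  show ?thesis
  proof (rule quotient_exists[of ?I source ?G \<sigma> \<tau>])
    fix c d s t g assume cd: "c \<in> ?I" "s \<in> states (source c)" "d \<in> ?I" "t \<in> states (source d)"
      and e: "\<sigma> (c, s) = \<sigma> (d, t)" and "g \<in> ?G"
    then have "cube_diagram_cocone X (fst g) (snd g)" by auto
    from cocone_point[OF X this cd(1,2)] cocone_point[OF X this cd(3,4)] e
    show "on_states (snd g c) s = on_states (snd g d) t" by (simp add: \<sigma>_def)
  next
    fix c d a b g assume cd: "c \<in> ?I" "a \<in> actions (source c)" "d \<in> ?I" "b \<in> actions (source d)"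
      and e: "\<tau> (c, a) = \<tau> (d, b)"
    from Hom_hom(3)[OF cubes_over_Hom[OF cd(1)] cd(2)] Hom_hom(3)[OF cubes_over_Hom[OF cd(3)] cd(4)] \<tau>[OF e]
    show "label (source c) a = label (source d) b" by simp
    assume "g \<in> ?G"
    then have "cube_diagram_cocone X (fst g) (snd g)" by auto
    from cocone_edge[OF X this cd(1) ea[OF cd(1,2)]] cocone_edge[OF X this cd(3) ea[OF cd(3,4)]] \<tau>[OF e]
    show "on_actions (snd g c) a = on_actions (snd g d) b" by simp
  next
    have XS: "small (states X)" "small (actions X)" using X by (simp_all add: Obj_WTS)
    show "small (\<sigma> ` (SIGMA c:?I. states (source c)))"
      by (rule small_subset[OF XS(1)]) (use Hom_hom(1)[OF cubes_over_Hom] in \<open>auto simp: \<sigma>_def\<close>)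
    have "\<tau> ` (SIGMA c:?I. actions (source c)) \<subseteq> enc ` (states X \<times> (enc ` (actions X \<times> states X) :: 'u set))"
    proof clarify
      fix c a assume c: "c \<in> ?I" "a \<in> actions (source c)"
      note cH = cubes_over_Hom[OF c(1)]
      from weakD(1,4)[OF HomD_WTS(6)[OF cH] ea[OF c]] Hom_hom(1,2)[OF cH] c(2)
      show "\<tau> (c, a) \<in> enc ` (states X \<times> (enc ` (actions X \<times> states X) :: 'u set))"
        unfolding \<tau>_def by simp
    qed
    then show "small (\<tau> ` (SIGMA c:?I. actions (source c)))"
      using small_subset small_image_Times XS by meson
  next
    fix Q q h
    assume Q: "Q \<in> Obj WTS" and q: "\<And>c. c \<in> ?I \<Longrightarrow> q c \<in> Hom WTS (source c) Q"
      and st: "states Q = (\<Union>c\<in>?I. on_states (q c) ` states (source c))"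
      and ac: "actions Q = (\<Union>c\<in>?I. on_actions (q c) ` actions (source c))"
      and ste: "\<And>c s d t. c \<in> ?I \<Longrightarrow> s \<in> states (source c) \<Longrightarrow> d \<in> ?I \<Longrightarrow> t \<in> states (source d) \<Longrightarrow>
       on_states (q c) s = on_states (q d) t \<longleftrightarrow> (\<forall>g\<in>?G. on_states (snd g c) s = on_states (snd g d) t)"
      and ace: "\<And>c u d v. c \<in> ?I \<Longrightarrow> u \<in> actions (source c) \<Longrightarrow> d \<in> ?I \<Longrightarrow> v \<in> actions (source d) \<Longrightarrow>
       on_actions (q c) u = on_actions (q d) v \<longleftrightarrow>
         label (source c) u = label (source d) v \<and> (\<forall>g\<in>?G. on_actions (snd g c) u = on_actions (snd g d) v)"
      and h: "\<And>g. g \<in> ?G \<Longrightarrow> h g \<in> Hom WTS Q (fst g)"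
      and hq: "\<And>g c. g \<in> ?G \<Longrightarrow> c \<in> ?I \<Longrightarrow> Comp WTS (h g) (q c) = snd g c"
    have "cube_diagram_cocone X Q q"
      unfolding is_cocone_def
    proof (intro conjI ballI, goal_cases)
      case (3 x)
      then obtain c \<phi> d where x: "x = (c, \<phi>, d)" and m: "(c, \<phi>, d) \<in> cubes_over_maps X" by (cases x) auto
      note mH = cubes_over_maps_Hom[OF m]
      have g: "Comp WTS (snd g d) \<phi> = snd g c" "snd g c \<in> Hom WTS (source c) (fst g)" if "g \<in> ?G" for g
        using that m mH unfolding is_cocone_def by (auto split: prod.splits)
      have "Comp WTS (q d) \<phi> = q c"
      proof (rule Comp_eqI[of _ "source c" "source d" _ Q])
        fix s assume s: "s \<in> states (source c)"
        have "on_states (snd g d) (on_states \<phi> s) = on_states (snd g c) s" if "g \<in> ?G" for g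
          using Comp_states[of \<phi> "source c" "source d" s "snd g d"] g[OF that] mH s by simp
        then have "\<forall>g\<in>?G. on_states (snd g d) (on_states \<phi> s) = on_states (snd g c) s" by (rule ballI)
        then show "on_states (q d) (on_states \<phi> s) = on_states (q c) s"
          by (rule iffD2[OF ste, rotated -1]) (use mH Hom_hom(1)[of \<phi> "source c" "source d"] s in simp_all)
      next
        fix u assume u: "u \<in> actions (source c)"
        have "on_actions (snd g d) (on_actions \<phi> u) = on_actions (snd g c) u" if "g \<in> ?G" for g
          using Comp_actions[of \<phi> "source c" "source d" u "snd g d"] g[OF that] mH u by simp
        then have "\<forall>g\<in>?G. on_actions (snd g d) (on_actions \<phi> u) = on_actions (snd g c) u" by (rule ballI)
        moreover have "label (source d) (on_actions \<phi> u) = label (source c) u"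
          using mH Hom_hom(3)[of \<phi> "source c" "source d"] u by simp
        ultimately have "label (source d) (on_actions \<phi> u) = label (source c) u \<and>
            (\<forall>g\<in>?G. on_actions (snd g d) (on_actions \<phi> u) = on_actions (snd g c) u)" by (rule conjI[rotated])
        then show "on_actions (q d) (on_actions \<phi> u) = on_actions (q c) u"
          by (rule iffD2[OF ace, rotated -1]) (use mH Hom_hom(2)[of \<phi> "source c" "source d"] u in simp_all)
      qed (use mH q in auto)
      then show ?case using x by simp
    qed (use Q q in auto)
    moreover have "\<exists>!k. k \<in> Hom WTS Q Z' \<and> (\<forall>c\<in>?I. Comp WTS k (q c) = c' c)" if cc: "cube_diagram_cocone X Z' c'" for Z' c'
    proof (rule ex1I[of _ "h (Z', c')"])
      show "h (Z', c') \<in> Hom WTS Q Z' \<and> (\<forall>c\<in>?I. Comp WTS (h (Z', c')) (q c) = c' c)"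
        using h[of "(Z', c')"] hq[of "(Z', c')"] cc by simp
      fix k assume k: "k \<in> Hom WTS Q Z' \<and> (\<forall>c\<in>?I. Comp WTS k (q c) = c' c)"
      show "k = h (Z', c')"
      proof (rule Hom_eqI[of _ Q Z'])
        fix s assume "s \<in> states Q"
        then obtain c x where c: "c \<in> ?I" "x \<in> states (source c)" "s = on_states (q c) x" unfolding st by blast
        have "Comp WTS k (q c) = Comp WTS (h (Z', c')) (q c)" using k hq[of "(Z', c')"] cc c(1) by simp
        from Comp_eqD(1)[OF this q[OF c(1)] q[OF c(1)] c(2)] c(3) show "on_states k s = on_states (h (Z', c')) s" by simp
      next
        fix s assume "s \<in> actions Q"
        then obtain c x where c: "c \<in> ?I" "x \<in> actions (source c)" "s = on_actions (q c) x" unfolding ac by blast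
        have "Comp WTS k (q c) = Comp WTS (h (Z', c')) (q c)" using k hq[of "(Z', c')"] cc c(1) by simp
        from Comp_eqD(2)[OF this q[OF c(1)] q[OF c(1)] c(2)] c(3) show "on_actions k s = on_actions (h (Z', c')) s" by simp
      qed (use k h[of "(Z', c')"] cc in auto)
    qed
    ultimately have "cube_diagram_colimit X Q q" unfolding is_colimit_def by blast
    then have "\<exists>p. case p of (Z, \<gamma>) \<Rightarrow> cube_diagram_colimit X Z \<gamma>" by auto
    from someI_ex[OF this] have "case Cub_cocone X of (Z, \<gamma>) \<Rightarrow> cube_diagram_colimit X Z \<gamma>"
      unfolding Cub_cocone_def .
    then show ?thesis unfolding Cub_def by (cases "Cub_cocone X") simp
  qed (use HomD_WTS(1)[OF cubes_over_Hom] in \<open>auto simp: is_cocone_def\<close>)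
qed

section \<open>Functoriality and counit of cubification\<close>

abbreviation leg :: "('u, 'l) ts \<Rightarrow> ('u, 'l) ts_map \<Rightarrow> ('u, 'l) ts_map" where
  "leg X \<equiv> snd (Cub_cocone X)"

lemma leg_Hom: "X \<in> Obj WTS \<Longrightarrow> c \<in> cubes_over X \<Longrightarrow> leg X c \<in> Hom WTS (source c) (Cub X)"
  using Cub_colimit unfolding is_colimit_def is_cocone_def by blast

lemma Cub_eqI:
  fixes X :: "('u, 'l) ts"
  assumes "X \<in> Obj WTS" "h \<in> Hom WTS (Cub X) Z" "h' \<in> Hom WTS (Cub X) Z"
    and "\<And>c. c \<in> cubes_over X \<Longrightarrow> Comp WTS h (leg X c) = Comp WTS h' (leg X c)"
  shows "h = h'"
  by (rule WTS.colimit_eqI[OF Cub_colimit[OF assms(1)] cubes_over_maps_Hom assms(2-4)])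

lemma Cub_factor:
  fixes X :: "('u, 'l) ts"
  assumes "X \<in> Obj WTS" "cube_diagram_cocone X Z k"
  shows "\<exists>h\<in>Hom WTS (Cub X) Z. \<forall>c\<in>cubes_over X. Comp WTS h (leg X c) = k c"
  using Cub_colimit[OF assms(1)] assms(2) unfolding is_colimit_def by blast

lemma Comp_cubes_over:
  assumes f: "f \<in> Hom WTS X Y" and c: "c \<in> cubes_over X"
  shows "Comp WTS f c \<in> cubes_over Y" "source (Comp WTS f c) = source c"
  using Comp_Hom_WTS[OF cubes_over_Hom[OF c] f] c by (auto simp: cubes_over_def Comp_sel Hom_def)

lemma Comp_cubes_over_maps:
  assumes f: "f \<in> Hom WTS X Y" and m: "(c, \<phi>, d) \<in> cubes_over_maps X"
  shows "(Comp WTS f c, \<phi>, Comp WTS f d) \<in> cubes_over_maps Y"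
proof -
  note mH = cubes_over_maps_Hom[OF m]
  have "Comp WTS d \<phi> = c" using m by (simp add: cubes_over_maps_def)
  then have "Comp WTS (Comp WTS f d) \<phi> = Comp WTS f c"
    using WTS.Comp_assoc[of \<phi> "source c" "source d" d X f Y] mH cubes_over_Hom[of d X] f by simp
  then show ?thesis
    using Comp_cubes_over[OF f] mH unfolding cubes_over_maps_def by simp
qed

text \<open>The description by \<open>THE\<close> is legitimate because the legs of \<open>Y\<close>
  at the cubes composed with \<open>f\<close> form a cocone over the diagram of
  \<open>X\<close>.\<close>

lemma Cub_map:
  fixes f :: "('u, 'l) ts_map"
  assumes f: "f \<in> Hom WTS X Y"
  shows "Cub_map f \<in> Hom WTS (Cub X) (Cub Y)"
    and "c \<in> cubes_over X \<Longrightarrow> Comp WTS (Cub_map f) (leg X c) = leg Y (Comp WTS f c)"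
proof -
  have XY: "X \<in> Obj WTS" "Y \<in> Obj WTS" and st: "source f = X" "target f = Y" using HomD_WTS[OF f] by auto
  have "cube_diagram_cocone Y (Cub Y) (leg Y)"
    using Cub_colimit[OF XY(2)] unfolding is_colimit_def by blast
  then have "cube_diagram_cocone X (Cub Y) (\<lambda>c. leg Y (Comp WTS f c))"
    unfolding is_cocone_def using Comp_cubes_over[OF f] Comp_cubes_over_maps[OF f] by fastforce
  then have "\<exists>!h. h \<in> Hom WTS (Cub X) (Cub Y) \<and> (\<forall>c\<in>cubes_over X. Comp WTS h (leg X c) = leg Y (Comp WTS f c))"
    using Cub_colimit[OF XY(1)] unfolding is_colimit_def by blast
  from theI'[OF this] show "Cub_map f \<in> Hom WTS (Cub X) (Cub Y)"
    "c \<in> cubes_over X \<Longrightarrow> Comp WTS (Cub_map f) (leg X c) = leg Y (Comp WTS f c)"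
    unfolding Cub_map_def st by blast+
qed

lemma counit:
  fixes X :: "('u, 'l) ts"
  assumes X: "X \<in> Obj WTS"
  obtains \<epsilon> where "\<epsilon> \<in> Hom WTS (Cub X) X" "\<And>c. c \<in> cubes_over X \<Longrightarrow> Comp WTS \<epsilon> (leg X c) = c"
  using Cub_factor[OF X identity_cocone[OF X]] by blast

text \<open>Cubification separates actions according to the edges that carry them, but a local
  \<open>K\<close> sees only labels, so the values of \<open>h\<close> on actions descend to
  \<open>X\<close>. The values on states descend because a leg sees a state only through its image
  in \<open>X\<close>.\<close>

lemma counit_extension:
  fixes X :: "('u, 'l) ts"
  assumes X: "X \<in> Obj RTS" and K: "K \<in> local_objects"
    and \<epsilon>: "\<epsilon> \<in> Hom WTS (Cub X) X" "\<And>c. c \<in> cubes_over X \<Longrightarrow> Comp WTS \<epsilon> (leg X c) = c"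
    and h: "h \<in> Hom WTS (Cub X) K"
  shows "\<exists>g\<in>Hom WTS X K. Comp WTS g \<epsilon> = h"
proof -
  have XW: "X \<in> Obj WTS" "weak_transition_system X" "regular X" using X by (simp_all add: Obj_RTS Obj_WTS)
  have KW: "K \<in> Obj WTS" using local_Obj[OF K] by (simp add: Obj_RTS)
  define k where "k c = Comp WTS h (leg X c)" for c
  have k: "k c \<in> Hom WTS (source c) K" if "c \<in> cubes_over X" for c
    unfolding k_def by (rule Comp_Hom_WTS[OF leg_Hom[OF XW(1) that] h])
  have cc: "cube_diagram_cocone X K k"
    unfolding is_cocone_def
  proof (intro conjI ballI, goal_cases)
    case (3 x)
    then obtain c \<phi> d where x: "x = (c, \<phi>, d)" and m: "(c, \<phi>, d) \<in> cubes_over_maps X" by (cases x) auto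
    note mH = cubes_over_maps_Hom[OF m]
    have "Comp WTS (leg X d) \<phi> = leg X c"
      using Cub_colimit[OF XW(1)] m unfolding is_colimit_def is_cocone_def by blast
    then show ?case
      unfolding x k_def using WTS.Comp_assoc[of \<phi> "source c" "source d" "leg X d" "Cub X" h K] mH leg_Hom[OF XW(1)] h by simp
  qed (use KW k in auto)
  define gs where "gs s = on_states (k (point X s)) (enc ([] :: bool list))" for s
  \<comment> \<open>Locality leaves only this candidate: the action of \<open>K\<close> with the
    required label.\<close>
  define ga where "ga u = inv_into (actions K) (label K) (label X u)" for u
  have gs: "on_states (k c) s = gs (on_states c s)" if "c \<in> cubes_over X" "s \<in> states (source c)" for c s
    unfolding gs_def by (rule cocone_point[OF XW(1) cc that])
  have ga: "on_actions (k c) a = ga (on_actions c a)" if c: "c \<in> cubes_over X" "a \<in> actions (source c)" for c a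
  proof -
    have "label K (on_actions (k c) a) = label X (on_actions c a)"
      using Hom_hom(3)[OF k[OF c(1)] c(2)] Hom_hom(3)[OF cubes_over_Hom[OF c(1)] c(2)] by simp
    then show ?thesis
      unfolding ga_def using K Hom_hom(2)[OF k[OF c(1)] c(2)]
      by (intro inv_into_f_eq[symmetric]) (auto simp: local_objects_def)
  qed
  have enc_st: "enc \<epsilon> \<in> states (copy (cube xs) :: ('u, 'l) ts)" if "length \<epsilon> = length xs" for \<epsilon> :: "bool list" and xs :: "'l list"
    using that by (auto simp: copy_sel cube_sel)
  \<comment> \<open>Every transition of \<open>X\<close> is the image of the longest transition of a
    cube over \<open>X\<close>, and on that cube the map agrees with the leg
    \<open>k\<close>.\<close>
  have tr: "(gs \<alpha>, map ga w, gs \<beta>) \<in> transitions K" if t: "(\<alpha>, w, \<beta>) \<in> transitions X" for \<alpha> w \<beta>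
  proof (rule cube_extension[OF XW(2,3) t])
    define xs where "xs = map (label X) w"
    have lxs: "length xs = length w" "xs \<noteq> []" using weakD(2)[OF XW(2) t] by (auto simp: xs_def)
    fix \<phi> assume \<phi>: "ts_hom (cube (map (label X) w)) X \<phi> (\<lambda>a. w ! snd a)"
      "\<phi> (replicate (length w) False) = \<alpha>" "\<phi> (replicate (length w) True) = \<beta>"
    let ?c = "cube_map X xs \<phi> (\<lambda>a. w ! snd a)"
    have c: "?c \<in> cubes_over X" using cube_map_Hom(2)[OF XW(1) \<phi>(1)] by (simp add: xs_def)
    have sc: "source ?c = copy (cube xs)" by (rule cube_map_sel)
    let ?F = "replicate (length xs) False" and ?T = "replicate (length xs) True"
    have "(enc ?F, map enc (cube_word xs), enc ?T) \<in> transitions (source ?c)"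
      unfolding sc copy_transition_enc[OF inj_enc_bools inj_enc_label_nat] by (rule cube_top_transition[OF lxs(2)])
    from Hom_hom(4)[OF k[OF c] this]
    have t': "(on_states (k ?c) (enc ?F), map (on_actions (k ?c)) (map enc (cube_word xs)), on_states (k ?c) (enc ?T)) \<in> transitions K" .
    have s: "on_states (k ?c) (enc ?F) = gs \<alpha>" "on_states (k ?c) (enc ?T) = gs \<beta>"
      using gs[OF c, unfolded sc, OF enc_st, of ?F] gs[OF c, unfolded sc, OF enc_st, of ?T] \<phi>(2,3) lxs(1)
      by (simp_all add: cube_map_sel)
    have "map (on_actions (k ?c)) (map enc (cube_word xs)) = map (\<lambda>i. ga (w ! i)) [0..<length w]"
      unfolding cube_word_def map_map lxs(1)
    proof (rule map_cong[OF refl])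
      fix i assume "i \<in> set [0..<length w]"
      then have a: "(xs ! i, i) \<in> actions (cube xs)" using lxs by (auto simp: cube_sel)
      then have "enc (xs ! i, i) \<in> actions (source ?c)" by (simp add: sc copy_sel)
      from ga[OF c this] cube_map_sel(2)[OF a]
      show "(on_actions (k ?c) \<circ> (enc \<circ> (\<lambda>i. (xs ! i, i)))) i = ga (w ! i)" by simp
    qed
    also have "\<dots> = map ga (map ((!) w) [0..<length w])" by simp
    also have "\<dots> = map ga w" by (simp only: map_nth)
    finally show "(gs \<alpha>, map ga w, gs \<beta>) \<in> transitions K" using t' s by simp
  qed
  have gaK: "ga u \<in> actions K \<and> label K (ga u) = label X u" if u: "u \<in> actions X" for u
  proof -
    obtain \<alpha> \<beta> where t: "(\<alpha>, [u], \<beta>) \<in> transitions X" using XW(3) u unfolding regular_def by blast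
    let ?c = "edge X \<alpha> u \<beta>"
    have c: "?c \<in> cubes_over X" unfolding edge_def by (rule cube_map_Hom(2)[OF XW(1) edge_hom[OF XW(2) t]])
    have m: "(label X u, 0) \<in> actions (cube [label X u])" by (simp add: cube_sel)
    then have a: "enc (label X u, 0 :: nat) \<in> actions (source ?c)" by (simp add: edge_def cube_map_sel copy_sel)
    have "on_actions ?c (enc (label X u, 0 :: nat)) = u" unfolding edge_def by (rule cube_map_sel(2)[OF m])
    with ga[OF c a] Hom_hom(2,3)[OF k[OF c] a] Hom_hom(3)[OF cubes_over_Hom[OF c] a] show ?thesis by simp
  qed
  have hom: "ts_hom X K gs ga"
  proof (rule ts_homI)
    fix s assume s: "s \<in> states X"
    have c: "point X s \<in> cubes_over X" unfolding point_def by (rule cube_map_Hom(2)[OF XW(1) point_hom[OF s]])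
    show "gs s \<in> states K"
      unfolding gs_def by (rule Hom_hom(1)[OF k[OF c]]) (simp add: point_def cube_map_sel enc_st)
  qed (use gaK tr in auto)
  let ?g = "mk X K gs ga"
  have g: "?g \<in> Hom WTS X K" by (rule mk_Hom[OF XW(1) KW hom])
  have "Comp WTS ?g \<epsilon> = h"
  proof (rule Cub_eqI[OF XW(1) Comp_Hom_WTS[OF \<epsilon>(1) g] h])
    fix c assume c: "c \<in> cubes_over X"
    note cH = cubes_over_Hom[OF c]
    have "Comp WTS (Comp WTS ?g \<epsilon>) (leg X c) = Comp WTS ?g c"
      using WTS.Comp_assoc[OF leg_Hom[OF XW(1) c] \<epsilon>(1) g] \<epsilon>(2)[OF c] by simp
    also have "\<dots> = k c"
      by (rule Comp_eqI[OF cH g k[OF c]]) (use Hom_hom(1,2)[OF cH] gs[OF c] ga[OF c] in auto)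
    finally show "Comp WTS (Comp WTS ?g \<epsilon>) (leg X c) = Comp WTS h (leg X c)" by (simp add: k_def)
  qed
  with g show ?thesis by blast
qed

text \<open>Each state lies on a 0-cube and, by regularity, each action on a 1-cube, so the counit
  reaches all of \<open>X\<close>.\<close>

lemma counit_epi:
  fixes X :: "('u, 'l) ts"
  assumes X: "X \<in> Obj RTS"
    and \<epsilon>: "\<epsilon> \<in> Hom WTS (Cub X) X" "\<And>c. c \<in> cubes_over X \<Longrightarrow> Comp WTS \<epsilon> (leg X c) = c"
    and g: "g \<in> Hom WTS X K" "g' \<in> Hom WTS X K" and e: "Comp WTS g \<epsilon> = Comp WTS g' \<epsilon>"
  shows "g = g'"
proof -
  have XW: "X \<in> Obj WTS" "weak_transition_system X" "regular X" using X by (simp_all add: Obj_RTS Obj_WTS)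
  have gc: "Comp WTS g c = Comp WTS g' c" if c: "c \<in> cubes_over X" for c
    using WTS.Comp_assoc[OF leg_Hom[OF XW(1) c] \<epsilon>(1) g(1)] WTS.Comp_assoc[OF leg_Hom[OF XW(1) c] \<epsilon>(1) g(2)]
      \<epsilon>(2)[OF c] e by simp
  show ?thesis
  proof (rule Hom_eqI[OF g])
    fix s assume s: "s \<in> states X"
    have c: "point X s \<in> Hom WTS (copy (cube [])) X" "point X s \<in> cubes_over X"
      unfolding point_def by (rule cube_map_Hom[OF XW(1) point_hom[OF s]])+
    have "enc ([] :: bool list) \<in> states (copy (cube []) :: ('u, 'l) ts)" by (simp add: copy_sel cube_sel)
    from Comp_eqD(1)[OF gc[OF c(2)] c(1) c(1) this] show "on_states g s = on_states g' s"
      by (simp add: point_def cube_map_sel)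
  next
    fix u assume u: "u \<in> actions X"
    obtain \<alpha> \<beta> where t: "(\<alpha>, [u], \<beta>) \<in> transitions X" using XW(3) u unfolding regular_def by blast
    have c: "edge X \<alpha> u \<beta> \<in> Hom WTS (copy (cube [label X u])) X" "edge X \<alpha> u \<beta> \<in> cubes_over X"
      unfolding edge_def by (rule cube_map_Hom[OF XW(1) edge_hom[OF XW(2) t]])+
    have m: "(label X u, 0) \<in> actions (cube [label X u])" by (simp add: cube_sel)
    then have "enc (label X u, 0 :: nat) \<in> actions (copy (cube [label X u]) :: ('u, 'l) ts)" by (simp add: copy_sel)
    from Comp_eqD(2)[OF gc[OF c(2)] c(1) c(1) this] show "on_actions g u = on_actions g' u"
      using cube_map_sel(2)[OF m] by (simp add: edge_def)
  qed
qed

text \<open>The counits identify maps from \<open>X\<close> and from \<open>Cub X\<close> to a local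
  object, and likewise for \<open>Y\<close>. By naturality of the counit, restriction along
  \<open>f\<close> corresponds to restriction along \<open>Cub_map f\<close>.\<close>

lemma Cub_local_equivalence:
  fixes f :: "('u, 'l) ts_map"
  assumes "f \<in> Arr RTS" and C: "Cub_map f \<in> RTS.local_equivalences local_objects"
  shows "f \<in> RTS.local_equivalences local_objects"
proof -
  define X Y where "X = source f" and "Y = target f"
  have f: "f \<in> Hom RTS X Y" using assms(1) by (simp add: Hom_def X_def Y_def)
  then have fW: "f \<in> Hom WTS X Y" and XY: "X \<in> Obj RTS" "Y \<in> Obj RTS" by (auto simp: Hom_RTS Hom_WTS Obj_RTS)
  have XYW: "X \<in> Obj WTS" "Y \<in> Obj WTS" using XY by (simp_all add: Obj_RTS)
  let ?C = "Cub_map f"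
  have CW: "?C \<in> Hom WTS (Cub X) (Cub Y)" by (rule Cub_map(1)[OF fW])
  then have CR: "?C \<in> Hom RTS (Cub X) (Cub Y)" using RTS.local_equivalences_Arr[OF C] by (simp add: Arr_RTS Hom_WTS)
  obtain \<epsilon> where \<epsilon>: "\<epsilon> \<in> Hom WTS (Cub X) X" "\<And>c. c \<in> cubes_over X \<Longrightarrow> Comp WTS \<epsilon> (leg X c) = c"
    by (rule counit[OF XYW(1)]) (rule that)
  obtain \<delta> where \<delta>: "\<delta> \<in> Hom WTS (Cub Y) Y" "\<And>c. c \<in> cubes_over Y \<Longrightarrow> Comp WTS \<delta> (leg Y c) = c"
    by (rule counit[OF XYW(2)]) (rule that)
  have nat: "Comp WTS \<delta> ?C = Comp WTS f \<epsilon>"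
  proof (rule Cub_eqI[OF XYW(1) Comp_Hom_WTS[OF CW \<delta>(1)] Comp_Hom_WTS[OF \<epsilon>(1) fW]])
    fix c assume c: "c \<in> cubes_over X"
    note l = leg_Hom[OF XYW(1) c]
    show "Comp WTS (Comp WTS \<delta> ?C) (leg X c) = Comp WTS (Comp WTS f \<epsilon>) (leg X c)"
      using WTS.Comp_assoc[OF l CW \<delta>(1)] WTS.Comp_assoc[OF l \<epsilon>(1) fW] Cub_map(2)[OF fW c]
        \<delta>(2)[OF Comp_cubes_over(1)[OF fW c]] \<epsilon>(2)[OF c] by simp
  qed
  \<comment> \<open>Regularity of both cubifications is read off from \<open>Cub_map f\<close>,
    which is an arrow of \<open>RTS\<close> because it is a local equivalence.\<close>
  have reg: "regular (Cub X)" "regular (Cub Y)" "regular X" "regular Y" using CR XY by (simp_all add: Hom_RTS Obj_RTS)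
  have lift: "Comp WTS (Comp WTS g f) \<epsilon> = Comp WTS (Comp WTS g \<delta>) ?C" if "g \<in> Hom WTS Y K" for g K
    using WTS.Comp_assoc[OF \<epsilon>(1) fW that] WTS.Comp_assoc[OF CW \<delta>(1) that] nat by simp
  show ?thesis
  proof (rule RTS.local_equivalencesI[OF f])
    fix K g assume K: "K \<in> local_objects" and g: "g \<in> Hom RTS X K"
    have gW: "g \<in> Hom WTS X K" and rK: "regular K" using g by (simp_all add: Hom_RTS)
    have "Comp WTS g \<epsilon> \<in> Hom RTS (Cub X) K" using Comp_Hom_WTS[OF \<epsilon>(1) gW] reg rK by (simp add: Hom_RTS)
    then obtain h where h: "h \<in> Hom RTS (Cub Y) K" "Comp RTS h ?C = Comp WTS g \<epsilon>"
      by (rule RTS.local_equivalences_ex[OF C CR K])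
    obtain g' where g': "g' \<in> Hom WTS Y K" "Comp WTS g' \<delta> = h"
      using counit_extension[OF XY(2) K \<delta>] h(1) by (auto simp: Hom_RTS)
    have "Comp WTS (Comp WTS g' f) \<epsilon> = Comp WTS g \<epsilon>"
      unfolding lift[OF g'(1)] g'(2) using h(2) by simp
    then have "Comp WTS g' f = g"
      by (intro counit_epi[OF XY(1) \<epsilon>(1) _ Comp_Hom_WTS[OF fW g'(1)] gW] \<epsilon>(2))
    then show "\<exists>h\<in>Hom RTS Y K. Comp RTS h f = g" using g'(1) reg rK by (auto simp: Hom_RTS)
  next
    fix K h h' assume K: "K \<in> local_objects" and h: "h \<in> Hom RTS Y K" "h' \<in> Hom RTS Y K"
      and e: "Comp RTS h f = Comp RTS h' f"
    have hW: "h \<in> Hom WTS Y K" "h' \<in> Hom WTS Y K" and rK: "regular K" using h by (simp_all add: Hom_RTS)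
    have "Comp WTS h \<delta> = Comp WTS h' \<delta>"
    proof (rule RTS.local_equivalences_uniq[OF C CR K])
      show "Comp WTS h \<delta> \<in> Hom RTS (Cub Y) K" "Comp WTS h' \<delta> \<in> Hom RTS (Cub Y) K"
        using Comp_Hom_WTS[OF \<delta>(1)] hW reg rK by (simp_all add: Hom_RTS)
      show "Comp RTS (Comp WTS h \<delta>) ?C = Comp RTS (Comp WTS h' \<delta>) ?C"
        using lift[OF hW(1)] lift[OF hW(2)] e by simp
    qed
    then show "h = h'" by (intro counit_epi[OF XY(2) \<delta>(1) _ hW] \<delta>(2))
  qed
qed

text \<open>Local equivalences form a localizer, so they contain the left determined weak
  equivalences, and cubification reflects them.\<close>

lemma Cub_equivalences_local:
  "(Cub_equivalences :: ('u, 'l) ts_map set) \<subseteq> RTS.local_equivalences local_objects"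
proof -
  have "smallest_localizer RTS (small_ordinals :: 'u rel set) action_injections {} \<subseteq>
      RTS.local_equivalences (local_objects :: ('u, 'l) ts set)"
    unfolding smallest_localizer_def using local_equivalences_localizer by blast
  then show ?thesis
    unfolding Cub_equivalences_def left_determined_def Let_def cofibrations_generated
    using Cub_local_equivalence by auto
qed

end

section \<open>Cubification of graphs\<close>

text \<open>Serves to replace the chosen colimit \<open>Cub\<close> by an explicit one; the legs are
  part of the comparison because maps out of \<open>Cub\<close> are recognised on them.\<close>

lemma (in cat) colimit_comparison:
  assumes c: "is_colimit C I D E Z c" "is_colimit C I D E Z' c'"
    and E: "\<And>i a j. (i, a, j) \<in> E \<Longrightarrow> i \<in> I \<and> j \<in> I \<and> a \<in> Hom C (D i) (D j)"
  obtains a b where "a \<in> Hom C Z Z'" "b \<in> Hom C Z' Z" "Comp C b a = Ident C Z" "Comp C a b = Ident C Z'"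
    "\<And>i. i \<in> I \<Longrightarrow> Comp C a (c i) = c' i" "\<And>i. i \<in> I \<Longrightarrow> Comp C b (c' i) = c i"
proof -
  have cc: "is_cocone C I D E Z c" "is_cocone C I D E Z' c'" using c unfolding is_colimit_def by blast+
  have cH: "c i \<in> Hom C (D i) Z" "c' i \<in> Hom C (D i) Z'" if "i \<in> I" for i
    using cc that unfolding is_cocone_def by blast+
  have Z: "Z \<in> Obj C" "Z' \<in> Obj C" using cc unfolding is_cocone_def by blast+
  obtain a where a: "a \<in> Hom C Z Z'" "\<And>i. i \<in> I \<Longrightarrow> Comp C a (c i) = c' i"
    using c(1) cc(2) unfolding is_colimit_def by blast
  obtain b where b: "b \<in> Hom C Z' Z" "\<And>i. i \<in> I \<Longrightarrow> Comp C b (c' i) = c i"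
    using c(2) cc(1) unfolding is_colimit_def by blast
  have "Comp C b a = Ident C Z"
  proof (rule colimit_eqI[OF c(1) E Comp_Hom[OF a(1) b(1)] Ident_Hom[OF Z(1)]])
    fix i assume i: "i \<in> I"
    show "Comp C (Comp C b a) (c i) = Comp C (Ident C Z) (c i)"
      using Comp_assoc[OF cH(1)[OF i] a(1) b(1)] a(2)[OF i] b(2)[OF i] Ident_Comp[OF cH(1)[OF i]] by simp
  qed
  moreover have "Comp C a b = Ident C Z'"
  proof (rule colimit_eqI[OF c(2) E Comp_Hom[OF b(1) a(1)] Ident_Hom[OF Z(2)]])
    fix i assume i: "i \<in> I"
    show "Comp C (Comp C a b) (c' i) = Comp C (Ident C Z') (c' i)"
      using Comp_assoc[OF cH(2)[OF i] b(1) a(1)] a(2)[OF i] b(2)[OF i] Ident_Comp[OF cH(2)[OF i]] by simp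
  qed
  ultimately show thesis using that a b by blast
qed

text \<open>Transports regularity from an explicit colimit to the chosen one: a splitting problem is
  carried over to \<open>X\<close>, solved there and carried back.\<close>

lemma regular_iso:
  assumes X: "regular X" and a: "a \<in> Hom WTS X Y" and b: "b \<in> Hom WTS Y X"
    and ba: "Comp WTS b a = Ident WTS X" and ab: "Comp WTS a b = Ident WTS Y"
  shows "regular Y"
proof -
  have XW: "weak_transition_system X" and YW: "weak_transition_system Y" using HomD_WTS[OF a] by blast+
  have abs: "on_states a (on_states b s) = s" if "s \<in> states Y" for s
    using Comp_states[OF b that, of a] ab that by simp
  have aba: "on_actions a (on_actions b u) = u" if "u \<in> actions Y" for u
    using Comp_actions[OF b that, of a] ab that by simp
  have abw: "map (on_actions a) (map (on_actions b) w) = w" if "set w \<subseteq> actions Y" for w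
    unfolding map_map using that aba by (intro map_idI) auto
  have "\<exists>\<alpha> \<beta>. (\<alpha>, [u], \<beta>) \<in> transitions Y" if u: "u \<in> actions Y" for u
  proof -
    obtain \<alpha> \<beta> where "(\<alpha>, [on_actions b u], \<beta>) \<in> transitions X"
      using X Hom_hom(2)[OF b u] unfolding regular_def by blast
    from Hom_hom(4)[OF a this] aba[OF u] show ?thesis by auto
  qed
  moreover have "CSA2 Y"
    unfolding CSA2_def
  proof (intro allI impI, elim conjE)
    fix \<alpha> us vs \<beta> assume ne: "us \<noteq> []" "vs \<noteq> []" and t: "(\<alpha>, us @ vs, \<beta>) \<in> transitions Y"
    note w = weakD[OF YW t]
    let ?b = "on_states b" and ?m = "map (on_actions b)"
    have t': "(?b \<alpha>, ?m us @ ?m vs, ?b \<beta>) \<in> transitions X" using Hom_hom(4)[OF b t] by simp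
    obtain \<nu> where \<nu>: "(?b \<alpha>, ?m us, \<nu>) \<in> transitions X" "(\<nu>, ?m vs, ?b \<beta>) \<in> transitions X"
      using closed_splitD[OF regular_closed_split[OF XW X] t', of "?m us" "?m vs"] ne by auto
    have "(\<alpha>, us, on_states a \<nu>) \<in> transitions Y" "(on_states a \<nu>, vs, \<beta>) \<in> transitions Y"
      using Hom_hom(4)[OF a \<nu>(1)] Hom_hom(4)[OF a \<nu>(2)] abs[OF w(1)] abs[OF w(4)] abw[of us] abw[of vs] w(3)
      by (simp_all del: map_map)
    moreover have "\<mu> = on_states a \<nu>" if m: "(\<alpha>, us, \<mu>) \<in> transitions Y" "(\<mu>, vs, \<beta>) \<in> transitions Y" for \<mu>
    proof -
      have "?b \<mu> = \<nu>"
        using unique_splitD[OF regular_unique_split[OF XW X] _ _ t' Hom_hom(4)[OF b m(1)] Hom_hom(4)[OF b m(2)] \<nu>] ne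
        by simp
      then show ?thesis using abs[OF weakD(4)[OF YW m(1)]] by simp
    qed
    ultimately show "\<exists>!\<nu>. \<nu> \<in> states Y \<and> (\<alpha>, us, \<nu>) \<in> transitions Y \<and> (\<nu>, vs, \<beta>) \<in> transitions Y"
      using weakD(4)[OF YW] by blast
  qed
  ultimately show ?thesis unfolding regular_def by blast
qed

definition graph :: "('s, 'a, 'l) transition_system \<Rightarrow> bool" where
  "graph G \<longleftrightarrow> (\<forall>\<alpha> w \<beta>. (\<alpha>, w, \<beta>) \<in> transitions G \<longrightarrow> (\<exists>u. w = [u]))"

context small_universe
begin

definition edge_code :: "'u \<Rightarrow> 'u \<Rightarrow> 'u \<Rightarrow> 'u" where
  "edge_code \<alpha> u \<beta> = enc (\<alpha>, enc (u, \<beta>) :: 'u)"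

lemma edge_code_eq: "edge_code \<alpha> u \<beta> = edge_code \<alpha>' u' \<beta>' \<longleftrightarrow> \<alpha> = \<alpha>' \<and> u = u' \<and> \<beta> = \<beta>'"
  unfolding edge_code_def by (simp add: inj_eq[OF inj_enc_pair])

definition edge_action :: "'u \<Rightarrow> 'u" where
  "edge_action e = fst (inv (enc :: 'u \<times> 'u \<Rightarrow> 'u) (snd (inv (enc :: 'u \<times> 'u \<Rightarrow> 'u) e)))"

lemma edge_action_code [simp]: "edge_action (edge_code \<alpha> u \<beta>) = u"
  unfolding edge_code_def edge_action_def by (simp add: inv_f_f[OF inj_enc_pair])

text \<open>The graph in which every edge has its own action is the cubification of a graph.\<close>

definition free_graph :: "('u, 'l) ts \<Rightarrow> ('u, 'l) ts" where
  "free_graph G =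
     \<lparr>states = states G, actions = {edge_code \<alpha> u \<beta> | \<alpha> u \<beta>. (\<alpha>, [u], \<beta>) \<in> transitions G},
      label = restrict (\<lambda>e. label G (edge_action e)) {edge_code \<alpha> u \<beta> | \<alpha> u \<beta>. (\<alpha>, [u], \<beta>) \<in> transitions G},
      transitions = {(\<alpha>, [edge_code \<alpha> u \<beta>], \<beta>) | \<alpha> u \<beta>. (\<alpha>, [u], \<beta>) \<in> transitions G}\<rparr>"

lemma free_graph_sel:
  "states (free_graph G) = states G"
  "e \<in> actions (free_graph G) \<longleftrightarrow> (\<exists>\<alpha> u \<beta>. e = edge_code \<alpha> u \<beta> \<and> (\<alpha>, [u], \<beta>) \<in> transitions G)"
  "(\<alpha>, w, \<beta>) \<in> transitions (free_graph G) \<longleftrightarrow> (\<exists>u. w = [edge_code \<alpha> u \<beta>] \<and> (\<alpha>, [u], \<beta>) \<in> transitions G)"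
  "(\<alpha>, [u], \<beta>) \<in> transitions G \<Longrightarrow> label (free_graph G) (edge_code \<alpha> u \<beta>) = label G u"
  by (auto simp: free_graph_def)

lemma free_graph_Obj:
  assumes "G \<in> Obj WTS"
  shows "free_graph G \<in> Obj RTS"
proof -
  have G: "weak_transition_system G" "small (states G)" "small (actions G)" using assms by (simp_all add: Obj_WTS)
  have "actions (free_graph G) \<subseteq> enc ` (states G \<times> (enc ` (actions G \<times> states G) :: 'u set))"
    unfolding free_graph_def edge_code_def using weakD[OF G(1)] by fastforce
  then have "small (actions (free_graph G))" using small_subset small_image_Times G by meson
  moreover have "weak_transition_system (free_graph G)" "regular (free_graph G)"
    by (rule edges_regular; use weakD[OF G(1)] in \<open>fastforce simp: free_graph_def\<close>)+
  ultimately show ?thesis using G(2) by (simp add: Obj_RTS Obj_WTS free_graph_sel)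
qed

text \<open>The longest transition of an n-cube is sent to a transition of length n, and a graph has
  only those of length one. A cube over a graph that has any transition is therefore an
  edge.\<close>

lemma graph_cube_transition:
  fixes G :: "('u, 'l) ts"
  assumes G: "graph G" and c: "c \<in> cubes_over G" and t: "(\<alpha>, w, \<beta>) \<in> transitions (source c)"
  shows "\<exists>x :: 'l. source c = copy (cube [x]) \<and> \<alpha> = enc [False] \<and> w = [enc (x, 0 :: nat)] \<and> \<beta> = enc [True]"
proof -
  obtain xs :: "'l list" where xs: "source c = copy (cube xs)" using c by (auto simp: cubes_over_def)
  obtain \<epsilon> us \<epsilon>' where e: "\<alpha> = enc \<epsilon>" "w = map enc us" "\<beta> = enc \<epsilon>'" "(\<epsilon>, us, \<epsilon>') \<in> transitions (cube xs)"
    using t unfolding xs copy_sel by blast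
  have ne: "xs \<noteq> []" using e(4) cube_transition_length[OF e(4)] weakD(2)[OF cube_regular(1) e(4)] by auto
  have "(enc (replicate (length xs) False), map enc (cube_word xs), enc (replicate (length xs) True)) \<in> transitions (source c)"
    unfolding xs copy_transition_enc[OF inj_enc_bools inj_enc_label_nat] by (rule cube_top_transition[OF ne])
  from Hom_hom(4)[OF cubes_over_Hom[OF c] this] have "\<exists>u. map (on_actions c) (map enc (cube_word xs)) = [u]"
    by (rule G[unfolded graph_def, rule_format])
  then have "length (map (on_actions c) (map enc (cube_word xs))) = 1" by (elim exE) (simp only: list.size One_nat_def)
  then have "length xs = 1" by (simp add: cube_word_def)
  then obtain x where "xs = [x]" by (auto simp: length_Suc_conv)
  with e xs show ?thesis by (auto simp: edge_cube_transition)
qed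

lemma graph_cube_edge:
  fixes G :: "('u, 'l) ts"
  assumes G: "graph G" and c: "c \<in> cubes_over G" and a: "a \<in> actions (source c)"
  shows "(enc [False], [a], enc [True]) \<in> transitions (source c)"
proof -
  obtain \<alpha> \<beta> where t: "(\<alpha>, [a], \<beta>) \<in> transitions (source c)" using cube_source_edge[OF c a] by blast
  from graph_cube_transition[OF G c t] t show ?thesis by auto
qed

definition free_leg :: "('u, 'l) ts \<Rightarrow> ('u, 'l) ts_map \<Rightarrow> ('u, 'l) ts_map" where
  "free_leg G c = mk (source c) (free_graph G) (on_states c)
     (\<lambda>a. edge_code (on_states c (enc [False])) (on_actions c a) (on_states c (enc [True])))"

lemma free_leg_Hom:
  assumes G: "G \<in> Obj WTS" "graph G" and c: "c \<in> cubes_over G"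
  shows "free_leg G c \<in> Hom WTS (source c) (free_graph G)"
proof -
  note cH = cubes_over_Hom[OF c]
  have F: "free_graph G \<in> Obj WTS" using free_graph_Obj[OF G(1)] by (simp add: Obj_RTS)
  have e: "(on_states c (enc [False]), [on_actions c a], on_states c (enc [True])) \<in> transitions G"
    if "a \<in> actions (source c)" for a
    using Hom_hom(4)[OF cH graph_cube_edge[OF G(2) c that]] by simp
  show ?thesis
    unfolding free_leg_def
  proof (rule mk_Hom[OF HomD_WTS(1)[OF cH] F], rule ts_homI)
    fix \<alpha> us \<beta> assume t: "(\<alpha>, us, \<beta>) \<in> transitions (source c)"
    then obtain x :: 'l where x: "\<alpha> = enc [False]" "us = [enc (x, 0 :: nat)]" "\<beta> = enc [True]"
      using graph_cube_transition[OF G(2) c] by blast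
    have "enc (x, 0 :: nat) \<in> actions (source c)" using weakD(3)[OF HomD_WTS(6)[OF cH] t] x by simp
    from e[OF this] show "(on_states c \<alpha>, map (\<lambda>a. edge_code (on_states c (enc [False])) (on_actions c a) (on_states c (enc [True]))) us,
        on_states c \<beta>) \<in> transitions (free_graph G)"
      unfolding x by (auto simp: free_graph_sel)
  qed (use Hom_hom(1,3)[OF cH] e free_graph_sel in \<open>auto, blast\<close>)
qed

text \<open>Only points and edges lie over a graph, and edges meet only in their end points. A
  cocone therefore amounts to a value for each state and, independently, an action for each
  edge.\<close>

lemma free_graph_colimit:
  assumes G: "G \<in> Obj RTS" "graph G"
  shows "cube_diagram_colimit G (free_graph G) (free_leg G)"
proof -
  have GW: "G \<in> Obj WTS" "weak_transition_system G" "regular G" using G by (simp_all add: Obj_RTS Obj_WTS)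
  let ?F = "free_graph G"
  have F: "?F \<in> Obj WTS" using free_graph_Obj[OF GW(1)] by (simp add: Obj_RTS)
  note lH = free_leg_Hom[OF GW(1) G(2)]
  have "cube_diagram_cocone G ?F (free_leg G)"
    unfolding is_cocone_def
  proof (intro conjI ballI, goal_cases)
    case (3 x)
    then obtain c \<phi> d where x: "x = (c, \<phi>, d)" and m: "(c, \<phi>, d) \<in> cubes_over_maps G" by (cases x) auto
    have c: "c \<in> cubes_over G" and d: "d \<in> cubes_over G" and phi: "\<phi> \<in> Hom WTS (source c) (source d)"
      using cubes_over_maps_Hom[OF m] by blast+
    have e: "Comp WTS d \<phi> = c" using m by (simp add: cubes_over_maps_def)
    have es: "on_states d (on_states \<phi> s) = on_states c s" if "s \<in> states (source c)" for s
      using Comp_states[OF phi that, of d] e by simp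
    have ea: "on_actions d (on_actions \<phi> s) = on_actions c s" if "s \<in> actions (source c)" for s
      using Comp_actions[OF phi that, of d] e by simp
    have "Comp WTS (free_leg G d) \<phi> = free_leg G c"
    proof (rule Comp_eqI[OF phi lH[OF d] lH[OF c]])
      fix s assume "s \<in> states (source c)"
      then show "on_states (free_leg G d) (on_states \<phi> s) = on_states (free_leg G c) s"
        using es Hom_hom(1)[OF phi] by (simp add: free_leg_def)
    next
      fix a assume a: "a \<in> actions (source c)"
      note t = graph_cube_edge[OF G(2) c a]
      note w = weakD[OF HomD_WTS(6)[OF phi] t]
      \<comment> \<open>A map between 1-cubes sends the only transition to the only transition, so
        it preserves end points and the code of an edge does not depend on the cube presenting
        it.\<close>
      have "on_states \<phi> (enc [False]) = enc [False]" "on_states \<phi> (enc [True]) = enc [True]"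
        using graph_cube_transition[OF G(2) d Hom_hom(4)[OF phi t]] by blast+
      then have "on_states d (enc [False]) = on_states c (enc [False])" "on_states d (enc [True]) = on_states c (enc [True])"
        using es[OF w(1)] es[OF w(4)] by simp_all
      then show "on_actions (free_leg G d) (on_actions \<phi> a) = on_actions (free_leg G c) a"
        using ea[OF a] a Hom_hom(2)[OF phi a] by (simp add: free_leg_def)
    qed
    then show ?case using x by simp
  qed (use F lH in auto)
  moreover have "\<exists>!h. h \<in> Hom WTS ?F Z \<and> (\<forall>c\<in>cubes_over G. Comp WTS h (free_leg G c) = k c)"
    if cc: "cube_diagram_cocone G Z k" for Z k
  proof -
    have Z: "Z \<in> Obj WTS" and k: "\<And>c. c \<in> cubes_over G \<Longrightarrow> k c \<in> Hom WTS (source c) Z"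
      using cc unfolding is_cocone_def by blast+
    define hs where "hs s = on_states (k (point G s)) (enc ([] :: bool list))" for s
    define he where "he \<alpha> u \<beta> = on_actions (k (edge G \<alpha> u \<beta>)) (enc (label G u, 0 :: nat))" for \<alpha> u \<beta>
    define ha where "ha e = (let \<alpha> = fst (inv (enc :: 'u \<times> 'u \<Rightarrow> 'u) e);
        p = inv (enc :: 'u \<times> 'u \<Rightarrow> 'u) (snd (inv (enc :: 'u \<times> 'u \<Rightarrow> 'u) e)) in he \<alpha> (fst p) (snd p))" for e
    have ha: "ha (edge_code \<alpha> u \<beta>) = he \<alpha> u \<beta>" for \<alpha> u \<beta>
      unfolding ha_def edge_code_def by (simp add: inv_f_f[OF inj_enc_pair])
    have hs: "on_states (k c) s = hs (on_states c s)" if "c \<in> cubes_over G" "s \<in> states (source c)" for c s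
      unfolding hs_def by (rule cocone_point[OF GW(1) cc that])
    have he: "on_actions (k c) a = he (on_states c (enc [False])) (on_actions c a) (on_states c (enc [True]))"
      if "c \<in> cubes_over G" "a \<in> actions (source c)" for c a
      unfolding he_def by (rule cocone_edge[OF GW(1) cc that(1) graph_cube_edge[OF G(2) that]])
    have pt: "point G s \<in> cubes_over G" "enc ([] :: bool list) \<in> states (source (point G s))"
      "on_states (point G s) (enc ([] :: bool list)) = s" if "s \<in> states G" for s
      unfolding point_def using cube_map_Hom(2)[OF GW(1) point_hom[OF that]]
      by (simp_all add: cube_map_sel copy_sel cube_sel)
    have ed: "edge G \<alpha> u \<beta> \<in> cubes_over G" "enc (label G u, 0 :: nat) \<in> actions (source (edge G \<alpha> u \<beta>))"
      "on_states (edge G \<alpha> u \<beta>) (enc [False]) = \<alpha>" "on_states (edge G \<alpha> u \<beta>) (enc [True]) = \<beta>"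
      "on_actions (edge G \<alpha> u \<beta>) (enc (label G u, 0 :: nat)) = u"
      if t: "(\<alpha>, [u], \<beta>) \<in> transitions G" for \<alpha> u \<beta>
    proof -
      have m: "(label G u, 0) \<in> actions (cube [label G u])" by (simp add: cube_sel)
      show "edge G \<alpha> u \<beta> \<in> cubes_over G" unfolding edge_def by (rule cube_map_Hom(2)[OF GW(1) edge_hom[OF GW(2) t]])
      show "enc (label G u, 0 :: nat) \<in> actions (source (edge G \<alpha> u \<beta>))"
        using m by (simp add: edge_def cube_map_sel copy_sel)
      show "on_states (edge G \<alpha> u \<beta>) (enc [False]) = \<alpha>" "on_states (edge G \<alpha> u \<beta>) (enc [True]) = \<beta>"
        by (simp_all add: edge_def cube_map_sel)
      show "on_actions (edge G \<alpha> u \<beta>) (enc (label G u, 0 :: nat)) = u"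
        unfolding edge_def by (rule cube_map_sel(2)[OF m])
    qed
    have hom: "ts_hom ?F Z hs ha"
    proof (rule ts_homI)
      fix s assume "s \<in> states ?F"
      then have s: "s \<in> states G" by (simp add: free_graph_sel)
      show "hs s \<in> states Z" unfolding hs_def by (rule Hom_hom(1)[OF k[OF pt(1)[OF s]] pt(2)[OF s]])
    next
      fix e assume "e \<in> actions ?F"
      then obtain \<alpha> u \<beta> where e: "e = edge_code \<alpha> u \<beta>" and t: "(\<alpha>, [u], \<beta>) \<in> transitions G"
        unfolding free_graph_sel by blast
      have "label Z (he \<alpha> u \<beta>) = label (source (edge G \<alpha> u \<beta>)) (enc (label G u, 0 :: nat))"
        unfolding he_def by (rule Hom_hom(3)[OF k[OF ed(1)[OF t]] ed(2)[OF t]])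
      also have "\<dots> = label G u"
        using Hom_hom(3)[OF cubes_over_Hom[OF ed(1)[OF t]] ed(2)[OF t]] ed(5)[OF t] by simp
      finally show "label Z (ha e) = label ?F e" unfolding e ha free_graph_sel(4)[OF t] .
      show "ha e \<in> actions Z" unfolding e ha he_def by (rule Hom_hom(2)[OF k[OF ed(1)[OF t]] ed(2)[OF t]])
    next
      fix \<alpha> us \<beta> assume "(\<alpha>, us, \<beta>) \<in> transitions ?F"
      then obtain u where us: "us = [edge_code \<alpha> u \<beta>]" and t: "(\<alpha>, [u], \<beta>) \<in> transitions G"
        unfolding free_graph_sel by blast
      note E = graph_cube_edge[OF G(2) ed(1)[OF t] ed(2)[OF t]]
      note w = weakD[OF HomD_WTS(6)[OF k[OF ed(1)[OF t]]] E]
      from Hom_hom(4)[OF k[OF ed(1)[OF t]] E]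
      have "(on_states (k (edge G \<alpha> u \<beta>)) (enc [False]), [he \<alpha> u \<beta>], on_states (k (edge G \<alpha> u \<beta>)) (enc [True])) \<in> transitions Z"
        by (simp add: he_def)
      then show "(hs \<alpha>, map ha us, hs \<beta>) \<in> transitions Z"
        using hs[OF ed(1)[OF t] w(1)] hs[OF ed(1)[OF t] w(4)] ed(3,4)[OF t] by (simp add: us ha)
    qed
    let ?h = "mk ?F Z hs ha"
    have h: "?h \<in> Hom WTS ?F Z" by (rule mk_Hom[OF F Z hom])
    show ?thesis
    proof (rule ex1I[of _ ?h])
      have "Comp WTS ?h (free_leg G c) = k c" if c: "c \<in> cubes_over G" for c
      proof (rule Comp_eqI[OF lH[OF c] h k[OF c]])
        fix s assume s: "s \<in> states (source c)"
        then show "on_states ?h (on_states (free_leg G c) s) = on_states (k c) s"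
          using hs[OF c s] Hom_hom(1)[OF lH[OF c] s] by (simp add: free_leg_def)
      next
        fix a assume a: "a \<in> actions (source c)"
        then show "on_actions ?h (on_actions (free_leg G c) a) = on_actions (k c) a"
          using he[OF c a] Hom_hom(2)[OF lH[OF c] a] by (simp add: free_leg_def ha)
      qed
      with h show "?h \<in> Hom WTS ?F Z \<and> (\<forall>c\<in>cubes_over G. Comp WTS ?h (free_leg G c) = k c)" by blast
      fix h' assume h': "h' \<in> Hom WTS ?F Z \<and> (\<forall>c\<in>cubes_over G. Comp WTS h' (free_leg G c) = k c)"
      have h's: "on_states h' (on_states (free_leg G c) s) = on_states (k c) s" if "c \<in> cubes_over G" "s \<in> states (source c)" for c s
        using Comp_states[OF lH[OF that(1)] that(2), of h'] h' that by simp
      have h'a: "on_actions h' (on_actions (free_leg G c) s) = on_actions (k c) s" if "c \<in> cubes_over G" "s \<in> actions (source c)" for c s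
        using Comp_actions[OF lH[OF that(1)] that(2), of h'] h' that by simp
      show "h' = ?h"
      proof (rule Hom_eqI[OF conjunct1[OF h'] h])
        fix s assume "s \<in> states ?F"
        then have s: "s \<in> states G" by (simp add: free_graph_sel)
        show "on_states h' s = on_states ?h s"
          using h's[OF pt(1,2)[OF s]] hs[OF pt(1,2)[OF s]] pt(2,3)[OF s] s by (simp add: free_leg_def free_graph_sel)
      next
        fix e assume eF: "e \<in> actions ?F"
        then obtain \<alpha> u \<beta> where e: "e = edge_code \<alpha> u \<beta>" and t: "(\<alpha>, [u], \<beta>) \<in> transitions G"
          unfolding free_graph_sel by blast
        show "on_actions h' e = on_actions ?h e"
          using h'a[OF ed(1,2)[OF t]] he[OF ed(1,2)[OF t]] ed(2-5)[OF t] eF by (simp add: free_leg_def e ha)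
      qed
    qed
  qed
  ultimately show ?thesis unfolding is_colimit_def by blast
qed

text \<open>On free graphs \<open>g\<close> induces a trivial fibration: several edges of
  \<open>G\<close> may be sent to one edge of \<open>H\<close>, which merely duplicates an action.
  Composing with the identifications of both cubifications shows that \<open>Cub_map g\<close> lifts
  against all cofibrations, so it belongs to every localizer.\<close>

lemma graph_Cub_equivalence:
  fixes g :: "('u, 'l) ts_map"
  assumes g: "g \<in> Hom RTS G H" and gr: "graph G" "graph H"
    and bij: "bij_betw (on_states g) (states G) (states H)"
    and edges: "\<And>\<alpha> v \<beta>. (\<alpha>, [v], \<beta>) \<in> transitions H \<Longrightarrow>
      \<exists>\<alpha>' u \<beta>'. (\<alpha>', [u], \<beta>') \<in> transitions G \<and> \<alpha> = on_states g \<alpha>' \<and> v = on_actions g u \<and> \<beta> = on_states g \<beta>'"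
  shows "g \<in> Cub_equivalences"
proof -
  have gW: "g \<in> Hom WTS G H" and GH: "G \<in> Obj RTS" "H \<in> Obj RTS" using g by (auto simp: Hom_RTS Hom_WTS Obj_RTS)
  have GHW: "G \<in> Obj WTS" "H \<in> Obj WTS" using GH by (simp_all add: Obj_RTS)
  let ?F = "\<lambda>G. free_graph G"
  have F: "?F G \<in> Obj RTS" "?F H \<in> Obj RTS" using free_graph_Obj GHW by blast+
  define f where "f e = edge_code (on_states g (fst (inv (enc :: 'u \<times> 'u \<Rightarrow> 'u) e))) (on_actions g (edge_action e))
      (on_states g (snd (inv (enc :: 'u \<times> 'u \<Rightarrow> 'u) (snd (inv (enc :: 'u \<times> 'u \<Rightarrow> 'u) e)))))" for e
  have f: "f (edge_code \<alpha> u \<beta>) = edge_code (on_states g \<alpha>) (on_actions g u) (on_states g \<beta>)" for \<alpha> u \<beta>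
    unfolding f_def by simp (simp add: edge_code_def inv_f_f[OF inj_enc_pair])
  have t: "(on_states g \<alpha>, [on_actions g u], on_states g \<beta>) \<in> transitions H" if "(\<alpha>, [u], \<beta>) \<in> transitions G" for \<alpha> u \<beta>
    using Hom_hom(4)[OF gW that] by simp
  have lb: "label H (on_actions g u) = label G u" if "(\<alpha>, [u], \<beta>) \<in> transitions G" for \<alpha> u \<beta>
    using Hom_hom(3)[OF gW] weakD(3)[OF HomD_WTS(6)[OF gW] that] by simp
  let ?f = "mk (?F G) (?F H) (on_states g) f"
  have hom: "ts_hom (?F G) (?F H) (on_states g) f"
  proof (rule ts_homI)
    fix e assume "e \<in> actions (?F G)"
    then obtain \<alpha> u \<beta> where e: "e = edge_code \<alpha> u \<beta>" "(\<alpha>, [u], \<beta>) \<in> transitions G" unfolding free_graph_sel by blast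
    show "f e \<in> actions (?F H)" unfolding e(1) f free_graph_sel using t[OF e(2)] by blast
    show "label (?F H) (f e) = label (?F G) e"
      unfolding e(1) f free_graph_sel(4)[OF e(2)] free_graph_sel(4)[OF t[OF e(2)]] by (rule lb[OF e(2)])
  qed (use Hom_hom(1)[OF gW] t f in \<open>auto simp: free_graph_sel\<close>)
  have fR: "?f \<in> Hom RTS (?F G) (?F H)" by (rule mk_Hom_RTS[OF F hom])
  then have fW: "?f \<in> Hom WTS (?F G) (?F H)" by (simp add: Hom_RTS)
  have tf: "?f \<in> trivial_fibrations"
  proof (rule trivial_fibrationI[OF fR])
    show "bij_betw (on_states ?f) (states (?F G)) (states (?F H))"
      using bij by (subst bij_betw_cong[of _ _ "on_states g"]) (simp_all add: free_graph_sel)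
    show "on_actions ?f ` actions (?F G) = actions (?F H)"
    proof
      show "on_actions ?f ` actions (?F G) \<subseteq> actions (?F H)" using Hom_hom(2)[OF fW] by blast
      show "actions (?F H) \<subseteq> on_actions ?f ` actions (?F G)"
      proof
        fix e assume "e \<in> actions (?F H)"
        then obtain \<alpha> v \<beta> where e: "e = edge_code \<alpha> v \<beta>" "(\<alpha>, [v], \<beta>) \<in> transitions H" unfolding free_graph_sel by blast
        obtain \<alpha>' u \<beta>' where u: "(\<alpha>', [u], \<beta>') \<in> transitions G" "\<alpha> = on_states g \<alpha>'" "v = on_actions g u" "\<beta> = on_states g \<beta>'"
          using edges[OF e(2)] by blast
        have "edge_code \<alpha>' u \<beta>' \<in> actions (?F G)" using u(1) by (auto simp: free_graph_sel)
        moreover from this have "on_actions ?f (edge_code \<alpha>' u \<beta>') = e" by (simp add: f e(1) u)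
        ultimately show "e \<in> on_actions ?f ` actions (?F G)" by blast
      qed
    qed
    fix \<alpha> w \<beta> assume s: "\<alpha> \<in> states (?F G)" "\<beta> \<in> states (?F G)" and w: "set w \<subseteq> actions (?F G)"
      and tr: "(on_states ?f \<alpha>, map (on_actions ?f) w, on_states ?f \<beta>) \<in> transitions (?F H)"
    obtain v where v: "map (on_actions ?f) w = [edge_code (on_states ?f \<alpha>) v (on_states ?f \<beta>)]"
      using iffD1[OF free_graph_sel(3) tr] by (elim exE conjE) (rule that)
    then obtain e where e: "w = [e]" "on_actions ?f e = edge_code (on_states ?f \<alpha>) v (on_states ?f \<beta>)" by auto
    have "e \<in> actions (?F G)" using w e(1) by simp
    then obtain \<alpha>' u \<beta>' where u: "e = edge_code \<alpha>' u \<beta>'" "(\<alpha>', [u], \<beta>') \<in> transitions G" unfolding free_graph_sel by blast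
    \<comment> \<open>In a free graph an action knows its end points. Comparing codes in
      \<open>H\<close> and using injectivity on states, the action \<open>e\<close> must join
      \<open>\<alpha>\<close> to \<open>\<beta>\<close>.\<close>
    have "edge_code (on_states g \<alpha>') (on_actions g u) (on_states g \<beta>') = edge_code (on_states g \<alpha>) v (on_states g \<beta>)"
      using e(2) \<open>e \<in> actions (?F G)\<close> s by (simp add: u(1) f)
    then have "on_states g \<alpha>' = on_states g \<alpha>" "on_states g \<beta>' = on_states g \<beta>" by (simp_all add: edge_code_eq)
    then have "\<alpha>' = \<alpha>" "\<beta>' = \<beta>"
      using bij s weakD(1,4)[OF HomD_WTS(6)[OF gW] u(2)] unfolding bij_betw_def inj_on_def free_graph_sel by blast+
    then show "(\<alpha>, w, \<beta>) \<in> transitions (?F G)" using e(1) u by (auto simp: free_graph_sel)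
  qed
  note colF = free_graph_colimit[OF GH(1) gr(1)] free_graph_colimit[OF GH(2) gr(2)]
  note colC = Cub_colimit[OF GHW(1)] Cub_colimit[OF GHW(2)]
  obtain a b where ab: "a \<in> Hom WTS (?F G) (Cub G)" "b \<in> Hom WTS (Cub G) (?F G)" "Comp WTS b a = Ident WTS (?F G)"
    "Comp WTS a b = Ident WTS (Cub G)" and b: "\<And>c. c \<in> cubes_over G \<Longrightarrow> Comp WTS b (leg G c) = free_leg G c"
    by (rule WTS.colimit_comparison[OF colF(1) colC(1)]) (erule cubes_over_maps_Hom, rule that)
  obtain a' b' where ab': "a' \<in> Hom WTS (?F H) (Cub H)" "b' \<in> Hom WTS (Cub H) (?F H)" "Comp WTS b' a' = Ident WTS (?F H)"
    "Comp WTS a' b' = Ident WTS (Cub H)" and a': "\<And>c. c \<in> cubes_over H \<Longrightarrow> Comp WTS a' (free_leg H c) = leg H c"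
    by (rule WTS.colimit_comparison[OF colF(2) colC(2)]) (erule cubes_over_maps_Hom, rule that)
  have regF: "regular (?F G)" "regular (?F H)" using F by (simp_all add: Obj_RTS)
  have regC: "regular (Cub G)" "regular (Cub H)" using regular_iso[OF regF(1) ab] regular_iso[OF regF(2) ab'] .
  have bR: "b \<in> Hom RTS (Cub G) (?F G)" and a'R: "a' \<in> Hom RTS (?F H) (Cub H)"
    using ab(2) ab'(1) regC regF by (simp_all add: Hom_RTS)
  have "RTS.iso b" by (rule RTS.isoI[OF bR, of a]) (use ab regC regF in \<open>simp_all add: Hom_RTS\<close>)
  moreover have "RTS.iso a'" by (rule RTS.isoI[OF a'R, of b']) (use ab' regC regF in \<open>simp_all add: Hom_RTS\<close>)
  moreover have CA: "(action_injections :: ('u, 'l) ts_map set) \<subseteq> Arr RTS" by (auto simp: action_injections_def)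
  ultimately have btf: "b \<in> rlp RTS action_injections" "a' \<in> rlp RTS action_injections" by (simp_all add: RTS.iso_rlp)
  have ftf: "?f \<in> rlp RTS action_injections" using tf by (simp add: rlp_action_injections)
  have fb: "Comp RTS ?f b \<in> rlp RTS action_injections" by (rule RTS.rlp_comp[OF bR btf(1) fR ftf CA])
  have fbR: "Comp RTS ?f b \<in> Hom RTS (Cub G) (?F H)" by (rule RTS.Comp_Hom[OF bR fR])
  have afb: "Comp RTS a' (Comp RTS ?f b) \<in> rlp RTS action_injections"
    by (rule RTS.rlp_comp[OF fbR fb a'R btf(2) CA])
  have fbW: "Comp WTS ?f b \<in> Hom WTS (Cub G) (?F H)" using fbR by (simp add: Hom_RTS)
  have "Cub_map g = Comp WTS a' (Comp WTS ?f b)"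
  proof (rule Cub_eqI[OF GHW(1) Cub_map(1)[OF gW] Comp_Hom_WTS[OF fbW ab'(1)]])
    fix c assume c: "c \<in> cubes_over G"
    note l = leg_Hom[OF GHW(1) c] and gc = Comp_cubes_over[OF gW c] and cH = cubes_over_Hom[OF c]
    have fl: "Comp WTS ?f (free_leg G c) = free_leg H (Comp WTS g c)"
    proof (rule Comp_eqI[OF free_leg_Hom[OF GHW(1) gr(1) c] fW])
      show "free_leg H (Comp WTS g c) \<in> Hom WTS (source c) (?F H)"
        using free_leg_Hom[OF GHW(2) gr(2) gc(1)] gc(2) by simp
      show "on_states ?f (on_states (free_leg G c) s) = on_states (free_leg H (Comp WTS g c)) s" if s: "s \<in> states (source c)" for s
        using s Hom_hom(1)[OF cH s] gc(2) Comp_states[OF cH s, of g] by (simp add: free_leg_def free_graph_sel)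
      fix u assume u: "u \<in> actions (source c)"
      note e = graph_cube_edge[OF gr(1) c u]
      note w = weakD[OF HomD_WTS(6)[OF cH] e]
      have "on_actions (free_leg G c) u \<in> actions (?F G)" by (rule Hom_hom(2)[OF free_leg_Hom[OF GHW(1) gr(1) c] u])
      then show "on_actions ?f (on_actions (free_leg G c) u) = on_actions (free_leg H (Comp WTS g c)) u"
        using u gc(2) Comp_actions[OF cH u, of g] Comp_states[OF cH w(1), of g] Comp_states[OF cH w(4), of g]
        by (simp add: free_leg_def f)
    qed
    have "Comp WTS (Comp WTS a' (Comp WTS ?f b)) (leg G c) = Comp WTS a' (Comp WTS ?f (Comp WTS b (leg G c)))"
      using WTS.Comp_assoc[OF l fbW ab'(1)] WTS.Comp_assoc[OF l ab(2) fW] by simp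
    also have "\<dots> = leg H (Comp WTS g c)" using b[OF c] fl a'[OF gc(1)] by simp
    finally show "Comp WTS (Cub_map g) (leg G c) = Comp WTS (Comp WTS a' (Comp WTS ?f b)) (leg G c)"
      using Cub_map(2)[OF gW c] by simp
  qed
  then have "Cub_map g \<in> rlp RTS action_injections" using afb by simp
  then have "Cub_map g \<in> smallest_localizer RTS (small_ordinals :: 'u rel set) action_injections {}"
    unfolding smallest_localizer_def grothendieck_localizer_def by blast
  then show ?thesis
    unfolding Cub_equivalences_def left_determined_def Let_def cofibrations_generated
    using g by (simp add: Hom_def)
qed

end

section \<open>Reflections belong to every localizer containing the cubification equivalences\<close>

definition skeleton :: "('s, 'a, 'l) transition_system \<Rightarrow> ('s, 'a, 'l) transition_system" where
  "skeleton X = X\<lparr>transitions := {(\<alpha>, w, \<beta>) \<in> transitions X. length w = 1}\<rparr>"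

lemma skeleton_sel [simp]:
  "states (skeleton X) = states X" "actions (skeleton X) = actions X" "label (skeleton X) = label X"
  "(\<alpha>, w, \<beta>) \<in> transitions (skeleton X) \<longleftrightarrow> (\<alpha>, w, \<beta>) \<in> transitions X \<and> length w = 1"
  by (simp_all add: skeleton_def)

lemma graph_skeleton: "graph (skeleton X)"
  unfolding graph_def by (auto simp: length_Suc_conv)

lemma skeleton_Obj:
  assumes "X \<in> Obj RTS"
  shows "skeleton X \<in> Obj RTS"
proof -
  have X: "weak_transition_system X" "regular X" "small (states X)" "small (actions X)"
    using assms by (simp_all add: Obj_RTS Obj_WTS)
  have 1: "\<alpha> \<in> states X \<and> \<beta> \<in> states X \<and> (\<exists>u\<in>actions X. w = [u])"
    if "(\<alpha>, w, \<beta>) \<in> transitions (skeleton X)" for \<alpha> w \<beta>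
    using that weakD[OF X(1), of \<alpha> w \<beta>] by (auto simp: length_Suc_conv)
  have 2: "\<exists>\<alpha> \<beta>. (\<alpha>, [u], \<beta>) \<in> transitions (skeleton X)" if "u \<in> actions X" for u
    using X(2) that unfolding regular_def by simp
  have 3: "label X \<in> extensional (actions X)" using X(1) unfolding weak_transition_system_def by blast
  have "weak_transition_system (skeleton X)" "regular (skeleton X)"
    by (rule edges_regular[of "skeleton X", unfolded skeleton_sel(1-3), OF 1 2 3]; assumption)+
  then show ?thesis using X(3,4) by (simp add: Obj_RTS Obj_WTS)
qed

lemma skeleton_inclusion:
  assumes "X \<in> Obj RTS"
  shows "mk (skeleton X) X (\<lambda>s. s) (\<lambda>u. u) \<in> Hom RTS (skeleton X) X"
  by (rule mk_Hom_RTS[OF skeleton_Obj[OF assms] assms]) (auto intro: ts_homI)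

text \<open>The states of \<open>X\<close> are kept although the actions are those of
  \<open>K\<close>: cubification inverts maps of graphs that are bijective on states, and the
  reflection may identify states.\<close>

definition edge_image :: "('u, 'l) ts \<Rightarrow> ('u, 'l) ts \<Rightarrow> ('u \<Rightarrow> 'u) \<Rightarrow> ('u, 'l) ts" where
  "edge_image X K g = K\<lparr>states := states X, transitions := {(\<alpha>, [g u], \<beta>) | \<alpha> u \<beta>. (\<alpha>, [u], \<beta>) \<in> transitions X}\<rparr>"

lemma edge_image_sel [simp]:
  "states (edge_image X K g) = states X" "actions (edge_image X K g) = actions K" "label (edge_image X K g) = label K"
  "(\<alpha>, w, \<beta>) \<in> transitions (edge_image X K g) \<longleftrightarrow> (\<exists>u. w = [g u] \<and> (\<alpha>, [u], \<beta>) \<in> transitions X)"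
  by (auto simp: edge_image_def)

lemma edge_image_Obj:
  assumes X: "X \<in> Obj RTS" and K: "K \<in> Obj RTS" and g: "g ` actions X = actions K"
  shows "edge_image X K g \<in> Obj RTS"
proof -
  have XW: "weak_transition_system X" "regular X" "small (states X)" and KW: "weak_transition_system K" "small (actions K)"
    using X K by (simp_all add: Obj_RTS Obj_WTS)
  have 1: "\<alpha> \<in> states X \<and> \<beta> \<in> states X \<and> (\<exists>u\<in>actions K. w = [u])"
    if "(\<alpha>, w, \<beta>) \<in> transitions (edge_image X K g)" for \<alpha> w \<beta>
    using that weakD[OF XW(1)] g by fastforce
  have 2: "\<exists>\<alpha> \<beta>. (\<alpha>, [u], \<beta>) \<in> transitions (edge_image X K g)" if "u \<in> actions K" for u
    using XW(2) that g unfolding regular_def by fastforce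
  have 3: "label K \<in> extensional (actions K)" using KW(1) unfolding weak_transition_system_def by blast
  have "weak_transition_system (edge_image X K g)" "regular (edge_image X K g)"
    by (rule edges_regular[of "edge_image X K g", unfolded edge_image_sel(1-3), OF 1 2 3]; assumption)+
  then show ?thesis using XW(3) KW(2) by (simp add: Obj_RTS Obj_WTS)
qed

lemma Ident_trivial_fibration:
  assumes "X \<in> Obj RTS"
  shows "Ident RTS X \<in> trivial_fibrations"
proof (rule trivial_fibrationI[OF RTS.Ident_Hom[OF assms]])
  show "bij_betw (on_states (Ident RTS X)) (states X) (states X)" by (auto simp: bij_betw_def inj_on_def)
  show "on_actions (Ident RTS X) ` actions X = actions X" by auto
  fix \<alpha> w \<beta> assume s: "\<alpha> \<in> states X" "\<beta> \<in> states X" "set w \<subseteq> actions X"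
    and t: "(on_states (Ident RTS X) \<alpha>, map (on_actions (Ident RTS X)) w, on_states (Ident RTS X) \<beta>) \<in> transitions X"
  have "map (on_actions (Ident RTS X)) w = w" using s(3) by (intro map_idI) auto
  with t s show "(\<alpha>, w, \<beta>) \<in> transitions X" by simp
qed

context small_universe
begin

section \<open>Pairs of actions with the same label\<close>

definition label_pairs :: "('u, 'l) ts \<Rightarrow> 'u set" where
  "label_pairs X = enc ` {(u, v). u \<in> actions X \<and> v \<in> actions X \<and> label X u = label X v}"

definition pfst :: "'u \<Rightarrow> 'u" where "pfst d = fst (inv (enc :: 'u \<times> 'u \<Rightarrow> 'u) d)"
definition psnd :: "'u \<Rightarrow> 'u" where "psnd d = snd (inv (enc :: 'u \<times> 'u \<Rightarrow> 'u) d)"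

lemma pfst_enc [simp]: "pfst (enc (u, v)) = u" and psnd_enc [simp]: "psnd (enc (u, v)) = v"
  by (simp_all add: pfst_def psnd_def inv_f_f[OF inj_enc_pair])

lemma label_pairs_iff: "enc (u, v) \<in> label_pairs X \<longleftrightarrow> u \<in> actions X \<and> v \<in> actions X \<and> label X u = label X v"
  unfolding label_pairs_def by (auto simp: inj_eq[OF inj_enc_pair] image_iff)

lemma label_pairsE:
  assumes "d \<in> label_pairs X"
  obtains u v where "d = enc (u, v)" "u \<in> actions X" "v \<in> actions X" "label X u = label X v"
  using assms unfolding label_pairs_def by auto

lemma label_pairsD:
  assumes "d \<in> label_pairs X"
  shows "d = enc (pfst d, psnd d)" "pfst d \<in> actions X" "psnd d \<in> actions X" "label X (pfst d) = label X (psnd d)"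
  using assms by (auto elim!: label_pairsE)

lemma pfst_image: "pfst ` label_pairs X = actions X" and psnd_image: "psnd ` label_pairs X = actions X"
proof -
  have "u \<in> pfst ` label_pairs X" "u \<in> psnd ` label_pairs X" if "u \<in> actions X" for u
    using that label_pairs_iff[of u u X] by (force simp: image_iff)+
  then show "pfst ` label_pairs X = actions X" "psnd ` label_pairs X = actions X"
    using label_pairsD by blast+
qed

lemma small_label_pairs: "X \<in> Obj RTS \<Longrightarrow> small (label_pairs X)"
  by (rule small_subset[of "enc ` (actions X \<times> actions X)"])
    (auto simp: label_pairs_def Obj_RTS Obj_WTS intro: small_image_Times)

text \<open>The first component governs the transitions; the second is a spare name under which an
  action can later be glued elsewhere. Reading second components need not give a map to
  \<open>X\<close>, and this is the exchange of actions that the reflection demands.\<close>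

abbreviation doubled :: "('u, 'l) ts \<Rightarrow> ('u, 'l) ts" where
  "doubled X \<equiv> expand X (label_pairs X) pfst"

lemma label_pairs_skeleton [simp]: "label_pairs (skeleton X) = label_pairs X"
  by (simp add: label_pairs_def)

lemma doubled_Obj: "X \<in> Obj RTS \<Longrightarrow> doubled X \<in> Obj RTS"
  by (rule expand_Obj[OF _ pfst_image small_label_pairs])

abbreviation diagonal :: "('u, 'l) ts \<Rightarrow> ('u, 'l) ts \<Rightarrow> ('u, 'l) ts_map" where
  "diagonal X Y \<equiv> mk X Y (\<lambda>s. s) (\<lambda>u. enc (u, u))"

lemma diagonal_word:
  "set w \<subseteq> actions X \<Longrightarrow> set (map (\<lambda>u. enc (u, u)) w) \<subseteq> label_pairs X \<and> map pfst (map (\<lambda>u. enc (u, u)) w) = w"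
  by (auto simp: label_pairs_iff comp_def)

lemma diagonal_Hom:
  assumes X: "X \<in> Obj RTS"
  shows "diagonal X (doubled X) \<in> Hom RTS X (doubled X)"
proof (rule mk_Hom_RTS[OF X doubled_Obj[OF X]], rule ts_homI)
  have XW: "weak_transition_system X" using X by (simp add: Obj_RTS Obj_WTS)
  fix \<alpha> us \<beta> assume t: "(\<alpha>, us, \<beta>) \<in> transitions X"
  with diagonal_word[OF weakD(3)[OF XW t]]
  show "(\<alpha>, map (\<lambda>u. enc (u, u)) us, \<beta>) \<in> transitions (doubled X)" by (simp del: map_map)
qed (auto simp: label_pairs_iff)

text \<open>Edges may be renamed within labels, longer transitions not at all. Second components
  therefore define a map from here to any quotient of \<open>X\<close> whose edges are
  saturated.\<close>

definition partly_doubled :: "('u, 'l) ts \<Rightarrow> ('u, 'l) ts" where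
  "partly_doubled X = (doubled X)\<lparr>transitions :=
     {(\<alpha>, w, \<beta>) \<in> transitions (doubled X). length w = 1 \<or> (\<forall>d\<in>set w. pfst d = psnd d)}\<rparr>"

lemma partly_doubled_sel [simp]:
  "states (partly_doubled X) = states X" "actions (partly_doubled X) = label_pairs X"
  "label (partly_doubled X) = label (doubled X)"
  "(\<alpha>, w, \<beta>) \<in> transitions (partly_doubled X) \<longleftrightarrow> set w \<subseteq> label_pairs X \<and> (\<alpha>, map pfst w, \<beta>) \<in> transitions X \<and>
     (length w = 1 \<or> (\<forall>d\<in>set w. pfst d = psnd d))"
  by (auto simp: partly_doubled_def)

text \<open>A word with a proper splitting has length at least two, so it consists of diagonal
  pairs, and then so do both of its parts.\<close>

lemma partly_doubled_Obj:
  assumes X: "X \<in> Obj RTS"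
  shows "partly_doubled X \<in> Obj RTS"
proof -
  let ?T = "{(\<alpha>, w, \<beta>) \<in> transitions (doubled X). length w = 1 \<or> (\<forall>d\<in>set w. pfst d = psnd d)}"
  have D: "weak_transition_system (doubled X)" "regular (doubled X)" "small (states X)" "small (label_pairs X)"
    using doubled_Obj[OF X] by (simp_all add: Obj_RTS Obj_WTS)
  have "closed_split ?T"
    unfolding closed_split_def
  proof (intro allI impI, elim conjE)
    fix \<alpha> w \<beta> us vs assume t: "(\<alpha>, w, \<beta>) \<in> ?T" and ne: "us \<noteq> []" "vs \<noteq> []" and m: "mset (us @ vs) = mset w"
    have "length (us @ vs) = length w" using m by (rule mset_eq_length)
    then have "length w \<noteq> 1" using ne by (cases us; cases vs) auto
    then have d: "\<forall>d\<in>set w. pfst d = psnd d" and tD: "(\<alpha>, w, \<beta>) \<in> transitions (doubled X)" using t by blast+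
    have "set (us @ vs) = set w" using m by (rule mset_eq_setD)
    then have "\<forall>d\<in>set us. pfst d = psnd d" "\<forall>d\<in>set vs. pfst d = psnd d" using d by auto
    with closed_splitD[OF regular_closed_split[OF D(1,2)] tD ne m]
    show "\<exists>\<nu>. (\<alpha>, us, \<nu>) \<in> ?T \<and> (\<nu>, vs, \<beta>) \<in> ?T" by blast
  qed
  moreover have "perm_closed ?T"
    unfolding perm_closed_def
  proof (intro allI impI, elim conjE)
    fix \<alpha> w \<beta> v assume t: "(\<alpha>, w, \<beta>) \<in> ?T" and m: "mset v = mset w"
    with perm_closedD[OF weak_perm_closed[OF D(1)], of \<alpha> w \<beta> v] mset_eq_setD[OF m] mset_eq_length[OF m]
    show "(\<alpha>, v, \<beta>) \<in> ?T" by simp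
  qed
  moreover have "?T \<subseteq> transitions (doubled X)" by blast
  ultimately have S: "weak_transition_system (subsystem (doubled X) ?T)" "regular (subsystem (doubled X) ?T)"
    using subsystem_regular[OF D(1) regular_unique_split[OF D(1,2)], of ?T] by blast+
  have "(\<exists>\<alpha> \<beta>. (\<alpha>, [u], \<beta>) \<in> ?T) \<longleftrightarrow> u \<in> actions (doubled X)" for u
  proof
    assume "u \<in> actions (doubled X)"
    then obtain \<alpha> \<beta> where "(\<alpha>, [u], \<beta>) \<in> transitions (doubled X)" using D(2) unfolding regular_def by blast
    then have "(\<alpha>, [u], \<beta>) \<in> ?T" by simp
    then show "\<exists>\<alpha> \<beta>. (\<alpha>, [u], \<beta>) \<in> ?T" by blast
  qed auto
  then have "actions (doubled X) = {u. \<exists>\<alpha> \<beta>. (\<alpha>, [u], \<beta>) \<in> ?T}" by blast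
  moreover have "label (doubled X) \<in> extensional (actions (doubled X))"
    using D(1) unfolding weak_transition_system_def by blast
  ultimately have "subsystem (doubled X) ?T = partly_doubled X"
    unfolding partly_doubled_def by (intro subsystem_eq)
  then show ?thesis using S D(3,4) by (simp add: Obj_RTS Obj_WTS)
qed

section \<open>Maps that a localizer must contain\<close>

context
  fixes V :: "('u, 'l) ts_map set"
  assumes loc: "grothendieck_localizer RTS (small_ordinals :: 'u rel set) action_injections V"
begin

lemma localizer_trivial_fibrations: "trivial_fibrations \<subseteq> V"
  and localizer_pushout: "f \<in> V \<Longrightarrow> f \<in> action_injections \<Longrightarrow> is_pushout RTS f g f' g' \<Longrightarrow> f' \<in> V"
  using loc unfolding grothendieck_localizer_def rlp_action_injections by blast+

lemma localizer_comp: "f \<in> Hom RTS a b \<Longrightarrow> g \<in> Hom RTS b c \<Longrightarrow> f \<in> V \<Longrightarrow> g \<in> V \<Longrightarrow> Comp RTS g f \<in> V"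
  and localizer_left: "f \<in> Hom RTS a b \<Longrightarrow> g \<in> Hom RTS b c \<Longrightarrow> f \<in> V \<Longrightarrow> Comp RTS g f \<in> V \<Longrightarrow> g \<in> V"
  and localizer_right: "f \<in> Hom RTS a b \<Longrightarrow> g \<in> Hom RTS b c \<Longrightarrow> g \<in> V \<Longrightarrow> Comp RTS g f \<in> V \<Longrightarrow> f \<in> V"
proof -
  have t: "two_out_of_three RTS V" using loc unfolding grothendieck_localizer_def by blast
  assume "f \<in> Hom RTS a b" "g \<in> Hom RTS b c"
  then have fg: "f \<in> Arr RTS" "g \<in> Arr RTS" "Cod RTS f = Dom RTS g" by (simp_all only: RTS.HomD)
  note * = t[unfolded two_out_of_three_def, rule_format, OF fg]
  show "f \<in> V \<Longrightarrow> g \<in> V \<Longrightarrow> Comp RTS g f \<in> V" "f \<in> V \<Longrightarrow> Comp RTS g f \<in> V \<Longrightarrow> g \<in> V"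
    "g \<in> V \<Longrightarrow> Comp RTS g f \<in> V \<Longrightarrow> f \<in> V" using * by blast+
qed

text \<open>The diagonal is a section of a trivial fibration, so two-out-of-three with an identity
  applies.\<close>

lemma localizer_diagonal:
  assumes X: "X \<in> Obj RTS"
  shows "diagonal X (doubled X) \<in> V"
proof -
  let ?p = "mk (doubled X) X (\<lambda>s. s) pfst"
  have p: "?p \<in> Hom RTS (doubled X) X" "?p \<in> trivial_fibrations"
    using expand_Hom[OF X pfst_image small_label_pairs[OF X]]
      expand_trivial_fibration[OF X pfst_image small_label_pairs[OF X]] .
  note d = diagonal_Hom[OF X]
  have W: "?p \<in> Hom WTS (doubled X) X" "diagonal X (doubled X) \<in> Hom WTS X (doubled X)" "Ident WTS X \<in> Hom WTS X X"
    using p(1) d RTS.Ident_Hom[OF X] by (simp_all add: Hom_RTS)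
  have "Comp WTS ?p (diagonal X (doubled X)) = Ident WTS X"
    by (rule Comp_eqI[OF W(2,1,3)]) (simp_all add: label_pairs_iff)
  then have "Comp RTS ?p (diagonal X (doubled X)) \<in> V"
    using Ident_trivial_fibration[OF X] localizer_trivial_fibrations by auto
  then show ?thesis
    using localizer_right[OF d p(1)] p(2) localizer_trivial_fibrations by blast
qed

text \<open>The diagonal of \<open>X\<close> in the partly doubled system is a pushout of the diagonal of its skeleton.\<close>

lemma localizer_partly_doubled:
  assumes X: "X \<in> Obj RTS"
  shows "mk (partly_doubled X) (doubled X) (\<lambda>s. s) (\<lambda>d. d) \<in> Hom RTS (partly_doubled X) (doubled X) \<inter> V"
proof -
  let ?A = "partly_doubled X" and ?G = "skeleton X"
  have XW: "weak_transition_system X" using X by (simp add: Obj_RTS Obj_WTS)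
  note A = partly_doubled_Obj[OF X] and G = skeleton_Obj[OF X]
  let ?a = "mk ?A (doubled X) (\<lambda>s. s) (\<lambda>d. d)" and ?dA = "diagonal X ?A" and ?dG = "diagonal ?G (doubled ?G)"
    and ?i = "mk ?G X (\<lambda>s. s) (\<lambda>u. u)" and ?j = "mk (doubled ?G) ?A (\<lambda>s. s) (\<lambda>d. d)"
  have a: "?a \<in> Hom RTS ?A (doubled X)"
    by (rule mk_Hom_RTS[OF A doubled_Obj[OF X]], rule ts_homI) auto
  have dA: "?dA \<in> Hom RTS X ?A"
  proof (rule mk_Hom_RTS[OF X A], rule ts_homI)
    fix \<alpha> us \<beta> assume t: "(\<alpha>, us, \<beta>) \<in> transitions X"
    with diagonal_word[OF weakD(3)[OF XW t]]
    show "(\<alpha>, map (\<lambda>u. enc (u, u)) us, \<beta>) \<in> transitions ?A" by (auto simp del: map_map)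
  qed (auto simp: label_pairs_iff)
  note dG = diagonal_Hom[OF G] and i = skeleton_inclusion[OF X]
  have j: "?j \<in> Hom RTS (doubled ?G) ?A"
    by (rule mk_Hom_RTS[OF doubled_Obj[OF G] A], rule ts_homI) auto
  have iW: "?i \<in> Hom WTS ?G X" and dAW: "?dA \<in> Hom WTS X ?A" and dGW: "?dG \<in> Hom WTS ?G (doubled ?G)"
    and jW: "?j \<in> Hom WTS (doubled ?G) ?A" and aW: "?a \<in> Hom WTS ?A (doubled X)"
    using i dA dG j a by (simp_all add: Hom_RTS)
  \<comment> \<open>A transition of \<open>partly_doubled X\<close> is either an edge, coming from
    the doubled skeleton, or a word of diagonal pairs, coming from \<open>X\<close>. A compatible
    pair of maps is thus defined on all of them.\<close>
  have "is_pushout RTS ?dG ?i ?dA ?j"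
  proof (rule RTS.is_pushoutI[OF dG i dA j])
    show "Comp RTS ?j ?dG = Comp RTS ?dA ?i"
      unfolding RTS_WTS
      by (rule Comp_eqI[OF dGW jW Comp_Hom_WTS[OF iW dAW]])
        (simp_all add: Comp_states[OF iW] Comp_actions[OF iW] label_pairs_iff)
    fix Z u v assume u: "u \<in> Hom RTS (doubled ?G) Z" and v: "v \<in> Hom RTS X Z"
      and e: "Comp RTS u ?dG = Comp RTS v ?i"
    have uW: "u \<in> Hom WTS (doubled ?G) Z" and vW: "v \<in> Hom WTS X Z" using u v by (simp_all add: Hom_RTS)
    have es: "on_states u s = on_states v s" if "s \<in> states X" for s
      using Comp_eqD(1)[OF e[unfolded RTS_WTS] dGW iW, of s] that by simp
    have ea: "on_actions u (enc (x, x)) = on_actions v x" if "x \<in> actions X" for x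
      using Comp_eqD(2)[OF e[unfolded RTS_WTS] dGW iW, of x] that by simp
    have hom: "ts_hom ?A Z (on_states v) (on_actions u)"
    proof (rule ts_homI)
      fix s assume "s \<in> states ?A" then show "on_states v s \<in> states Z" using Hom_hom(1)[OF vW] by simp
    next
      fix d assume d: "d \<in> actions ?A"
      then show "on_actions u d \<in> actions Z" using Hom_hom(2)[OF uW] by simp
      show "label Z (on_actions u d) = label ?A d" using d Hom_hom(3)[OF uW, of d] by simp
    next
      fix \<alpha> w \<beta> assume t: "(\<alpha>, w, \<beta>) \<in> transitions ?A"
      then have w: "set w \<subseteq> label_pairs X" "(\<alpha>, map pfst w, \<beta>) \<in> transitions X" by auto
      have st: "\<alpha> \<in> states X" "\<beta> \<in> states X" using weakD[OF XW w(2)] by auto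
      from t consider "length w = 1" | "\<forall>d\<in>set w. pfst d = psnd d" by auto
      then show "(on_states v \<alpha>, map (on_actions u) w, on_states v \<beta>) \<in> transitions Z"
      proof cases
        case 1
        then have "(\<alpha>, w, \<beta>) \<in> transitions (doubled ?G)" using w by simp
        from Hom_hom(4)[OF uW this] show ?thesis using es st by simp
      next
        case 2
        have *: "map (on_actions u) w = map (on_actions v) (map pfst w)"
          unfolding map_map
        proof (rule map_cong[OF refl])
          fix d assume d: "d \<in> set w"
          then have "d \<in> label_pairs X" using w(1) by blast
          then have "d = enc (pfst d, pfst d)" "pfst d \<in> actions X" using label_pairsD 2 d by metis+
          then show "on_actions u d = (on_actions v \<circ> pfst) d" using ea by (metis comp_apply)
        qed
        show ?thesis using Hom_hom(4)[OF vW w(2)] by (simp only: *)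
      qed
    qed
    have h: "mk ?A Z (on_states v) (on_actions u) \<in> Hom RTS ?A Z"
      by (rule mk_Hom_RTS[OF A RTS.Hom_Obj(2)[OF v] hom])
    then have hW: "mk ?A Z (on_states v) (on_actions u) \<in> Hom WTS ?A Z" by (simp add: Hom_RTS)
    show "\<exists>h\<in>Hom RTS ?A Z. Comp RTS h ?j = u \<and> Comp RTS h ?dA = v"
    proof (intro bexI[OF _ h] conjI; unfold RTS_WTS)
      show "Comp WTS (mk ?A Z (on_states v) (on_actions u)) ?j = u"
        by (rule Comp_eqI[OF jW hW uW]) (simp_all add: es)
      show "Comp WTS (mk ?A Z (on_states v) (on_actions u)) ?dA = v"
        by (rule Comp_eqI[OF dAW hW vW]) (simp_all add: ea label_pairs_iff)
    qed
  next
    fix Z h h' assume h: "h \<in> Hom RTS ?A Z" "h' \<in> Hom RTS ?A Z" and e: "Comp RTS h ?j = Comp RTS h' ?j"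
    show "h = h'"
      by (rule surjective_epi[OF jW, of h Z h']) (use h e in \<open>auto simp: Hom_RTS\<close>)
  qed
  moreover have "?dG \<in> action_injections"
  proof (rule action_injectionI[OF dG], rule inj_onI)
    fix x y assume "x \<in> actions ?G" "y \<in> actions ?G" "on_actions ?dG x = on_actions ?dG y"
    then have "(enc (x, x) :: 'u) = enc (y, y)" by simp
    from injD[OF inj_enc_pair this] show "x = y" by simp
  qed
  ultimately have "?dA \<in> V" using localizer_pushout localizer_diagonal[OF G] by blast
  moreover have dW: "diagonal X (doubled X) \<in> Hom WTS X (doubled X)" using diagonal_Hom[OF X] by (simp add: Hom_RTS)
  \<comment> \<open>Both diagonals out of \<open>X\<close>, into the partly and into the fully
    doubled system, are in \<open>V\<close>; two-out-of-three gives the inclusion between their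
    targets.\<close>
  have "Comp WTS ?a ?dA = diagonal X (doubled X)"
    by (rule Comp_eqI[OF dAW aW dW]) (simp_all add: label_pairs_iff)
  then have "Comp RTS ?a ?dA \<in> V" using localizer_diagonal[OF X] by simp
  ultimately have "?a \<in> V" by (rule localizer_left[OF dA a])
  with a show ?thesis by blast
qed

context
  assumes Cub: "Cub_equivalences \<subseteq> V"
begin

text \<open>The skeleton of \<open>X\<close> and its image in \<open>K\<close> have the same edges up to labels, so their
  cubifications differ by a trivial fibration.\<close>

lemma localizer_skeleton:
  assumes X: "X \<in> Obj RTS" and K: "K \<in> Obj RTS" and \<eta>: "\<eta> \<in> Hom RTS X K" "on_actions \<eta> ` actions X = actions K"
  defines "H \<equiv> expand (edge_image X K (on_actions \<eta>)) (actions X) (on_actions \<eta>)"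
  shows "mk (skeleton X) H (\<lambda>s. s) (\<lambda>u. u) \<in> Hom RTS (skeleton X) H \<inter> V" and "H \<in> Obj RTS"
proof -
  let ?G = "skeleton X" and ?I = "edge_image X K (on_actions \<eta>)"
  have XW: "weak_transition_system X" "small (actions X)" using X by (simp_all add: Obj_RTS Obj_WTS)
  have \<eta>W: "\<eta> \<in> Hom WTS X K" using \<eta>(1) by (simp add: Hom_RTS)
  note G = skeleton_Obj[OF X] and I = edge_image_Obj[OF X K \<eta>(2)]
  have im: "on_actions \<eta> ` actions X = actions ?I" using \<eta>(2) by simp
  show H: "H \<in> Obj RTS" unfolding H_def by (rule expand_Obj[OF I im XW(2)])
  let ?t = "mk H ?I (\<lambda>s. s) (on_actions \<eta>)" and ?j = "mk ?G H (\<lambda>s. s) (\<lambda>u. u)"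
    and ?g = "mk ?G ?I (\<lambda>s. s) (on_actions \<eta>)"
  have t: "?t \<in> Hom RTS H ?I" "?t \<in> trivial_fibrations"
    unfolding H_def by (rule expand_Hom[OF I im XW(2)] expand_trivial_fibration[OF I im XW(2)])+
  have j: "?j \<in> Hom RTS ?G H"
  proof (rule mk_Hom_RTS[OF G H], rule ts_homI)
    fix \<alpha> us \<beta> assume "(\<alpha>, us, \<beta>) \<in> transitions ?G"
    then obtain u where u: "us = [u]" "(\<alpha>, [u], \<beta>) \<in> transitions X" by (auto simp: length_Suc_conv)
    then show "(\<alpha>, map (\<lambda>u. u) us, \<beta>) \<in> transitions H" using weakD(3)[OF XW(1) u(2)] by (auto simp: H_def)
  qed (auto simp: H_def Hom_hom(3)[OF \<eta>W])
  have g: "?g \<in> Hom RTS ?G ?I"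
  proof (rule mk_Hom_RTS[OF G I], rule ts_homI)
    fix \<alpha> us \<beta> assume "(\<alpha>, us, \<beta>) \<in> transitions ?G"
    then show "(\<alpha>, map (on_actions \<eta>) us, \<beta>) \<in> transitions ?I" by (auto simp: length_Suc_conv)
  qed (use Hom_hom(2,3)[OF \<eta>W] in auto)
  have "?g \<in> Cub_equivalences"
  proof (rule graph_Cub_equivalence[OF g graph_skeleton])
    show "graph ?I" unfolding graph_def by auto
    show "bij_betw (on_states ?g) (states ?G) (states ?I)" by (auto simp: bij_betw_def inj_on_def image_iff)
    fix \<alpha> v \<beta> assume "(\<alpha>, [v], \<beta>) \<in> transitions ?I"
    then obtain u where u: "v = on_actions \<eta> u" "(\<alpha>, [u], \<beta>) \<in> transitions X" by auto
    note w = weakD[OF XW(1) u(2)]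
    show "\<exists>\<alpha>' u \<beta>'. (\<alpha>', [u], \<beta>') \<in> transitions ?G \<and> \<alpha> = on_states ?g \<alpha>' \<and> v = on_actions ?g u \<and> \<beta> = on_states ?g \<beta>'"
      using u w by (intro exI[of _ \<alpha>] exI[of _ u] exI[of _ \<beta>]) simp
  qed
  then have gV: "?g \<in> V" using Cub by blast
  have W: "?j \<in> Hom WTS ?G H" "?t \<in> Hom WTS H ?I" "?g \<in> Hom WTS ?G ?I"
    using j t(1) g by (simp_all add: Hom_RTS)
  have "Comp WTS ?t ?j = ?g"
    by (rule Comp_eqI[OF W]) (simp_all add: H_def)
  then have "Comp RTS ?t ?j \<in> V" using gV by simp
  then have "?j \<in> V" using localizer_right[OF j t(1)] t(2) localizer_trivial_fibrations by blast
  with j show "?j \<in> Hom RTS ?G H \<inter> V" by blast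
qed

text \<open>\<open>Q\<close> is the pushout of \<open>X\<close> along the map from its skeleton to
  \<open>H\<close>, realised as the universal quotient for maps out of \<open>X\<close> that allow
  every edge to exchange its action within the label. Such a map is the same as one that also
  extends over \<open>H\<close>, so membership in \<open>V\<close> passes from
  \<open>localizer_skeleton\<close> to \<open>q\<close>.\<close>

lemma localizer_edge_saturation:
  assumes X: "X \<in> Obj RTS" and K: "K \<in> local_objects" and \<eta>: "\<eta> \<in> Hom RTS X K" "on_actions \<eta> ` actions X = actions K"
  obtains Q q where "q \<in> Hom RTS X Q" "q \<in> V" "on_states q ` states X = states Q" "on_actions q ` actions X = actions Q"
    "\<And>\<alpha> u v \<beta>. (\<alpha>, [u], \<beta>) \<in> transitions X \<Longrightarrow> v \<in> actions X \<Longrightarrow> label X u = label X v \<Longrightarrow>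
        (on_states q \<alpha>, [on_actions q v], on_states q \<beta>) \<in> transitions Q"
    "\<And>Z g. g \<in> Hom RTS X Z \<Longrightarrow>
        \<forall>\<alpha> u v \<beta>. (\<alpha>, [u], \<beta>) \<in> transitions X \<and> v \<in> actions X \<and> label X u = label X v \<longrightarrow>
          (on_states g \<alpha>, [on_actions g v], on_states g \<beta>) \<in> transitions Z \<Longrightarrow>
        \<exists>h\<in>Hom RTS Q Z. Comp RTS h q = g"
proof -
  let ?sat = "\<lambda>g Z. \<forall>\<alpha> u v \<beta>. (\<alpha>, [u], \<beta>) \<in> transitions X \<and> v \<in> actions X \<and> label X u = label X v \<longrightarrow>
          (on_states g \<alpha>, [on_actions g v], on_states g \<beta>) \<in> transitions Z"
  let ?C = "{g :: ('u, 'l) ts_map. g \<in> Hom RTS X (target g) \<and> ?sat g (target g)}"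
  have XW: "weak_transition_system X" using X by (simp add: Obj_RTS Obj_WTS)
  have \<eta>W: "\<eta> \<in> Hom WTS X K" using \<eta>(1) by (simp add: Hom_RTS)
  define H where "H = expand (edge_image X K (on_actions \<eta>)) (actions X) (on_actions \<eta>)"
  note lH = localizer_skeleton[OF X local_Obj[OF K] \<eta>, folded H_def]
  \<comment> \<open>In \<open>H\<close> one action may stand for another when both have the same
    image in \<open>K\<close>, and as \<open>K\<close> is local this means the same label.\<close>
  have H_sel: "states H = states X" "actions H = actions X"
    "\<And>u. u \<in> actions X \<Longrightarrow> label H u = label X u"
    "\<And>\<alpha> w \<beta>. (\<alpha>, w, \<beta>) \<in> transitions H \<Longrightarrow> \<exists>u v. w = [v] \<and> v \<in> actions X \<and> (\<alpha>, [u], \<beta>) \<in> transitions X \<and> label X u = label X v"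
    "\<And>\<alpha> u v \<beta>. (\<alpha>, [u], \<beta>) \<in> transitions X \<Longrightarrow> v \<in> actions X \<Longrightarrow> label X u = label X v \<Longrightarrow> (\<alpha>, [v], \<beta>) \<in> transitions H"
  proof -
    show "states H = states X" "actions H = actions X" by (simp_all add: H_def)
    show "label H u = label X u" if "u \<in> actions X" for u using that Hom_hom(3)[OF \<eta>W that] by (simp add: H_def)
    fix \<alpha> w \<beta> assume "(\<alpha>, w, \<beta>) \<in> transitions H"
    then obtain u v where u: "w = [v]" "v \<in> actions X" "on_actions \<eta> v = on_actions \<eta> u" "(\<alpha>, [u], \<beta>) \<in> transitions X"
      by (auto simp: H_def map_eq_Cons_conv)
    moreover have "u \<in> actions X" using weakD(3)[OF XW u(4)] by simp
    ultimately show "\<exists>u v. w = [v] \<and> v \<in> actions X \<and> (\<alpha>, [u], \<beta>) \<in> transitions X \<and> label X u = label X v"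
      using Hom_hom(3)[OF \<eta>W] by metis
  next
    fix \<alpha> u v \<beta> assume t: "(\<alpha>, [u], \<beta>) \<in> transitions X" and v: "v \<in> actions X" "label X u = label X v"
    have "u \<in> actions X" using weakD(3)[OF XW t] by simp
    then have "on_actions \<eta> v = on_actions \<eta> u" using local_action_eq[OF K \<eta>W \<eta>W v(1) _ v(2)[symmetric]] by blast
    then show "(\<alpha>, [v], \<beta>) \<in> transitions H" using t v by (auto simp: H_def)
  qed
  let ?G = "skeleton X"
  let ?j = "mk ?G H (\<lambda>s. s) (\<lambda>u. u)" and ?i = "mk ?G X (\<lambda>s. s) (\<lambda>u. u)"
  have j: "?j \<in> Hom RTS ?G H" "?j \<in> V" using lH(1) by blast+
  note i = skeleton_inclusion[OF X]
  have jW: "?j \<in> Hom WTS ?G H" and iW: "?i \<in> Hom WTS ?G X" using j(1) i by (simp_all add: Hom_RTS)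
  show thesis
  proof (rule regular_quotient_exists[OF X, of ?C])
    show "\<And>g. g \<in> ?C \<Longrightarrow> g \<in> Hom RTS X (target g)" by blast
    fix Q q
    assume q: "q \<in> Hom RTS X Q" and st: "on_states q ` states X = states Q" and ac: "on_actions q ` actions X = actions Q"
      and fac: "\<And>g. g \<in> ?C \<Longrightarrow> \<exists>h\<in>Hom RTS Q (target g). Comp RTS h q = g"
      and tr: "\<And>\<alpha> u \<beta>. \<alpha> \<in> states X \<Longrightarrow> \<beta> \<in> states X \<Longrightarrow> u \<in> actions X \<Longrightarrow>
        (\<And>g. g \<in> ?C \<Longrightarrow> (on_states g \<alpha>, [on_actions g u], on_states g \<beta>) \<in> transitions (target g)) \<Longrightarrow>
        (on_states q \<alpha>, [on_actions q u], on_states q \<beta>) \<in> transitions Q"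
    have qW: "q \<in> Hom WTS X Q" using q by (simp add: Hom_RTS)
    have qsat: "(on_states q \<alpha>, [on_actions q v], on_states q \<beta>) \<in> transitions Q"
      if t: "(\<alpha>, [u], \<beta>) \<in> transitions X" and v: "v \<in> actions X" "label X u = label X v" for \<alpha> u v \<beta>
      by (rule tr) (use weakD[OF XW t] t v in auto)
    have fac': "\<exists>h\<in>Hom RTS Q Z. Comp RTS h q = g" if "g \<in> Hom RTS X Z" "?sat g Z" for g Z
    proof -
      have "target g = Z" using that(1) by (simp add: Hom_RTS Hom_WTS)
      then show ?thesis using fac[of g] that by simp
    qed
    let ?k = "mk H Q (on_states q) (on_actions q)"
    have "ts_hom H Q (on_states q) (on_actions q)"
    proof (rule ts_homI)
      fix \<alpha> us \<beta> assume "(\<alpha>, us, \<beta>) \<in> transitions H"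
      from H_sel(4)[OF this] qsat show "(on_states q \<alpha>, map (on_actions q) us, on_states q \<beta>) \<in> transitions Q" by auto
    qed (use Hom_hom(1-3)[OF qW] H_sel(1-3) in auto)
    then have k: "?k \<in> Hom RTS H Q" by (rule mk_Hom_RTS[OF lH(2) RTS.Hom_Obj(2)[OF q]])
    then have kW: "?k \<in> Hom WTS H Q" by (simp add: Hom_RTS)
    have "is_pushout RTS ?j ?i q ?k"
    proof (rule RTS.is_pushoutI[OF j(1) i q k])
      show "Comp RTS ?k ?j = Comp RTS q ?i"
        unfolding RTS_WTS
        by (rule Comp_eqI[OF jW kW Comp_Hom_WTS[OF iW qW]])
          (simp_all add: Comp_states[OF iW] Comp_actions[OF iW] H_sel)
      fix Z u v assume u: "u \<in> Hom RTS H Z" and v: "v \<in> Hom RTS X Z" and e: "Comp RTS u ?j = Comp RTS v ?i"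
      have uW: "u \<in> Hom WTS H Z" and vW: "v \<in> Hom WTS X Z" using u v by (simp_all add: Hom_RTS)
      have es: "on_states u s = on_states v s" if "s \<in> states X" for s
        using Comp_eqD(1)[OF e[unfolded RTS_WTS] jW iW, of s] that by simp
      have ea: "on_actions u x = on_actions v x" if "x \<in> actions X" for x
        using Comp_eqD(2)[OF e[unfolded RTS_WTS] jW iW, of x] that by simp
      have "?sat v Z"
      proof (intro allI impI, elim conjE)
        fix \<alpha> x y \<beta> assume t: "(\<alpha>, [x], \<beta>) \<in> transitions X" and y: "y \<in> actions X" "label X x = label X y"
        from Hom_hom(4)[OF uW H_sel(5)[OF t y]] es ea y(1) weakD(1,4)[OF XW t]
        show "(on_states v \<alpha>, [on_actions v y], on_states v \<beta>) \<in> transitions Z" by simp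
      qed
      from fac'[OF v this] obtain h where h: "h \<in> Hom RTS Q Z" "Comp RTS h q = v" by blast
      have hW: "h \<in> Hom WTS Q Z" using h(1) by (simp add: Hom_RTS)
      have "Comp WTS h ?k = u"
      proof (rule Comp_eqI[OF kW hW uW])
        show "on_states h (on_states ?k s) = on_states u s" if "s \<in> states H" for s
          using that Comp_states[OF qW, of s h] h(2) es H_sel(1) by simp
        show "on_actions h (on_actions ?k s) = on_actions u s" if "s \<in> actions H" for s
          using that Comp_actions[OF qW, of s h] h(2) ea H_sel(2) by simp
      qed
      with h show "\<exists>h\<in>Hom RTS Q Z. Comp RTS h ?k = u \<and> Comp RTS h q = v" by auto
    next
      fix Z h h' assume "h \<in> Hom RTS Q Z" "h' \<in> Hom RTS Q Z" and e: "Comp RTS h q = Comp RTS h' q"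
      then have "h \<in> Hom WTS Q Z" "h' \<in> Hom WTS Q Z" by (simp_all add: Hom_RTS)
      from surjective_epi[OF qW st ac this] e show "h = h'" by simp
    qed
    moreover have "?j \<in> action_injections" by (rule action_injectionI[OF j(1)]) (auto intro: inj_onI)
    ultimately have "q \<in> V" using localizer_pushout j(2) by blast
    then show thesis by (rule that[OF q _ st ac qsat fac'])
  qed
qed

end

end

end

lemma word_preimage:
  assumes "set l \<subseteq> e ` A"
  obtains w where "set w \<subseteq> A" "map e w = l"
proof
  show "set (map (inv_into A e) l) \<subseteq> A" using assms inv_into_into[of _ e A] by auto
  show "map e (map (inv_into A e) l) = l"
    unfolding map_map using assms f_inv_into_f[of _ e A] by (intro map_idI) auto
qed

definition variant_system ::
  "('u, 'l) ts \<Rightarrow> ('u, 'l) ts \<Rightarrow> 'u set \<Rightarrow> ('u \<Rightarrow> 'u) \<Rightarrow> ('u \<Rightarrow> 'u) \<Rightarrow> ('u, 'l) ts" where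
  "variant_system Z K A e g = K\<lparr>states := states Z, transitions :=
     {(a, l, b). a \<in> states Z \<and> b \<in> states Z \<and> l \<noteq> [] \<and> set l \<subseteq> actions K \<and>
        (\<forall>w. set w \<subseteq> A \<and> map e w = l \<longrightarrow> (a, map g w, b) \<in> transitions Z)}\<rparr>"

lemma variant_system_sel [simp]:
  "states (variant_system Z K A e g) = states Z" "actions (variant_system Z K A e g) = actions K"
  "label (variant_system Z K A e g) = label K"
  "(a, l, b) \<in> transitions (variant_system Z K A e g) \<longleftrightarrow> a \<in> states Z \<and> b \<in> states Z \<and> l \<noteq> [] \<and>
     set l \<subseteq> actions K \<and> (\<forall>w. set w \<subseteq> A \<and> map e w = l \<longrightarrow> (a, map g w, b) \<in> transitions Z)"
  by (auto simp: variant_system_def)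

text \<open>Since \<open>e\<close> maps onto the actions of \<open>K\<close>, every word has a
  variant. For the composition axiom variants of the outer pieces are fixed once, while the middle
  piece ranges over all of its variants.\<close>

lemma variant_system_Obj:
  assumes Z: "Z \<in> Obj RTS" and K: "K \<in> Obj RTS" and e: "e ` A = actions K"
  shows "variant_system Z K A e g \<in> Obj WTS" "unique_split (transitions (variant_system Z K A e g))"
proof -
  let ?M = "variant_system Z K A e g"
  have ZW: "weak_transition_system Z" "regular Z" "small (states Z)" using Z by (simp_all add: Obj_RTS Obj_WTS)
  have KW: "weak_transition_system K" "small (actions K)" using K by (simp_all add: Obj_RTS Obj_WTS)
  have M: "(a, map g w, b) \<in> transitions Z" if "(a, map e w, b) \<in> transitions ?M" "set w \<subseteq> A" for a w b
    using that unfolding variant_system_sel by blast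
  have pre: thesis if "(a, l, b) \<in> transitions ?M" "\<And>w. set w \<subseteq> A \<Longrightarrow> l = map e w \<Longrightarrow> thesis" for a l b thesis
  proof -
    have "set l \<subseteq> e ` A" using that(1) e by simp
    then show thesis by (rule word_preimage) (use that(2) in blast)
  qed
  have "multiset_axiom ?M"
    unfolding multiset_axiom_def
  proof (intro allI impI, elim conjE)
    fix a us vs b assume t: "(a, us, b) \<in> transitions ?M" and m: "mset vs = mset us"
    have "(a, map g w, b) \<in> transitions Z" if w: "set w \<subseteq> A" "map e w = vs" for w
    proof -
      have "mset us = mset (map e w)" using m w(2) by simp
      from mset_map_preimage[OF this] obtain w' where w': "mset w' = mset w" "map e w' = us" by blast
      have "(a, map g w', b) \<in> transitions Z" using M[of a w' b] t w' w(1) mset_eq_setD[OF w'(1)] by simp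
      then show ?thesis by (rule perm_closedD[OF weak_perm_closed[OF ZW(1)]]) (simp add: w'(1))
    qed
    moreover have "vs \<noteq> []" using m t by auto
    ultimately show "(a, vs, b) \<in> transitions ?M" using t mset_eq_setD[OF m] by simp
  qed
  moreover have "composition_axiom ?M"
    unfolding composition_axiom_def
  proof (intro allI impI, elim conjE)
    fix a us vs ws b \<nu>\<^sub>1 \<nu>\<^sub>2
    assume ne: "us \<noteq> []" "vs \<noteq> []" "ws \<noteq> []" and t: "(a, us @ vs @ ws, b) \<in> transitions ?M"
      "(a, us, \<nu>\<^sub>1) \<in> transitions ?M" "(\<nu>\<^sub>1, vs @ ws, b) \<in> transitions ?M"
      "(a, us @ vs, \<nu>\<^sub>2) \<in> transitions ?M" "(\<nu>\<^sub>2, ws, b) \<in> transitions ?M"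
    obtain u where u: "set u \<subseteq> A" "us = map e u" by (rule pre[OF t(2)])
    obtain w where w: "set w \<subseteq> A" "ws = map e w" by (rule pre[OF t(5)])
    have "(\<nu>\<^sub>1, map g v, \<nu>\<^sub>2) \<in> transitions Z" if v: "set v \<subseteq> A" "map e v = vs" for v
    proof (rule composition_axiomD[where us = "map g u" and ws = "map g w" and \<alpha> = a and \<beta> = b])
      show "composition_axiom Z" using ZW(1) unfolding weak_transition_system_def by blast
      show "(a, map g u @ map g v @ map g w, b) \<in> transitions Z" using M[of a "u @ v @ w" b] t(1) u v w by simp
      show "(a, map g u, \<nu>\<^sub>1) \<in> transitions Z" using M[of a u] t(2) u by simp
      show "(\<nu>\<^sub>1, map g v @ map g w, b) \<in> transitions Z" using M[of \<nu>\<^sub>1 "v @ w"] t(3) v w by simp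
      show "(a, map g u @ map g v, \<nu>\<^sub>2) \<in> transitions Z" using M[of a "u @ v"] t(4) u v by simp
      show "(\<nu>\<^sub>2, map g w, b) \<in> transitions Z" using M[of \<nu>\<^sub>2 w] t(5) w by simp
    qed (use ne u v w in auto)
    then show "(\<nu>\<^sub>1, vs, \<nu>\<^sub>2) \<in> transitions ?M" using t(2,4) ne by simp
  qed
  moreover have "label ?M \<in> extensional (actions ?M)" using KW(1) unfolding weak_transition_system_def by simp
  ultimately have "weak_transition_system ?M" unfolding weak_transition_system_def by auto
  then show "?M \<in> Obj WTS" using ZW(3) KW(2) by (simp add: Obj_WTS)
  show "unique_split (transitions ?M)"
    unfolding unique_split_def
  proof (intro allI impI, elim conjE)
    fix a us vs b \<nu> \<nu>'
    assume ne: "us \<noteq> []" "vs \<noteq> []" and t: "(a, us @ vs, b) \<in> transitions ?M" "(a, us, \<nu>) \<in> transitions ?M"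
      "(\<nu>, vs, b) \<in> transitions ?M" "(a, us, \<nu>') \<in> transitions ?M" "(\<nu>', vs, b) \<in> transitions ?M"
    obtain u where u: "set u \<subseteq> A" "us = map e u" by (rule pre[OF t(2)])
    obtain v where v: "set v \<subseteq> A" "vs = map e v" by (rule pre[OF t(3)])
    show "\<nu> = \<nu>'"
    proof (rule unique_splitD[OF regular_unique_split[OF ZW(1,2)], of "map g u" "map g v" a b])
      show "(a, map g u @ map g v, b) \<in> transitions Z" using M[of a "u @ v"] t(1) u v by simp
      show "(a, map g u, \<nu>) \<in> transitions Z" "(a, map g u, \<nu>') \<in> transitions Z" using M[of a u] t(2,4) u by simp_all
      show "(\<nu>, map g v, b) \<in> transitions Z" "(\<nu>', map g v, b) \<in> transitions Z" using M[of _ v] t(3,5) v by simp_all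
    qed (use ne u v in auto)
  qed
qed

context small_universe
begin

context
  fixes V :: "('u, 'l) ts_map set"
  assumes loc: "grothendieck_localizer RTS (small_ordinals :: 'u rel set) action_injections V"
    and Cub: "Cub_equivalences \<subseteq> V"
begin

text \<open>The system \<open>E\<close> below carries the actions of \<open>X\<close> and the transitions of its reflection \<open>K\<close>.  It is
  reached from \<open>X\<close> by saturating the edges and then gluing in \<open>doubled X\<close>, along second
  components of pairs of actions.\<close>

lemma localizer_reflection:
  assumes X: "X \<in> Obj RTS" and K: "K \<in> local_objects" and \<eta>: "\<eta> \<in> Hom RTS X K"
    and st: "on_states \<eta> ` states X = states K" and ac: "on_actions \<eta> ` actions X = actions K"
    and \<eta>L: "\<eta> \<in> RTS.local_equivalences local_objects"
  shows "\<eta> \<in> V"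
proof -
  have XW: "weak_transition_system X" "small (actions X)" using X by (simp_all add: Obj_RTS Obj_WTS)
  have \<eta>W: "\<eta> \<in> Hom WTS X K" using \<eta> by (simp add: Hom_RTS)
  note KR = local_Obj[OF K]
  have KW: "weak_transition_system K" using KR by (simp add: Obj_RTS Obj_WTS)
  have \<eta>l: "on_actions \<eta> u = on_actions \<eta> v" if "u \<in> actions X" "v \<in> actions X" "label X u = label X v" for u v
    by (rule local_action_eq[OF K \<eta>W \<eta>W that])
  define E where "E = expand K (actions X) (on_actions \<eta>)"
  have E: "E \<in> Obj RTS" unfolding E_def by (rule expand_Obj[OF KR ac XW(2)])
  have E_sel: "states E = states K" "actions E = actions X" "\<And>u. u \<in> actions X \<Longrightarrow> label E u = label X u"
    "\<And>\<alpha> w \<beta>. (\<alpha>, w, \<beta>) \<in> transitions E \<longleftrightarrow> set w \<subseteq> actions X \<and> (\<alpha>, map (on_actions \<eta>) w, \<beta>) \<in> transitions K"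
    using Hom_hom(3)[OF \<eta>W] by (simp_all add: E_def)
  \<comment> \<open>\<open>\<eta>\<close> is \<open>?t\<close> after \<open>?x\<close> and
    \<open>?t\<close> is a trivial fibration, so it remains to put \<open>?x\<close> into
    \<open>V\<close>. This map factors through the edge saturation \<open>Q\<close>.\<close>
  let ?t = "mk E K (\<lambda>s. s) (on_actions \<eta>)" and ?x = "mk X E (on_states \<eta>) (\<lambda>u. u)"
  have t: "?t \<in> Hom RTS E K" "?t \<in> trivial_fibrations"
    unfolding E_def by (rule expand_Hom[OF KR ac XW(2)] expand_trivial_fibration[OF KR ac XW(2)])+
  have x: "?x \<in> Hom RTS X E"
  proof (rule mk_Hom_RTS[OF X E], rule ts_homI)
    fix \<alpha> us \<beta> assume tr: "(\<alpha>, us, \<beta>) \<in> transitions X"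
    from Hom_hom(4)[OF \<eta>W tr] weakD(3)[OF XW(1) tr]
    show "(on_states \<eta> \<alpha>, map (\<lambda>u. u) us, on_states \<eta> \<beta>) \<in> transitions E" by (simp add: E_sel)
  qed (auto simp: E_sel Hom_hom(1)[OF \<eta>W])
  have tW: "?t \<in> Hom WTS E K" and xW: "?x \<in> Hom WTS X E" using t(1) x by (simp_all add: Hom_RTS)
  obtain Q q where q: "q \<in> Hom RTS X Q" "q \<in> V" and qst: "on_states q ` states X = states Q"
    and qac: "on_actions q ` actions X = actions Q"
    and qsat: "\<And>\<alpha> u v \<beta>. (\<alpha>, [u], \<beta>) \<in> transitions X \<Longrightarrow> v \<in> actions X \<Longrightarrow> label X u = label X v \<Longrightarrow>
        (on_states q \<alpha>, [on_actions q v], on_states q \<beta>) \<in> transitions Q"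
    and qfac: "\<And>Z g. g \<in> Hom RTS X Z \<Longrightarrow>
        \<forall>\<alpha> u v \<beta>. (\<alpha>, [u], \<beta>) \<in> transitions X \<and> v \<in> actions X \<and> label X u = label X v \<longrightarrow>
          (on_states g \<alpha>, [on_actions g v], on_states g \<beta>) \<in> transitions Z \<Longrightarrow>
        \<exists>h\<in>Hom RTS Q Z. Comp RTS h q = g"
    by (rule localizer_edge_saturation[OF loc Cub X K \<eta> ac]) (rule that)
  have qW: "q \<in> Hom WTS X Q" using q(1) by (simp add: Hom_RTS)
  have "\<exists>h\<in>Hom RTS Q E. Comp RTS h q = ?x"
  proof (rule qfac[OF x], intro allI impI, elim conjE)
    fix \<alpha> u v \<beta> assume tr: "(\<alpha>, [u], \<beta>) \<in> transitions X" and v: "v \<in> actions X" "label X u = label X v"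
    note w = weakD[OF XW(1) tr]
    have "on_actions \<eta> v = on_actions \<eta> u" using \<eta>l[of v u] v w(3) by simp
    then show "(on_states ?x \<alpha>, [on_actions ?x v], on_states ?x \<beta>) \<in> transitions E"
      using Hom_hom(4)[OF \<eta>W tr] w v by (simp add: E_sel)
  qed
  then obtain z where z: "z \<in> Hom RTS Q E" "Comp WTS z q = ?x" by auto
  have zW: "z \<in> Hom WTS Q E" using z(1) by (simp add: Hom_RTS)
  have zs: "on_states z (on_states q s) = on_states \<eta> s" if "s \<in> states X" for s
    using Comp_states[OF qW that, of z] z(2) that by simp
  have za: "on_actions z (on_actions q u) = u" if "u \<in> actions X" for u
    using Comp_actions[OF qW that, of z] z(2) that by simp
  let ?A = "partly_doubled X" and ?D = "doubled X"
  note A = partly_doubled_Obj[OF X] and D = doubled_Obj[OF X]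
  \<comment> \<open>Gluing data: \<open>Q\<close> receives a pair through its second component. This
    is a map on \<open>partly_doubled X\<close>, because the edges of \<open>Q\<close> are saturated
    and longer words are diagonal. On \<open>doubled X\<close> it need not be one, and the pushout
    supplies the missing transitions.\<close>
  let ?a = "mk ?A ?D (\<lambda>s. s) (\<lambda>d. d)" and ?a' = "mk ?A Q (on_states q) (\<lambda>d. on_actions q (psnd d))"
    and ?b = "mk ?D E (on_states \<eta>) psnd"
  have a: "?a \<in> Hom RTS ?A ?D" "?a \<in> V" using localizer_partly_doubled[OF loc X] by blast+
  note pD = label_pairsD
  have a': "?a' \<in> Hom RTS ?A Q"
  proof (rule mk_Hom_RTS[OF A RTS.Hom_Obj(2)[OF q(1)]], rule ts_homI)
    fix d assume "d \<in> actions ?A"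
    then have d: "d \<in> label_pairs X" by simp
    show "on_actions q (psnd d) \<in> actions Q" using Hom_hom(2)[OF qW pD(3)[OF d]] .
    show "label Q (on_actions q (psnd d)) = label ?A d"
      using Hom_hom(3)[OF qW pD(3)[OF d]] pD(4)[OF d] d by simp
  next
    fix \<alpha> w \<beta> assume tr: "(\<alpha>, w, \<beta>) \<in> transitions ?A"
    then have w: "set w \<subseteq> label_pairs X" "(\<alpha>, map pfst w, \<beta>) \<in> transitions X" by auto
    from tr consider "length w = 1" | "\<forall>d\<in>set w. pfst d = psnd d" by auto
    then show "(on_states q \<alpha>, map (\<lambda>d. on_actions q (psnd d)) w, on_states q \<beta>) \<in> transitions Q"
    proof cases
      case 1
      then obtain d where d: "w = [d]" by (auto simp: length_Suc_conv)
      then have "d \<in> label_pairs X" using w(1) by simp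
      from qsat[OF _ pD(3)[OF this] pD(4)[OF this]] w(2) d show ?thesis by simp
    next
      case 2
      then have *: "map (\<lambda>d. on_actions q (psnd d)) w = map (on_actions q) (map pfst w)" by auto
      show ?thesis using Hom_hom(4)[OF qW w(2)] by (simp only: *)
    qed
  qed (use Hom_hom(1)[OF qW] in simp)
  have b: "?b \<in> Hom RTS ?D E"
  proof (rule mk_Hom_RTS[OF D E], rule ts_homI)
    fix d assume "d \<in> actions ?D"
    then have d: "d \<in> label_pairs X" by simp
    show "psnd d \<in> actions E" "label E (psnd d) = label ?D d" using pD(3,4)[OF d] d by (simp_all add: E_sel)
  next
    fix \<alpha> w \<beta> assume "(\<alpha>, w, \<beta>) \<in> transitions ?D"
    then have w: "set w \<subseteq> label_pairs X" "(\<alpha>, map pfst w, \<beta>) \<in> transitions X" by auto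
    have "map (on_actions \<eta>) (map psnd w) = map (on_actions \<eta>) (map pfst w)"
      unfolding map_map
    proof (rule map_cong[OF refl])
      fix d assume "d \<in> set w"
      then have "d \<in> label_pairs X" using w(1) by blast
      from \<eta>l[OF pD(3)[OF this] pD(2)[OF this] pD(4)[OF this, symmetric]]
      show "(on_actions \<eta> \<circ> psnd) d = (on_actions \<eta> \<circ> pfst) d" by simp
    qed
    with Hom_hom(4)[OF \<eta>W w(2)] have "(on_states \<eta> \<alpha>, map (on_actions \<eta>) (map psnd w), on_states \<eta> \<beta>) \<in> transitions K"
      by (simp only:)
    moreover have "set (map psnd w) \<subseteq> actions X" using w(1) pD(3) by auto
    ultimately show "(on_states \<eta> \<alpha>, map psnd w, on_states \<eta> \<beta>) \<in> transitions E"
      unfolding E_sel by blast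
  qed (use Hom_hom(1)[OF \<eta>W] in \<open>simp add: E_sel\<close>)
  have aW: "?a \<in> Hom WTS ?A ?D" and a'W: "?a' \<in> Hom WTS ?A Q" and bW: "?b \<in> Hom WTS ?D E"
    using a(1) a' b by (simp_all add: Hom_RTS)
  have bst: "on_states ?b ` states ?D = states E" using st by (simp add: E_sel)
  have bac: "on_actions ?b ` actions ?D = actions E" using psnd_image by (simp add: E_sel)
  have "is_pushout RTS ?a ?a' z ?b"
  proof (rule RTS.is_pushoutI[OF a(1) a' z(1) b])
    show "Comp RTS ?b ?a = Comp RTS z ?a'"
      unfolding RTS_WTS
      by (rule Comp_eqI[OF aW bW Comp_Hom_WTS[OF a'W zW]])
        (simp_all add: Comp_states[OF a'W] Comp_actions[OF a'W] zs za pD(3))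
    fix Z u v assume u: "u \<in> Hom RTS ?D Z" and v: "v \<in> Hom RTS Q Z" and e: "Comp RTS u ?a = Comp RTS v ?a'"
    have uW: "u \<in> Hom WTS ?D Z" and vW: "v \<in> Hom WTS Q Z" and Z: "Z \<in> Obj RTS"
      using u v by (auto simp: Hom_RTS Hom_WTS Obj_RTS)
    let ?g = "Comp WTS v q"
    have g: "?g \<in> Hom WTS X Z" by (rule Comp_Hom_WTS[OF qW vW])
    have gs: "on_states ?g s = on_states v (on_states q s)" if "s \<in> states X" for s by (rule Comp_states[OF qW that])
    have ga: "on_actions ?g s = on_actions v (on_actions q s)" if "s \<in> actions X" for s by (rule Comp_actions[OF qW that])
    have us: "on_states u s = on_states ?g s" if "s \<in> states X" for s
      using Comp_eqD(1)[OF e[unfolded RTS_WTS] aW a'W, of s] that gs[OF that] by simp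
    have ua: "on_actions u d = on_actions ?g (psnd d)" if "d \<in> label_pairs X" for d
      using Comp_eqD(2)[OF e[unfolded RTS_WTS] aW a'W, of d] that ga[OF pD(3)[OF that]] by simp
    \<comment> \<open>The map \<open>u\<close> lets \<open>?g\<close> be applied to every renaming
      of a transition of \<open>X\<close>, but transitions of \<open>E\<close> come from those of
      \<open>K\<close>, which need not be images of transitions of \<open>X\<close>. They are
      reached by extending a map along \<open>\<eta>\<close>, and for this the target has to be
      local: hence the variant system.\<close>
    let ?M0 = "variant_system Z K (actions X) (on_actions \<eta>) (on_actions ?g)"
    note M0 = variant_system_Obj[OF Z KR ac, of "on_actions ?g"]
    have M0W: "weak_transition_system ?M0" using M0(1) by (simp add: Obj_WTS)
    have M: "core ?M0 \<in> local_objects"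
    proof -
      have "inj_on (label (core ?M0)) (actions (core ?M0))"
      proof (rule inj_onI)
        fix x y assume xy: "x \<in> actions (core ?M0)" "y \<in> actions (core ?M0)" "label (core ?M0) x = label (core ?M0) y"
        then have "label K x = label K y" by (simp add: core_sel(4))
        moreover have "x \<in> actions K" "y \<in> actions K" using core_regular(3)[OF M0W M0(2)] xy by auto
        ultimately show "x = y" using K unfolding local_objects_def inj_on_def by blast
      qed
      then show ?thesis using core_Obj[OF M0] by (simp add: local_objects_def)
    qed
    have "ts_hom X ?M0 (on_states ?g) (on_actions \<eta>)"
    proof (rule ts_homI)
      fix \<alpha> w \<beta> assume tr: "(\<alpha>, w, \<beta>) \<in> transitions X"
      note w = weakD[OF XW(1) tr]
      have "(on_states ?g \<alpha>, map (on_actions ?g) w', on_states ?g \<beta>) \<in> transitions Z"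
        if w': "set w' \<subseteq> actions X" "map (on_actions \<eta>) w' = map (on_actions \<eta>) w" for w'
      proof -
        have len: "length w' = length w" using w'(2) by (metis length_map)
        \<comment> \<open>Pairing corresponding letters gives a transition of
          \<open>doubled X\<close> above the one of \<open>X\<close>. Applying \<open>u\<close> to
          it uses the second components, which spell \<open>w'\<close>.\<close>
        define d :: "'u list" where "d = map enc (zip w w')"
        have p1: "map pfst d = w" and p2: "map psnd d = w'"
          unfolding d_def using len by (simp_all add: comp_def pfst_def psnd_def inv_f_f[OF inj_enc_pair])
        have "set d \<subseteq> label_pairs X"
        proof
          fix y assume "y \<in> set d"
          then obtain i where i: "i < length w" "y = enc (w ! i, w' ! i)"
            unfolding d_def using len by (auto simp: set_zip)
          have "w ! i \<in> actions X" "w' ! i \<in> actions X" using i(1) len w(3) w'(1) by auto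
          moreover have "on_actions \<eta> (w' ! i) = on_actions \<eta> (w ! i)"
            using w'(2) i(1) len by (metis nth_map)
          ultimately show "y \<in> label_pairs X" using Hom_hom(3)[OF \<eta>W] by (metis i(2) label_pairs_iff)
        qed
        then have "(\<alpha>, d, \<beta>) \<in> transitions ?D" using tr p1 by simp
        moreover have "map (on_actions u) d = map (on_actions ?g) (map psnd d)"
          unfolding map_map using ua \<open>set d \<subseteq> label_pairs X\<close> by (intro map_cong) auto
        ultimately show ?thesis using Hom_hom(4)[OF uW, of \<alpha> d \<beta>] us[OF w(1)] us[OF w(4)] unfolding p2 by metis
      qed
      then show "(on_states ?g \<alpha>, map (on_actions \<eta>) w, on_states ?g \<beta>) \<in> transitions ?M0"
        using w Hom_hom(1)[OF g] Hom_hom(2)[OF \<eta>W] by auto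
    qed (use Hom_hom(1)[OF g] Hom_hom(2,3)[OF \<eta>W] in auto)
    then have "ts_hom X (core ?M0) (on_states ?g) (on_actions \<eta>)"
      using ts_hom_core[OF XW(1)] X by (simp add: Obj_RTS)
    then have m: "mk X (core ?M0) (on_states ?g) (on_actions \<eta>) \<in> Hom RTS X (core ?M0)"
      by (rule mk_Hom_RTS[OF X local_Obj[OF M]])
    obtain k where k: "k \<in> Hom RTS K (core ?M0)" "Comp RTS k \<eta> = mk X (core ?M0) (on_states ?g) (on_actions \<eta>)"
      by (rule RTS.local_equivalences_ex[OF \<eta>L \<eta> M m])
    have kW: "k \<in> Hom WTS K (core ?M0)" using k(1) by (simp add: Hom_RTS)
    have ks: "on_states k (on_states \<eta> s) = on_states ?g s" if "s \<in> states X" for s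
      using Comp_states[OF \<eta>W that, of k] k(2) that by simp
    have ka: "on_actions k (on_actions \<eta> s) = on_actions \<eta> s" if "s \<in> actions X" for s
      using Comp_actions[OF \<eta>W that, of k] k(2) that by simp
    have hom: "ts_hom E Z (on_states k) (on_actions ?g)"
    proof (rule ts_homI)
      fix s assume "s \<in> states E"
      then show "on_states k s \<in> states Z" using Hom_hom(1)[OF kW, of s] by (simp add: E_sel core_sel(1))
    next
      fix \<alpha> w \<beta> assume "(\<alpha>, w, \<beta>) \<in> transitions E"
      then have w: "set w \<subseteq> actions X" "(\<alpha>, map (on_actions \<eta>) w, \<beta>) \<in> transitions K" by (simp_all add: E_sel)
      have *: "map (on_actions k) (map (on_actions \<eta>) w) = map (on_actions \<eta>) w"
        unfolding map_map using w(1) ka by (intro map_cong) auto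
      have "(on_states k \<alpha>, map (on_actions \<eta>) w, on_states k \<beta>) \<in> transitions (core ?M0)"
        using Hom_hom(4)[OF kW w(2)] unfolding * .
      then have "(on_states k \<alpha>, map (on_actions \<eta>) w, on_states k \<beta>) \<in> transitions ?M0"
        unfolding core_sel(2) by (rule subsetD[OF core_transitions_subset])
      \<comment> \<open>The word \<open>w\<close> is one of the variants of its own image.\<close>
      then show "(on_states k \<alpha>, map (on_actions ?g) w, on_states k \<beta>) \<in> transitions Z"
        using w(1) unfolding variant_system_sel by blast
    qed (use Hom_hom(2,3)[OF g] in \<open>simp_all add: E_sel\<close>)
    let ?h = "mk E Z (on_states k) (on_actions ?g)"
    have h: "?h \<in> Hom RTS E Z" by (rule mk_Hom_RTS[OF E Z hom])
    then have hW: "?h \<in> Hom WTS E Z" by (simp add: Hom_RTS)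
    have hb: "Comp WTS ?h ?b = u"
      by (rule Comp_eqI[OF bW hW uW]) (simp_all add: E_sel ks us ua pD(3) Hom_hom(1)[OF \<eta>W])
    have "Comp WTS (Comp WTS ?h z) q = Comp WTS ?h ?x"
      using WTS.Comp_assoc[OF qW zW hW] z(2) by simp
    also have "\<dots> = ?g"
      by (rule Comp_eqI[OF xW hW g]) (simp_all add: E_sel ks Hom_hom(1)[OF \<eta>W])
    finally have "Comp WTS ?h z = v"
      by (rule surjective_epi[OF qW qst qac Comp_Hom_WTS[OF zW hW] vW])
    with h hb show "\<exists>h\<in>Hom RTS E Z. Comp RTS h ?b = u \<and> Comp RTS h z = v" by auto
  next
    fix Z h h' assume "h \<in> Hom RTS E Z" "h' \<in> Hom RTS E Z" and e: "Comp RTS h ?b = Comp RTS h' ?b"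
    then have "h \<in> Hom WTS E Z" "h' \<in> Hom WTS E Z" by (simp_all add: Hom_RTS)
    from surjective_epi[OF bW bst bac this] e show "h = h'" by simp
  qed
  moreover have "?a \<in> action_injections" by (rule action_injectionI[OF a(1)]) (auto intro: inj_onI)
  ultimately have "z \<in> V" using localizer_pushout[OF loc] a(2) by blast
  then have "?x \<in> V" using localizer_comp[OF loc q(1) z(1) q(2)] z(2) by simp
  moreover have "?t \<in> V" using localizer_trivial_fibrations[OF loc] t(2) by blast
  ultimately have "Comp RTS ?t ?x \<in> V" by (intro localizer_comp[OF loc x t(1)])
  moreover have "Comp WTS ?t ?x = \<eta>"
    by (rule Comp_eqI[OF xW tW \<eta>W]) (simp_all add: E_sel Hom_hom(1)[OF \<eta>W])
  ultimately show ?thesis by simp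
qed

text \<open>Reflecting both ends turns \<open>f\<close> into a local equivalence between local
  objects, which is an isomorphism. The reflection maps lie in \<open>V\<close>, and
  two-out-of-three returns to \<open>f\<close>.\<close>

lemma local_equivalences_in_localizer: "RTS.local_equivalences local_objects \<subseteq> V"
proof
  fix f :: "('u, 'l) ts_map" assume fL: "f \<in> RTS.local_equivalences local_objects"
  define X Y where "X = source f" and "Y = target f"
  have f: "f \<in> Hom RTS X Y" using RTS.local_equivalences_Arr[OF fL] by (simp add: Hom_def X_def Y_def)
  note X = RTS.Hom_Obj(1)[OF f] and Y = RTS.Hom_Obj(2)[OF f]
  obtain K \<eta> where K: "K \<in> local_objects" and \<eta>: "\<eta> \<in> Hom RTS X K" "on_states \<eta> ` states X = states K"
    "on_actions \<eta> ` actions X = actions K" "\<eta> \<in> RTS.local_equivalences local_objects"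
    by (rule reflection[OF X])
  obtain K' \<eta>' where K': "K' \<in> local_objects" and \<eta>': "\<eta>' \<in> Hom RTS Y K'" "on_states \<eta>' ` states Y = states K'"
    "on_actions \<eta>' ` actions Y = actions K'" "\<eta>' \<in> RTS.local_equivalences local_objects"
    by (rule reflection[OF Y])
  have V: "\<eta> \<in> V" "\<eta>' \<in> V" using localizer_reflection[OF X K \<eta>] localizer_reflection[OF Y K' \<eta>'] .
  note f' = RTS.Comp_Hom[OF f \<eta>'(1)]
  obtain k where k: "k \<in> Hom RTS K K'" "Comp RTS k \<eta> = Comp RTS \<eta>' f"
    by (rule RTS.local_equivalences_ex[OF \<eta>(4,1) K' f'])
  have "Comp RTS k \<eta> \<in> RTS.local_equivalences local_objects"
    unfolding k(2) by (rule RTS.local_equivalence_comp[OF f fL \<eta>'(1,4)])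
  then have "k \<in> RTS.local_equivalences local_objects"
    using RTS.two_out_of_three_local_equivalences[of local_objects, unfolded two_out_of_three_def, rule_format, of \<eta> k]
      \<eta> RTS.HomD[OF k(1)] RTS.HomD[OF \<eta>(1)] by metis
  then have "RTS.iso k" by (rule RTS.local_equivalence_between_local[OF k(1) _ K K'])
  moreover have "(action_injections :: ('u, 'l) ts_map set) \<subseteq> Arr RTS" by (auto simp: action_injections_def)
  ultimately have "k \<in> V"
    using RTS.iso_rlp[of k action_injections] localizer_trivial_fibrations[OF loc] by (auto simp: rlp_action_injections)
  then have "Comp RTS \<eta>' f \<in> V" using localizer_comp[OF loc \<eta>(1) k(1) V(1)] k(2) by simp
  then show "f \<in> V" by (rule localizer_right[OF loc f \<eta>'(1) V(2)])
qed

end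

end

section \<open>Factorization through fibrations\<close>

context small_universe
begin

text \<open>The product of systems has as actions the pairs with equal label; here its full
  subsystem on the states \<open>I\<close> is taken. All actions are kept whatever \<open>I\<close>
  is, so that systems for different \<open>I\<close> can be compared; those left without an edge
  vanish in the core.\<close>

definition restricted_product :: "('u, 'l) ts \<Rightarrow> ('u, 'l) ts \<Rightarrow> 'u set \<Rightarrow> ('u, 'l) ts" where
  "restricted_product Y K I =
     (let A = enc ` {(u, v). u \<in> actions Y \<and> v \<in> actions K \<and> label Y u = label K v} in
      \<lparr>states = I, actions = A, label = restrict (\<lambda>d. label Y (pfst d)) A,
       transitions = {(\<alpha>, w, \<beta>). \<alpha> \<in> I \<and> \<beta> \<in> I \<and> set w \<subseteq> A \<and>
         (pfst \<alpha>, map pfst w, pfst \<beta>) \<in> transitions Y \<and> (psnd \<alpha>, map psnd w, psnd \<beta>) \<in> transitions K}\<rparr>)"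

lemma restricted_product_sel:
  "states (restricted_product Y K I) = I"
  "d \<in> actions (restricted_product Y K I) \<longleftrightarrow>
     d = enc (pfst d, psnd d) \<and> pfst d \<in> actions Y \<and> psnd d \<in> actions K \<and> label Y (pfst d) = label K (psnd d)"
  "d \<in> actions (restricted_product Y K I) \<Longrightarrow> label (restricted_product Y K I) d = label Y (pfst d)"
  "(\<alpha>, w, \<beta>) \<in> transitions (restricted_product Y K I) \<longleftrightarrow>
     \<alpha> \<in> I \<and> \<beta> \<in> I \<and> set w \<subseteq> actions (restricted_product Y K I) \<and>
     (pfst \<alpha>, map pfst w, pfst \<beta>) \<in> transitions Y \<and> (psnd \<alpha>, map psnd w, psnd \<beta>) \<in> transitions K"
proof -
  have "d \<in> enc ` {(u, v). u \<in> actions Y \<and> v \<in> actions K \<and> label Y u = label K v} \<longleftrightarrow>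
     d = enc (pfst d, psnd d) \<and> pfst d \<in> actions Y \<and> psnd d \<in> actions K \<and> label Y (pfst d) = label K (psnd d)"
    (is "d \<in> ?A \<longleftrightarrow> ?R") for d
  proof
    assume ?R
    then have "(pfst d, psnd d) \<in> {(u, v). u \<in> actions Y \<and> v \<in> actions K \<and> label Y u = label K v}" by simp
    then show "d \<in> ?A" by (rule image_eqI[where x = "(pfst d, psnd d)", rotated]) (rule conjunct1[OF \<open>?R\<close>])
  qed auto
  then show "d \<in> actions (restricted_product Y K I) \<longleftrightarrow>
     d = enc (pfst d, psnd d) \<and> pfst d \<in> actions Y \<and> psnd d \<in> actions K \<and> label Y (pfst d) = label K (psnd d)"
    by (simp add: restricted_product_def Let_def)
qed (simp_all add: restricted_product_def Let_def)

lemma restricted_product_Obj: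
  assumes Y: "Y \<in> Obj RTS" and K: "K \<in> Obj RTS" and I: "I \<subseteq> enc ` (states Y \<times> states K)"
  shows "restricted_product Y K I \<in> Obj WTS" "unique_split (transitions (restricted_product Y K I))"
proof -
  let ?P = "restricted_product Y K I"
  have YW: "weak_transition_system Y" "regular Y" "small (states Y)" "small (actions Y)" using Y by (simp_all add: Obj_RTS Obj_WTS)
  have KW: "weak_transition_system K" "regular K" "small (states K)" "small (actions K)" using K by (simp_all add: Obj_RTS Obj_WTS)
  have "multiset_axiom ?P"
    unfolding multiset_axiom_def
  proof (intro allI impI, elim conjE)
    fix \<alpha> us vs \<beta> assume t: "(\<alpha>, us, \<beta>) \<in> transitions ?P" and m: "mset vs = mset us"
    note t' = t[unfolded restricted_product_sel(4)]
    have "(pfst \<alpha>, map pfst vs, pfst \<beta>) \<in> transitions Y"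
      using perm_closedD[OF weak_perm_closed[OF YW(1)], of "pfst \<alpha>" "map pfst us" "pfst \<beta>" "map pfst vs"] t' m by simp
    moreover have "(psnd \<alpha>, map psnd vs, psnd \<beta>) \<in> transitions K"
      using perm_closedD[OF weak_perm_closed[OF KW(1)], of "psnd \<alpha>" "map psnd us" "psnd \<beta>" "map psnd vs"] t' m by simp
    ultimately show "(\<alpha>, vs, \<beta>) \<in> transitions ?P"
      unfolding restricted_product_sel(4) mset_eq_setD[OF m] using t' by blast
  qed
  moreover have "composition_axiom ?P"
    unfolding composition_axiom_def
  proof (intro allI impI, elim conjE)
    fix \<alpha> us vs ws \<beta> \<nu>\<^sub>1 \<nu>\<^sub>2
    assume ne: "us \<noteq> []" "vs \<noteq> []" "ws \<noteq> []" and t: "(\<alpha>, us @ vs @ ws, \<beta>) \<in> transitions ?P"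
      "(\<alpha>, us, \<nu>\<^sub>1) \<in> transitions ?P" "(\<nu>\<^sub>1, vs @ ws, \<beta>) \<in> transitions ?P"
      "(\<alpha>, us @ vs, \<nu>\<^sub>2) \<in> transitions ?P" "(\<nu>\<^sub>2, ws, \<beta>) \<in> transitions ?P"
    note t' = t[unfolded restricted_product_sel(4) map_append]
    have "composition_axiom Y" "composition_axiom K" using YW(1) KW(1) unfolding weak_transition_system_def by blast+
    then have "(pfst \<nu>\<^sub>1, map pfst vs, pfst \<nu>\<^sub>2) \<in> transitions Y" "(psnd \<nu>\<^sub>1, map psnd vs, psnd \<nu>\<^sub>2) \<in> transitions K"
      using composition_axiomD[of Y "map pfst us" "map pfst vs" "map pfst ws" "pfst \<alpha>" "pfst \<beta>"]
        composition_axiomD[of K "map psnd us" "map psnd vs" "map psnd ws" "psnd \<alpha>" "psnd \<beta>"] ne t' by simp_all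
    then show "(\<nu>\<^sub>1, vs, \<nu>\<^sub>2) \<in> transitions ?P" using t' unfolding restricted_product_sel(4) by simp
  qed
  moreover have "label ?P \<in> extensional (actions ?P)" by (simp add: restricted_product_def Let_def)
  moreover have "\<alpha> \<in> states ?P \<and> us \<noteq> [] \<and> set us \<subseteq> actions ?P \<and> \<beta> \<in> states ?P"
    if "(\<alpha>, us, \<beta>) \<in> transitions ?P" for \<alpha> us \<beta>
    using that weakD(2)[OF YW(1), of "pfst \<alpha>" "map pfst us" "pfst \<beta>"] unfolding restricted_product_sel(1,4) by auto
  ultimately have "weak_transition_system ?P" unfolding weak_transition_system_def by blast
  moreover have "small I" by (rule small_subset[OF small_image_Times[OF YW(3) KW(3)] I])
  moreover have "small (actions ?P)"
    by (rule small_subset[OF small_image_Times[OF YW(4) KW(4)]]) (auto simp: restricted_product_def Let_def)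
  ultimately show "?P \<in> Obj WTS" by (simp add: Obj_WTS restricted_product_sel(1))
  show "unique_split (transitions ?P)"
    unfolding unique_split_def
  proof (intro allI impI, elim conjE)
    fix \<alpha> us vs \<beta> \<nu> \<nu>'
    assume ne: "us \<noteq> []" "vs \<noteq> []" and t: "(\<alpha>, us @ vs, \<beta>) \<in> transitions ?P" "(\<alpha>, us, \<nu>) \<in> transitions ?P"
      "(\<nu>, vs, \<beta>) \<in> transitions ?P" "(\<alpha>, us, \<nu>') \<in> transitions ?P" "(\<nu>', vs, \<beta>) \<in> transitions ?P"
    note t' = t[unfolded restricted_product_sel(4) map_append]
    have "pfst \<nu> = pfst \<nu>'"
      by (rule unique_splitD[OF regular_unique_split[OF YW(1,2)], of "map pfst us" "map pfst vs" "pfst \<alpha>" "pfst \<beta>"])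
        (use ne t' in auto)
    moreover have "psnd \<nu> = psnd \<nu>'"
      by (rule unique_splitD[OF regular_unique_split[OF KW(1,2)], of "map psnd us" "map psnd vs" "psnd \<alpha>" "psnd \<beta>"])
        (use ne t' in auto)
    moreover have "\<mu> = enc (pfst \<mu>, psnd \<mu>)" if "\<mu> \<in> I" for \<mu> using that I by auto
    ultimately show "\<nu> = \<nu>'" using t' by metis
  qed
qed

lemma restricted_product_pairing:
  assumes b: "b \<in> Hom WTS B Y" and c: "c \<in> Hom WTS B K"
    and I: "\<And>s. s \<in> states B \<Longrightarrow> enc (on_states b s, on_states c s) \<in> I"
  shows "ts_hom B (restricted_product Y K I) (\<lambda>s. enc (on_states b s, on_states c s)) (\<lambda>u. enc (on_actions b u, on_actions c u))"
proof (rule ts_homI)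
  fix u assume u: "u \<in> actions B"
  show *: "enc (on_actions b u, on_actions c u) \<in> actions (restricted_product Y K I)"
    unfolding restricted_product_sel(2) using Hom_hom(2,3)[OF b u] Hom_hom(2,3)[OF c u] by simp
  show "label (restricted_product Y K I) (enc (on_actions b u, on_actions c u)) = label B u"
    unfolding restricted_product_sel(3)[OF *] using Hom_hom(3)[OF b u] by simp
next
  fix \<alpha> us \<beta> assume t: "(\<alpha>, us, \<beta>) \<in> transitions B"
  note w = weakD[OF HomD_WTS(6)[OF b] t]
  have "set (map (\<lambda>u. enc (on_actions b u, on_actions c u)) us) \<subseteq> actions (restricted_product Y K I)"
    unfolding restricted_product_sel(2) subset_iff using w(3) Hom_hom(2,3)[OF b] Hom_hom(2,3)[OF c] by fastforce
  then show "(enc (on_states b \<alpha>, on_states c \<alpha>), map (\<lambda>u. enc (on_actions b u, on_actions c u)) us,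
      enc (on_states b \<beta>, on_states c \<beta>)) \<in> transitions (restricted_product Y K I)"
    unfolding restricted_product_sel(4) using I[OF w(1)] I[OF w(4)] Hom_hom(4)[OF b t] Hom_hom(4)[OF c t]
    by (simp add: comp_def)
qed (use I in \<open>simp add: restricted_product_sel(1)\<close>)

text \<open>The middle object is the part of \<open>Y \<times> K\<close>, with \<open>K\<close> the reflection of \<open>X\<close>, on the largest set of
  states on which maps to local objects are determined by their values on \<open>X\<close>.\<close>

lemma factor_local_equivalence:
  fixes f :: "('u, 'l) ts_map"
  assumes "f \<in> Arr RTS"
  shows "\<exists>e\<in>RTS.local_equivalences local_objects.
    \<exists>m\<in>rlp RTS (action_injections \<inter> RTS.local_equivalences local_objects). Cod RTS e = Dom RTS m \<and> f = Comp RTS m e"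
proof -
  define X Y where "X = source f" and "Y = target f"
  have f: "f \<in> Hom RTS X Y" using assms by (simp add: Hom_def X_def Y_def)
  then have fW: "f \<in> Hom WTS X Y" and XR: "X \<in> Obj RTS" and YR: "Y \<in> Obj RTS" by (auto simp: Hom_RTS Hom_WTS Obj_RTS)
  have XW: "weak_transition_system X" "regular X" using XR by (simp_all add: Obj_RTS Obj_WTS)
  obtain K \<eta> where K: "K \<in> local_objects" and \<eta>: "\<eta> \<in> Hom RTS X K" and \<eta>L: "\<eta> \<in> RTS.local_equivalences local_objects"
    by (rule reflection[OF XR])
  note KR = local_Obj[OF K]
  have \<eta>W: "\<eta> \<in> Hom WTS X K" using \<eta> by (simp add: Hom_RTS)
  let ?S = "enc ` (states Y \<times> states K) :: 'u set"
  \<comment> \<open>The intermediate state of a transition may fall outside \<open>I\<close>, so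
    regularity has to be restored by passing to the core.\<close>
  define Z where "Z I = core (restricted_product Y K I)" for I
  have Z: "Z I \<in> Obj RTS" "Z I \<in> Obj WTS" and Z_in: "ts_hom (Z I) (restricted_product Y K I) (\<lambda>s. s) (\<lambda>u. u)"
    if "I \<subseteq> ?S" for I
  proof -
    note P = restricted_product_Obj[OF YR KR that]
    show "Z I \<in> Obj RTS" "Z I \<in> Obj WTS" unfolding Z_def using core_Obj[OF P] by (simp_all add: Obj_RTS)
    have "weak_transition_system (restricted_product Y K I)" using P(1) by (simp add: Obj_WTS)
    then show "ts_hom (Z I) (restricted_product Y K I) (\<lambda>s. s) (\<lambda>u. u)"
      unfolding Z_def by (rule core_ts_hom[OF _ P(2)])
  qed
  have Z_states: "states (Z I) = I" for I by (simp add: Z_def core_sel restricted_product_sel)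
  let ?p = "\<lambda>b c s. enc (on_states b s, on_states c s) :: 'u" and ?q = "\<lambda>b c u. enc (on_actions b u, on_actions c u) :: 'u"
  have pairing: "mk B (Z I) (?p b c) (?q b c) \<in> Hom RTS B (Z I)"
    if I: "I \<subseteq> ?S" and b: "b \<in> Hom RTS B Y" and c: "c \<in> Hom RTS B K" and bc: "\<And>s. s \<in> states B \<Longrightarrow> ?p b c s \<in> I"
    for I B and b c :: "('u, 'l) ts_map"
  proof (rule mk_Hom_RTS[OF RTS.Hom_Obj(1)[OF b] Z(1)[OF I]])
    have B: "weak_transition_system B" "regular B" using RTS.Hom_Obj(1)[OF b] by (simp_all add: Obj_RTS Obj_WTS)
    show "ts_hom B (Z I) (?p b c) (?q b c)"
      unfolding Z_def
      by (rule ts_hom_core[OF B restricted_product_pairing]) (use b c bc in \<open>simp_all add: Hom_RTS\<close>)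
  qed
  \<comment> \<open>Determinacy is asked for states only, because the action part of a map to a
    local object is forced by labels.\<close>
  define det where "det I \<longleftrightarrow> I \<subseteq> ?S \<and> (\<forall>s\<in>states X. ?p f \<eta> s \<in> I) \<and>
      (\<forall>L\<in>local_objects. \<forall>h\<in>Hom WTS (Z I) L. \<forall>h'\<in>Hom WTS (Z I) L.
        (\<forall>s\<in>states X. on_states h (?p f \<eta> s) = on_states h' (?p f \<eta> s)) \<longrightarrow> (\<forall>t\<in>I. on_states h t = on_states h' t))" for I
  \<comment> \<open>Determinacy survives enlargement: \<open>Z I\<close> maps to \<open>Z J\<close>,
    so two maps out of the larger system can be compared after restriction. For this reason the
    union of all determined sets is determined.\<close>
  have restr: "on_states h t = on_states h' t"
    if J: "J \<subseteq> ?S" and I: "det I" "I \<subseteq> J" and L: "L \<in> local_objects" and h: "h \<in> Hom WTS (Z J) L" "h' \<in> Hom WTS (Z J) L"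
      and e: "\<And>s. s \<in> states X \<Longrightarrow> on_states h (?p f \<eta> s) = on_states h' (?p f \<eta> s)" and t: "t \<in> I" for I J L h h' t
  proof -
    have IS: "I \<subseteq> ?S" and IX: "\<And>s. s \<in> states X \<Longrightarrow> ?p f \<eta> s \<in> I" using I(1) unfolding det_def by blast+
    have "ts_hom (restricted_product Y K I) (restricted_product Y K J) (\<lambda>s. s) (\<lambda>u. u)"
    proof (rule ts_homI)
      have act: "actions (restricted_product Y K I) = actions (restricted_product Y K J)"
        by (simp add: restricted_product_def Let_def)
      show "u \<in> actions (restricted_product Y K J)" if "u \<in> actions (restricted_product Y K I)" for u using that act by simp
      show "label (restricted_product Y K J) u = label (restricted_product Y K I) u" if "u \<in> actions (restricted_product Y K I)" for u
        using restricted_product_sel(3)[of u Y K I] restricted_product_sel(3)[of u Y K J] that act by simp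
      show "(\<alpha>, map (\<lambda>u. u) us, \<beta>) \<in> transitions (restricted_product Y K J)"
        if "(\<alpha>, us, \<beta>) \<in> transitions (restricted_product Y K I)" for \<alpha> us \<beta>
        using that I(2) unfolding restricted_product_sel(4) act by auto
    qed (use I(2) in \<open>auto simp: restricted_product_sel(1)\<close>)
    note ij = ts_hom_comp[OF Z_in[OF IS] this]
    have ZI: "weak_transition_system (Z I)" "regular (Z I)" using Z(1)[OF IS] by (simp_all add: Obj_RTS Obj_WTS)
    have "ts_hom (Z I) (Z J) (\<lambda>s. s) (\<lambda>u. u)"
      unfolding Z_def[of J] by (rule ts_hom_core[OF ZI ij])
    then have \<iota>: "mk (Z I) (Z J) (\<lambda>s. s) (\<lambda>u. u) \<in> Hom WTS (Z I) (Z J)" by (rule mk_Hom[OF Z(2)[OF IS] Z(2)[OF J]])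
    let ?\<iota> = "mk (Z I) (Z J) (\<lambda>s. s) (\<lambda>u. u)"
    have \<iota>s: "on_states (Comp WTS k ?\<iota>) s = on_states k s" if "s \<in> I" for k s
      using Comp_states[OF \<iota>, of s k] that by (simp add: Z_states)
    have "\<forall>s\<in>states X. on_states (Comp WTS h ?\<iota>) (?p f \<eta> s) = on_states (Comp WTS h' ?\<iota>) (?p f \<eta> s)"
      using \<iota>s IX e by simp
    then have "on_states (Comp WTS h ?\<iota>) t = on_states (Comp WTS h' ?\<iota>) t"
      using I(1) L Comp_Hom_WTS[OF \<iota> h(1)] Comp_Hom_WTS[OF \<iota> h(2)] t unfolding det_def by blast
    then show ?thesis using \<iota>s[OF t] by simp
  qed
  define J where "J = \<Union>{I. det I}"
  have JS: "J \<subseteq> ?S" unfolding J_def det_def by blast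
  have "det (?p f \<eta> ` states X)"
    unfolding det_def using Hom_hom(1)[OF fW] Hom_hom(1)[OF \<eta>W] by auto
  then have JX: "?p f \<eta> s \<in> J" if "s \<in> states X" for s unfolding J_def using that by blast
  have Jdet: "on_states h t = on_states h' t"
    if I: "I \<subseteq> ?S" "J \<subseteq> I" and L: "L \<in> local_objects" and h: "h \<in> Hom WTS (Z I) L" "h' \<in> Hom WTS (Z I) L"
      and e: "\<And>s. s \<in> states X \<Longrightarrow> on_states h (?p f \<eta> s) = on_states h' (?p f \<eta> s)" and t: "t \<in> J" for I L h h' t
  proof -
    obtain I' where I': "det I'" "t \<in> I'" using t unfolding J_def by blast
    then have "I' \<subseteq> I" using I(2) unfolding J_def by blast
    from restr[OF I(1) I'(1) this L h e I'(2)] show ?thesis by blast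
  qed
  let ?Z = "Z J" and ?e = "mk X (Z J) (?p f \<eta>) (?q f \<eta>)" and ?m = "mk (Z J) Y pfst pfst" and ?n = "mk (Z J) K psnd psnd"
  have e: "?e \<in> Hom RTS X ?Z" by (rule pairing[OF JS f \<eta> JX])
  then have eW: "?e \<in> Hom WTS X ?Z" by (simp add: Hom_RTS)
  note ZJ = ts_homD[OF Z_in[OF JS]]
  have J_pair: "t = enc (pfst t, psnd t)" "pfst t \<in> states Y" "psnd t \<in> states K" if "t \<in> J" for t
    using that JS by auto
  have Za: "d = enc (pfst d, psnd d)" "pfst d \<in> actions Y" "psnd d \<in> actions K" "label Y (pfst d) = label ?Z d"
    "label K (psnd d) = label ?Z d" if "d \<in> actions ?Z" for d
    using ZJ(2)[OF that] ZJ(3)[OF that] restricted_product_sel(3)[OF ZJ(2)[OF that]]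
    unfolding restricted_product_sel(2) by auto
  have m: "?m \<in> Hom RTS ?Z Y"
  proof (rule mk_Hom_RTS[OF Z(1)[OF JS] YR], rule ts_homI)
    fix \<alpha> us \<beta> assume "(\<alpha>, us, \<beta>) \<in> transitions ?Z"
    from ZJ(4)[OF this] show "(pfst \<alpha>, map pfst us, pfst \<beta>) \<in> transitions Y"
      unfolding restricted_product_sel(4) by simp
  qed (use J_pair Za in \<open>simp_all add: Z_states\<close>)
  have n: "?n \<in> Hom RTS ?Z K"
  proof (rule mk_Hom_RTS[OF Z(1)[OF JS] KR], rule ts_homI)
    fix \<alpha> us \<beta> assume "(\<alpha>, us, \<beta>) \<in> transitions ?Z"
    from ZJ(4)[OF this] show "(psnd \<alpha>, map psnd us, psnd \<beta>) \<in> transitions K"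
      unfolding restricted_product_sel(4) by simp
  qed (use J_pair Za in \<open>simp_all add: Z_states\<close>)
  have mW: "?m \<in> Hom WTS ?Z Y" and nW: "?n \<in> Hom WTS ?Z K" using m n by (simp_all add: Hom_RTS)
  have me: "Comp WTS ?m ?e = f"
    by (rule Comp_eqI[OF eW mW fW]) (use Hom_hom(1,2)[OF eW] in simp_all)
  have ne: "Comp WTS ?n ?e = \<eta>"
    by (rule Comp_eqI[OF eW nW \<eta>W]) (use Hom_hom(1,2)[OF eW] in simp_all)
  \<comment> \<open>Existence uses the projection to \<open>K\<close>, through which every map from
    \<open>X\<close> to a local object extends; uniqueness is what \<open>J\<close> was chosen
    for.\<close>
  have "?e \<in> RTS.local_equivalences local_objects"
  proof (rule RTS.local_equivalencesI[OF e])
    fix L g assume L: "L \<in> local_objects" and g: "g \<in> Hom RTS X L"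
    obtain k where k: "k \<in> Hom RTS K L" "Comp RTS k \<eta> = g" by (rule RTS.local_equivalences_ex[OF \<eta>L \<eta> L g])
    have "Comp RTS (Comp RTS k ?n) ?e = g" using RTS.Comp_assoc[OF e n k(1)] ne k(2) by simp
    then show "\<exists>h\<in>Hom RTS ?Z L. Comp RTS h ?e = g" using RTS.Comp_Hom[OF n k(1)] by blast
  next
    fix L h h' assume L: "L \<in> local_objects" and h: "h \<in> Hom RTS ?Z L" "h' \<in> Hom RTS ?Z L"
      and eq: "Comp RTS h ?e = Comp RTS h' ?e"
    have hW: "h \<in> Hom WTS ?Z L" "h' \<in> Hom WTS ?Z L" using h by (simp_all add: Hom_RTS)
    have "on_states h (?p f \<eta> s) = on_states h' (?p f \<eta> s)" if "s \<in> states X" for s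
      using Comp_eqD(1)[OF eq[unfolded RTS_WTS] eW eW that] that by simp
    then have "on_states h t = on_states h' t" if "t \<in> J" for t
      using Jdet[OF JS subset_refl L hW] that by blast
    then show "h = h'"
      by (intro Hom_eqI[OF hW]) (auto simp: Z_states intro: local_action_eq[OF L hW])
  qed
  moreover have "?m \<in> rlp RTS (action_injections \<inter> RTS.local_equivalences local_objects)"
    unfolding rlp_def
  proof (intro CollectI conjI ballI)
    show "?m \<in> Arr RTS" using m by (rule RTS.HomD)
    fix i :: "('u, 'l) ts_map" assume "i \<in> action_injections \<inter> RTS.local_equivalences local_objects"
    then have iL: "i \<in> RTS.local_equivalences local_objects" by blast
    define A B where "A = source i" and "B = target i"
    have i: "i \<in> Hom RTS A B" using RTS.local_equivalences_Arr[OF iL] by (simp add: Hom_def A_def B_def)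
    then have iW: "i \<in> Hom WTS A B" by (simp add: Hom_RTS)
    show "lifts RTS i ?m"
    proof (rule RTS.liftsI[OF i m])
      fix u v assume u: "u \<in> Hom RTS A ?Z" and v: "v \<in> Hom RTS B Y" and sq: "Comp RTS ?m u = Comp RTS v i"
      have uW: "u \<in> Hom WTS A ?Z" and vW: "v \<in> Hom WTS B Y" using u v by (simp_all add: Hom_RTS)
      \<comment> \<open>The component in \<open>Y\<close> is given by the square. The component in
        \<open>K\<close> extends along the local equivalence \<open>i\<close> because
        \<open>K\<close> is local.\<close>
      obtain c where c: "c \<in> Hom RTS B K" "Comp RTS c i = Comp RTS ?n u"
        by (rule RTS.local_equivalences_ex[OF iL i K RTS.Comp_Hom[OF u n]])
      have cW: "c \<in> Hom WTS B K" using c(1) by (simp add: Hom_RTS)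
      have iss: "?p v c (on_states i s) = on_states u s" if s: "s \<in> states A" for s
      proof -
        have us: "on_states u s \<in> J" using Hom_hom(1)[OF uW s] by (simp add: Z_states)
        have "on_states v (on_states i s) = pfst (on_states u s)"
          using Comp_eqD(1)[OF sq[unfolded RTS_WTS] uW iW s] us by (simp add: Z_states)
        moreover have "on_states c (on_states i s) = psnd (on_states u s)"
          using Comp_eqD(1)[OF c(2)[unfolded RTS_WTS] iW uW s] us by (simp add: Z_states)
        ultimately show ?thesis using J_pair(1)[OF us] by simp
      qed
      have ia: "?q v c (on_actions i s) = on_actions u s" if s: "s \<in> actions A" for s
      proof -
        have us: "on_actions u s \<in> actions ?Z" by (rule Hom_hom(2)[OF uW s])
        have "on_actions v (on_actions i s) = pfst (on_actions u s)"
          using Comp_eqD(2)[OF sq[unfolded RTS_WTS] uW iW s] us by simp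
        moreover have "on_actions c (on_actions i s) = psnd (on_actions u s)"
          using Comp_eqD(2)[OF c(2)[unfolded RTS_WTS] iW uW s] us by simp
        ultimately show ?thesis using Za(1)[OF us] by simp
      qed
      \<comment> \<open>The pair maps \<open>B\<close> to the product, but possibly outside
        \<open>J\<close>. Adding its image keeps the set determined: two maps that agree on the
        image of \<open>X\<close> agree on \<open>J\<close>, hence after composition with
        \<open>i\<close>, hence on \<open>B\<close> because \<open>i\<close> is a local equivalence.
        Maximality of \<open>J\<close> then forces the image into \<open>J\<close>, and the pair is
        the lift.\<close>
      let ?I = "J \<union> ?p v c ` states B"
      have IS: "?I \<subseteq> ?S" using JS Hom_hom(1)[OF vW] Hom_hom(1)[OF cW] by auto
      let ?b = "mk B (Z ?I) (?p v c) (?q v c)"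
      have b: "?b \<in> Hom RTS B (Z ?I)" by (rule pairing[OF IS v c(1)]) blast
      then have bW: "?b \<in> Hom WTS B (Z ?I)" by (simp add: Hom_RTS)
      have "det ?I"
        unfolding det_def
      proof (intro conjI ballI impI)
        show "?I \<subseteq> ?S" by (rule IS)
        show "?p f \<eta> s \<in> ?I" if "s \<in> states X" for s using JX[OF that] by blast
        fix L h h' t assume L: "L \<in> local_objects" and h: "h \<in> Hom WTS (Z ?I) L" "h' \<in> Hom WTS (Z ?I) L"
          and eq: "\<forall>s\<in>states X. on_states h (?p f \<eta> s) = on_states h' (?p f \<eta> s)" and t: "t \<in> ?I"
        have hJ: "on_states h t = on_states h' t" if "t \<in> J" for t
          by (rule Jdet[OF IS Un_upper1 L h _ that]) (use eq in blast)
        have hR: "h \<in> Hom RTS (Z ?I) L" "h' \<in> Hom RTS (Z ?I) L"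
          using h Z(1)[OF IS] local_Obj[OF L] by (simp_all add: Hom_RTS Obj_RTS)
        have hbW: "Comp WTS h ?b \<in> Hom WTS B L" "Comp WTS h' ?b \<in> Hom WTS B L"
          using Comp_Hom_WTS[OF bW] h by blast+
        have "Comp WTS (Comp WTS h ?b) i = Comp WTS (Comp WTS h' ?b) i"
        proof (rule Comp_eqI[OF iW hbW(1) Comp_Hom_WTS[OF iW hbW(2)]])
          fix s assume s: "s \<in> states A"
          note iss' = Hom_hom(1)[OF iW s]
          have "on_states u s \<in> J" using Hom_hom(1)[OF uW s] by (simp add: Z_states)
          then show "on_states (Comp WTS h ?b) (on_states i s) = on_states (Comp WTS (Comp WTS h' ?b) i) s"
            using Comp_states[OF iW s, of "Comp WTS h' ?b"] Comp_states[OF bW iss', of h] Comp_states[OF bW iss', of h']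
              iss[OF s] iss' hJ by simp
        next
          fix s assume s: "s \<in> actions A"
          have "on_actions (Comp WTS h ?b) (on_actions i s) = on_actions (Comp WTS h' ?b) (on_actions i s)"
            by (rule local_action_eq[OF L hbW Hom_hom(2)[OF iW s] Hom_hom(2)[OF iW s] refl])
          then show "on_actions (Comp WTS h ?b) (on_actions i s) = on_actions (Comp WTS (Comp WTS h' ?b) i) s"
            using Comp_actions[OF iW s, of "Comp WTS h' ?b"] by simp
        qed
        then have hb: "Comp WTS h ?b = Comp WTS h' ?b"
          using RTS.local_equivalences_uniq[OF iL i L RTS.Comp_Hom[OF b hR(1)] RTS.Comp_Hom[OF b hR(2)]] by simp
        from t show "on_states h t = on_states h' t"
        proof
          assume "t \<in> ?p v c ` states B"
          then obtain s where s: "s \<in> states B" "t = ?p v c s" by blast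
          then show ?thesis using Comp_eqD(1)[OF hb bW bW s(1)] by simp
        qed (rule hJ)
      qed
      then have IJ: "?I \<subseteq> J" unfolding J_def by blast
      let ?h = "mk B ?Z (?p v c) (?q v c)"
      have h: "?h \<in> Hom RTS B ?Z" by (rule pairing[OF JS v c(1)]) (use IJ in blast)
      then have hW: "?h \<in> Hom WTS B ?Z" by (simp add: Hom_RTS)
      have "Comp WTS ?h i = u"
        by (rule Comp_eqI[OF iW hW uW]) (simp_all add: iss ia Hom_hom(1,2)[OF iW])
      moreover have "Comp WTS ?m ?h = v"
        by (rule Comp_eqI[OF hW mW vW]) (use Hom_hom(1,2)[OF hW] in simp_all)
      ultimately show "\<exists>h\<in>Hom RTS B ?Z. Comp RTS h i = u \<and> Comp RTS ?m h = v" using h by auto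
    qed
  qed
  moreover have "Cod RTS ?e = Dom RTS ?m" by simp
  moreover have "f = Comp RTS ?m ?e" using me by simp
  ultimately show ?thesis by blast
qed

end

theorem corollary6p6:
  assumes "inaccessible |UNIV :: 'u set|"
    and "|UNIV :: 'l set| <o |UNIV :: 'u set|"
  shows "\<exists>N :: ('u, 'l) ts_map model_data.
    left_bousfield_localization RTS (small_ordinals :: 'u rel set)
      generating_cofibrations Cub_equivalences N"
proof -
  interpret small_universe "TYPE('u \<times> 'l)" by unfold_locales (rule assms)+
  let ?W = "RTS.local_equivalences (local_objects :: ('u, 'l) ts set)"
  let ?N = "\<lparr>cofibrations = action_injections, weak_equivalences = ?W,
      fibrations = rlp RTS (action_injections \<inter> ?W)\<rparr> :: ('u, 'l) ts_map model_data"
  have "model_structure RTS ?N"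
  proof (rule RTS.model_structureI[where TF = trivial_fibrations])
    show "action_injections = llp RTS (trivial_fibrations :: ('u, 'l) ts_map set)"
      by (rule llp_trivial_fibrations[symmetric])
    show "trivial_fibrations = rlp RTS (action_injections :: ('u, 'l) ts_map set)"
      by (rule rlp_action_injections[symmetric])
    show "?W \<subseteq> Arr RTS" using RTS.local_equivalences_Arr by blast
    show "two_out_of_three RTS ?W" by (rule RTS.two_out_of_three_local_equivalences)
    show "trivial_fibrations \<subseteq> ?W" using trivial_fibration_local_equivalence by blast
  qed (rule factor_action_injection factor_local_equivalence RTS.local_equivalence_retract; assumption)+
  \<comment> \<open>The local equivalences are a localizer containing the cubification equivalences,
    and they are contained in any other one, so the intersection is attained.\<close>
  moreover have "smallest_localizer RTS (small_ordinals :: 'u rel set) action_injections Cub_equivalences = ?W"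
    unfolding smallest_localizer_def
    using local_equivalences_localizer Cub_equivalences_local local_equivalences_in_localizer by blast
  ultimately have "left_bousfield_localization RTS (small_ordinals :: 'u rel set) generating_cofibrations Cub_equivalences ?N"
    unfolding left_bousfield_localization_def left_determined_def Let_def by (simp add: cofibrations_generated)
  then show ?thesis by blast
qed

end
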